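(* Let $\nu>0$, $T^*>0$, $\mathbf{u}_0\in H^1(\mathbb{T}^3)$, and $\mathbf{f}\in L^2(0,T^*;\dot L^2)$. Then there exist $T\in(0,T^* )$ and a unique strong solution $\mathbf{u}$ on $[0,T]$ of $$\partial_t\mathbf{u}+(\nabla\times\mathbf{u})\times\mathbf{u}=\nu\triangle\mathbf{u}+\mathbf{f},\qquad \mathbf{u}(0)=\mathbf{u}_0,$$ on $\mathbb{T}^3$. Moreover, strong solutions depend continuously on the initial data in the sense of $C([0,T];H^1)\cap L^2(0,T;H^2)$: if $\mathbf{u}$ and $\mathbf{u}_n$ ($n\in\mathbb{N}$) are strong solutions on $[0,T]$ with the same $\nu$ and $\mathbf{f}$ and $\mathbf{u}_n(0)\to\mathbf{u}(0)$ in $H^1$, then $\mathbf{u}_n\to\mathbf{u}$ in $C([0,T];H^1)\cap L^2(0,T;H^2)$. Finally, the following energy balance holds for all $t\in[0,T]$: $$\|\mathbf{u}(t)\|_{L^2}^2+2\nu\int_0^t\|\nabla\mathbf{u}(s)\|_{L^2}^2\,ds=\|\mathbf{u}_0\|_{L^2}^2+2\int_0^t(\mathbf{f}(s),\mathbf{u}(s))\,ds.$$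
   Context: $\mathbb{T}^3=\mathbb{R}^3/(2\pi\mathbb{Z})^3$. All functions $\mathbf{u},\mathbf{f}$ are $\mathbb{R}^3$-valued; $L^2$, $H^s$ denote spaces of such vector fields on $\mathbb{T}^3$, $(\cdot,\cdot)$ is the $L^2$ inner product, and $\dot L^2$ is the subspace of $L^2$ of fields with zero mean. Solutions $\mathbf{u}$ are not required to be divergence-free or mean-free. A strong solution on $[0,T]$ with data $\mathbf{u}_0\in H^1$ and forcing $\mathbf{f}\in L^2(0,T;\dot L^2)$ is a function $\mathbf{u}\in C([0,T];H^1)\cap L^2(0,T;H^2)$ with $\partial_t\mathbf{u}\in L^2(0,T;L^2)$ that satisfies $\partial_t\mathbf{u}+(\nabla\times\mathbf{u})\times\mathbf{u}=\nu\triangle\mathbf{u}+\mathbf{f}$ in the sense of $L^2(0,T;L^2)$, with $\mathbf{u}(0)=\mathbf{u}_0$ in the sense of $C([0,T];H^1)$. *)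

theory Defs
  imports "HOL-Analysis.Analysis"
begin

subsection \<open>Square-integrable vector fields on the torus\<close>

text \<open>
  Functions on \<open>\<T>\<^sup>3 = \<real>\<^sup>3 / (2\<pi>\<int>)\<^sup>3\<close> are represented by their values on the cell
  \<open>[0, 2\<pi>)\<^sup>3\<close>, which contains exactly one representative of each coset. Borel measurable
  representatives suffice, since every Lebesgue measurable function agrees almost everywhere
  with a Borel measurable one. Periodicity enters through the test fields used to define weak
  derivatives.
\<close>

definition torus :: "(real^3) measure" where
  "torus = restrict_space lborel {x. \<forall>i. 0 \<le> x $ i \<and> x $ i < 2 * pi}"

definition square_integrable :: "(real^3 \<Rightarrow> real^3) \<Rightarrow> bool" where
  "square_integrable f \<longleftrightarrow>
     f \<in> borel_measurable torus \<and> integrable torus (\<lambda>x. (norm (f x))\<^sup>2)"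

lemma cell_borel: "{x::real^3. \<forall>i. 0 \<le> x $ i \<and> x $ i < 2 * pi} \<in> sets borel"
proof -
  have "{x::real^3. \<forall>i. 0 \<le> x $ i \<and> x $ i < 2 * pi}
      = (\<Inter>i. {x. 0 \<le> x \<bullet> axis i 1} \<inter> {x. x \<bullet> axis i 1 < 2 * pi})"
    by (auto simp: inner_axis)
  also have "\<dots> \<in> sets borel" by (intro sets.countable_INT') (auto)
  finally show ?thesis .
qed

lemma finite_measure_torus: "finite_measure torus"
proof
  let ?A = "{x::real^3. \<forall>i. 0 \<le> x $ i \<and> x $ i < 2 * pi}"
  have "emeasure torus (space torus) = emeasure lborel ?A"
    using cell_borel by (simp add: torus_def emeasure_restrict_space space_restrict_space)
  also have "\<dots> \<le> emeasure lborel (cbox 0 (\<chi> i. 2 * pi) :: (real^3) set)"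
    by (intro emeasure_mono) (auto simp: mem_box_cart less_imp_le)
  also have "\<dots> < \<infinity>" by (rule emeasure_lborel_cbox_finite)
  finally show "emeasure torus (space torus) \<noteq> \<infinity>" by simp
qed

interpretation torus: finite_measure torus by (rule finite_measure_torus)

lemma square_integrable_bounded:
  assumes "f \<in> borel_measurable torus" "\<And>x. norm (f x) \<le> B"
  shows "square_integrable f"
proof -
  have "norm ((norm (f x))\<^sup>2) \<le> B\<^sup>2" for x
    using assms(2)[of x] by (simp add: power_mono)
  then show ?thesis unfolding square_integrable_def
    using assms(1) by (auto intro!: torus.integrable_const_bound[where B="B\<^sup>2"])
qed

lemma square_integrable_add:
  assumes "square_integrable f" "square_integrable g"
  shows "square_integrable (\<lambda>x. f x + g x)"
  unfolding square_integrable_def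
proof
  have [measurable]: "f \<in> borel_measurable torus" "g \<in> borel_measurable torus"
    using assms by (auto simp: square_integrable_def)
  show "(\<lambda>x. f x + g x) \<in> borel_measurable torus" by measurable
  have "integrable torus (\<lambda>x. 2 * (norm (f x))\<^sup>2 + 2 * (norm (g x))\<^sup>2)"
    using assms by (auto simp: square_integrable_def)
  moreover have "(norm (f x + g x))\<^sup>2 \<le> 2 * (norm (f x))\<^sup>2 + 2 * (norm (g x))\<^sup>2" for x
  proof -
    have "(norm (f x + g x))\<^sup>2 \<le> (norm (f x) + norm (g x))\<^sup>2"
      by (intro power_mono norm_triangle_ineq) auto
    also have "\<dots> \<le> 2 * (norm (f x))\<^sup>2 + 2 * (norm (g x))\<^sup>2"
      using sum_squares_bound[of "norm (f x)" "norm (g x)"] by (simp add: power2_sum)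
    finally show ?thesis .
  qed
  ultimately show "integrable torus (\<lambda>x. (norm (f x + g x))\<^sup>2)"
    by (auto intro: Bochner_Integration.integrable_bound)
qed

lemma square_integrable_scaleR:
  assumes "square_integrable f"
  shows "square_integrable (\<lambda>x. r *\<^sub>R f x)"
  using assms by (auto simp: square_integrable_def power_mult_distrib)

lemma square_integrable_inner:
  assumes "square_integrable f" "square_integrable g"
  shows "integrable torus (\<lambda>x. f x \<bullet> g x)"
proof -
  have [measurable]: "f \<in> borel_measurable torus" "g \<in> borel_measurable torus"
    using assms by (auto simp: square_integrable_def)
  have "integrable torus (\<lambda>x. (norm (f x))\<^sup>2 + (norm (g x))\<^sup>2)"
    using assms by (auto simp: square_integrable_def)
  moreover have "\<bar>f x \<bullet> g x\<bar> \<le> (norm (f x))\<^sup>2 + (norm (g x))\<^sup>2" for x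
    using Cauchy_Schwarz_ineq2[of "f x" "g x"] sum_squares_bound[of "norm (f x)" "norm (g x)"]
      mult_nonneg_nonneg[OF norm_ge_zero[of "f x"] norm_ge_zero[of "g x"]]
    unfolding mult.assoc by linarith
  ultimately show ?thesis
    by (auto intro: Bochner_Integration.integrable_bound)
qed

text \<open>\<open>L\<^sup>2(\<T>\<^sup>3; \<real>\<^sup>3)\<close>, as almost-everywhere classes; \<open>rep_l2 u\<close> is an arbitrary representative.\<close>

quotient_type l2 = "real^3 \<Rightarrow> real^3" /
  partial: "\<lambda>f g. square_integrable f \<and> square_integrable g \<and> (AE x in torus. f x = g x)"
  morphisms rep_l2 abs_l2
proof (rule part_equivpI)
  have "square_integrable (\<lambda>x. 0)" by (rule square_integrable_bounded[where B=0]) auto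
  then show "\<exists>f. square_integrable f \<and> square_integrable f \<and> (AE x in torus. f x = f x)"
    by auto
qed (auto intro!: sympI transpI)

instantiation l2 :: real_vector
begin

lift_definition zero_l2 :: l2 is "\<lambda>x. 0"
  by (auto intro: square_integrable_bounded[where B=0])

lift_definition plus_l2 :: "l2 \<Rightarrow> l2 \<Rightarrow> l2" is "\<lambda>f g x. f x + g x"
  by (auto intro: square_integrable_add)

lift_definition scaleR_l2 :: "real \<Rightarrow> l2 \<Rightarrow> l2" is "\<lambda>r f x. r *\<^sub>R f x"
  by (auto intro: square_integrable_scaleR)

lift_definition uminus_l2 :: "l2 \<Rightarrow> l2" is "\<lambda>f x. - f x"
  using square_integrable_scaleR[of _ "-1"] by auto

definition minus_l2 :: "l2 \<Rightarrow> l2 \<Rightarrow> l2" where "minus_l2 u v = u + (- v)"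

instance
proof
  fix u v w :: l2 and r s :: real
  show "u + v + w = u + (v + w)"
    by transfer (auto simp: add.assoc intro: square_integrable_add)
  show "u + v = v + u"
    by transfer (auto simp: add.commute intro: square_integrable_add)
  show "0 + u = u" by transfer auto
  show "- u + u = 0"
    by transfer (auto intro: square_integrable_bounded[where B=0])
  show "u - v = u + - v" by (rule minus_l2_def)
  show "r *\<^sub>R (u + v) = r *\<^sub>R u + r *\<^sub>R v"
    by transfer (auto simp: scaleR_add_right intro: square_integrable_add square_integrable_scaleR)
  show "(r + s) *\<^sub>R u = r *\<^sub>R u + s *\<^sub>R u"
    by transfer (auto simp: scaleR_add_left intro: square_integrable_add square_integrable_scaleR)
  show "r *\<^sub>R s *\<^sub>R u = (r * s) *\<^sub>R u"
    by transfer (auto intro: square_integrable_scaleR)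
  show "1 *\<^sub>R u = u" by transfer auto
qed

end

instantiation l2 :: real_inner
begin

lift_definition inner_l2 :: "l2 \<Rightarrow> l2 \<Rightarrow> real" is "\<lambda>f g. \<integral>x. f x \<bullet> g x \<partial>torus"
  by (rule integral_cong_AE) (auto simp: square_integrable_def)

definition norm_l2 :: "l2 \<Rightarrow> real" where "norm_l2 u = sqrt (u \<bullet> u)"

definition sgn_l2 :: "l2 \<Rightarrow> l2" where "sgn_l2 u = u /\<^sub>R norm u"

definition dist_l2 :: "l2 \<Rightarrow> l2 \<Rightarrow> real" where "dist_l2 u v = norm (u - v)"

definition uniformity_l2 :: "(l2 \<times> l2) filter" where
  "uniformity_l2 = (INF e\<in>{0<..}. principal {(u, v). dist u v < e})"

definition open_l2 :: "l2 set \<Rightarrow> bool" where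
  "open_l2 U \<longleftrightarrow> (\<forall>u\<in>U. eventually (\<lambda>(u', v). u' = u \<longrightarrow> v \<in> U) uniformity)"

instance
proof
  fix u v w :: l2 and r :: real
  show "sgn u = u /\<^sub>R norm u" by (rule sgn_l2_def)
  show "dist u v = norm (u - v)" by (rule dist_l2_def)
  show "(uniformity :: (l2 \<times> l2) filter) = (INF e\<in>{0<..}. principal {(u, v). dist u v < e})"
    by (rule uniformity_l2_def)
  show "open U \<longleftrightarrow> (\<forall>u\<in>U. eventually (\<lambda>(u', v). u' = u \<longrightarrow> v \<in> U) uniformity)" for U :: "l2 set"
    by (rule open_l2_def)
  show "u \<bullet> v = v \<bullet> u" by transfer (simp add: inner_commute)
  show "(u + v) \<bullet> w = u \<bullet> w + v \<bullet> w"
    by transfer (simp add: inner_add_left square_integrable_inner)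
  show "(r *\<^sub>R u) \<bullet> v = r * (u \<bullet> v)" by transfer simp
  show "0 \<le> u \<bullet> u" by transfer simp
  show "u \<bullet> u = 0 \<longleftrightarrow> u = 0"
  proof transfer
    fix f assume f: "square_integrable f \<and> square_integrable f \<and> (AE x in torus. f x = f x)"
    then have "(\<integral>x. f x \<bullet> f x \<partial>torus) = 0 \<longleftrightarrow> (AE x in torus. f x \<bullet> f x = 0)"
      by (intro integral_nonneg_eq_0_iff_AE square_integrable_inner) auto
    with f show "(\<integral>x. f x \<bullet> f x \<partial>torus) = 0 \<longleftrightarrow>
        square_integrable f \<and> square_integrable (\<lambda>x. 0) \<and> (AE x in torus. f x = 0)"
      by (auto intro: square_integrable_bounded[where B=0])
  qed
  show "norm u = sqrt (u \<bullet> u)" by (rule norm_l2_def)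
qed

end

lemma abs_rep_l2: "square_integrable (rep_l2 u)" "abs_l2 (rep_l2 u) = u"
  using Quotient_rep_reflp[OF Quotient_l2] Quotient_abs_rep[OF Quotient_l2] by auto

lemma norm_abs_l2:
  assumes "square_integrable f"
  shows "norm (abs_l2 f) = sqrt (\<integral>x. (norm (f x))\<^sup>2 \<partial>torus)"
  unfolding norm_eq_sqrt_inner using assms by (simp add: inner_l2.abs_eq power2_norm_eq_inner)

lemma abs_l2_eq:
  assumes "square_integrable f" "square_integrable g" "AE x in torus. f x = g x"
  shows "abs_l2 f = abs_l2 g"
  using assms by (intro Quotient_rel_abs[OF Quotient_l2]) auto

lemma abs_l2_minus:
  assumes "square_integrable f" "square_integrable g"
  shows "abs_l2 f - abs_l2 g = abs_l2 (\<lambda>x. f x - g x)"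
proof -
  have "square_integrable (\<lambda>x. - g x)"
    using square_integrable_scaleR[OF assms(2), of "-1"] by simp
  then have "abs_l2 f + - abs_l2 g = abs_l2 (\<lambda>x. f x + - g x)"
    using assms by (simp only: plus_l2.abs_eq uminus_l2.abs_eq simp_thms eventually_True)
  then show ?thesis by simp
qed

lemma square_integrable_minus:
  assumes "square_integrable f" "square_integrable g"
  shows "square_integrable (\<lambda>x. f x - g x)"
  using square_integrable_add[OF assms(1) square_integrable_scaleR[OF assms(2), of "-1"]] by simp

lemma tendsto_abs_l2:
  assumes f: "\<And>n. square_integrable (f n)" "square_integrable g"
    and "(\<lambda>n. \<integral>x. (norm (f n x - g x))\<^sup>2 \<partial>torus) \<longlonglongrightarrow> 0"
  shows "(\<lambda>n. abs_l2 (f n)) \<longlonglongrightarrow> abs_l2 g"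
proof -
  have "norm (abs_l2 (f n) - abs_l2 g) = sqrt (\<integral>x. (norm (f n x - g x))\<^sup>2 \<partial>torus)" for n
    unfolding abs_l2_minus[OF f] by (rule norm_abs_l2[OF square_integrable_minus[OF f]])
  moreover have "(\<lambda>n. sqrt (\<integral>x. (norm (f n x - g x))\<^sup>2 \<partial>torus)) \<longlonglongrightarrow> 0"
    using tendsto_real_sqrt[OF assms(3)] by simp
  ultimately have "(\<lambda>n. norm (abs_l2 (f n) - abs_l2 g)) \<longlonglongrightarrow> 0"
    by simp
  then show ?thesis
    by (rule LIM_zero_cancel[OF tendsto_norm_zero_cancel])
qed

lemma tendsto_abs_l2_dominated:
  assumes f: "\<And>n. f n \<in> borel_measurable torus" and g: "square_integrable g"
    and w: "square_integrable w"
    and lim: "\<And>x. x \<in> space torus \<Longrightarrow> (\<lambda>n. f n x) \<longlonglongrightarrow> g x"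
    and le: "\<And>n x. x \<in> space torus \<Longrightarrow> norm (f n x) \<le> norm (w x)"
  shows "(\<lambda>n. abs_l2 (f n)) \<longlonglongrightarrow> abs_l2 g" "square_integrable (f n)"
proof -
  note [measurable] = f
  have [measurable]: "g \<in> borel_measurable torus" "w \<in> borel_measurable torus"
    using g w by (auto simp: square_integrable_def)
  show sq: "square_integrable (f n)" for n
    unfolding square_integrable_def
  proof
    show "integrable torus (\<lambda>x. (norm (f n x))\<^sup>2)"
      by (rule Bochner_Integration.integrable_bound[of _ "\<lambda>x. (norm (w x))\<^sup>2"])
         (use w le in \<open>auto simp: square_integrable_def intro!: AE_I2 power_mono\<close>)
  qed (rule f)
  have "(\<lambda>n. \<integral>x. (norm (f n x - g x))\<^sup>2 \<partial>torus) \<longlonglongrightarrow> (\<integral>x. 0 \<partial>torus)"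
  proof (rule integral_dominated_convergence)
    show "integrable torus (\<lambda>x. 4 * (norm (w x))\<^sup>2)"
      using w by (auto simp: square_integrable_def)
    show "AE x in torus. (\<lambda>n. (norm (f n x - g x))\<^sup>2) \<longlonglongrightarrow> 0"
    proof (rule AE_I2)
      fix x assume "x \<in> space torus"
      then have "(\<lambda>n. norm (f n x - g x)) \<longlonglongrightarrow> 0"
        using lim LIM_zero tendsto_norm_zero by blast
      then show "(\<lambda>n. (norm (f n x - g x))\<^sup>2) \<longlonglongrightarrow> 0"
        using tendsto_power[of _ 0 _ 2] by fastforce
    qed
    show "AE x in torus. norm ((norm (f n x - g x))\<^sup>2) \<le> 4 * (norm (w x))\<^sup>2" for n
    proof (rule AE_I2)
      fix x assume x: "x \<in> space torus"
      have "norm (g x) \<le> norm (w x)"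
        using LIMSEQ_le_const2[OF tendsto_norm[OF lim[OF x]]] le[OF x] by blast
      then have "norm (f n x - g x) \<le> 2 * norm (w x)"
        using le[OF x, of n] norm_triangle_ineq4[of "f n x" "g x"] by linarith
      then have "(norm (f n x - g x))\<^sup>2 \<le> (2 * norm (w x))\<^sup>2"
        by (intro power_mono) auto
      then show "norm ((norm (f n x - g x))\<^sup>2) \<le> 4 * (norm (w x))\<^sup>2"
        by (simp add: power_mult_distrib)
    qed
  qed auto
  then show "(\<lambda>n. abs_l2 (f n)) \<longlonglongrightarrow> abs_l2 g"
    by (intro tendsto_abs_l2 sq g) simp
qed

text \<open>Separability of \<open>l2\<close>, which the library's Bochner integral requires of its value type.\<close>

definition ind_l2 :: "(real^3) set \<Rightarrow> real^3 \<Rightarrow> l2" where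
  "ind_l2 A y = abs_l2 (\<lambda>x. indicator A x *\<^sub>R y)"

lemma measurable_torus: "A \<in> sets borel \<Longrightarrow> indicator A \<in> borel_measurable torus"
  unfolding torus_def by (intro measurable_restrict_space1) auto

lemma sets_torus: "A \<in> sets torus \<Longrightarrow> A \<in> sets borel"
  unfolding torus_def using cell_borel by (auto simp: sets_restrict_space)

lemma square_integrable_ind:
  assumes "A \<in> sets borel"
  shows "square_integrable (\<lambda>x. indicator A x *\<^sub>R y)"
proof (rule square_integrable_bounded)
  show "(\<lambda>x. indicator A x *\<^sub>R y) \<in> borel_measurable torus"
    using measurable_torus[OF assms] by measurable
  show "norm (indicator A x *\<^sub>R y) \<le> norm y" for x
    by (simp add: indicator_def)
qed

lemma abs_l2_sum:
  assumes "finite I" "\<And>i. i \<in> I \<Longrightarrow> square_integrable (f i)"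
  shows "(\<Sum>i\<in>I. abs_l2 (f i)) = abs_l2 (\<lambda>x. \<Sum>i\<in>I. f i x) \<and> square_integrable (\<lambda>x. \<Sum>i\<in>I. f i x)"
  using assms
proof (induction I rule: finite_induct)
  case empty
  then show ?case by (auto simp: zero_l2_def intro: square_integrable_bounded[where B=0])
next
  case (insert i I)
  then have IH: "(\<Sum>i\<in>I. abs_l2 (f i)) = abs_l2 (\<lambda>x. \<Sum>i\<in>I. f i x)"
    "square_integrable (\<lambda>x. \<Sum>i\<in>I. f i x)" "square_integrable (f i)" by auto
  have "square_integrable (\<lambda>x. f i x + (\<Sum>i\<in>I. f i x))"
    by (rule square_integrable_add[OF IH(3) IH(2)])
  then show ?case using insert.hyps IH by (simp add: plus_l2.abs_eq)
qed

lemma countable_dense_l2: "\<exists>D :: l2 set. countable D \<and> closure D = UNIV"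
proof -
  obtain E :: "(real^3) set set" where E: "countable E" "topological_basis E"
    using ex_countable_basis by auto
  define G where "G = \<Inter> ` {F. finite F \<and> F \<subseteq> E}"
  have cG: "countable G"
    unfolding G_def using E(1) countable_Collect_finite_subset by blast
  have "E \<subseteq> G"
  proof
    fix A assume "A \<in> E"
    then show "A \<in> G" unfolding G_def by (intro image_eqI[of _ _ "{A}"]) auto
  qed
  have openG: "open A" if "A \<in> G" for A
    using that topological_basis_open[OF E(2)] by (auto simp: G_def intro!: open_Inter)
  have "topological_basis G"
  proof (rule topological_basisI)
    fix U :: "(real^3) set" and x assume "open U" "x \<in> U"
    then obtain A where "A \<in> E" "x \<in> A" "A \<subseteq> U"
      using topological_basisE[OF E(2)] by metis
    then show "\<exists>A\<in>G. x \<in> A \<and> A \<subseteq> U" using \<open>E \<subseteq> G\<close> by blast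
  qed (rule openG)
  then have borelG: "sets borel = sigma_sets UNIV G"
    by (subst borel_eq_countable_basis[OF cG]) (simp_all add: sets_measure_of)
  have "UNIV \<in> G"
    unfolding G_def by (intro image_eqI[of _ _ "{}"]) auto
  have "Int_stable G"
  proof (rule Int_stableI)
    fix A B assume "A \<in> G" "B \<in> G"
    then obtain F F' where "A = \<Inter>F" "B = \<Inter>F'" "finite F" "F \<subseteq> E" "finite F'" "F' \<subseteq> E"
      by (auto simp: G_def)
    then show "A \<inter> B \<in> G"
      unfolding G_def by (intro image_eqI[of _ _ "F \<union> F'"]) auto
  qed
  define S where "S = (\<lambda>(A, i). ind_l2 A (axis i 1)) ` (G \<times> UNIV)"
  define D where "D = (\<lambda>xs. \<Sum>(q, b)\<leftarrow>xs. q *\<^sub>R b) ` lists (\<rat> \<times> S)"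
  have "countable S" unfolding S_def using cG by auto
  then have "countable D" unfolding D_def using countable_rat by (intro countable_image countable_lists) auto
  have D_add: "u + v \<in> D" if uv: "u \<in> D" "v \<in> D" for u v
  proof -
    obtain xs ys where "xs \<in> lists (\<rat> \<times> S)" "ys \<in> lists (\<rat> \<times> S)"
      "u = (\<Sum>(q, b)\<leftarrow>xs. q *\<^sub>R b)" "v = (\<Sum>(q, b)\<leftarrow>ys. q *\<^sub>R b)"
      using uv by (auto simp: D_def)
    then show ?thesis unfolding D_def by (intro image_eqI[of _ _ "xs @ ys"]) auto
  qed
  have D_scale: "r *\<^sub>R u \<in> D" if r: "r \<in> \<rat>" and u: "u \<in> D" for r u
  proof -
    obtain xs where xs: "xs \<in> lists (\<rat> \<times> S)" "u = (\<Sum>(q, b)\<leftarrow>xs. q *\<^sub>R b)"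
      using u by (auto simp: D_def)
    have "r *\<^sub>R (\<Sum>(q, b)\<leftarrow>xs. q *\<^sub>R b) = (\<Sum>(q, b)\<leftarrow>map (\<lambda>(q, b). (r * q, b)) xs. q *\<^sub>R b)"
      by (induction xs) (auto simp: scaleR_add_right)
    moreover have "map (\<lambda>(q, b). (r * q, b)) xs \<in> lists (\<rat> \<times> S)"
      using xs(1) r by (auto simp: lists_eq_set)
    ultimately show ?thesis unfolding D_def xs(2) by blast
  qed
  have D_S: "b \<in> D" if "b \<in> S" for b
    unfolding D_def using that by (intro image_eqI[of _ _ "[(1, b)]"]) auto
  define V where "V = closure D"
  have V_lim: "u \<in> V" if "\<And>n::nat. s n \<in> V" "s \<longlonglongrightarrow> u" for s u
    using closed_sequentially[OF closed_closure[of D], of s u] that unfolding V_def by blast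
  have V_add: "u + v \<in> V" if uv: "u \<in> V" "v \<in> V" for u v
  proof -
    obtain s where s: "\<forall>n. s n \<in> D" "s \<longlonglongrightarrow> u"
      using uv(1) unfolding V_def closure_sequential by blast
    obtain s' where s': "\<forall>n. s' n \<in> D" "s' \<longlonglongrightarrow> v"
      using uv(2) unfolding V_def closure_sequential by blast
    have "s n + s' n \<in> V" for n
      using D_add s(1) s'(1) closure_subset[of D] unfolding V_def by blast
    then show ?thesis by (rule V_lim[OF _ tendsto_add[OF s(2) s'(2)]])
  qed
  have V_scale: "r *\<^sub>R u \<in> V" if u: "u \<in> V" for r u
  proof -
    obtain s where s: "\<forall>n. s n \<in> D" "s \<longlonglongrightarrow> u"
      using u unfolding V_def closure_sequential by blast
    have "r \<in> closure \<rat>" by (simp add: Rats_closure_real)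
    then obtain q where q: "\<forall>n. q n \<in> \<rat>" "q \<longlonglongrightarrow> r"
      unfolding closure_sequential by blast
    have "q n *\<^sub>R s n \<in> V" for n
      using D_scale s(1) q(1) closure_subset[of D] unfolding V_def by blast
    then show ?thesis by (rule V_lim[OF _ tendsto_scaleR[OF q(2) s(2)]])
  qed
  have V_0: "0 \<in> V"
  proof -
    have "0 \<in> D" unfolding D_def by (intro image_eqI[of _ _ "[]"]) auto
    then show ?thesis using closure_subset by (auto simp: V_def)
  qed
  have V_sum: "(\<Sum>i\<in>I. u i) \<in> V" if "finite I" "\<And>i. i \<in> I \<Longrightarrow> u i \<in> V" for I :: "'i set" and u
    using that by (induction I rule: finite_induct) (simp_all add: V_0 V_add)
  have ind_axis: "ind_l2 A (axis i 1) \<in> V" if A: "A \<in> sets borel" for A and i :: 3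
  proof -
    have "A \<in> sigma_sets UNIV G" using A borelG by simp
    then show ?thesis
    proof (induction rule: sigma_sets_induct_disjoint[OF \<open>Int_stable G\<close> subset_UNIV[of G, folded Pow_UNIV], consumes 1, case_names basic empty compl union])
      case (basic A)
      then have "ind_l2 A (axis i 1) \<in> S" by (auto simp: S_def)
      then show ?case using D_S closure_subset by (auto simp: V_def)
    next
      case empty
      then show ?case using V_0 by (simp add: ind_l2_def zero_l2_def)
    next
      case (compl A)
      have "ind_l2 UNIV (axis i 1) \<in> V"
        using \<open>UNIV \<in> G\<close> D_S closure_subset by (auto simp: V_def S_def)
      moreover have "ind_l2 (UNIV - A) (axis i 1) = ind_l2 UNIV (axis i 1) + (-1) *\<^sub>R ind_l2 A (axis i 1)"
      proof -
        have "A \<in> sets borel" unfolding borelG by (rule compl(1))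
        then have "ind_l2 UNIV (axis i 1) - ind_l2 A (axis i 1) = abs_l2 (\<lambda>x. indicator UNIV x *\<^sub>R axis i 1 - indicator A x *\<^sub>R axis i 1)"
          unfolding ind_l2_def by (intro abs_l2_minus square_integrable_ind) auto
        also have "\<dots> = ind_l2 (UNIV - A) (axis i 1)"
          unfolding ind_l2_def by (rule arg_cong[of _ _ abs_l2]) (auto simp: fun_eq_iff indicator_def)
        finally show ?thesis by simp
      qed
      ultimately show ?case by (simp only: V_add V_scale compl)
    next
      case (union A)
      have meas: "A k \<in> sets borel" for k unfolding borelG using union(2) by (simp add: image_subset_iff)
      have "ind_l2 (\<Union>k<n. A k) (axis i 1) \<in> V" for n
      proof (induction n)
        case 0
        then show ?case using V_0 by (simp add: ind_l2_def zero_l2_def)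
      next
        case (Suc n)
        have "(\<Union>k<n. A k) \<inter> A n = {}"
        proof -
          have "A k \<inter> A n = {}" if "k < n" for k
            by (rule disjoint_family_onD[OF union(1)]) (use that in auto)
          then show ?thesis unfolding disjoint_iff by (metis UN_E IntI empty_iff lessThan_iff)
        qed
        then have "indicator (\<Union>k<Suc n. A k) x = indicator (\<Union>k<n. A k) x + (indicator (A n) x :: real)" for x
          unfolding lessThan_Suc UN_insert by (subst Un_commute) (rule indicator_add[symmetric])
        then have "abs_l2 (\<lambda>x. indicator (\<Union>k<Suc n. A k) x *\<^sub>R axis i 1) =
          abs_l2 (\<lambda>x. indicator (\<Union>k<n. A k) x *\<^sub>R axis i 1 + indicator (A n) x *\<^sub>R axis i 1)"
          by (simp only: scaleR_add_left)
        also have "\<dots> = ind_l2 (\<Union>k<n. A k) (axis i 1) + ind_l2 (A n) (axis i 1)"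
          unfolding ind_l2_def using meas
          by (intro plus_l2.abs_eq[symmetric]) (simp_all add: square_integrable_ind sets.finite_UN)
        finally show ?case unfolding ind_l2_def[of "\<Union>k<Suc n. A k"]
          using Suc union(3)[of n] V_add by simp
      qed
      moreover have "(\<lambda>n. ind_l2 (\<Union>k<n. A k) (axis i 1)) \<longlonglongrightarrow> ind_l2 (\<Union>k. A k) (axis i 1)"
        unfolding ind_l2_def
      proof (rule tendsto_abs_l2_dominated)
        show "(\<lambda>x. indicator (\<Union>k<n. A k) x *\<^sub>R (axis i 1 :: real^3)) \<in> borel_measurable torus" for n
          by (rule square_integrable_ind[unfolded square_integrable_def, THEN conjunct1])
             (use meas in auto)
        show "square_integrable (\<lambda>x. indicator (\<Union>k. A k) x *\<^sub>R axis i 1)"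
          using meas by (intro square_integrable_ind) auto
        show "square_integrable (\<lambda>x. indicator UNIV x *\<^sub>R axis i (1::real))"
          by (intro square_integrable_ind) auto
        show "(\<lambda>n. indicator (\<Union>k<n. A k) x *\<^sub>R axis i 1) \<longlonglongrightarrow> indicator (\<Union>k. A k) x *\<^sub>R (axis i 1 :: real^3)" for x
          by (intro tendsto_scaleR tendsto_const LIMSEQ_indicator_UN)
      qed (auto simp: indicator_def)
      ultimately show ?case by (rule V_lim)
    qed
  qed
  have ind: "ind_l2 A y \<in> V" if A: "A \<in> sets borel" for A y
  proof -
    have "(\<Sum>i\<in>UNIV. (y $ i) *\<^sub>R ind_l2 A (axis i 1)) = (\<Sum>i\<in>UNIV. abs_l2 (\<lambda>x. (y $ i) *\<^sub>R (indicator A x *\<^sub>R axis i 1)))"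
      unfolding ind_l2_def using A by (simp add: scaleR_l2.abs_eq square_integrable_ind)
    also have "\<dots> = abs_l2 (\<lambda>x. \<Sum>i\<in>UNIV. (y $ i) *\<^sub>R (indicator A x *\<^sub>R axis i 1))"
      using A by (intro abs_l2_sum[THEN conjunct1] square_integrable_scaleR square_integrable_ind) auto
    also have "\<dots> = ind_l2 A y"
      unfolding ind_l2_def
      by (intro arg_cong[of _ _ abs_l2] ext) (auto simp: vec_eq_iff axis_def indicator_def if_distrib cong: if_cong)
    finally have "ind_l2 A y = (\<Sum>i\<in>UNIV. (y $ i) *\<^sub>R ind_l2 A (axis i 1))" by simp
    also have "\<dots> \<in> V" using A by (intro V_sum V_scale ind_axis) auto
    finally show ?thesis .
  qed
  have "u \<in> V" for u
  proof -
    have u: "square_integrable (rep_l2 u)" by (rule abs_rep_l2)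
    then have "rep_l2 u \<in> borel_measurable torus" by (simp add: square_integrable_def)
    from borel_measurable_implies_sequence_metric[OF this, of 0]
    obtain s where s: "\<And>i. simple_function torus (s i)"
      "\<And>x. x \<in> space torus \<Longrightarrow> (\<lambda>i. s i x) \<longlonglongrightarrow> rep_l2 u x"
      "\<And>i x. x \<in> space torus \<Longrightarrow> dist (s i x) 0 \<le> 2 * dist (rep_l2 u x) 0"
      by metis
    have sm: "s i \<in> borel_measurable torus" for i
      using s(1) by (rule borel_measurable_simple_function)
    have w: "square_integrable (\<lambda>x. 2 *\<^sub>R rep_l2 u x)"
      using u by (rule square_integrable_scaleR)
    have lim: "(\<lambda>i. abs_l2 (s i)) \<longlonglongrightarrow> u" and sq: "square_integrable (s i)" for i
    proof -
      have le: "norm (s j x) \<le> norm (2 *\<^sub>R rep_l2 u x)" if "x \<in> space torus" for j x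
        using s(3)[OF that, of j] by simp
      note dom = tendsto_abs_l2_dominated[OF sm u w s(2) le]
      show "(\<lambda>i. abs_l2 (s i)) \<longlonglongrightarrow> u" using dom(1) by (simp add: abs_rep_l2)
      show "square_integrable (s i)" by (rule dom(2))
    qed
    have "abs_l2 (s i) \<in> V" for i
    proof -
      let ?I = "s i ` space torus"
      let ?A = "\<lambda>y. s i -` {y} \<inter> space torus"
      have fin: "finite ?I" and A: "\<And>y. y \<in> ?I \<Longrightarrow> ?A y \<in> sets borel"
        using s(1)[of i] unfolding simple_function_def by (blast intro: sets_torus)+
      have "(\<Sum>y\<in>?I. ind_l2 (?A y) y) = abs_l2 (\<lambda>x. \<Sum>y\<in>?I. indicator (?A y) x *\<^sub>R y)"
        and sq': "square_integrable (\<lambda>x. \<Sum>y\<in>?I. indicator (?A y) x *\<^sub>R y)"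
        unfolding ind_l2_def
        using abs_l2_sum[OF fin, of "\<lambda>y x. indicator (?A y) x *\<^sub>R y", OF square_integrable_ind[OF A]]
        by blast+
      note \<open>(\<Sum>y\<in>?I. ind_l2 (?A y) y) = abs_l2 (\<lambda>x. \<Sum>y\<in>?I. indicator (?A y) x *\<^sub>R y)\<close>
      also have "abs_l2 (\<lambda>x. \<Sum>y\<in>?I. indicator (?A y) x *\<^sub>R y) = abs_l2 (s i)"
      proof (rule abs_l2_eq[OF sq' sq AE_I2])
        fix x assume x: "x \<in> space torus"
        have "(\<Sum>y\<in>?I. indicator (?A y) x *\<^sub>R y) = (\<Sum>y\<in>{s i x}. indicator (?A y) x *\<^sub>R y)"
          using fin x by (intro sum.mono_neutral_right) (auto simp: indicator_def)
        then show "(\<Sum>y\<in>?I. indicator (?A y) x *\<^sub>R y) = s i x" using x by simp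
      qed
      finally have "abs_l2 (s i) = (\<Sum>y\<in>?I. ind_l2 (?A y) y)" ..
      also have "\<dots> \<in> V" by (intro V_sum fin ind A)
      finally show ?thesis .
    qed
    then show ?thesis using lim by (rule V_lim)
  qed
  then show ?thesis using \<open>countable D\<close> unfolding V_def by auto
qed

instance l2 :: second_countable_topology
proof
  obtain D :: "l2 set" where D: "countable D" "closure D = UNIV"
    using countable_dense_l2 by auto
  define B where "B = (\<lambda>(d, n). ball d (1 / real (Suc n))) ` (D \<times> UNIV)"
  have "countable B" unfolding B_def using D(1) by auto
  moreover have "topological_basis B"
  proof (rule topological_basisI)
    fix U :: "l2 set" and u assume "open U" "u \<in> U"
    then obtain e where e: "e > 0" "ball u e \<subseteq> U" by (auto simp: open_contains_ball)
    obtain n where n: "1 / real (Suc n) < e / 2" using nat_approx_posE[of "e / 2"] e(1) by auto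
    obtain d where d: "d \<in> D" "dist d u < 1 / real (Suc n)"
      using D(2) closure_approachable[of u D] by (metis UNIV_I divide_pos_pos of_nat_0_less_iff zero_less_Suc zero_less_one)
    have "ball d (1 / real (Suc n)) \<subseteq> ball u e"
    proof
      fix v assume "v \<in> ball d (1 / real (Suc n))"
      then show "v \<in> ball u e"
        using d(2) n dist_triangle[of u v d] by (simp add: dist_commute)
    qed
    then show "\<exists>B'\<in>B. u \<in> B' \<and> B' \<subseteq> U"
      using d e(2) by (intro bexI[of _ "ball d (1 / real (Suc n))"]) (auto simp: B_def)
  qed (auto simp: B_def)
  ultimately show "\<exists>B::l2 set set. countable B \<and> open = generate_topology B"
    using topological_basis_imp_subbasis by blast
qed

lemma norm_diff_l2:
  "(norm (u - v))\<^sup>2 = (\<integral>x. (norm (rep_l2 u x - rep_l2 v x))\<^sup>2 \<partial>torus)"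
  "integrable torus (\<lambda>x. (norm (rep_l2 u x - rep_l2 v x))\<^sup>2)"
proof -
  have sq: "square_integrable (\<lambda>x. rep_l2 u x - rep_l2 v x)"
    by (rule square_integrable_minus[OF abs_rep_l2(1) abs_rep_l2(1)])
  then show "integrable torus (\<lambda>x. (norm (rep_l2 u x - rep_l2 v x))\<^sup>2)"
    by (simp add: square_integrable_def)
  have "u - v = abs_l2 (\<lambda>x. rep_l2 u x - rep_l2 v x)"
    using abs_l2_minus[OF abs_rep_l2(1) abs_rep_l2(1), of u v] by (simp add: abs_rep_l2)
  then have "norm (u - v) = sqrt (\<integral>x. (norm (rep_l2 u x - rep_l2 v x))\<^sup>2 \<partial>torus)"
    using norm_abs_l2[OF sq] by simp
  then show "(norm (u - v))\<^sup>2 = (\<integral>x. (norm (rep_l2 u x - rep_l2 v x))\<^sup>2 \<partial>torus)"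
    by (simp add: integral_nonneg_AE)
qed

text \<open>Riesz--Fischer.\<close>

instance l2 :: banach
proof
  fix X :: "nat \<Rightarrow> l2" assume X: "Cauchy X"
  have "\<exists>r. \<forall>k. (\<forall>m\<ge>r k. \<forall>n\<ge>r k. norm (X m - X n) < (1/2) ^ k) \<and> r k < r (Suc k)"
  proof (rule dependent_nat_choice)
    show "\<exists>N. \<forall>m\<ge>N. \<forall>n\<ge>N. norm (X m - X n) < (1/2) ^ 0"
      using CauchyD[OF X, of 1] by auto
    fix M k
    obtain N where "\<forall>m\<ge>N. \<forall>n\<ge>N. norm (X m - X n) < (1/2) ^ Suc k"
      using CauchyD[OF X, of "(1/2) ^ Suc k"] by auto
    then show "\<exists>N. (\<forall>m\<ge>N. \<forall>n\<ge>N. norm (X m - X n) < (1/2) ^ Suc k) \<and> M < N"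
      by (intro exI[of _ "max N (Suc M)"]) auto
  qed
  then obtain r where r: "\<And>k m n. m \<ge> r k \<Longrightarrow> n \<ge> r k \<Longrightarrow> norm (X m - X n) < (1/2) ^ k"
    and r_less: "\<And>k. r k < r (Suc k)" by blast
  have mono: "strict_mono r" using r_less by (simp add: strict_mono_Suc_iff)
  define f where "f k = rep_l2 (X (r k))" for k
  have [measurable]: "f k \<in> borel_measurable torus" for k
    using abs_rep_l2(1) unfolding f_def square_integrable_def by blast
  have f_int: "integrable torus (\<lambda>x. (norm (f m x - f n x))\<^sup>2)" for m n
    unfolding f_def by (rule norm_diff_l2(2))
  have f_le: "(\<integral>x. (norm (f m x - f n x))\<^sup>2 \<partial>torus) \<le> ((1/2) ^ k)\<^sup>2" if "m \<ge> k" "n \<ge> k" for k m n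
  proof -
    have "r k \<le> r m" "r k \<le> r n"
      using mono that by (auto simp: strict_mono_less_eq)
    then have "norm (X (r m) - X (r n)) \<le> (1/2) ^ k" using r by (simp add: less_imp_le)
    then have "(norm (X (r m) - X (r n)))\<^sup>2 \<le> ((1/2) ^ k)\<^sup>2" by (intro power_mono) auto
    then show ?thesis unfolding f_def norm_diff_l2(1) .
  qed
  let ?g = "\<lambda>k x. norm (f (Suc k) x - f k x)"
  let ?\<mu> = "measure torus (space torus)"
  have g_le: "(\<integral>\<^sup>+x. ?g k x \<partial>torus) \<le> ennreal ((1/2) ^ k * (?\<mu> + 1))" for k
  proof -
    have le: "?g k x \<le> (1/2) ^ k + 2 ^ k * (?g k x)\<^sup>2" for x
    proof -
      have "?g k x * 1 \<le> (1/2) ^ k + 2 ^ k * (?g k x)\<^sup>2"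
      proof (cases "?g k x \<le> (1/2) ^ k")
        case False
        then have "(1/2) ^ k * ?g k x \<le> (?g k x)\<^sup>2"
          by (simp add: power2_eq_square mult_right_mono)
        then have "2 ^ k * ((1/2) ^ k * ?g k x) \<le> 2 ^ k * (?g k x)\<^sup>2"
          by (rule mult_left_mono) simp
        moreover have "2 ^ k * ((1/2) ^ k * ?g k x) = ?g k x"
          by (simp add: power_divide)
        moreover have "0 \<le> (1/2 :: real) ^ k" by simp
        ultimately show ?thesis by linarith
      qed (simp add: add_increasing2)
      then show ?thesis by simp
    qed
    have "(\<integral>\<^sup>+x. ?g k x \<partial>torus) \<le> (\<integral>\<^sup>+x. ennreal ((1/2) ^ k + 2 ^ k * (?g k x)\<^sup>2) \<partial>torus)"
      by (intro nn_integral_mono ennreal_leI le)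
    also have "\<dots> = ennreal (\<integral>x. (1/2) ^ k + 2 ^ k * (?g k x)\<^sup>2 \<partial>torus)"
      by (intro nn_integral_eq_integral Bochner_Integration.integrable_add) (auto intro: f_int)
    also have "(\<integral>x. (1/2) ^ k + 2 ^ k * (?g k x)\<^sup>2 \<partial>torus)
        = (1/2) ^ k * ?\<mu> + 2 ^ k * (\<integral>x. (?g k x)\<^sup>2 \<partial>torus)"
      by (subst Bochner_Integration.integral_add) (auto intro: f_int)
    also have "\<dots> \<le> (1/2) ^ k * ?\<mu> + 2 ^ k * ((1/2) ^ k)\<^sup>2"
      using f_le[of k "Suc k" k] by (intro add_left_mono mult_left_mono) auto
    also have "\<dots> = (1/2) ^ k * (?\<mu> + 1)"
      by (simp add: power2_eq_square power_divide field_simps)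
    finally show ?thesis by (simp add: ennreal_leI)
  qed
  have "(\<integral>\<^sup>+x. (\<Sum>k. ennreal (?g k x)) \<partial>torus) = (\<Sum>k. \<integral>\<^sup>+x. ?g k x \<partial>torus)"
    by (rule nn_integral_suminf) auto
  also have "\<dots> \<le> (\<Sum>k. ennreal ((1/2) ^ k * (?\<mu> + 1)))"
    by (intro suminf_le g_le) auto
  also have "\<dots> = ennreal (\<Sum>k. (1/2) ^ k * (?\<mu> + 1))"
    by (intro suminf_ennreal2 summable_mult2 summable_geometric) auto
  also have "\<dots> < \<infinity>" by simp
  finally have "AE x in torus. (\<Sum>k. ennreal (?g k x)) \<noteq> \<infinity>"
    by (intro nn_integral_PInf_AE) auto
  then have conv: "AE x in torus. convergent (\<lambda>k. f k x)"
  proof eventually_elim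
    case (elim x)
    then have "summable (\<lambda>k. ?g k x)"
      by (intro summable_suminf_not_top) auto
    then have "summable (\<lambda>k. f (Suc k) x - f k x)" by (rule summable_norm_cancel)
    then have "convergent (\<lambda>n. \<Sum>k<n. f (Suc k) x - f k x)"
      by (simp add: summable_iff_convergent)
    then have "convergent (\<lambda>n. f n x - f 0 x)"
      by (simp only: sum_lessThan_telescope[of "\<lambda>k. f k x"])
    from convergent_add[OF this convergent_const[of "f 0 x"]] show ?case by simp
  qed
  define h where "h x = lim (\<lambda>k. f k x)" for x
  have [measurable]: "h \<in> borel_measurable torus"
    unfolding h_def[abs_def] by (rule borel_measurable_lim_metric) auto
  have h_nn: "(\<integral>\<^sup>+x. ennreal ((norm (f k x - h x))\<^sup>2) \<partial>torus) \<le> ennreal (((1/2) ^ k)\<^sup>2)" for k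
  proof -
    have "(\<integral>\<^sup>+x. ennreal ((norm (f k x - h x))\<^sup>2) \<partial>torus)
        = (\<integral>\<^sup>+x. liminf (\<lambda>m. ennreal ((norm (f k x - f m x))\<^sup>2)) \<partial>torus)"
    proof (rule nn_integral_cong_AE, use conv in eventually_elim)
      case (elim x)
      then have "(\<lambda>m. f m x) \<longlonglongrightarrow> h x" unfolding h_def by (simp add: convergent_LIMSEQ_iff)
      then have "(\<lambda>m. ennreal ((norm (f k x - f m x))\<^sup>2)) \<longlonglongrightarrow> ennreal ((norm (f k x - h x))\<^sup>2)"
        by (intro tendsto_intros tendsto_ennrealI)
      then show ?case by (rule lim_imp_Liminf[OF trivial_limit_sequentially, symmetric])
    qed
    also have "\<dots> \<le> liminf (\<lambda>m. \<integral>\<^sup>+x. ennreal ((norm (f k x - f m x))\<^sup>2) \<partial>torus)"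
      by (rule nn_integral_liminf) auto
    also have "\<dots> \<le> ennreal (((1/2) ^ k)\<^sup>2)"
    proof (rule Liminf_le)
      show "\<forall>\<^sub>F m in sequentially. (\<integral>\<^sup>+x. ennreal ((norm (f k x - f m x))\<^sup>2) \<partial>torus) \<le> ennreal (((1/2) ^ k)\<^sup>2)"
        using eventually_ge_at_top[of k]
      proof eventually_elim
        case (elim m)
        then show ?case
          using f_le[of k k m] f_int[of k m] by (simp add: nn_integral_eq_integral ennreal_leI)
      qed
    qed simp
    finally show ?thesis .
  qed
  have h_int: "integrable torus (\<lambda>x. (norm (f k x - h x))\<^sup>2)" for k
    using h_nn[of k] by (intro integrableI_bounded) (auto intro: le_less_trans)
  then have "square_integrable (\<lambda>x. f k x - h x)" for k
    by (auto simp: square_integrable_def)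
  from square_integrable_minus[OF _ this, of "f 0" 0] have h_sq: "square_integrable h"
    using abs_rep_l2(1) by (simp add: f_def)
  have le: "norm (X (r k) - abs_l2 h) \<le> (1/2) ^ k" for k
  proof -
    have "X (r k) - abs_l2 h = abs_l2 (\<lambda>x. f k x - h x)"
      using abs_l2_minus[OF abs_rep_l2(1) h_sq] by (simp add: f_def abs_rep_l2)
    moreover have "square_integrable (\<lambda>x. f k x - h x)"
      using h_int by (auto simp: square_integrable_def)
    ultimately have "norm (X (r k) - abs_l2 h) = sqrt (\<integral>x. (norm (f k x - h x))\<^sup>2 \<partial>torus)"
      by (simp only: norm_abs_l2)
    also have "(\<integral>x. (norm (f k x - h x))\<^sup>2 \<partial>torus) \<le> ((1/2) ^ k)\<^sup>2"
      using h_nn[of k] h_int[of k] by (simp add: nn_integral_eq_integral)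
    finally show ?thesis by (simp add: real_le_lsqrt)
  qed
  have "(\<lambda>k. X (r k) - abs_l2 h) \<longlonglongrightarrow> 0"
    using le by (intro Lim_null_comparison[OF _ LIMSEQ_power_zero[of "1/2 :: real"]]) auto
  then have "(X \<circ> r) \<longlonglongrightarrow> abs_l2 h"
    unfolding comp_def by (rule LIM_zero_cancel)
  then show "convergent X"
    using Cauchy_converges_subseq[OF X mono] by (auto simp: convergent_def)
qed


subsection \<open>Sobolev spaces on the torus\<close>

primrec C_k :: "nat \<Rightarrow> ('a::euclidean_space \<Rightarrow> 'b::real_normed_vector) \<Rightarrow> bool" where
  "C_k 0 f \<longleftrightarrow> continuous_on UNIV f"
| "C_k (Suc k) f \<longleftrightarrow> (\<forall>x. f differentiable (at x)) \<and>
     (\<forall>b\<in>Basis. C_k k (\<lambda>x. frechet_derivative f (at x) b))"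

definition C_infinity :: "('a::euclidean_space \<Rightarrow> 'b::real_normed_vector) \<Rightarrow> bool" where
  "C_infinity f \<longleftrightarrow> (\<forall>k. C_k k f)"

definition torus_test_field :: "(real^3 \<Rightarrow> real^3) \<Rightarrow> bool" where
  "torus_test_field \<psi> \<longleftrightarrow>
     C_infinity \<psi> \<and> (\<forall>x i. \<psi> (x + (2 * pi) *\<^sub>R axis i 1) = \<psi> x)"

definition has_weak_pd :: "l2 \<Rightarrow> l2 \<Rightarrow> 3 \<Rightarrow> bool" where
  "has_weak_pd u w j \<longleftrightarrow> (\<forall>\<psi>. torus_test_field \<psi> \<longrightarrow>
     (\<integral>x. rep_l2 u x \<bullet> frechet_derivative \<psi> (at x) (axis j 1) \<partial>torus) =
     - (\<integral>x. rep_l2 w x \<bullet> \<psi> x \<partial>torus))"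

text \<open>The weak partial derivative \<open>\<partial>\<^sub>j u\<close>; meaningful only where \<open>has_weak_pd u w j\<close> holds for some \<open>w\<close>.\<close>

definition pd :: "3 \<Rightarrow> l2 \<Rightarrow> l2" where
  "pd j u = (THE w. has_weak_pd u w j)"

text \<open>\<open>H\<^sup>m(\<T>\<^sup>3)\<close> and its norm. For \<open>m = 2\<close> the squared norm unfolds to
  \<open>\<parallel>u\<parallel>\<^sup>2 + (\<Sum>j. \<parallel>\<partial>\<^sub>j u\<parallel>\<^sup>2) + (\<Sum>j k. \<parallel>\<partial>\<^sub>k \<partial>\<^sub>j u\<parallel>\<^sup>2)\<close>.\<close>

primrec sobolev :: "nat \<Rightarrow> l2 set" where
  "sobolev 0 = UNIV"
| "sobolev (Suc m) = {u. \<forall>j. (\<exists>w. has_weak_pd u w j) \<and> pd j u \<in> sobolev m}"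

primrec sobolev_norm :: "nat \<Rightarrow> l2 \<Rightarrow> real" where
  "sobolev_norm 0 u = norm u"
| "sobolev_norm (Suc m) u = sqrt ((norm u)\<^sup>2 + (\<Sum>j\<in>UNIV. (sobolev_norm m (pd j u))\<^sup>2))"

definition mean_free :: "l2 set" where
  "mean_free = {u. (\<integral>x. rep_l2 u x \<partial>torus) = 0}"

definition laplacian :: "l2 \<Rightarrow> l2" where
  "laplacian u = (\<Sum>j\<in>UNIV. pd j (pd j u))"

definition curl :: "l2 \<Rightarrow> real^3 \<Rightarrow> real^3" where
  "curl u x = (let D = (\<lambda>j i. rep_l2 (pd j u) x $ i) in
     vector [D 2 3 - D 3 2, D 3 1 - D 1 3, D 1 2 - D 2 1])"


subsection \<open>Spaces of time-dependent fields\<close>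

text \<open>\<open>L\<^sup>2(0,T;X)\<close> for a subspace \<open>X\<close> of \<open>l2\<close> with norm \<open>N\<close>: strong (Bochner) measurability into
  \<open>(X, N)\<close> together with square integrability of the norm. Values on null sets are irrelevant.\<close>

definition L2_time :: "real \<Rightarrow> l2 set \<Rightarrow> (l2 \<Rightarrow> real) \<Rightarrow> (real \<Rightarrow> l2) set" where
  "L2_time T X N = {u.
     (\<exists>s. (\<forall>n::nat. simple_function (lebesgue_on {0<..<T}) (s n) \<and> s n ` {0<..<T} \<subseteq> X) \<and>
          (AE t in lebesgue_on {0<..<T}. u t \<in> X \<and> (\<lambda>n. N (s n t - u t)) \<longlonglongrightarrow> 0)) \<and>
     integrable (lebesgue_on {0<..<T}) (\<lambda>t. (N (u t))\<^sup>2)}"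

definition L2_time_norm :: "real \<Rightarrow> (l2 \<Rightarrow> real) \<Rightarrow> (real \<Rightarrow> l2) \<Rightarrow> real" where
  "L2_time_norm T N u = sqrt (\<integral>t. (N (u t))\<^sup>2 \<partial>lebesgue_on {0<..<T})"

definition C_time :: "real \<Rightarrow> l2 set \<Rightarrow> (l2 \<Rightarrow> real) \<Rightarrow> (real \<Rightarrow> l2) set" where
  "C_time T X N = {u. \<forall>t\<in>{0..T}. u t \<in> X \<and>
     ((\<lambda>s. N (u s - u t)) \<longlongrightarrow> 0) (at t within {0..T})}"

definition C_time_norm :: "real \<Rightarrow> (l2 \<Rightarrow> real) \<Rightarrow> (real \<Rightarrow> l2) \<Rightarrow> real" where
  "C_time_norm T N u = (SUP t\<in>{0..T}. N (u t))"

text \<open>\<open>\<partial>\<^sub>t u = g\<close> in the sense of \<open>l2\<close>-valued distributions on \<open>(0,T)\<close>; the integrals are Bochner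
  integrals in \<open>l2\<close>.\<close>

definition has_weak_time_deriv :: "real \<Rightarrow> (real \<Rightarrow> l2) \<Rightarrow> (real \<Rightarrow> l2) \<Rightarrow> bool" where
  "has_weak_time_deriv T u g \<longleftrightarrow>
     (\<forall>\<phi> :: real \<Rightarrow> real.
        C_infinity \<phi> \<and> (\<exists>a b. 0 < a \<and> b < T \<and> (\<forall>t. t \<notin> {a..b} \<longrightarrow> \<phi> t = 0)) \<longrightarrow>
        (\<integral>t. deriv \<phi> t *\<^sub>R u t \<partial>lebesgue_on {0<..<T}) =
        - (\<integral>t. \<phi> t *\<^sub>R g t \<partial>lebesgue_on {0<..<T}))"


subsection \<open>Strong solutions\<close>

text \<open>
  The equation is required almost everywhere on \<open>(0,T) \<times> \<T>\<^sup>3\<close>. As the other three terms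
  belong to \<open>L\<^sup>2(0,T;L\<^sup>2)\<close>, this forces the nonlinear term to belong to it too, and
  is therefore the same as equality in \<open>L\<^sup>2(0,T;L\<^sup>2)\<close>.
\<close>

definition strong_solution ::
    "real \<Rightarrow> real \<Rightarrow> (real \<Rightarrow> l2) \<Rightarrow> l2 \<Rightarrow> (real \<Rightarrow> l2) \<Rightarrow> bool" where
  "strong_solution \<nu> T f u\<^sub>0 u \<longleftrightarrow>
     u \<in> C_time T (sobolev 1) (sobolev_norm 1) \<and>
     u \<in> L2_time T (sobolev 2) (sobolev_norm 2) \<and>
     u 0 = u\<^sub>0 \<and>
     (\<exists>g \<in> L2_time T UNIV norm. has_weak_time_deriv T u g \<and>
        (AE t in lebesgue_on {0<..<T}. AE x in torus.
           rep_l2 (g t) x + cross3 (curl (u t) x) (rep_l2 (u t) x) =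
           \<nu> *\<^sub>R rep_l2 (laplacian (u t)) x + rep_l2 (f t) x))"

end

theory Submission
  imports Defs
begin

text \<open>
  In the real orthonormal basis of \<open>L\<^sup>2(\<T>\<^sup>3)\<close> formed by the functions \<open>cos (k \<bullet> x) + sin (k \<bullet> x)\<close> times
  coordinate vectors, \<open>1 - \<Delta>\<close> is diagonal with eigenvalues \<open>m = 1 + |k|\<^sup>2\<close> and the Sobolev norms are
  weighted \<open>\<ell>\<^sup>2\<close> norms \<open>N s u = \<Sum>n. m\<^sub>n\<^sup>s c\<^sub>n\<^sup>2\<close>. The linear equation \<open>u' = - \<nu> (1 - \<Delta>) u + F\<close> decouples into
  scalar equations for the coefficients, which gives existence, uniqueness and the estimate of
  \<open>u\<close> in \<open>C H\<^sup>1 \<inter> L\<^sup>2 H\<^sup>2\<close> by \<open>F\<close> in \<open>L\<^sup>2 L\<^sup>2\<close>.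

  Put \<open>B(u,v) = (\<nabla> \<times> u) \<times> v\<close>. Since \<open>\<Sum>n. 1 / m\<^sub>n\<^sup>2 < \<infinity>\<close>, \<open>H\<^sup>2\<close> embeds into \<open>L\<^sup>\<infinity>\<close>, and after
  splitting off finitely many modes \<open>\<parallel>B(u,v)\<parallel>\<^sup>2 \<le> N 1 u (\<epsilon> N 2 v + C\<^sub>\<epsilon> N 1 v)\<close> for every \<open>\<epsilon> > 0\<close>. This bound
  makes the Picard iteration contract on a short time interval. For two solutions on a given
  interval it yields, together with Gronwall's inequality, a Lipschitz estimate of the difference
  as long as the difference stays below \<open>1\<close>; for close initial data that never fails. The
  energy balance follows from \<open>B(u,v) \<bullet> v = 0\<close>.
\<close>

subsection \<open>Absolutely continuous functions on an interval\<close>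

definition tmeas :: "real \<Rightarrow> real measure" where
  "tmeas T = lebesgue_on {0<..<T}"

definition prim :: "real \<Rightarrow> (real \<Rightarrow> real) \<Rightarrow> real \<Rightarrow> real" where
  "prim T g t = (\<integral>s. (if s \<le> t then g s else 0) \<partial>tmeas T)"

lemma space_tmeas [simp]: "space (tmeas T) = {0<..<T}"
  by (simp add: tmeas_def)

lemma borel_measurable_tmeas_id [measurable]: "(\<lambda>s. s) \<in> borel_measurable (tmeas T)"
  unfolding tmeas_def by (intro measurable_restrict_space1 measurable_completion) auto

lemma finite_measure_tmeas: "finite_measure (tmeas T)"
proof
  have "emeasure (tmeas T) (space (tmeas T)) = emeasure lborel {0<..<T}"
    by (simp add: tmeas_def emeasure_restrict_space)
  also have "\<dots> \<noteq> \<infinity>" by (cases "0 \<le> T") auto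
  finally show "emeasure (tmeas T) (space (tmeas T)) \<noteq> \<infinity>" .
qed

interpretation tmeas: finite_measure "tmeas T" for T
  by (rule finite_measure_tmeas)

lemma emeasure_tmeas: "0 \<le> T \<Longrightarrow> emeasure (tmeas T) (space (tmeas T)) = ennreal T"
  by (simp add: tmeas_def emeasure_restrict_space)

lemma AE_tmeas_neq: "AE s in tmeas T. s \<noteq> r"
proof -
  have "AE s in lebesgue. s \<noteq> r"
    by (rule AE_completion) (rule AE_lborel_singleton)
  then show ?thesis
    unfolding tmeas_def by (simp add: AE_restrict_space_iff) (auto elim: eventually_mono)
qed

lemma integrable_mult_bounded:
  fixes g b :: "real \<Rightarrow> real"
  assumes "integrable (tmeas T) g" "b \<in> borel_measurable (tmeas T)"
    and "\<And>s. s \<in> {0<..<T} \<Longrightarrow> \<bar>b s\<bar> \<le> B"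
  shows "integrable (tmeas T) (\<lambda>s. b s * g s)" "integrable (tmeas T) (\<lambda>s. g s * b s)"
proof -
  have [measurable]: "g \<in> borel_measurable (tmeas T)" "b \<in> borel_measurable (tmeas T)"
    using assms by auto
  show "integrable (tmeas T) (\<lambda>s. b s * g s)"
  proof (rule Bochner_Integration.integrable_bound)
    show "integrable (tmeas T) (\<lambda>s. B * g s)" using assms(1) by simp
    show "AE s in tmeas T. norm (b s * g s) \<le> norm (B * g s)"
    proof (intro AE_I2)
      fix s assume "s \<in> space (tmeas T)"
      then have "\<bar>b s\<bar> \<le> \<bar>B\<bar>" using assms(3)[of s] by simp
      then show "norm (b s * g s) \<le> norm (B * g s)" by (simp add: abs_mult mult_right_mono)
    qed
  qed simp
  then show "integrable (tmeas T) (\<lambda>s. g s * b s)" by (simp add: mult.commute)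
qed

lemma integrable_if:
  fixes g :: "real \<Rightarrow> real"
  assumes g: "integrable (tmeas T) g"
  shows "integrable (tmeas T) (\<lambda>s. if s \<le> t then g s else 0)"
proof -
  have [measurable]: "g \<in> borel_measurable (tmeas T)" using g by auto
  show ?thesis by (rule Bochner_Integration.integrable_bound[OF g]) auto
qed

lemma prim_add:
  assumes "integrable (tmeas T) g" "integrable (tmeas T) h"
  shows "prim T (\<lambda>s. g s + h s) t = prim T g t + prim T h t"
proof -
  have "prim T (\<lambda>s. g s + h s) t
      = (\<integral>s. (if s \<le> t then g s else 0) + (if s \<le> t then h s else 0) \<partial>tmeas T)"
    unfolding prim_def by (rule Bochner_Integration.integral_cong) auto
  then show ?thesis
    using assms by (simp add: prim_def integrable_if Bochner_Integration.integral_add)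
qed

lemma prim_cmult: "prim T (\<lambda>s. r * g s) t = r * prim T g t"
proof -
  have "prim T (\<lambda>s. r * g s) t = (\<integral>s. r * (if s \<le> t then g s else 0) \<partial>tmeas T)"
    unfolding prim_def by (rule Bochner_Integration.integral_cong) auto
  then show ?thesis by (simp add: prim_def)
qed

lemma prim_divide: "prim T (\<lambda>s. g s / r) t = prim T g t / r"
  using prim_cmult[of T "1 / r" g t] by simp

lemma prim_diff:
  assumes "integrable (tmeas T) g" "integrable (tmeas T) h"
  shows "prim T (\<lambda>s. g s - h s) t = prim T g t - prim T h t"
  using prim_add[OF assms(1), of "\<lambda>s. (-1) * h s" t] assms(2) prim_cmult[of T "-1" h t] by simp

lemma prim_cong:
  assumes "\<And>s. s \<in> {0<..<T} \<Longrightarrow> s \<le> t \<Longrightarrow> g s = h s"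
  shows "prim T g t = prim T h t"
  unfolding prim_def using assms by (intro Bochner_Integration.integral_cong) auto

lemma prim_mono:
  assumes "integrable (tmeas T) g" "integrable (tmeas T) h"
    and "AE s in tmeas T. s < t \<longrightarrow> g s \<le> h s"
  shows "prim T g t \<le> prim T h t"
  unfolding prim_def
proof (rule integral_mono_AE)
  show "AE s in tmeas T. (if s \<le> t then g s else 0) \<le> (if s \<le> t then h s else 0)"
    using assms(3) AE_tmeas_neq[where T=T and r=t] by eventually_elim auto
qed (use assms integrable_if in auto)

lemma prim_nonneg:
  assumes "\<And>s. s \<in> {0<..<T} \<Longrightarrow> s \<le> t \<Longrightarrow> 0 \<le> g s"
  shows "0 \<le> prim T g t"
  unfolding prim_def using assms by (intro integral_nonneg_AE AE_I2) auto

lemma prim_0: "prim T g 0 = 0"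
proof -
  have "prim T g 0 = prim T (\<lambda>s. 0) 0" by (rule prim_cong) auto
  then show ?thesis by (simp add: prim_def)
qed

lemma prim_total: "t \<ge> T \<Longrightarrow> prim T g t = (\<integral>s. g s \<partial>tmeas T)"
  unfolding prim_def by (intro Bochner_Integration.integral_cong) auto

lemma prim_le_total:
  assumes "integrable (tmeas T) g" "\<And>s. s \<in> {0<..<T} \<Longrightarrow> 0 \<le> g s"
  shows "prim T g t \<le> (\<integral>s. g s \<partial>tmeas T)"
  unfolding prim_def using assms by (intro integral_mono integrable_if) auto

lemma abs_prim_le:
  assumes "integrable (tmeas T) g"
  shows "\<bar>prim T g t\<bar> \<le> (\<integral>s. \<bar>g s\<bar> \<partial>tmeas T)"
proof -
  have "\<bar>prim T g t\<bar> \<le> (\<integral>s. norm (if s \<le> t then g s else 0) \<partial>tmeas T)"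
    unfolding prim_def real_norm_def[symmetric] by (rule integral_norm_bound)
  also have "\<dots> \<le> (\<integral>s. \<bar>g s\<bar> \<partial>tmeas T)"
    using assms by (intro integral_mono integrable_norm integrable_if) auto
  finally show ?thesis .
qed

lemma continuous_prim:
  assumes g: "integrable (tmeas T) g"
  shows "continuous_on S (prim T g)"
proof -
  have [measurable]: "g \<in> borel_measurable (tmeas T)" using g by auto
  have "(\<lambda>n. prim T g (x n)) \<longlonglongrightarrow> prim T g t" if x: "x \<longlonglongrightarrow> t" for x t
    unfolding prim_def
  proof (rule integral_dominated_convergence[where w="\<lambda>s. \<bar>g s\<bar>"])
    show "AE s in tmeas T. (\<lambda>n. if s \<le> x n then g s else 0) \<longlonglongrightarrow> (if s \<le> t then g s else 0)"
      using AE_tmeas_neq[where T=T and r=t]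
    proof eventually_elim
      case (elim s)
      show ?case
      proof (cases "s < t")
        case True
        then have "\<forall>\<^sub>F n in sequentially. s < x n" using x by (simp add: order_tendsto_iff)
        then have "\<forall>\<^sub>F n in sequentially. (if s \<le> x n then g s else 0) = (if s \<le> t then g s else 0)"
          by eventually_elim (use True in auto)
        then show ?thesis by (rule tendsto_eventually)
      next
        case False
        then have "s > t" using elim by simp
        then have "\<forall>\<^sub>F n in sequentially. x n < s" using x by (simp add: order_tendsto_iff)
        then have "\<forall>\<^sub>F n in sequentially. (if s \<le> x n then g s else 0) = (if s \<le> t then g s else 0)"
          by eventually_elim (use \<open>s > t\<close> in auto)
        then show ?thesis by (rule tendsto_eventually)
      qed
    qed
  qed (use g in auto)
  then show ?thesis
    unfolding continuous_on_sequentially comp_def by blast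
qed

lemma borel_measurable_prim:
  "integrable (tmeas T) g \<Longrightarrow> prim T g \<in> borel_measurable (tmeas T)"
  by (rule measurable_compose[OF borel_measurable_tmeas_id borel_measurable_continuous_onI])
     (rule continuous_prim)

lemma continuous_on_tmeas_measurable:
  fixes c :: "real \<Rightarrow> 'b::real_normed_vector"
  assumes "continuous_on {0..T} c"
  shows "c \<in> borel_measurable (tmeas T)"
  unfolding tmeas_def
  by (rule continuous_imp_measurable_on_sets_lebesgue)
     (auto intro: continuous_on_subset[OF assms])

lemma continuous_on_bounded_interval:
  fixes c :: "real \<Rightarrow> real"
  assumes "continuous_on {0..T} c"
  obtains B where "\<And>s. s \<in> {0..T} \<Longrightarrow> \<bar>c s\<bar> \<le> B"
proof -
  have "bounded (c ` {0..T})" by (intro compact_imp_bounded compact_continuous_image assms) auto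
  then obtain B where "\<And>s. s \<in> {0..T} \<Longrightarrow> \<bar>c s\<bar> \<le> B" by (force simp: bounded_iff)
  then show ?thesis by (rule that)
qed

text \<open>The integral of \<open>g(s) h(r)\<close> over the square \<open>[0,t]\<^sup>2\<close> is split along the diagonal.\<close>

lemma prim_mult:
  assumes g: "integrable (tmeas T) g" and h: "integrable (tmeas T) h"
  shows "prim T g t * prim T h t = prim T (\<lambda>s. g s * prim T h s + prim T g s * h s) t"
proof -
  let ?M = "tmeas T"
  interpret P: pair_sigma_finite ?M ?M ..
  have [measurable]: "g \<in> borel_measurable ?M" "h \<in> borel_measurable ?M" using g h by auto
  define G where "G s = (if s \<le> t then g s else 0)" for s
  define H where "H s = (if s \<le> t then h s else 0)" for s
  have G: "integrable ?M G" and H: "integrable ?M H"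
    unfolding G_def[abs_def] H_def[abs_def] using g h by (auto intro: integrable_if)
  have [measurable]: "G \<in> borel_measurable ?M" "H \<in> borel_measurable ?M" using G H by auto
  have GH: "integrable (?M \<Otimes>\<^sub>M ?M) (\<lambda>(s, r). G s * H r)"
  proof (rule P.Fubini_integrable)
    show "integrable ?M (\<lambda>x. \<integral>y. norm (case (x, y) of (s, r) \<Rightarrow> G s * H r) \<partial>?M)"
      using G by (simp add: abs_mult)
    show "AE x in ?M. integrable ?M (\<lambda>y. case (x, y) of (s, r) \<Rightarrow> G s * H r)"
      using H by simp
  qed measurable
  define A where "A = (\<lambda>(s, r). if r \<le> s then G s * H r else 0)"
  define B where "B = (\<lambda>(s, r). if s < r then G s * H r else 0)"
  have Am: "A \<in> borel_measurable (?M \<Otimes>\<^sub>M ?M)" and Bm: "B \<in> borel_measurable (?M \<Otimes>\<^sub>M ?M)"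
    unfolding A_def B_def by measurable
  have A: "integrable (?M \<Otimes>\<^sub>M ?M) A"
    by (rule Bochner_Integration.integrable_bound[OF GH Am]) (auto simp: A_def)
  have B: "integrable (?M \<Otimes>\<^sub>M ?M) B"
    by (rule Bochner_Integration.integrable_bound[OF GH Bm]) (auto simp: B_def)
  have A': "integrable (?M \<Otimes>\<^sub>M ?M) (\<lambda>(s, r). A (s, r))"
    and B': "integrable (?M \<Otimes>\<^sub>M ?M) (\<lambda>(s, r). B (s, r))"
    using A B by simp_all
  have "prim T g t * prim T h t = (\<integral>s. (\<integral>r. G s * H r \<partial>?M) \<partial>?M)"
    by (simp add: prim_def G_def H_def)
  also have "\<dots> = (\<integral>x. (case x of (s, r) \<Rightarrow> G s * H r) \<partial>(?M \<Otimes>\<^sub>M ?M))"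
    using P.integral_fst[OF GH] by simp
  also have "\<dots> = (\<integral>x. A x + B x \<partial>(?M \<Otimes>\<^sub>M ?M))"
    by (rule Bochner_Integration.integral_cong) (auto simp: A_def B_def)
  also have "\<dots> = integral\<^sup>L (?M \<Otimes>\<^sub>M ?M) A + integral\<^sup>L (?M \<Otimes>\<^sub>M ?M) B"
    using A B by simp
  also have "integral\<^sup>L (?M \<Otimes>\<^sub>M ?M) A = (\<integral>s. (\<integral>r. A (s, r) \<partial>?M) \<partial>?M)"
    using P.integral_fst[OF A'] by simp
  also have "(\<integral>s. (\<integral>r. A (s, r) \<partial>?M) \<partial>?M) = prim T (\<lambda>s. g s * prim T h s) t"
    unfolding prim_def[of T "\<lambda>s. g s * prim T h s"]
  proof (rule Bochner_Integration.integral_cong[OF refl])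
    fix s
    have "(\<integral>r. A (s, r) \<partial>?M) = (\<integral>r. G s * (if r \<le> s then h r else 0) \<partial>?M)"
      by (rule Bochner_Integration.integral_cong) (auto simp: A_def G_def H_def)
    then show "(\<integral>r. A (s, r) \<partial>?M) = (if s \<le> t then g s * prim T h s else 0)"
      by (simp add: G_def prim_def)
  qed
  also have "integral\<^sup>L (?M \<Otimes>\<^sub>M ?M) B = (\<integral>r. (\<integral>s. B (s, r) \<partial>?M) \<partial>?M)"
    using P.integral_snd[OF B'] by simp
  also have "(\<integral>r. (\<integral>s. B (s, r) \<partial>?M) \<partial>?M) = prim T (\<lambda>s. prim T g s * h s) t"
    unfolding prim_def[of T "\<lambda>s. prim T g s * h s"]
  proof (rule Bochner_Integration.integral_cong[OF refl])
    fix r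
    have "(\<integral>s. B (s, r) \<partial>?M) = (\<integral>s. H r * (if s \<le> r then g s else 0) \<partial>?M)"
    proof (rule integral_cong_AE)
      show "AE s in ?M. B (s, r) = H r * (if s \<le> r then g s else 0)"
        using AE_tmeas_neq[where T=T and r=r] by eventually_elim (auto simp: B_def G_def H_def)
      have "(\<lambda>s. B (s, r)) = (\<lambda>s. if s < r then G s * H r else 0)" by (simp add: B_def)
      then show "(\<lambda>s. B (s, r)) \<in> borel_measurable ?M" by simp
    qed measurable
    then show "(\<integral>s. B (s, r) \<partial>?M) = (if r \<le> t then prim T g r * h r else 0)"
      by (simp add: H_def prim_def)
  qed
  also have "prim T (\<lambda>s. g s * prim T h s) t + prim T (\<lambda>s. prim T g s * h s) t
      = prim T (\<lambda>s. g s * prim T h s + prim T g s * h s) t"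
    by (rule prim_add[symmetric])
       (auto intro!: integrable_mult_bounded(2)[OF g borel_measurable_prim[OF h] abs_prim_le[OF h]]
          integrable_mult_bounded(1)[OF h borel_measurable_prim[OF g] abs_prim_le[OF g]])
  finally show ?thesis .
qed

text \<open>\<open>ac T p p'\<close>: \<open>p\<close> is absolutely continuous on \<open>[0,T]\<close> with derivative \<open>p'\<close>.\<close>

definition ac :: "real \<Rightarrow> (real \<Rightarrow> real) \<Rightarrow> (real \<Rightarrow> real) \<Rightarrow> bool" where
  "ac T p p' \<longleftrightarrow> integrable (tmeas T) p' \<and> (\<forall>t\<in>{0..T}. p t = p 0 + prim T p' t)"

lemma ac_prim: "ac T p p' \<Longrightarrow> t \<in> {0..T} \<Longrightarrow> p t = p 0 + prim T p' t"
  and ac_integrable: "ac T p p' \<Longrightarrow> integrable (tmeas T) p'"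
  unfolding ac_def by blast+

lemma ac_continuous: "ac T p p' \<Longrightarrow> continuous_on {0..T} p"
  by (subst continuous_on_cong[OF refl, of _ _ "\<lambda>t. p 0 + prim T p' t"])
     (auto intro: ac_prim intro!: continuous_intros continuous_prim ac_integrable)

lemma ac_mult:
  assumes p: "ac T p p'" and q: "ac T q q'"
  shows "ac T (\<lambda>t. p t * q t) (\<lambda>s. p' s * q s + p s * q' s)"
  unfolding ac_def
proof (intro conjI ballI)
  have ip: "integrable (tmeas T) p'" and iq: "integrable (tmeas T) q'"
    using p q by (auto intro: ac_integrable)
  let ?P = "prim T p'" and ?Q = "prim T q'"
  have 1: "integrable (tmeas T) (\<lambda>s. p' s * ?Q s)" "integrable (tmeas T) (\<lambda>s. ?P s * q' s)"
    by (auto intro!: integrable_mult_bounded(2)[OF ip borel_measurable_prim[OF iq] abs_prim_le[OF iq]]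
          integrable_mult_bounded(1)[OF iq borel_measurable_prim[OF ip] abs_prim_le[OF ip]])
  let ?d = "\<lambda>s. (p' s * ?Q s + ?P s * q' s) + (q 0 * p' s + p 0 * q' s)"
  have d: "p' s * q s + p s * q' s = ?d s" if "s \<in> {0<..<T}" for s
  proof -
    have "p s = p 0 + ?P s" "q s = q 0 + ?Q s" using p q that by (auto intro: ac_prim)
    then show ?thesis by (simp only:) (simp add: algebra_simps)
  qed
  have "integrable (tmeas T) ?d" using 1 ip iq by simp
  then show "integrable (tmeas T) (\<lambda>s. p' s * q s + p s * q' s)"
    by (rule Bochner_Integration.integrable_cong[THEN iffD1, rotated 2]) (simp_all add: d)
  fix t assume t: "t \<in> {0..T}"
  have "prim T (\<lambda>s. p' s * q s + p s * q' s) t = prim T ?d t"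
    by (rule prim_cong) (rule d)
  also have "\<dots> = ?P t * ?Q t + (q 0 * ?P t + p 0 * ?Q t)"
  proof -
    have 2: "integrable (tmeas T) (\<lambda>s. p' s * ?Q s + ?P s * q' s)"
      "integrable (tmeas T) (\<lambda>s. q 0 * p' s)" "integrable (tmeas T) (\<lambda>s. p 0 * q' s)"
      using 1 ip iq by auto
    show ?thesis
      unfolding prim_add[OF 2(1) Bochner_Integration.integrable_add[OF 2(2,3)]] prim_add[OF 2(2,3)] prim_cmult
      unfolding prim_mult[OF ip iq] ..
  qed
  also have "\<dots> = p t * q t - p 0 * q 0"
  proof -
    have "p t = p 0 + ?P t" "q t = q 0 + ?Q t" using p q t by (auto intro: ac_prim)
    then show ?thesis by (simp only:) (simp add: algebra_simps)
  qed
  finally show "p t * q t = p 0 * q 0 + prim T (\<lambda>s. p' s * q s + p s * q' s) t" by simp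
qed

lemma prim_eq_lebesgue_on:
  assumes g: "g \<in> borel_measurable (tmeas T)" and t: "t \<in> {0..T}"
  shows "prim T g t = (\<integral>s. g s \<partial>lebesgue_on {0..t})"
proof -
  define h where "h s = indicator {0<..<T} s * (if s \<le> t then g s else 0)" for s
  have m: "(\<lambda>s. if s \<le> t then g s else 0) \<in> borel_measurable (tmeas T)" using g by measurable
  have h: "h \<in> borel_measurable lebesgue"
    using m borel_measurable_restrict_space_iff[of "{0<..<T}" lebesgue "\<lambda>s. if s \<le> t then g s else 0"]
    by (simp add: tmeas_def h_def[abs_def])
  have "prim T g t = (\<integral>s. h s \<partial>lebesgue)"
    unfolding prim_def h_def tmeas_def by (subst integral_restrict_space) auto
  also have "\<dots> = (\<integral>s. indicator {0..t} s *\<^sub>R g s \<partial>lebesgue)"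
  proof (rule integral_cong_AE[OF h])
    have eq: "indicator {0..t} s *\<^sub>R g s = h s + indicator {0} s * (g 0 - h 0)
        + indicator {T} s * (indicator {0..t} T * g T - h T - indicator {0} T * (g 0 - h 0))" for s
      using t by (auto simp: h_def indicator_def)
    have [measurable]: "indicator {r} \<in> borel_measurable lebesgue" for r :: real
      by (intro borel_measurable_indicator) auto
    show "(\<lambda>s. indicator {0..t} s *\<^sub>R g s) \<in> borel_measurable lebesgue"
      unfolding eq using h by measurable
    have "AE s in lebesgue. s \<noteq> 0 \<and> s \<noteq> T"
      by (intro AE_conjI AE_completion AE_lborel_singleton)
    then show "AE s in lebesgue. h s = indicator {0..t} s *\<^sub>R g s"
      by eventually_elim (use t in \<open>auto simp: h_def indicator_def\<close>)
  qed
  also have "\<dots> = (\<integral>s. g s \<partial>lebesgue_on {0..t})"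
    by (subst integral_restrict_space) auto
  finally show ?thesis .
qed

lemma ac_C1:
  assumes d: "\<And>t. (p has_real_derivative p' t) (at t)" and c: "continuous_on UNIV p'"
  shows "ac T p p'"
  unfolding ac_def
proof (intro conjI ballI)
  have m: "p' \<in> borel_measurable (tmeas T)"
    using c by (intro continuous_on_tmeas_measurable) (auto intro: continuous_on_subset)
  obtain B where "\<And>s. s \<in> {0..T} \<Longrightarrow> \<bar>p' s\<bar> \<le> B"
    using continuous_on_bounded_interval[OF continuous_on_subset[OF c subset_UNIV]] by blast
  then show "integrable (tmeas T) p'"
    by (intro tmeas.integrable_const_bound[where B=B] m AE_I2) auto
  fix t assume t: "t \<in> {0..T}"
  have "prim T p' t = (\<integral>s. indicator {0..t} s *\<^sub>R p' s \<partial>lebesgue)"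
    using prim_eq_lebesgue_on[OF m t] by (simp add: integral_restrict_space)
  also have "\<dots> = (\<integral>s. p' s * indicator {0..t} s \<partial>lborel)"
  proof (subst integral_completion)
    show "(\<lambda>s. indicator {0..t} s *\<^sub>R p' s) \<in> borel_measurable lborel"
      using borel_measurable_continuous_onI[OF c] by simp
  qed (simp add: mult.commute)
  also have "\<dots> = p t - p 0"
    using t d c by (intro integral_FTC_Icc_real) (auto simp: continuous_on_eq_continuous_within)
  finally show "p t = p 0 + prim T p' t" by simp
qed

lemma integrable_of_square:
  fixes g :: "real \<Rightarrow> real"
  assumes [measurable]: "g \<in> borel_measurable (tmeas T)" and "integrable (tmeas T) (\<lambda>s. (g s)\<^sup>2)"
  shows "integrable (tmeas T) g"
proof (rule Bochner_Integration.integrable_bound)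
  show "integrable (tmeas T) (\<lambda>s. 1 + (g s)\<^sup>2)" using assms(2) by simp
  show "AE s in tmeas T. norm (g s) \<le> norm (1 + (g s)\<^sup>2)"
  proof (intro AE_I2)
    fix s
    have "0 \<le> (\<bar>g s\<bar> - 1)\<^sup>2" by simp
    then have "2 * \<bar>g s\<bar> \<le> 1 + (g s)\<^sup>2" by (simp add: power2_diff)
    then show "norm (g s) \<le> norm (1 + (g s)\<^sup>2)" by simp
  qed
qed simp

lemma scalar_energy:
  assumes c: "ac T c (\<lambda>s. - a * c s + F s)" and F: "F \<in> borel_measurable (tmeas T)"
    and F2: "integrable (tmeas T) (\<lambda>s. (F s)\<^sup>2)" and t: "t \<in> {0..T}"
  shows "(c t)\<^sup>2 + 2 * a * prim T (\<lambda>s. (c s)\<^sup>2) t = (c 0)\<^sup>2 + 2 * prim T (\<lambda>s. c s * F s) t"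
    and "integrable (tmeas T) (\<lambda>s. (c s)\<^sup>2)" "integrable (tmeas T) (\<lambda>s. c s * F s)"
proof -
  have cc: "continuous_on {0..T} c" by (rule ac_continuous[OF c])
  then have cm [measurable]: "c \<in> borel_measurable (tmeas T)" by (rule continuous_on_tmeas_measurable)
  obtain B where B: "\<And>s. s \<in> {0..T} \<Longrightarrow> \<bar>c s\<bar> \<le> B"
    using continuous_on_bounded_interval[OF cc] by blast
  show i1: "integrable (tmeas T) (\<lambda>s. (c s)\<^sup>2)"
  proof (rule tmeas.integrable_const_bound[where B="B\<^sup>2"])
    show "AE s in tmeas T. norm ((c s)\<^sup>2) \<le> B\<^sup>2"
    proof (intro AE_I2)
      fix s assume "s \<in> space (tmeas T)"
      then have "\<bar>c s\<bar>\<^sup>2 \<le> B\<^sup>2" using B[of s] by (intro power_mono) auto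
      then show "norm ((c s)\<^sup>2) \<le> B\<^sup>2" by simp
    qed
  qed measurable
  show i2: "integrable (tmeas T) (\<lambda>s. c s * F s)"
    by (rule integrable_mult_bounded(1)[OF integrable_of_square[OF F F2] cm, of B]) (use B in auto)
  have "c t * c t = c 0 * c 0 + prim T (\<lambda>s. (- a * c s + F s) * c s + c s * (- a * c s + F s)) t"
    by (rule ac_prim[OF ac_mult[OF c c] t])
  also have "(\<lambda>s. (- a * c s + F s) * c s + c s * (- a * c s + F s)) = (\<lambda>s. (- 2 * a) * (c s)\<^sup>2 + 2 * (c s * F s))"
    by (auto simp: fun_eq_iff power2_eq_square algebra_simps)
  also have "prim T \<dots> t = - 2 * a * prim T (\<lambda>s. (c s)\<^sup>2) t + 2 * prim T (\<lambda>s. c s * F s) t"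
    unfolding prim_add[OF integrable_mult_right[OF i1] integrable_mult_right[OF i2]] prim_cmult ..
  finally show "(c t)\<^sup>2 + 2 * a * prim T (\<lambda>s. (c s)\<^sup>2) t = (c 0)\<^sup>2 + 2 * prim T (\<lambda>s. c s * F s) t"
    by (simp add: power2_eq_square)
qed

lemma scalar_estimate:
  assumes c: "ac T c (\<lambda>s. - (\<nu> * m) * c s + F s)" and F: "F \<in> borel_measurable (tmeas T)"
    and F2: "integrable (tmeas T) (\<lambda>s. (F s)\<^sup>2)" and t: "t \<in> {0..T}" and \<nu>: "\<nu> > 0" and m: "m > 0"
  shows "m * (c t)\<^sup>2 + \<nu> * m\<^sup>2 * prim T (\<lambda>s. (c s)\<^sup>2) t \<le> m * (c 0)\<^sup>2 + prim T (\<lambda>s. (F s)\<^sup>2) t / \<nu>"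
proof -
  note e = scalar_energy[OF c F F2 t]
  have "2 * m * prim T (\<lambda>s. c s * F s) t = prim T (\<lambda>s. 2 * m * (c s * F s)) t"
    by (simp add: prim_cmult)
  also have "\<dots> \<le> prim T (\<lambda>s. \<nu> * m\<^sup>2 * (c s)\<^sup>2 + (1 / \<nu>) * (F s)\<^sup>2) t"
  proof (rule prim_mono)
    show "AE s in tmeas T. s < t \<longrightarrow> 2 * m * (c s * F s) \<le> \<nu> * m\<^sup>2 * (c s)\<^sup>2 + (1 / \<nu>) * (F s)\<^sup>2"
    proof (intro AE_I2 impI)
      fix s
      have "0 \<le> (\<nu> * m * c s - F s)\<^sup>2 / \<nu>" using \<nu> by simp
      also have "\<dots> = \<nu> * m\<^sup>2 * (c s)\<^sup>2 + (1 / \<nu>) * (F s)\<^sup>2 - 2 * m * (c s * F s)"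
        using \<nu> by (simp add: power2_eq_square field_simps)
      finally show "2 * m * (c s * F s) \<le> \<nu> * m\<^sup>2 * (c s)\<^sup>2 + (1 / \<nu>) * (F s)\<^sup>2" by simp
    qed
  qed (use e F2 in auto)
  also have "\<dots> = \<nu> * m\<^sup>2 * prim T (\<lambda>s. (c s)\<^sup>2) t + prim T (\<lambda>s. (F s)\<^sup>2) t / \<nu>"
    using e F2 by (subst prim_add) (auto simp: prim_cmult, simp add: prim_cmult[of T "1/\<nu>", simplified])
  finally have "2 * m * prim T (\<lambda>s. c s * F s) t
      \<le> \<nu> * m\<^sup>2 * prim T (\<lambda>s. (c s)\<^sup>2) t + prim T (\<lambda>s. (F s)\<^sup>2) t / \<nu>" .
  moreover have "m * (c t)\<^sup>2 + 2 * (\<nu> * m\<^sup>2 * prim T (\<lambda>s. (c s)\<^sup>2) t) = m * (c 0)\<^sup>2 + 2 * m * prim T (\<lambda>s. c s * F s) t"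
    using arg_cong[OF e(1), of "\<lambda>x. m * x"] by (simp add: algebra_simps power2_eq_square)
  ultimately show ?thesis by linarith
qed

lemma scalar_duhamel:
  assumes F: "integrable (tmeas T) F"
  shows "\<exists>c. c 0 = c0 \<and> ac T c (\<lambda>s. - a * c s + F s)"
proof -
  let ?p = "\<lambda>t. exp (- a * t)" and ?E = "\<lambda>s. exp (a * s) * F s"
  have E: "integrable (tmeas T) ?E"
  proof (rule integrable_mult_bounded(1)[OF F])
    fix s assume "s \<in> {0<..<T}"
    then have "a * s \<le> \<bar>a\<bar> * T" by (metis abs_ge_self abs_ge_zero abs_mult abs_of_pos greaterThanLessThan_iff less_imp_le mult_left_mono order_trans)
    then show "\<bar>exp (a * s)\<bar> \<le> exp (\<bar>a\<bar> * T)" by simp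
  qed measurable
  have p: "ac T ?p (\<lambda>t. - a * exp (- a * t))"
    by (rule ac_C1) (auto intro!: derivative_eq_intros continuous_intros)
  define q where "q t = c0 + prim T ?E t" for t
  have q: "ac T q ?E" unfolding ac_def q_def prim_0 using E by simp
  have "ac T (\<lambda>t. ?p t * q t) (\<lambda>s. - a * (?p s * q s) + F s)"
  proof -
    have "(\<lambda>s. (- a * exp (- a * s)) * q s + ?p s * ?E s) = (\<lambda>s. - a * (?p s * q s) + F s)"
    proof
      fix s
      have "?p s * ?E s = F s"
        by (simp only: mult.assoc[symmetric] exp_add[symmetric]) simp
      then show "(- a * exp (- a * s)) * q s + ?p s * ?E s = - a * (?p s * q s) + F s"
        by (simp only: mult.assoc)
    qed
    then show ?thesis using ac_mult[OF p q] by (simp only:)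
  qed
  then show ?thesis
    by (intro exI[of _ "\<lambda>t. ?p t * q t"]) (simp add: q_def prim_0)
qed

lemma prim_power:
  assumes g: "integrable (tmeas T) g"
  shows "(prim T g t) ^ Suc k = real (Suc k) * prim T (\<lambda>s. g s * (prim T g s) ^ k) t"
    and "integrable (tmeas T) (\<lambda>s. g s * (prim T g s) ^ k)"
proof -
  have int: "integrable (tmeas T) (\<lambda>s. g s * (prim T g s) ^ k)" for k
  proof (rule integrable_mult_bounded(2)[OF g])
    show "\<bar>prim T g s ^ k\<bar> \<le> (\<integral>s. \<bar>g s\<bar> \<partial>tmeas T) ^ k" for s
      unfolding power_abs by (intro power_mono abs_prim_le g) auto
  qed (use borel_measurable_prim[OF g] in measurable)
  then show "integrable (tmeas T) (\<lambda>s. g s * (prim T g s) ^ k)" .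
  show "(prim T g t) ^ Suc k = real (Suc k) * prim T (\<lambda>s. g s * (prim T g s) ^ k) t"
  proof (induction k arbitrary: t)
    case 0
    then show ?case by simp
  next
    case (Suc k)
    let ?A = "prim T g" and ?h = "\<lambda>s. g s * (prim T g s) ^ k"
    have "?A t ^ Suc (Suc k) = real (Suc k) * (?A t * prim T ?h t)"
      using Suc.IH[of t] by (simp add: mult_ac)
    also have "?A t * prim T ?h t = prim T (\<lambda>s. g s * prim T ?h s + ?A s * ?h s) t"
      by (rule prim_mult[OF g int])
    also have "\<dots> = prim T (\<lambda>s. (real (Suc (Suc k)) / real (Suc k)) * (g s * ?A s ^ Suc k)) t"
    proof (rule prim_cong)
      fix s
      have "prim T ?h s = ?A s ^ Suc k / real (Suc k)" using Suc.IH[of s] by (simp add: field_simps)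
      then show "g s * prim T ?h s + ?A s * ?h s = (real (Suc (Suc k)) / real (Suc k)) * (g s * ?A s ^ Suc k)"
        by (simp add: field_simps)
    qed
    also have "\<dots> = (real (Suc (Suc k)) / real (Suc k)) * prim T (\<lambda>s. g s * ?A s ^ Suc k) t"
      by (rule prim_cmult)
    finally show ?case by simp
  qed
qed

lemma gronwall_prim:
  assumes g: "integrable (tmeas T) g" and g0: "\<And>s. s \<in> {0<..<T} \<Longrightarrow> 0 \<le> g s"
    and y: "continuous_on {0..T} y" and S: "S \<in> {0..T}" and y0: "0 \<le> y0"
    and le: "\<And>t. t \<in> {0..S} \<Longrightarrow> y t \<le> y0 + prim T (\<lambda>s. g s * y s) t"
    and t: "t \<in> {0..S}"
  shows "y t \<le> y0 * exp (prim T g t)"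
proof -
  let ?A = "prim T g"
  have A0: "0 \<le> ?A s" for s using g0 by (intro prim_nonneg) auto
  have ym: "y \<in> borel_measurable (tmeas T)" using y by (rule continuous_on_tmeas_measurable)
  obtain Y where Y: "\<And>s. s \<in> {0..T} \<Longrightarrow> \<bar>y s\<bar> \<le> Y"
    using continuous_on_bounded_interval[OF y] by blast
  have gy: "integrable (tmeas T) (\<lambda>s. g s * y s)"
    by (rule integrable_mult_bounded(2)[OF g ym, of Y]) (use Y in auto)
  have *: "y t \<le> y0 * (\<Sum>k<n. ?A t ^ k / fact k) + Y * (?A t ^ n / fact n)" if "t \<in> {0..S}" for t n
    using that
  proof (induction n arbitrary: t)
    case 0
    then show ?case using Y[of t] S by simp
  next
    case (Suc n)
    define h where "h k s = g s * ?A s ^ k" for k s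
    have h: "integrable (tmeas T) (h k)" for k
      unfolding h_def[abs_def] by (rule prim_power(2)[OF g])
    have hA: "prim T (h k) s / fact k = ?A s ^ Suc k / fact (Suc k)" for k s
    proof -
      have "prim T g s ^ Suc k = real (Suc k) * prim T (h k) s"
        using prim_power(1)[OF g, of s k] by (simp only: h_def[abs_def])
      then show ?thesis by (simp only: fact_Suc of_nat_mult) (simp del: of_nat_Suc)
    qed
    have hs: "integrable (tmeas T) (\<lambda>s. \<Sum>k<m. (1 / fact k) * h k s)" for m
      using h by simp
    have prim_sum: "prim T (\<lambda>s. \<Sum>k<m. (1 / fact k) * h k s) t = (\<Sum>k<m. ?A t ^ Suc k / fact (Suc k))" for m
    proof (induction m)
      case 0
      then show ?case by (simp add: prim_def)
    next
      case (Suc m)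
      then show ?case
        using h hs by (simp only: sum.lessThan_Suc prim_add integrable_mult_right)
           (simp add: prim_divide hA[symmetric] del: power_Suc of_nat_Suc fact_Suc)
    qed
    have "y t \<le> y0 + prim T (\<lambda>s. g s * y s) t" using le Suc.prems by simp
    also have "prim T (\<lambda>s. g s * y s) t
        \<le> prim T (\<lambda>s. y0 * (\<Sum>k<n. (1 / fact k) * h k s) + Y / fact n * h n s) t"
    proof (rule prim_mono[OF gy])
      show "AE s in tmeas T. s < t \<longrightarrow> g s * y s \<le> y0 * (\<Sum>k<n. (1 / fact k) * h k s) + Y / fact n * h n s"
      proof (intro AE_I2 impI)
        fix s assume s: "s \<in> space (tmeas T)" "s < t"
        then have "g s * y s \<le> g s * (y0 * (\<Sum>k<n. ?A s ^ k / fact k) + Y * (?A s ^ n / fact n))"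
          using Suc.prems by (intro mult_left_mono Suc.IH g0) auto
        also have "\<dots> = y0 * (\<Sum>k<n. (1 / fact k) * h k s) + Y / fact n * h n s"
          by (simp add: h_def algebra_simps sum_distrib_left)
        finally show "g s * y s \<le> y0 * (\<Sum>k<n. (1 / fact k) * h k s) + Y / fact n * h n s" .
      qed
    qed (use h hs in auto)
    also have "\<dots> = y0 * (\<Sum>k<n. ?A t ^ Suc k / fact (Suc k)) + Y * (?A t ^ Suc n / fact (Suc n))"
    proof -
      have "prim T (\<lambda>s. y0 * (\<Sum>k<n. (1 / fact k) * h k s) + Y / fact n * h n s) t
          = y0 * (\<Sum>k<n. ?A t ^ Suc k / fact (Suc k)) + Y / fact n * prim T (h n) t"
        unfolding prim_add[OF integrable_mult_right[OF hs] integrable_mult_right[OF h]] prim_cmult prim_sum ..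
      also have "Y / fact n * prim T (h n) t = Y * (prim T (h n) t / fact n)" by simp
      finally show ?thesis unfolding hA by simp
    qed
    finally have "y t \<le> y0 * (1 + (\<Sum>k<n. ?A t ^ Suc k / fact (Suc k))) + Y * (?A t ^ Suc n / fact (Suc n))"
      by (simp add: distrib_left)
    also have "1 + (\<Sum>k<n. ?A t ^ Suc k / fact (Suc k)) = (\<Sum>k<Suc n. ?A t ^ k / fact k)"
      unfolding sum.lessThan_Suc_shift by simp
    finally show ?case .
  qed
  have "(\<lambda>n. ?A t ^ n /\<^sub>R fact n) sums exp (?A t)" by (rule exp_converges)
  then have e: "(\<lambda>n. \<Sum>k<n. ?A t ^ k / fact k) \<longlonglongrightarrow> exp (?A t)" 
    by (simp add: sums_def divide_inverse mult.commute)
  have z: "(\<lambda>n. ?A t ^ n / fact n) \<longlonglongrightarrow> 0"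
    using summable_LIMSEQ_zero[OF summable_exp_generic[of "?A t"]] by (simp add: divide_inverse mult.commute)
  have "(\<lambda>n. y0 * (\<Sum>k<n. ?A t ^ k / fact k) + Y * (?A t ^ n / fact n)) \<longlonglongrightarrow> y0 * exp (?A t) + Y * 0"
    by (intro tendsto_intros e z)
  then show ?thesis using *[OF t] by (intro LIMSEQ_le_const[of _ "y0 * exp (?A t)"]) auto
qed

subsection \<open>Smooth functions with compact support and weak derivatives\<close>

lemma C_k_Suc_real:
  fixes f :: "real \<Rightarrow> real"
  assumes d: "\<And>x. (f has_real_derivative f' x) (at x)"
  shows "C_k (Suc k) f \<longleftrightarrow> C_k k f'"
proof -
  have "frechet_derivative f (at x) = (\<lambda>h. f' x * h)" for x
    using d[of x] frechet_derivative_at[of f "\<lambda>h. f' x * h" x] by (simp add: has_field_derivative_def)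
  moreover have "f differentiable (at x)" for x
    using d[of x] unfolding has_field_derivative_def differentiable_def by blast
  ultimately show ?thesis by simp
qed

lemmas C_k_SucI = C_k_Suc_real[THEN iffD2]

lemma C_k_deriv:
  fixes f :: "real \<Rightarrow> real"
  assumes "C_k (Suc k) f"
  shows "(f has_real_derivative deriv f x) (at x)" "C_k k (deriv f)"
proof -
  have d: "(f has_real_derivative deriv f x) (at x)" for x
    using assms by (simp add: DERIV_deriv_iff_real_differentiable)
  then show "(f has_real_derivative deriv f x) (at x)" .
  show "C_k k (deriv f)" by (rule C_k_Suc_real[THEN iffD1, OF d assms])
qed

lemma C_k_Suc_D:
  fixes f :: "real \<Rightarrow> real"
  shows "C_k (Suc k) f \<Longrightarrow> C_k k f"
proof (induction k arbitrary: f)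
  case 0
  then show ?case by (simp add: continuous_at_imp_continuous_on differentiable_imp_continuous_within)
next
  case (Suc k)
  note d = C_k_deriv[OF Suc.prems]
  have "C_k k (deriv f)" using d(2) by (rule Suc.IH)
  then show ?case by (rule C_k_SucI[OF d(1)])
qed

lemma C_k_add:
  fixes f g :: "real \<Rightarrow> real"
  shows "C_k k f \<Longrightarrow> C_k k g \<Longrightarrow> C_k k (\<lambda>x. f x + g x)"
proof (induction k arbitrary: f g)
  case 0
  then show ?case by (auto intro: continuous_on_add)
next
  case (Suc k)
  note d = C_k_deriv[OF Suc.prems(1)] C_k_deriv[OF Suc.prems(2)]
  have "C_k k (\<lambda>x. deriv f x + deriv g x)" by (rule Suc.IH[OF d(2,4)])
  then show ?case
    by (rule C_k_SucI[OF DERIV_add[OF d(1,3)]])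
qed

lemma C_k_mult:
  fixes f g :: "real \<Rightarrow> real"
  shows "C_k k f \<Longrightarrow> C_k k g \<Longrightarrow> C_k k (\<lambda>x. f x * g x)"
proof (induction k arbitrary: f g)
  case 0
  then show ?case by (auto intro: continuous_on_mult)
next
  case (Suc k)
  note d = C_k_deriv[OF Suc.prems(1)] C_k_deriv[OF Suc.prems(2)]
  have "C_k k (\<lambda>x. deriv f x * g x + deriv g x * f x)"
    by (rule C_k_add[OF Suc.IH[OF d(2) C_k_Suc_D[OF Suc.prems(2)]] Suc.IH[OF d(4) C_k_Suc_D[OF Suc.prems(1)]]])
  then show ?case
    by (rule C_k_SucI[OF DERIV_mult[OF d(1,3)]])
qed

lemma C_k_const: "C_k k (\<lambda>x::real. r :: real)"
proof (induction k arbitrary: r)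
  case (Suc k)
  show ?case by (rule C_k_SucI[OF DERIV_const Suc])
qed auto

lemma C_k_affine:
  fixes f :: "real \<Rightarrow> real"
  shows "C_k k f \<Longrightarrow> C_k k (\<lambda>x. f (a * x + b))"
proof (induction k arbitrary: f)
  case 0
  then show ?case
    by (intro C_k.simps(1)[THEN iffD2] continuous_on_compose2[of UNIV f UNIV "\<lambda>x. a * x + b"] continuous_intros) auto
next
  case (Suc k)
  note d = C_k_deriv[OF Suc.prems]
  have "((\<lambda>x. f (a * x + b)) has_real_derivative deriv f (a * x + b) * a) (at x)" for x
    by (rule DERIV_chain2[OF d(1)]) (auto intro!: derivative_eq_intros)
  moreover have "C_k k (\<lambda>x. deriv f (a * x + b) * a)"
    by (intro C_k_mult C_k_const Suc.IH d)
  ultimately show ?case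
    by (rule C_k_SucI)
qed

definition flat_exp :: "nat \<Rightarrow> real \<Rightarrow> real" where
  "flat_exp k x = (if x > 0 then (1 / x) ^ k * exp (- (1 / x)) else 0)"

lemma flat_exp_tendsto_0: "(flat_exp k \<longlongrightarrow> 0) (at 0)"
proof -
  have "((\<lambda>x. inverse x ^ k / exp (inverse x)) \<longlongrightarrow> 0) (at_right (0::real))"
    by (rule filterlim_compose[OF tendsto_power_div_exp_0 filterlim_inverse_at_top_right])
  moreover have "\<forall>\<^sub>F x in at_right 0. flat_exp k x = inverse x ^ k / exp (inverse x)"
    by (auto simp: eventually_at_filter flat_exp_def exp_minus divide_inverse)
  ultimately have "(flat_exp k \<longlongrightarrow> 0) (at_right 0)"
    by (rule tendsto_cong[THEN iffD2, rotated])
  moreover have "(flat_exp k \<longlongrightarrow> 0) (at_left 0)"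
    by (rule tendsto_eventually) (auto simp: eventually_at_filter flat_exp_def)
  ultimately show ?thesis by (simp add: filterlim_at_split)
qed

lemma flat_exp_deriv:
  "(flat_exp k has_real_derivative flat_exp (k + 2) x - real k * flat_exp (k + 1) x) (at x)"
proof -
  consider "x > 0" | "x < 0" | "x = 0" by linarith
  then show ?thesis
  proof cases
    case 1
    have "((\<lambda>x. (1 / x) ^ k * exp (- (1 / x))) has_real_derivative
        flat_exp (k + 2) x - real k * flat_exp (k + 1) x) (at x)"
    proof -
      have "((\<lambda>x. (1 / x) ^ k * exp (- (1 / x))) has_real_derivative
        real k * (1 / x) ^ (k - Suc 0) * (- (1 / x\<^sup>2)) * exp (- (1 / x))
         + (1 / x) ^ k * (exp (- (1 / x)) * (1 / x\<^sup>2))) (at x)"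
        using 1 by (auto intro!: derivative_eq_intros simp: power2_eq_square)
      moreover have "real k * (1 / x) ^ (k - Suc 0) * (- (1 / x\<^sup>2)) = - real k * (1 / x) ^ (k + 1)"
        by (cases k) (auto simp: power2_eq_square algebra_simps add_divide_distrib diff_divide_distrib)
      moreover have "(1 / x) ^ k * (exp (- (1 / x)) * (1 / x\<^sup>2)) = (1 / x) ^ (k + 2) * exp (- (1 / x))"
        by (simp add: power2_eq_square power_add)
      ultimately show ?thesis using 1 by (simp only: flat_exp_def) (simp add: algebra_simps)
    qed
    then show ?thesis
      by (rule has_field_derivative_transform_within_open[where S="{0<..}"]) (use 1 in \<open>auto simp: flat_exp_def\<close>)
  next
    case 2
    have "((\<lambda>x. 0) has_real_derivative flat_exp (k + 2) x - real k * flat_exp (k + 1) x) (at x)"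
      using 2 by (auto simp: flat_exp_def)
    then show ?thesis
      by (rule has_field_derivative_transform_within_open[where S="{..<0}"]) (use 2 in \<open>auto simp: flat_exp_def\<close>)
  next
    case 3
    have "((\<lambda>h. (flat_exp k (0 + h) - flat_exp k 0) / h) \<longlongrightarrow> 0) (at 0)"
    proof (rule Lim_transform_eventually[OF flat_exp_tendsto_0])
      show "\<forall>\<^sub>F x in at 0. flat_exp (Suc k) x = (flat_exp k (0 + x) - flat_exp k 0) / x"
        by (auto simp: flat_exp_def eventually_at_filter)
    qed
    then show ?thesis using 3 by (simp add: DERIV_def flat_exp_def)
  qed
qed

lemma C_k_flat_exp: "C_k n (flat_exp k)"
proof (induction n arbitrary: k)
  case 0
  have "isCont (flat_exp k) x" for x by (rule DERIV_isCont[OF flat_exp_deriv])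
  then show ?case by (simp add: continuous_on_eq_continuous_at)
next
  case (Suc n)
  have "C_k n (\<lambda>x. flat_exp (k + 2) x + (- real k) * flat_exp (k + 1) x)"
    by (intro C_k_add C_k_mult C_k_const Suc.IH)
  then have "C_k n (\<lambda>x. flat_exp (k + 2) x - real k * flat_exp (k + 1) x)" by simp
  then show ?case by (rule C_k_SucI[OF flat_exp_deriv])
qed

lemma ex_smooth_step:
  obtains \<theta> \<rho> :: "real \<Rightarrow> real" and \<kappa>
  where "\<And>k. C_k k \<theta>" "\<And>x. (\<theta> has_real_derivative \<rho> x) (at x)" "\<And>x. 0 \<le> \<rho> x"
    "\<And>x. x \<notin> {0..1} \<Longrightarrow> \<rho> x = 0" "continuous_on UNIV \<rho>" "\<kappa> > 0"
    "\<And>x. x \<le> 0 \<Longrightarrow> \<theta> x = 0" "\<And>x. x \<ge> 1 \<Longrightarrow> \<theta> x = \<kappa>"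
proof -
  define \<rho> where "\<rho> x = flat_exp 0 x * flat_exp 0 (1 - x)" for x
  have ck: "C_k k \<rho>" for k
    unfolding \<rho>_def[abs_def] using C_k_affine[OF C_k_flat_exp, of k 0 "-1" 1]
    by (intro C_k_mult C_k_flat_exp) (simp add: algebra_simps)
  then have cont: "continuous_on UNIV \<rho>" using C_k.simps(1) by blast
  have "\<exists>F. \<forall>x. (-\<infinity> :: ereal) < ereal x \<longrightarrow> ereal x < \<infinity> \<longrightarrow> (F has_vector_derivative \<rho> x) (at x)"
    by (rule einterval_antiderivative) (use cont in \<open>auto simp: continuous_on_eq_continuous_at\<close>)
  then obtain F where "\<And>x. (F has_vector_derivative \<rho> x) (at x)" by auto
  then have F: "(F has_real_derivative \<rho> x) (at x)" for x
    by (simp add: has_real_derivative_iff_has_vector_derivative)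
  define \<theta> where "\<theta> x = F x - F 0" for x
  have d: "(\<theta> has_real_derivative \<rho> x) (at x)" for x
    unfolding \<theta>_def[abs_def] using DERIV_diff[OF F DERIV_const] by simp
  have nn: "0 \<le> \<rho> x" and z: "x \<notin> {0<..<1} \<Longrightarrow> \<rho> x = 0" and pos: "x \<in> {0<..<1} \<Longrightarrow> \<rho> x > 0" for x
    by (auto simp: \<rho>_def flat_exp_def)
  have mvt: "\<exists>z. x < z \<and> z < y \<and> \<theta> y - \<theta> x = (y - x) * \<rho> z" if "x < y" for x y
    using MVT2[OF that, of \<theta> \<rho>] d by blast
  have c0: "\<theta> x = 0" if "x \<le> 0" for x
  proof (cases "x = 0")
    case False
    then have "x < 0" using that by simp
    from mvt[OF this] obtain w where "x < w" "w < 0" "\<theta> 0 - \<theta> x = (0 - x) * \<rho> w" by blast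
    then show ?thesis using z[of w] by (simp add: \<theta>_def)
  qed (simp add: \<theta>_def)
  have c1: "\<theta> x = \<theta> 1" if "x \<ge> 1" for x
  proof (cases "x = 1")
    case False
    then have "1 < x" using that by simp
    from mvt[OF this] obtain w where "1 < w" "w < x" "\<theta> x - \<theta> 1 = (x - 1) * \<rho> w" by blast
    then show ?thesis using z[of w] by simp
  qed simp
  obtain w where "0 < w" "w < 1" "\<theta> 1 - \<theta> 0 = (1 - 0) * \<rho> w" using mvt[of 0 1] zero_less_one by blast
  then have "\<theta> 1 > 0" using pos[of w] c0[of 0] by simp
  moreover have "C_k k \<theta>" for k
    by (rule C_k_Suc_D[OF C_k_SucI[OF d ck]])
  moreover have "\<rho> x = 0" if "x \<notin> {0..1}" for x using z[of x] that by auto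
  ultimately show ?thesis using that[OF _ d nn _ cont _ c0 c1] by blast
qed

definition time_test :: "real \<Rightarrow> (real \<Rightarrow> real) \<Rightarrow> bool" where
  "time_test T \<phi> \<longleftrightarrow> C_infinity \<phi> \<and> (\<exists>a b. 0 < a \<and> b < T \<and> (\<forall>t. t \<notin> {a..b} \<longrightarrow> \<phi> t = 0))"

lemma time_test_ac:
  assumes "time_test T \<phi>"
  shows "ac T \<phi> (deriv \<phi>)" "\<phi> 0 = 0" "\<phi> T = 0" "continuous_on UNIV (deriv \<phi>)" "continuous_on UNIV \<phi>"
proof -
  have c: "C_k k \<phi>" for k using assms by (simp add: time_test_def C_infinity_def)
  note d = C_k_deriv[OF c]
  show cd: "continuous_on UNIV (deriv \<phi>)" using d(2)[of 0] by simp
  show "continuous_on UNIV \<phi>" using c[of 0] by simp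
  show "ac T \<phi> (deriv \<phi>)" by (rule ac_C1[OF d(1) cd])
  show "\<phi> 0 = 0" "\<phi> T = 0" using assms by (force simp: time_test_def)+
qed

lemma ac_weak_deriv:
  assumes "time_test T \<phi>" and c: "ac T c g" and T: "T > 0"
  shows "(\<integral>t. deriv \<phi> t * c t \<partial>tmeas T) = - (\<integral>t. \<phi> t * g t \<partial>tmeas T)"
    and "integrable (tmeas T) (\<lambda>t. deriv \<phi> t * c t)" "integrable (tmeas T) (\<lambda>t. \<phi> t * g t)"
proof -
  note \<phi> = time_test_ac[OF assms(1)]
  have cc: "continuous_on {0..T} c" by (rule ac_continuous[OF c])
  obtain B where B: "\<And>s. s \<in> {0..T} \<Longrightarrow> \<bar>c s\<bar> \<le> B"
    using continuous_on_bounded_interval[OF cc] by blast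
  obtain B' where B': "\<And>s. s \<in> {0..T} \<Longrightarrow> \<bar>\<phi> s\<bar> \<le> B'"
    using continuous_on_bounded_interval[OF continuous_on_subset[OF \<phi>(5) subset_UNIV]] by blast
  show i1: "integrable (tmeas T) (\<lambda>t. deriv \<phi> t * c t)"
    by (rule integrable_mult_bounded(2)[OF ac_integrable[OF \<phi>(1)] continuous_on_tmeas_measurable[OF cc], of B])
       (use B in auto)
  show i2: "integrable (tmeas T) (\<lambda>t. \<phi> t * g t)"
    by (rule integrable_mult_bounded(1)[OF ac_integrable[OF c] continuous_on_tmeas_measurable[OF continuous_on_subset[OF \<phi>(5) subset_UNIV]], of B'])
       (use B' in auto)
  have "\<phi> T * c T = \<phi> 0 * c 0 + prim T (\<lambda>s. deriv \<phi> s * c s + \<phi> s * g s) T"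
    by (rule ac_prim[OF ac_mult[OF \<phi>(1) c]]) (use T in auto)
  then show "(\<integral>t. deriv \<phi> t * c t \<partial>tmeas T) = - (\<integral>t. \<phi> t * g t \<partial>tmeas T)"
    using i1 i2 \<phi>(2,3) by (simp add: prim_add prim_total)
qed

text \<open>Du Bois-Reymond: test with a difference of two smooth steps, whose derivative
  concentrates at two given points.\<close>

lemma weak_deriv_ac:
  assumes c: "continuous_on {0..T} c" and g: "integrable (tmeas T) g" and T: "T > 0"
    and weak: "\<And>\<phi>. time_test T \<phi> \<Longrightarrow> (\<integral>t. deriv \<phi> t * c t \<partial>tmeas T) = - (\<integral>t. \<phi> t * g t \<partial>tmeas T)"
  shows "ac T c g"
proof -
  have G: "ac T (prim T g) g" unfolding ac_def prim_0 using g by simp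
  define d where "d t = c t - prim T g t" for t
  have dc: "continuous_on {0..T} d"
    unfolding d_def by (intro continuous_intros c continuous_prim g)
  obtain B where B: "\<And>s. s \<in> {0..T} \<Longrightarrow> \<bar>d s\<bar> \<le> B"
    using continuous_on_bounded_interval[OF dc] by blast
  obtain C where C: "\<And>s. s \<in> {0..T} \<Longrightarrow> \<bar>c s\<bar> \<le> C"
    using continuous_on_bounded_interval[OF c] by blast
  have d0: "(\<integral>t. deriv \<phi> t * d t \<partial>tmeas T) = 0" if "time_test T \<phi>" for \<phi>
  proof -
    have "integrable (tmeas T) (\<lambda>t. deriv \<phi> t * c t)"
      by (rule integrable_mult_bounded(2)[OF ac_integrable[OF time_test_ac(1)[OF that]] continuous_on_tmeas_measurable[OF c], of C])
         (use C in auto)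
    then show ?thesis
      using ac_weak_deriv[OF that G T] weak[OF that] by (simp add: d_def right_diff_distrib)
  qed
  obtain \<theta> \<rho> :: "real \<Rightarrow> real" and \<kappa>
    where \<theta>: "\<And>k. C_k k \<theta>" "\<And>x. (\<theta> has_real_derivative \<rho> x) (at x)" "\<And>x. 0 \<le> \<rho> x"
    "\<And>x. x \<notin> {0..1} \<Longrightarrow> \<rho> x = 0" "continuous_on UNIV \<rho>" "\<kappa> > 0"
    "\<And>x. x \<le> 0 \<Longrightarrow> \<theta> x = 0" "\<And>x. x \<ge> 1 \<Longrightarrow> \<theta> x = \<kappa>"
    using ex_smooth_step by blast
  define P where "P \<epsilon> a t = \<theta> ((t - a) / \<epsilon>)" for \<epsilon> a t
  define K where "K \<epsilon> a t = \<rho> ((t - a) / \<epsilon>) / \<epsilon>" for \<epsilon> a t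
  have P: "(P \<epsilon> a has_real_derivative K \<epsilon> a t) (at t)" if "\<epsilon> > 0" for \<epsilon> a t
  proof -
    have "((\<lambda>t. (t - a) / \<epsilon>) has_real_derivative 1 / \<epsilon>) (at t)"
      using that by (auto intro!: derivative_eq_intros)
    from DERIV_chain2[OF \<theta>(2) this] show ?thesis by (simp add: P_def[abs_def] K_def)
  qed
  have Kc: "continuous_on UNIV (K \<epsilon> a)" if "\<epsilon> > 0" for \<epsilon> a
    unfolding K_def[abs_def] using that
    by (intro continuous_intros continuous_on_compose2[OF \<theta>(5)]) auto
  have Pk: "C_k k (P \<epsilon> a)" for k \<epsilon> a
    using C_k_affine[OF \<theta>(1), of k "1 / \<epsilon>" "- (a / \<epsilon>)"] by (simp add: P_def[abs_def] diff_divide_distrib)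
  have conc: "\<bar>(\<integral>t. K \<epsilon> a t * d t \<partial>tmeas T) - \<kappa> * d a\<bar> \<le> \<kappa> * \<eta>" "integrable (tmeas T) (\<lambda>t. K \<epsilon> a t * d t)"
    if a: "0 < a" "a + \<epsilon> < T" "\<epsilon> > 0" and \<eta>: "\<And>t. t \<in> {a..a+\<epsilon>} \<Longrightarrow> \<bar>d t - d a\<bar> \<le> \<eta>" for a \<epsilon> \<eta>
  proof -
    have PK: "ac T (P \<epsilon> a) (K \<epsilon> a)" using P Kc a by (intro ac_C1) auto
    note iK = ac_integrable[OF PK]
    show iKd: "integrable (tmeas T) (\<lambda>t. K \<epsilon> a t * d t)"
      by (rule integrable_mult_bounded(2)[OF iK continuous_on_tmeas_measurable[OF dc], of B]) (use B in auto)
    have "P \<epsilon> a T = P \<epsilon> a 0 + prim T (K \<epsilon> a) T" by (rule ac_prim[OF PK]) (use T in auto)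
    then have K1: "(\<integral>t. K \<epsilon> a t \<partial>tmeas T) = \<kappa>"
      using a \<theta>(7)[of "- (a / \<epsilon>)"] \<theta>(8)[of "(T - a) / \<epsilon>"] by (simp add: P_def prim_total field_simps)
    have "\<bar>(\<integral>t. K \<epsilon> a t * d t \<partial>tmeas T) - \<kappa> * d a\<bar> = norm (\<integral>t. K \<epsilon> a t * d t - K \<epsilon> a t * d a \<partial>tmeas T)"
      using iK iKd K1 by simp
    also have "\<dots> \<le> (\<integral>t. norm (K \<epsilon> a t * d t - K \<epsilon> a t * d a) \<partial>tmeas T)"
      by (rule integral_norm_bound)
    also have "\<dots> \<le> (\<integral>t. K \<epsilon> a t * \<eta> \<partial>tmeas T)"
    proof (rule integral_mono)
      show "norm (K \<epsilon> a t * d t - K \<epsilon> a t * d a) \<le> K \<epsilon> a t * \<eta>" for t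
      proof (cases "t \<in> {a..a+\<epsilon>}")
        case True
        have "K \<epsilon> a t \<ge> 0" using \<theta>(3) a by (simp add: K_def)
        then show ?thesis using \<eta>[OF True] mult_left_mono
          by (simp add: abs_mult flip: right_diff_distrib) 
      next
        case False
        then have "(t - a) / \<epsilon> \<notin> {0..1}" using a by (auto simp: field_simps)
        then have "K \<epsilon> a t = 0" using \<theta>(4) by (simp add: K_def)
        then show ?thesis by simp
      qed
    qed (use iK iKd in auto)
    also have "\<dots> = \<kappa> * \<eta>" using K1 by simp
    finally show "\<bar>(\<integral>t. K \<epsilon> a t * d t \<partial>tmeas T) - \<kappa> * d a\<bar> \<le> \<kappa> * \<eta>" .
  qed
  have eq: "d a = d b" if ab: "0 < a" "a < b" "b < T" for a b
  proof (rule ccontr)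
    assume "d a \<noteq> d b"
    define \<eta> where "\<eta> = \<bar>d a - d b\<bar> / 4"
    have \<eta>: "\<eta> > 0" using \<open>d a \<noteq> d b\<close> by (simp add: \<eta>_def)
    have "uniformly_continuous_on {0..T} d" by (rule compact_uniformly_continuous[OF dc]) simp
    then obtain \<delta> where \<delta>: "\<delta> > 0" "\<And>s t. s \<in> {0..T} \<Longrightarrow> t \<in> {0..T} \<Longrightarrow> \<bar>t - s\<bar> < \<delta> \<Longrightarrow> \<bar>d t - d s\<bar> < \<eta>"
      using \<eta> unfolding uniformly_continuous_on_def dist_real_def by metis
    define \<epsilon> where "\<epsilon> = min (\<delta> / 2) ((T - b) / 2)"
    have \<epsilon>: "\<epsilon> > 0" "\<epsilon> < \<delta>" "b + \<epsilon> < T" using \<delta> ab by (auto simp: \<epsilon>_def min_def field_simps)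
    have ca: "\<bar>(\<integral>t. K \<epsilon> a t * d t \<partial>tmeas T) - \<kappa> * d a\<bar> \<le> \<kappa> * \<eta>"
        and ia: "integrable (tmeas T) (\<lambda>t. K \<epsilon> a t * d t)"
      by (rule conc; use ab \<epsilon> in \<open>force intro: less_imp_le \<delta>(2)\<close>)+
    have cb: "\<bar>(\<integral>t. K \<epsilon> b t * d t \<partial>tmeas T) - \<kappa> * d b\<bar> \<le> \<kappa> * \<eta>"
        and ib: "integrable (tmeas T) (\<lambda>t. K \<epsilon> b t * d t)"
      by (rule conc; use ab \<epsilon> in \<open>force intro: less_imp_le \<delta>(2)\<close>)+
    define \<phi> where "\<phi> t = P \<epsilon> a t + (-1) * P \<epsilon> b t" for t
    have d\<phi>: "(\<phi> has_real_derivative (K \<epsilon> a t - K \<epsilon> b t)) (at t)" for t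
      unfolding \<phi>_def[abs_def] using DERIV_add[OF P[OF \<epsilon>(1)] DERIV_cmult[OF P[OF \<epsilon>(1)], of "-1"]] by simp
    have "\<phi> t = 0" if "t \<notin> {a..b + \<epsilon>}" for t
    proof -
      have "t < a \<or> t > b + \<epsilon>" using that by auto
      then consider "t < a" | "t > b + \<epsilon>" by blast
      then show "\<phi> t = 0"
      proof cases
        case 1
        then have "(t - a) / \<epsilon> \<le> 0" "(t - b) / \<epsilon> \<le> 0" using ab \<epsilon> by (auto simp: field_simps)
        then show ?thesis using \<theta>(7) by (simp add: \<phi>_def P_def)
      next
        case 2
        then have "(t - a) / \<epsilon> \<ge> 1" "(t - b) / \<epsilon> \<ge> 1" using ab \<epsilon> by (auto simp: field_simps)
        then show ?thesis using \<theta>(8) by (simp add: \<phi>_def P_def)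
      qed
    qed
    moreover have "C_infinity \<phi>"
      unfolding C_infinity_def \<phi>_def[abs_def] by (intro allI C_k_add C_k_mult C_k_const Pk)
    ultimately have "time_test T \<phi>"
      unfolding time_test_def using ab(1) \<epsilon>(3) by blast
    from d0[OF this] have "(\<integral>t. K \<epsilon> a t * d t \<partial>tmeas T) = (\<integral>t. K \<epsilon> b t * d t \<partial>tmeas T)"
      using ia ib by (simp add: DERIV_imp_deriv[OF d\<phi>] left_diff_distrib)
    then have "\<bar>\<kappa> * d a - \<kappa> * d b\<bar> \<le> 2 * (\<kappa> * \<eta>)" using ca cb by linarith
    moreover have "\<bar>\<kappa> * d a - \<kappa> * d b\<bar> = 4 * (\<kappa> * \<eta>)"
      using \<theta>(6) by (simp add: \<eta>_def abs_mult flip: right_diff_distrib)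
    moreover have "\<kappa> * \<eta> > 0" using \<theta>(6) \<eta> by simp
    ultimately show False by linarith
  qed
  have const: "d t = d (T / 2)" if "t \<in> {0<..<T}" for t
  proof -
    consider "t < T / 2" | "t = T / 2" | "T / 2 < t" by linarith
    then show ?thesis
    proof cases
      case 1 then show ?thesis using eq[of t "T / 2"] that T by simp
    next
      case 2 show ?thesis by (simp only: 2[symmetric])
    next
      case 3 then show ?thesis using eq[of "T / 2" t] that T by simp
    qed
  qed
  have const': "d t = d (T / 2)" if "t \<in> {0..T}" for t
  proof -
    have cl: "closure {0<..<T} = {0..T}" using T by simp
    show ?thesis
      by (rule continuous_constant_on_closure[of "{0<..<T}", unfolded cl, OF dc const that])
  qed
  have "c t = c 0 + prim T g t" if "t \<in> {0..T}" for t
  proof -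
    have "d t = d 0" using const'[OF that] const'[of 0] T by simp
    then show ?thesis unfolding d_def prim_0 by linarith
  qed
  then show ?thesis using g unfolding ac_def by blast
qed

subsection \<open>Scales of Hilbert spaces with a common orthogonal basis\<close>

locale weighted_basis =
  fixes e :: "nat \<Rightarrow> 'a::{real_inner, banach, second_countable_topology}" and m :: "nat \<Rightarrow> real"
  assumes orth: "e i \<bullet> e j = (if i = j then 1 else 0)"
    and complete: "(\<And>n. u \<bullet> e n = 0) \<Longrightarrow> u = 0"
    and m_ge_1: "1 \<le> m n"
begin

definition proj :: "nat \<Rightarrow> 'a \<Rightarrow> 'a" where
  "proj K u = (\<Sum>n<K. (u \<bullet> e n) *\<^sub>R e n)"

lemma sum_inner_basis: "(\<Sum>n\<in>I. a n *\<^sub>R e n) \<bullet> e k = (if finite I \<and> k \<in> I then a k else 0)"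
proof (cases "finite I")
  case True
  then show ?thesis by (simp add: inner_sum_left orth sum.delta' if_distrib cong: if_cong)
qed simp

lemma proj_inner: "proj K u \<bullet> e k = (if k < K then u \<bullet> e k else 0)"
  unfolding proj_def sum_inner_basis by simp

lemma norm_sum_basis: "finite I \<Longrightarrow> (norm (\<Sum>n\<in>I. a n *\<^sub>R e n))\<^sup>2 = (\<Sum>n\<in>I. (a n)\<^sup>2)"
  unfolding power2_norm_eq_inner inner_sum_right by (simp add: sum_inner_basis power2_eq_square)

lemma basis_eqI: "(\<And>n. u \<bullet> e n = v \<bullet> e n) \<Longrightarrow> u = v"
  using complete[of "u - v"] by (simp add: inner_diff_left)

lemma riesz_fischer:
  assumes "summable (\<lambda>n. (a n)\<^sup>2)"
  shows "\<exists>u. (\<forall>n. u \<bullet> e n = a n) \<and> (\<lambda>K. \<Sum>n<K. a n *\<^sub>R e n) \<longlonglongrightarrow> u"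
proof -
  have "summable (\<lambda>n. a n *\<^sub>R e n)"
    unfolding summable_Cauchy
  proof (intro allI impI)
    fix \<epsilon> :: real assume \<epsilon>: "\<epsilon> > 0"
    then obtain N where N: "\<And>k n. k \<ge> N \<Longrightarrow> norm (\<Sum>i\<in>{k..<n}. (a i)\<^sup>2) < \<epsilon>\<^sup>2"
      using assms unfolding summable_Cauchy by (meson zero_less_power)
    have "norm (\<Sum>i\<in>{k..<n}. a i *\<^sub>R e i) < \<epsilon>" if "k \<ge> N" for k n
    proof -
      have "(norm (\<Sum>i\<in>{k..<n}. a i *\<^sub>R e i))\<^sup>2 < \<epsilon>\<^sup>2"
        using N[OF that, of n] by (simp add: norm_sum_basis)
      then show ?thesis using \<epsilon> by (simp add: power2_less_imp_less)
    qed
    then show "\<exists>N. \<forall>k\<ge>N. \<forall>n. norm (\<Sum>i\<in>{k..<n}. a i *\<^sub>R e i) < \<epsilon>" by blast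
  qed
  then obtain u where u: "(\<lambda>K. \<Sum>n<K. a n *\<^sub>R e n) \<longlonglongrightarrow> u"
    unfolding summable_def sums_def by blast
  have "u \<bullet> e k = a k" for k
  proof -
    have "(\<lambda>K. (\<Sum>n<K. a n *\<^sub>R e n) \<bullet> e k) \<longlonglongrightarrow> u \<bullet> e k"
      by (intro tendsto_inner u tendsto_const)
    moreover have "\<forall>\<^sub>F K in sequentially. (\<Sum>n<K. a n *\<^sub>R e n) \<bullet> e k = a k"
      using eventually_gt_at_top[of k] by eventually_elim (simp add: sum_inner_basis)
    ultimately show ?thesis
      by (rule LIMSEQ_unique[OF _ tendsto_eventually])
  qed
  then show ?thesis using u by blast
qed

lemma bessel: "(\<Sum>n<K. (u \<bullet> e n)\<^sup>2) \<le> (norm u)\<^sup>2"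
proof -
  have "proj K u \<bullet> proj K u = (\<Sum>n<K. (u \<bullet> e n)\<^sup>2)"
    unfolding power2_norm_eq_inner[symmetric] unfolding proj_def by (simp add: norm_sum_basis)
  moreover have "u \<bullet> proj K u = (\<Sum>n<K. (u \<bullet> e n)\<^sup>2)"
    by (simp add: proj_def inner_sum_right power2_eq_square)
  ultimately have "(norm (u - proj K u))\<^sup>2 = (norm u)\<^sup>2 - (\<Sum>n<K. (u \<bullet> e n)\<^sup>2)"
    by (simp add: power2_norm_eq_inner inner_diff_left inner_diff_right inner_commute)
  then show ?thesis by (metis diff_ge_0_iff_ge zero_le_power2)
qed

lemma summable_coeff: "summable (\<lambda>n. (u \<bullet> e n)\<^sup>2)"
  by (rule summableI_nonneg_bounded[where x="(norm u)\<^sup>2"]) (auto intro: bessel)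

lemma proj_tendsto: "(\<lambda>K. proj K u) \<longlonglongrightarrow> u"
proof -
  obtain v where v: "\<forall>n. v \<bullet> e n = u \<bullet> e n" "(\<lambda>K. proj K u) \<longlonglongrightarrow> v"
    using riesz_fischer[OF summable_coeff[of u]] unfolding proj_def by blast
  then have "v = u" by (intro basis_eqI) simp
  then show ?thesis using v by simp
qed

lemma parseval_inner: "(\<lambda>n. (u \<bullet> e n) * (v \<bullet> e n)) sums (u \<bullet> v)"
proof -
  have "(\<lambda>K. u \<bullet> proj K v) \<longlonglongrightarrow> u \<bullet> v"
    by (intro tendsto_inner tendsto_const proj_tendsto)
  then show ?thesis by (simp add: sums_def proj_def inner_sum_right mult.commute)
qed

lemma parseval: "(\<lambda>n. (u \<bullet> e n)\<^sup>2) sums (norm u)\<^sup>2"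
  using parseval_inner[of u u] by (simp add: power2_eq_square dot_square_norm)

lemma borel_measurable_coeff:
  assumes "\<And>n. (\<lambda>x. f x \<bullet> e n) \<in> borel_measurable M"
  shows "f \<in> borel_measurable M"
proof (rule borel_measurable_LIMSEQ_metric)
  show "(\<lambda>x. proj K (f x)) \<in> borel_measurable M" for K
    unfolding proj_def using assms by measurable
qed (rule proj_tendsto)

definition W :: "nat \<Rightarrow> 'a \<Rightarrow> ennreal" where
  "W s u = (\<Sum>n. ennreal (m n ^ s * (u \<bullet> e n)\<^sup>2))"

definition H :: "nat \<Rightarrow> 'a set" where
  "H s = {u. summable (\<lambda>n. m n ^ s * (u \<bullet> e n)\<^sup>2)}"

definition N :: "nat \<Rightarrow> 'a \<Rightarrow> real" where
  "N s u = (\<Sum>n. m n ^ s * (u \<bullet> e n)\<^sup>2)"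

lemma m_pos: "0 < m n" and m_nonneg: "0 \<le> m n"
  using m_ge_1[of n] by linarith+

lemma weight_nonneg: "0 \<le> m n ^ s * (u \<bullet> e n)\<^sup>2"
  using m_nonneg by simp

lemma W_eq_N: "u \<in> H s \<Longrightarrow> W s u = ennreal (N s u)"
  unfolding W_def N_def H_def by (intro suminf_ennreal2) (auto intro: weight_nonneg)

lemma H_iff_W: "u \<in> H s \<longleftrightarrow> W s u < \<infinity>"
proof
  assume "W s u < \<infinity>"
  then show "u \<in> H s" unfolding W_def H_def
    by (auto intro!: summable_suminf_not_top weight_nonneg)
qed (simp add: W_eq_N)

lemma N_nonneg: "0 \<le> N s u" if "u \<in> H s"
  using that unfolding N_def H_def by (auto intro!: suminf_nonneg weight_nonneg)

lemma W_0: "W 0 u = ennreal ((norm u)\<^sup>2)"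
  by (simp add: W_def suminf_ennreal2[OF _ summable_coeff] sums_unique[OF parseval, symmetric])

lemma W_mono: "s \<le> s' \<Longrightarrow> W s u \<le> W s' u"
  unfolding W_def using m_ge_1
  by (intro suminf_le summableI ennreal_leI mult_right_mono power_increasing) auto

lemma H_mono: "u \<in> H s' \<Longrightarrow> s \<le> s' \<Longrightarrow> u \<in> H s"
  unfolding H_iff_W by (rule order_le_less_trans[OF W_mono])

lemma N_mono: "u \<in> H s' \<Longrightarrow> s \<le> s' \<Longrightarrow> N s u \<le> N s' u"
  using W_mono[of s s' u] H_mono[of u s' s] by (simp add: W_eq_N N_nonneg)

lemma norm_le_W: "ennreal ((norm u)\<^sup>2) \<le> W s u"
  using W_mono[of 0 s u] by (simp add: W_0)

lemma norm_le_N: "u \<in> H s \<Longrightarrow> (norm u)\<^sup>2 \<le> N s u"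
  using norm_le_W[of u s] by (simp add: W_eq_N N_nonneg)

lemma W_scaleR: "W s (r *\<^sub>R u) = ennreal (r\<^sup>2) * W s u"
  unfolding W_def using weight_nonneg
  by (subst ennreal_suminf_cmult[symmetric]) (auto simp: ennreal_mult' [symmetric] power_mult_distrib mult_ac)

lemma W_minus: "W s (- u) = W s u"
  by (simp add: W_def)

lemma W_zero [simp]: "W s 0 = 0"
  by (simp add: W_def)

lemma square_add_le: "(a + b)\<^sup>2 \<le> 2 * a\<^sup>2 + 2 * (b::real)\<^sup>2"
  using sum_squares_bound[of a b] by (simp add: power2_sum)

lemma W_add: "W s (u + v) \<le> 2 * W s u + 2 * W s v"
proof -
  have "W s (u + v) \<le> (\<Sum>n. 2 * ennreal (m n ^ s * (u \<bullet> e n)\<^sup>2) + 2 * ennreal (m n ^ s * (v \<bullet> e n)\<^sup>2))"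
    unfolding W_def
  proof (intro suminf_le summableI)
    fix n
    have "m n ^ s * ((u + v) \<bullet> e n)\<^sup>2 \<le> m n ^ s * (2 * (u \<bullet> e n)\<^sup>2 + 2 * (v \<bullet> e n)\<^sup>2)"
      unfolding inner_add_left using m_nonneg by (intro mult_left_mono square_add_le) auto
    also have "\<dots> = 2 * (m n ^ s * (u \<bullet> e n)\<^sup>2) + 2 * (m n ^ s * (v \<bullet> e n)\<^sup>2)"
      by (simp add: algebra_simps)
    finally have "ennreal (m n ^ s * ((u + v) \<bullet> e n)\<^sup>2)
        \<le> ennreal (2 * (m n ^ s * (u \<bullet> e n)\<^sup>2) + 2 * (m n ^ s * (v \<bullet> e n)\<^sup>2))"
      by (rule ennreal_leI)
    also have "\<dots> = 2 * ennreal (m n ^ s * (u \<bullet> e n)\<^sup>2) + 2 * ennreal (m n ^ s * (v \<bullet> e n)\<^sup>2)"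
      using weight_nonneg by (simp add: ennreal_mult' del: mult_nonneg_nonneg)
    finally show "ennreal (m n ^ s * ((u + v) \<bullet> e n)\<^sup>2)
      \<le> 2 * ennreal (m n ^ s * (u \<bullet> e n)\<^sup>2) + 2 * ennreal (m n ^ s * (v \<bullet> e n)\<^sup>2)" .
  qed
  also have "\<dots> = 2 * W s u + 2 * W s v"
    unfolding W_def by (simp add: suminf_add[symmetric] summableI ennreal_suminf_cmult)
  finally show ?thesis .
qed

lemma H_add: "u \<in> H s \<Longrightarrow> v \<in> H s \<Longrightarrow> u + v \<in> H s"
  unfolding H_iff_W using W_add[of s u v]
  by (auto intro!: order_le_less_trans[OF W_add] simp: ennreal_mult_less_top)

lemma H_scaleR: "u \<in> H s \<Longrightarrow> r *\<^sub>R u \<in> H s"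
  unfolding H_iff_W W_scaleR by (simp add: ennreal_mult_less_top)

lemma H_diff: "u \<in> H s \<Longrightarrow> v \<in> H s \<Longrightarrow> u - v \<in> H s"
  using H_add[of u s "- v"] H_scaleR[of v s "-1"] by simp

lemma H_zero [simp]: "0 \<in> H s"
  by (simp add: H_iff_W)

lemma N_add: "u \<in> H s \<Longrightarrow> v \<in> H s \<Longrightarrow> N s (u + v) \<le> 2 * N s u + 2 * N s v"
  using W_add[of s u v]
  by (simp add: W_eq_N H_add N_nonneg ennreal_mult'[symmetric] flip: ennreal_plus ennreal_numeral)

lemma N_minus: "N s (- u) = N s u"
  by (simp add: N_def)

lemma N_diff: "u \<in> H s \<Longrightarrow> v \<in> H s \<Longrightarrow> N s (u - v) \<le> 2 * N s u + 2 * N s v"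
  using N_add[of u s "- v"] H_scaleR[of v s "-1"] by (simp add: N_minus)

lemma sum_basis_H: "finite I \<Longrightarrow> (\<Sum>n\<in>I. a n *\<^sub>R e n) \<in> H s"
  unfolding H_def by (auto simp: sum_inner_basis intro!: summable_finite[of I])

lemma proj_H: "proj K u \<in> H s"
  unfolding proj_def by (rule sum_basis_H) simp

lemma N_tail:
  assumes "u \<in> H s"
  shows "(\<lambda>K. N s (u - proj K u)) \<longlonglongrightarrow> 0"
proof -
  let ?f = "\<lambda>n. m n ^ s * (u \<bullet> e n)\<^sup>2"
  have f: "summable ?f" using assms by (simp add: H_def)
  have "N s (u - proj K u) = (\<Sum>n. ?f n) - (\<Sum>n<K. ?f n)" for K
  proof -
    have "(\<lambda>n. ?f n - (if n < K then ?f n else 0)) sums ((\<Sum>n. ?f n) - (\<Sum>n<K. ?f n))"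
      using sums_If_finite_set[of "{..<K}" ?f] by (intro sums_diff summable_sums f) auto
    moreover have "(\<lambda>n. ?f n - (if n < K then ?f n else 0)) = (\<lambda>n. m n ^ s * ((u - proj K u) \<bullet> e n)\<^sup>2)"
      by (auto simp: inner_diff_left proj_inner)
    ultimately show ?thesis unfolding N_def by (simp add: sums_iff)
  qed
  moreover have "(\<lambda>K. (\<Sum>n. ?f n) - (\<Sum>n<K. ?f n)) \<longlonglongrightarrow> (\<Sum>n. ?f n) - (\<Sum>n. ?f n)"
    by (intro tendsto_intros summable_LIMSEQ f)
  ultimately show ?thesis by simp
qed

lemma W_liminf:
  assumes "\<And>n. (\<lambda>k. x k \<bullet> e n) \<longlonglongrightarrow> u \<bullet> e n"
  shows "W s u \<le> liminf (\<lambda>k. W s (x k))"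
proof -
  have "W s u = (\<integral>\<^sup>+n. liminf (\<lambda>k. ennreal (m n ^ s * (x k \<bullet> e n)\<^sup>2)) \<partial>count_space UNIV)"
    unfolding W_def nn_integral_count_space_nat[symmetric]
  proof (intro nn_integral_cong lim_imp_Liminf[symmetric])
    fix n
    show "(\<lambda>k. ennreal (m n ^ s * (x k \<bullet> e n)\<^sup>2)) \<longlonglongrightarrow> ennreal (m n ^ s * (u \<bullet> e n)\<^sup>2)"
      by (intro tendsto_ennrealI tendsto_intros assms)
  qed simp
  also have "\<dots> \<le> liminf (\<lambda>k. \<integral>\<^sup>+n. ennreal (m n ^ s * (x k \<bullet> e n)\<^sup>2) \<partial>count_space UNIV)"
    by (rule nn_integral_liminf) simp
  finally show ?thesis unfolding nn_integral_count_space_nat W_def .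
qed

lemma borel_measurable_W [measurable (raw)]:
  assumes "f \<in> borel_measurable M"
  shows "(\<lambda>x. W s (f x)) \<in> borel_measurable M"
proof -
  have [measurable]: "(\<lambda>x. f x \<bullet> e n) \<in> borel_measurable M" for n
    by (intro borel_measurable_inner assms borel_measurable_const)
  show ?thesis unfolding W_def by measurable
qed

definition multiplier :: "(nat \<Rightarrow> real) \<Rightarrow> 'a \<Rightarrow> 'a" where
  "multiplier a u = (SOME v. \<forall>n. v \<bullet> e n = a n * (u \<bullet> e n))"

lemma multiplier_inner:
  assumes "summable (\<lambda>n. (a n * (u \<bullet> e n))\<^sup>2)"
  shows "multiplier a u \<bullet> e n = a n * (u \<bullet> e n)"
  using someI_ex[of "\<lambda>v. \<forall>n. v \<bullet> e n = a n * (u \<bullet> e n)"] riesz_fischer[OF assms]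
  unfolding multiplier_def by blast

lemma multiplier_m: "u \<in> H 2 \<Longrightarrow> multiplier m u \<bullet> e n = m n * (u \<bullet> e n)"
  by (rule multiplier_inner) (simp add: H_def power_mult_distrib)

lemma multiplier_inverse:
  shows "multiplier (\<lambda>n. 1 / m n) u \<bullet> e n = (u \<bullet> e n) / m n"
    and "multiplier (\<lambda>n. 1 / m n) u \<in> H 2" and "N 2 (multiplier (\<lambda>n. 1 / m n) u) = (norm u)\<^sup>2"
proof -
  have "summable (\<lambda>n. ((1 / m n) * (u \<bullet> e n))\<^sup>2)"
  proof (rule summable_comparison_test[OF _ summable_coeff[of u]], intro exI allI impI)
    fix n
    have "\<bar>(u \<bullet> e n) / m n\<bar> \<le> \<bar>u \<bullet> e n\<bar>"
      using m_ge_1[of n] mult_right_mono[OF m_ge_1[of n], of "\<bar>u \<bullet> e n\<bar>"] by (simp add: field_simps)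
    then have "\<bar>(u \<bullet> e n) / m n\<bar>\<^sup>2 \<le> \<bar>u \<bullet> e n\<bar>\<^sup>2" by (intro power_mono) auto
    then show "norm (((1 / m n) * (u \<bullet> e n))\<^sup>2) \<le> (u \<bullet> e n)\<^sup>2" by (simp add: power2_abs power_divide)
  qed
  from multiplier_inner[OF this] show i: "multiplier (\<lambda>n. 1 / m n) u \<bullet> e n = (u \<bullet> e n) / m n" for n by simp
  have eq: "(\<lambda>n. m n ^ 2 * (multiplier (\<lambda>n. 1 / m n) u \<bullet> e n)\<^sup>2) = (\<lambda>n. (u \<bullet> e n)\<^sup>2)"
    using m_pos by (auto simp: i power_divide less_imp_neq[THEN not_sym])
  show "multiplier (\<lambda>n. 1 / m n) u \<in> H 2" "N 2 (multiplier (\<lambda>n. 1 / m n) u) = (norm u)\<^sup>2"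
    unfolding H_def N_def mem_Collect_eq eq using parseval[of u] by (auto simp: sums_iff)
qed

subsection \<open>The diagonal linear equation\<close>

text \<open>\<open>u' = - \<nu> A u + F\<close> with \<open>A e\<^sub>n = m\<^sub>n e\<^sub>n\<close>, read coefficient by coefficient.\<close>

definition lin :: "real \<Rightarrow> real \<Rightarrow> (real \<Rightarrow> 'a) \<Rightarrow> (real \<Rightarrow> 'a) \<Rightarrow> bool" where
  "lin \<nu> T u F \<longleftrightarrow> F \<in> borel_measurable (tmeas T) \<and>
     (\<integral>\<^sup>+s. ennreal ((norm (F s))\<^sup>2) \<partial>tmeas T) < \<infinity> \<and> u 0 \<in> H 1 \<and>
     (\<forall>n. ac T (\<lambda>t. u t \<bullet> e n) (\<lambda>s. - (\<nu> * m n) * (u s \<bullet> e n) + F s \<bullet> e n))"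

lemma coeff_square_integrable:
  assumes [measurable]: "F \<in> borel_measurable (tmeas T)"
    and "(\<integral>\<^sup>+s. ennreal ((norm (F s))\<^sup>2) \<partial>tmeas T) < \<infinity>"
  shows "(\<lambda>s. F s \<bullet> e n) \<in> borel_measurable (tmeas T)" "integrable (tmeas T) (\<lambda>s. (F s \<bullet> e n)\<^sup>2)"
    "integrable (tmeas T) (\<lambda>s. F s \<bullet> e n)" "integrable (tmeas T) (\<lambda>s. (norm (F s))\<^sup>2)"
proof -
  show m [measurable]: "(\<lambda>s. F s \<bullet> e n) \<in> borel_measurable (tmeas T)"
    by (intro borel_measurable_inner assms borel_measurable_const)
  show i: "integrable (tmeas T) (\<lambda>s. (norm (F s))\<^sup>2)"
    using assms(2) by (intro integrableI_bounded) auto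
  show i2: "integrable (tmeas T) (\<lambda>s. (F s \<bullet> e n)\<^sup>2)"
  proof (rule Bochner_Integration.integrable_bound[OF i])
    have "(F s \<bullet> e n)\<^sup>2 \<le> (norm (F s))\<^sup>2" for s
      using bessel[where K="Suc n" and u="F s"] member_le_sum[of n "{..<Suc n}" "\<lambda>i. (F s \<bullet> e i)\<^sup>2"] by simp
    then show "AE s in tmeas T. norm ((F s \<bullet> e n)\<^sup>2) \<le> norm ((norm (F s))\<^sup>2)" by simp
  qed measurable
  show "integrable (tmeas T) (\<lambda>s. F s \<bullet> e n)" by (rule integrable_of_square[OF m i2])
qed

lemma lin_D:
  assumes "lin \<nu> T u F"
  shows "F \<in> borel_measurable (tmeas T)" "(\<integral>\<^sup>+s. ennreal ((norm (F s))\<^sup>2) \<partial>tmeas T) < \<infinity>" "u 0 \<in> H 1"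
    "ac T (\<lambda>t. u t \<bullet> e n) (\<lambda>s. - (\<nu> * m n) * (u s \<bullet> e n) + F s \<bullet> e n)"
    "continuous_on {0..T} (\<lambda>t. u t \<bullet> e n)" "u \<in> borel_measurable (tmeas T)"
proof -
  show "F \<in> borel_measurable (tmeas T)" "(\<integral>\<^sup>+s. ennreal ((norm (F s))\<^sup>2) \<partial>tmeas T) < \<infinity>" "u 0 \<in> H 1"
    and a: "ac T (\<lambda>t. u t \<bullet> e n) (\<lambda>s. - (\<nu> * m n) * (u s \<bullet> e n) + F s \<bullet> e n)" for n
    using assms unfolding lin_def by blast+
  show c: "continuous_on {0..T} (\<lambda>t. u t \<bullet> e n)" for n by (rule ac_continuous[OF a])
  show "u \<in> borel_measurable (tmeas T)"
    by (intro borel_measurable_coeff continuous_on_tmeas_measurable c)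
qed

lemma ennreal_prim:
  assumes "integrable (tmeas T) h" "\<And>s. 0 \<le> h s"
  shows "ennreal (prim T h t) = (\<integral>\<^sup>+s. ennreal (h s) * indicator {..t} s \<partial>tmeas T)"
proof -
  have "(\<integral>\<^sup>+s. ennreal (h s) * indicator {..t} s \<partial>tmeas T) = (\<integral>\<^sup>+s. ennreal (if s \<le> t then h s else 0) \<partial>tmeas T)"
    by (intro nn_integral_cong) (auto simp: indicator_def)
  also have "\<dots> = ennreal (prim T h t)"
    unfolding prim_def using assms by (intro nn_integral_eq_integral integrable_if) auto
  finally show ?thesis ..
qed

lemma lin_estimate:
  assumes l: "lin \<nu> T u F" and \<nu>: "\<nu> > 0" and t: "t \<in> {0..T}"
  shows "W 1 (u t) + ennreal \<nu> * (\<integral>\<^sup>+s. W 2 (u s) * indicator {..t} s \<partial>tmeas T)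
    \<le> W 1 (u 0) + ennreal (1 / \<nu>) * (\<integral>\<^sup>+s. ennreal ((norm (F s))\<^sup>2) * indicator {..t} s \<partial>tmeas T)"
proof -
  note D = lin_D[OF l]
  note [measurable] = D(1) D(6)
  note F = coeff_square_integrable[OF D(1,2)]
  have cm [measurable]: "(\<lambda>s. u s \<bullet> e n) \<in> borel_measurable (tmeas T)" for n
    by (intro borel_measurable_inner D(6) borel_measurable_const)
  note [measurable] = F(1)
  have coeff_le: "ennreal (m n ^ 1 * (u t \<bullet> e n)\<^sup>2)
        + ennreal \<nu> * (\<integral>\<^sup>+s. ennreal (m n ^ 2 * (u s \<bullet> e n)\<^sup>2) * indicator {..t} s \<partial>tmeas T)
      \<le> ennreal (m n ^ 1 * (u 0 \<bullet> e n)\<^sup>2)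
        + ennreal (1 / \<nu>) * (\<integral>\<^sup>+s. ennreal ((F s \<bullet> e n)\<^sup>2) * indicator {..t} s \<partial>tmeas T)" for n
  proof -
    have i: "integrable (tmeas T) (\<lambda>s. (u s \<bullet> e n)\<^sup>2)"
      by (rule scalar_energy(2)[OF D(4) F(1,2) t])
    have p: "0 \<le> prim T (\<lambda>s. (u s \<bullet> e n)\<^sup>2) t" "0 \<le> prim T (\<lambda>s. (F s \<bullet> e n)\<^sup>2) t" by (auto intro: prim_nonneg)
    have P: "ennreal (m n ^ 2 * prim T (\<lambda>s. (u s \<bullet> e n)\<^sup>2) t)
        = (\<integral>\<^sup>+s. ennreal (m n ^ 2 * (u s \<bullet> e n)\<^sup>2) * indicator {..t} s \<partial>tmeas T)"
      using i by (subst ennreal_prim[symmetric]) (auto simp: prim_cmult)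
    have Q: "ennreal (prim T (\<lambda>s. (F s \<bullet> e n)\<^sup>2) t) = (\<integral>\<^sup>+s. ennreal ((F s \<bullet> e n)\<^sup>2) * indicator {..t} s \<partial>tmeas T)"
      by (rule ennreal_prim[OF F(2)]) simp
    have add: "ennreal a + ennreal r * ennreal b = ennreal (a + r * b)" if "0 \<le> a" "0 \<le> b" "0 \<le> r" for a b r
      using that by (simp add: ennreal_mult)
    have "m n * (u t \<bullet> e n)\<^sup>2 + \<nu> * (m n ^ 2 * prim T (\<lambda>s. (u s \<bullet> e n)\<^sup>2) t)
        \<le> m n * (u 0 \<bullet> e n)\<^sup>2 + (1 / \<nu>) * prim T (\<lambda>s. (F s \<bullet> e n)\<^sup>2) t"
      using scalar_estimate[OF D(4) F(1,2) t \<nu> m_pos[of n]] by (simp add: mult.assoc)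
    from ennreal_leI[OF this] show ?thesis
      unfolding P[symmetric] Q[symmetric] power_one_right
      using \<nu> p m_nonneg[of n] by (subst (asm) (1 2) add[symmetric]) auto
  qed
  have W2: "(\<integral>\<^sup>+s. W 2 (u s) * indicator {..t} s \<partial>tmeas T)
      = (\<Sum>n. \<integral>\<^sup>+s. ennreal (m n ^ 2 * (u s \<bullet> e n)\<^sup>2) * indicator {..t} s \<partial>tmeas T)"
    unfolding W_def by (subst nn_integral_suminf[symmetric]) (auto simp: ennreal_suminf_multc intro!: nn_integral_cong)
  have W0: "(\<integral>\<^sup>+s. ennreal ((norm (F s))\<^sup>2) * indicator {..t} s \<partial>tmeas T)
      = (\<Sum>n. \<integral>\<^sup>+s. ennreal ((F s \<bullet> e n)\<^sup>2) * indicator {..t} s \<partial>tmeas T)"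
    unfolding W_0[symmetric] W_def
    by (subst nn_integral_suminf[symmetric]) (auto simp: ennreal_suminf_multc intro!: nn_integral_cong)
  have "W 1 (u t) + ennreal \<nu> * (\<integral>\<^sup>+s. W 2 (u s) * indicator {..t} s \<partial>tmeas T)
      = (\<Sum>n. ennreal (m n ^ 1 * (u t \<bullet> e n)\<^sup>2)
        + ennreal \<nu> * (\<integral>\<^sup>+s. ennreal (m n ^ 2 * (u s \<bullet> e n)\<^sup>2) * indicator {..t} s \<partial>tmeas T))"
    unfolding W2 W_def[of 1] by (simp only: suminf_add[OF summableI summableI, symmetric] ennreal_suminf_cmult)
  also have "\<dots> \<le> (\<Sum>n. ennreal (m n ^ 1 * (u 0 \<bullet> e n)\<^sup>2)
        + ennreal (1 / \<nu>) * (\<integral>\<^sup>+s. ennreal ((F s \<bullet> e n)\<^sup>2) * indicator {..t} s \<partial>tmeas T))"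
    by (intro suminf_le coeff_le summableI)
  also have "\<dots> = W 1 (u 0) + ennreal (1 / \<nu>) * (\<integral>\<^sup>+s. ennreal ((norm (F s))\<^sup>2) * indicator {..t} s \<partial>tmeas T)"
    unfolding W0 W_def[of 1] by (simp only: suminf_add[OF summableI summableI, symmetric] ennreal_suminf_cmult)
  finally show ?thesis .
qed

lemma lin_estimate_total:
  assumes l: "lin \<nu> T u F" and \<nu>: "\<nu> > 0" and t: "t \<in> {0..T}"
  shows "W 1 (u t) \<le> W 1 (u 0) + ennreal (1 / \<nu>) * (\<integral>\<^sup>+s. ennreal ((norm (F s))\<^sup>2) \<partial>tmeas T)"
    and "ennreal \<nu> * (\<integral>\<^sup>+s. W 2 (u s) \<partial>tmeas T) \<le> W 1 (u 0) + ennreal (1 / \<nu>) * (\<integral>\<^sup>+s. ennreal ((norm (F s))\<^sup>2) \<partial>tmeas T)"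
proof -
  have "W 1 (u t) \<le> W 1 (u t) + ennreal \<nu> * (\<integral>\<^sup>+s. W 2 (u s) * indicator {..t} s \<partial>tmeas T)" by simp
  also have "\<dots> \<le> W 1 (u 0) + ennreal (1 / \<nu>) * (\<integral>\<^sup>+s. ennreal ((norm (F s))\<^sup>2) * indicator {..t} s \<partial>tmeas T)"
    by (rule lin_estimate[OF assms])
  also have "\<dots> \<le> W 1 (u 0) + ennreal (1 / \<nu>) * (\<integral>\<^sup>+s. ennreal ((norm (F s))\<^sup>2) \<partial>tmeas T)"
    by (intro add_left_mono mult_left_mono nn_integral_mono) (auto simp: indicator_def)
  finally show "W 1 (u t) \<le> \<dots>" .
  have T: "T \<in> {0..T}" using t by auto
  have eq: "(\<integral>\<^sup>+s. h s * indicator {..T} s \<partial>tmeas T) = (\<integral>\<^sup>+s. h s \<partial>tmeas T)" for h :: "real \<Rightarrow> ennreal"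
    by (intro nn_integral_cong) auto
  have "ennreal \<nu> * (\<integral>\<^sup>+s. W 2 (u s) \<partial>tmeas T) \<le> W 1 (u T) + ennreal \<nu> * (\<integral>\<^sup>+s. W 2 (u s) \<partial>tmeas T)" by simp
  also have "\<dots> \<le> W 1 (u 0) + ennreal (1 / \<nu>) * (\<integral>\<^sup>+s. ennreal ((norm (F s))\<^sup>2) \<partial>tmeas T)"
    using lin_estimate[OF l \<nu> T] by (simp only: eq)
  finally show "ennreal \<nu> * (\<integral>\<^sup>+s. W 2 (u s) \<partial>tmeas T) \<le> \<dots>" .
qed

lemma lin_H1:
  assumes l: "lin \<nu> T u F" and \<nu>: "\<nu> > 0" and t: "t \<in> {0..T}"
  shows "u t \<in> H 1" "(\<integral>\<^sup>+s. W 2 (u s) \<partial>tmeas T) < \<infinity>" "AE s in tmeas T. u s \<in> H 2"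
proof -
  note D = lin_D[OF l]
  note [measurable] = D(6)
  have b: "W 1 (u 0) + ennreal (1 / \<nu>) * (\<integral>\<^sup>+s. ennreal ((norm (F s))\<^sup>2) \<partial>tmeas T) < \<infinity>"
    using D(2,3) by (simp add: H_iff_W ennreal_mult_less_top)
  show "u t \<in> H 1"
    unfolding H_iff_W by (rule order_le_less_trans[OF lin_estimate_total(1)[OF assms] b])
  have "ennreal \<nu> * (\<integral>\<^sup>+s. W 2 (u s) \<partial>tmeas T) < \<infinity>"
    by (rule order_le_less_trans[OF lin_estimate_total(2)[OF assms] b])
  then show i: "(\<integral>\<^sup>+s. W 2 (u s) \<partial>tmeas T) < \<infinity>" using \<nu> by (auto simp: ennreal_mult_less_top)
  have "AE s in tmeas T. W 2 (u s) \<noteq> \<infinity>"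
    using i by (intro nn_integral_PInf_AE) auto
  then show "AE s in tmeas T. u s \<in> H 2" by eventually_elim (simp add: H_iff_W top.not_eq_extremum)
qed

lemma nn_integral_square_add:
  fixes F G :: "real \<Rightarrow> 'a"
  assumes [measurable]: "F \<in> borel_measurable M" "G \<in> borel_measurable M"
  shows "(\<integral>\<^sup>+s. ennreal ((norm (F s + G s))\<^sup>2) \<partial>M)
    \<le> 2 * (\<integral>\<^sup>+s. ennreal ((norm (F s))\<^sup>2) \<partial>M) + 2 * (\<integral>\<^sup>+s. ennreal ((norm (G s))\<^sup>2) \<partial>M)"
proof -
  have "(\<integral>\<^sup>+s. ennreal ((norm (F s + G s))\<^sup>2) \<partial>M)
      \<le> (\<integral>\<^sup>+s. 2 * ennreal ((norm (F s))\<^sup>2) + 2 * ennreal ((norm (G s))\<^sup>2) \<partial>M)"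
    unfolding W_0[symmetric] by (intro nn_integral_mono W_add)
  also have "\<dots> = 2 * (\<integral>\<^sup>+s. ennreal ((norm (F s))\<^sup>2) \<partial>M) + 2 * (\<integral>\<^sup>+s. ennreal ((norm (G s))\<^sup>2) \<partial>M)"
    by (simp add: nn_integral_add nn_integral_cmult)
  finally show ?thesis .
qed

lemma nn_integral_square_diff:
  fixes F G :: "real \<Rightarrow> 'a"
  assumes "F \<in> borel_measurable M" "G \<in> borel_measurable M"
  shows "(\<integral>\<^sup>+s. ennreal ((norm (F s - G s))\<^sup>2) \<partial>M)
    \<le> 2 * (\<integral>\<^sup>+s. ennreal ((norm (F s))\<^sup>2) \<partial>M) + 2 * (\<integral>\<^sup>+s. ennreal ((norm (G s))\<^sup>2) \<partial>M)"
  using nn_integral_square_add[OF assms(1) borel_measurable_uminus[OF assms(2)]] by simp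

lemma lin_diff:
  assumes "lin \<nu> T u F" "lin \<nu> T v G"
  shows "lin \<nu> T (\<lambda>t. u t - v t) (\<lambda>t. F t - G t)"
  unfolding lin_def
proof (intro conjI allI)
  note D = lin_D[OF assms(1)] and E = lin_D[OF assms(2)]
  note [measurable] = D(1) E(1)
  show "(\<lambda>t. F t - G t) \<in> borel_measurable (tmeas T)" by measurable
  show "(\<integral>\<^sup>+s. ennreal ((norm (F s - G s))\<^sup>2) \<partial>tmeas T) < \<infinity>"
    using D(2) E(2) by (intro order_le_less_trans[OF nn_integral_square_diff]) (auto simp: ennreal_mult_less_top)
  show "u 0 - v 0 \<in> H 1" by (intro H_diff D E)
  fix n
  let ?f = "\<lambda>s. - (\<nu> * m n) * (u s \<bullet> e n) + F s \<bullet> e n" and ?g = "\<lambda>s. - (\<nu> * m n) * (v s \<bullet> e n) + G s \<bullet> e n"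
  have eq: "(\<lambda>s. - (\<nu> * m n) * ((u s - v s) \<bullet> e n) + (F s - G s) \<bullet> e n) = (\<lambda>s. ?f s - ?g s)"
    by (simp add: fun_eq_iff inner_diff_left algebra_simps)
  note f = ac_integrable[OF D(4)[of n]] and g = ac_integrable[OF E(4)[of n]]
  show "ac T (\<lambda>t. (u t - v t) \<bullet> e n) (\<lambda>s. - (\<nu> * m n) * ((u s - v s) \<bullet> e n) + (F s - G s) \<bullet> e n)"
    unfolding eq unfolding ac_def prim_diff[OF f g] inner_diff_left
  proof (intro conjI ballI)
    show "integrable (tmeas T) (\<lambda>s. ?f s - ?g s)" by (rule Bochner_Integration.integrable_diff[OF f g])
    fix t assume t: "t \<in> {0..T}"
    show "u t \<bullet> e n - v t \<bullet> e n = u 0 \<bullet> e n - v 0 \<bullet> e n + (prim T ?f t - prim T ?g t)"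
      using ac_prim[OF D(4)[of n] t] ac_prim[OF E(4)[of n] t] by linarith
  qed
qed

lemma ac_cong:
  assumes "ac T p q" "\<And>t. t \<in> {0..T} \<Longrightarrow> p t = p' t" "\<And>t. t \<in> {0<..<T} \<Longrightarrow> q t = q' t" "T \<ge> 0"
  shows "ac T p' q'"
  unfolding ac_def
proof (intro conjI ballI)
  show "integrable (tmeas T) q'"
    using ac_integrable[OF assms(1)] assms(3) by (subst Bochner_Integration.integrable_cong[OF refl, of _ _ q]) auto
  fix t assume t: "t \<in> {0..T}"
  have "prim T q' t = prim T q t" using assms(3) by (intro prim_cong) auto
  then show "p' t = p' 0 + prim T q' t"
    using ac_prim[OF assms(1) t] assms(2)[OF t] assms(2)[of 0] assms(4) by auto
qed

lemma lin_tail: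
  assumes "lin \<nu> T u F" "T \<ge> 0"
  shows "lin \<nu> T (\<lambda>t. u t - proj K (u t)) (\<lambda>t. F t - proj K (F t))"
  unfolding lin_def
proof (intro conjI allI)
  note D = lin_D[OF assms(1)]
  note [measurable] = D(1)
  have [measurable]: "(\<lambda>s. F s \<bullet> e n) \<in> borel_measurable (tmeas T)" for n
    by (intro borel_measurable_inner D(1) borel_measurable_const)
  show "(\<lambda>t. F t - proj K (F t)) \<in> borel_measurable (tmeas T)" unfolding proj_def by measurable
  have le: "W 0 (x - proj K x) \<le> W 0 x" for x
    unfolding W_def by (intro suminf_le summableI ennreal_leI) (auto simp: inner_diff_left proj_inner)
  have "(\<integral>\<^sup>+s. ennreal ((norm (F s - proj K (F s)))\<^sup>2) \<partial>tmeas T) \<le> (\<integral>\<^sup>+s. ennreal ((norm (F s))\<^sup>2) \<partial>tmeas T)"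
    unfolding W_0[symmetric] by (intro nn_integral_mono le)
  then show "(\<integral>\<^sup>+s. ennreal ((norm (F s - proj K (F s)))\<^sup>2) \<partial>tmeas T) < \<infinity>"
    using D(2) by (rule order_le_less_trans)
  show "u 0 - proj K (u 0) \<in> H 1" by (intro H_diff D proj_H)
  fix n
  show "ac T (\<lambda>t. (u t - proj K (u t)) \<bullet> e n)
     (\<lambda>s. - (\<nu> * m n) * ((u s - proj K (u s)) \<bullet> e n) + (F s - proj K (F s)) \<bullet> e n)"
  proof (cases "n < K")
    case True
    then show ?thesis by (simp add: inner_diff_left proj_inner ac_def prim_def)
  next
    case False
    then show ?thesis using D(4)[of n] by (simp add: inner_diff_left proj_inner)
  qed
qed

lemma lin_tail_uniform:
  assumes l: "lin \<nu> T u F" and \<nu>: "\<nu> > 0" and T: "T \<ge> 0" and \<epsilon>: "\<epsilon> > 0"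
  shows "\<exists>K. \<forall>t\<in>{0..T}. N 1 (u t - proj K (u t)) \<le> \<epsilon>"
proof -
  note D = lin_D[OF l]
  note F = coeff_square_integrable[OF D(1,2)]
  have [measurable]: "(\<lambda>s. F s \<bullet> e n) \<in> borel_measurable (tmeas T)" for n by (rule F(1))
  note [measurable] = D(1)
  let ?r = "\<lambda>K. \<integral>s. (norm (F s - proj K (F s)))\<^sup>2 \<partial>tmeas T"
  have sq: "(norm (x - proj K x))\<^sup>2 \<le> 4 * (norm x)\<^sup>2" for x K
  proof -
    have "(norm (proj K x))\<^sup>2 \<le> (norm x)\<^sup>2" using bessel[where K=K and u=x] by (simp add: proj_def norm_sum_basis)
    then have "norm (proj K x) \<le> norm x" by (rule power2_le_imp_le) simp
    then have "norm (x - proj K x) \<le> 2 * norm x" using norm_triangle_ineq4[of x "proj K x"] by linarith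
    then have "(norm (x - proj K x))\<^sup>2 \<le> (2 * norm x)\<^sup>2" by (intro power_mono) auto
    then show ?thesis by (simp add: power_mult_distrib)
  qed
  have pm [measurable]: "(\<lambda>s. proj K (F s)) \<in> borel_measurable (tmeas T)" for K
    unfolding proj_def by measurable
  have ri: "integrable (tmeas T) (\<lambda>s. (norm (F s - proj K (F s)))\<^sup>2)" for K
    by (rule Bochner_Integration.integrable_bound[of _ "\<lambda>s. 4 * (norm (F s))\<^sup>2"]) (use F(4) sq in auto)
  have "?r \<longlonglongrightarrow> (\<integral>s. 0 \<partial>tmeas T)"
  proof (rule integral_dominated_convergence[where w="\<lambda>s. 4 * (norm (F s))\<^sup>2"])
    have "(\<lambda>K. (norm (x - proj K x))\<^sup>2) \<longlonglongrightarrow> (norm (x - x))\<^sup>2" for x :: 'a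
      by (intro tendsto_intros proj_tendsto)
    then show "AE s in tmeas T. (\<lambda>K. (norm (F s - proj K (F s)))\<^sup>2) \<longlonglongrightarrow> 0" by simp
  qed (use F(4) sq in auto)
  then have "(\<lambda>K. N 1 (u 0 - proj K (u 0)) + (1 / \<nu>) * ?r K) \<longlonglongrightarrow> 0 + (1 / \<nu>) * 0"
    by (intro tendsto_intros N_tail D) simp
  then have "\<forall>\<^sub>F K in sequentially. N 1 (u 0 - proj K (u 0)) + (1 / \<nu>) * ?r K < \<epsilon>"
    using \<epsilon> by (simp add: order_tendsto_iff)
  then obtain K where K: "N 1 (u 0 - proj K (u 0)) + (1 / \<nu>) * ?r K < \<epsilon>"
    by (auto simp: eventually_sequentially)
  have "N 1 (u t - proj K (u t)) \<le> \<epsilon>" if t: "t \<in> {0..T}" for t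
  proof -
    note l' = lin_tail[OF l T, of K]
    have h: "u 0 - proj K (u 0) \<in> H 1" "u t - proj K (u t) \<in> H 1"
      using lin_D(3)[OF l'] lin_H1(1)[OF l' \<nu> t] by auto
    have r0: "0 \<le> ?r K" by simp
    have "ennreal (N 1 (u t - proj K (u t))) \<le> W 1 (u 0 - proj K (u 0)) + ennreal (1 / \<nu>) * (\<integral>\<^sup>+s. ennreal ((norm (F s - proj K (F s)))\<^sup>2) \<partial>tmeas T)"
      using lin_estimate_total(1)[OF l' \<nu> t] W_eq_N[OF h(2)] by simp
    also have "(\<integral>\<^sup>+s. ennreal ((norm (F s - proj K (F s)))\<^sup>2) \<partial>tmeas T) = ennreal (?r K)"
      by (intro nn_integral_eq_integral ri) auto
    also have "W 1 (u 0 - proj K (u 0)) + ennreal (1 / \<nu>) * ennreal (?r K)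
        = ennreal (N 1 (u 0 - proj K (u 0)) + (1 / \<nu>) * ?r K)"
      unfolding W_eq_N[OF h(1)] using N_nonneg[OF h(1)] r0 \<nu>
      by (simp add: ennreal_plus ennreal_mult[symmetric] del: integral_nonneg_eq_0_iff_AE)
    also have "\<dots> \<le> ennreal \<epsilon>" using K by (intro ennreal_leI) simp
    finally show ?thesis using \<epsilon> by simp
  qed
  then show ?thesis by blast
qed

lemma N_split: "x \<in> H s \<Longrightarrow> N s x = (\<Sum>n<K. m n ^ s * (x \<bullet> e n)\<^sup>2) + N s (x - proj K x)"
proof -
  let ?f = "\<lambda>n. m n ^ s * (x \<bullet> e n)\<^sup>2" and ?g = "\<lambda>n. m n ^ s * ((x - proj K x) \<bullet> e n)\<^sup>2"
  assume x: "x \<in> H s"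
  have "?g sums N s (x - proj K x)"
    using H_diff[OF x proj_H, of K] unfolding H_def N_def by (auto intro: summable_sums)
  moreover have "(\<lambda>n. if n < K then ?f n else 0) sums (\<Sum>n<K. ?f n)"
    using sums_If_finite_set[of "{..<K}" ?f] by simp
  ultimately have "(\<lambda>n. (if n < K then ?f n else 0) + ?g n) sums ((\<Sum>n<K. ?f n) + N s (x - proj K x))"
    by (intro sums_add)
  moreover have "(\<lambda>n. (if n < K then ?f n else 0) + ?g n) = ?f"
    by (auto simp: inner_diff_left proj_inner)
  ultimately show ?thesis by (simp add: N_def[of s x] sums_iff)
qed

lemma N_continuous:
  assumes H: "\<And>t. t \<in> S \<Longrightarrow> x t \<in> H s" and c: "\<And>n. continuous_on S (\<lambda>t. x t \<bullet> e n)"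
    and tail: "\<And>\<epsilon>. \<epsilon> > 0 \<Longrightarrow> \<exists>K. \<forall>t\<in>S. N s (x t - proj K (x t)) \<le> \<epsilon>"
  shows "continuous_on S (\<lambda>t. N s (x t))"
proof -
  have "\<exists>K. \<forall>t\<in>S. N s (x t - proj K (x t)) \<le> inverse (real (Suc k))" for k
    by (rule tail) simp
  then obtain K where K: "\<And>k t. t \<in> S \<Longrightarrow> N s (x t - proj (K k) (x t)) \<le> inverse (real (Suc k))" by metis
  show ?thesis
  proof (rule uniform_limit_theorem[where F=sequentially and f="\<lambda>k t. \<Sum>n<K k. m n ^ s * (x t \<bullet> e n)\<^sup>2"])
    show "\<forall>\<^sub>F k in sequentially. continuous_on S (\<lambda>t. \<Sum>n<K k. m n ^ s * (x t \<bullet> e n)\<^sup>2)"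
      by (intro always_eventually allI continuous_intros c)
    show "uniform_limit S (\<lambda>k t. \<Sum>n<K k. m n ^ s * (x t \<bullet> e n)\<^sup>2) (\<lambda>t. N s (x t)) sequentially"
    proof (rule uniform_limitI)
      fix \<epsilon> :: real assume "\<epsilon> > 0"
      then obtain k0 where k0: "inverse (real (Suc k0)) < \<epsilon>" using reals_Archimedean by blast
      show "\<forall>\<^sub>F k in sequentially. \<forall>t\<in>S. dist (\<Sum>n<K k. m n ^ s * (x t \<bullet> e n)\<^sup>2) (N s (x t)) < \<epsilon>"
        using eventually_ge_at_top[of k0]
      proof eventually_elim
        case (elim k)
        have "inverse (real (Suc k)) \<le> inverse (real (Suc k0))" using elim by (intro le_imp_inverse_le) auto
        show ?case
        proof (intro ballI)
          fix t assume t: "t \<in> S"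
          have "dist (\<Sum>n<K k. m n ^ s * (x t \<bullet> e n)\<^sup>2) (N s (x t)) = N s (x t - proj (K k) (x t))"
            using N_split[OF H[OF t], of "K k"] N_nonneg[OF H_diff[OF H[OF t] proj_H[of "K k" "x t"]]]
            by (simp add: dist_real_def)
          then show "dist (\<Sum>n<K k. m n ^ s * (x t \<bullet> e n)\<^sup>2) (N s (x t)) < \<epsilon>"
            using K[OF t, of k] \<open>inverse (real (Suc k)) \<le> _\<close> k0 by linarith
        qed
      qed
    qed
  qed simp
qed

lemma lin_N_continuous:
  assumes l: "lin \<nu> T u F" and \<nu>: "\<nu> > 0" and T: "T \<ge> 0" and a: "a \<in> H 1"
  shows "continuous_on {0..T} (\<lambda>t. N 1 (u t - a))"
proof (rule N_continuous)
  show "u t - a \<in> H 1" if "t \<in> {0..T}" for t by (intro H_diff lin_H1(1)[OF l \<nu> that] a)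
  show "continuous_on {0..T} (\<lambda>t. (u t - a) \<bullet> e n)" for n
    unfolding inner_diff_left by (intro continuous_intros lin_D(5)[OF l])
  fix \<epsilon> :: real assume \<epsilon>: "\<epsilon> > 0"
  then obtain K1 where K1: "\<forall>t\<in>{0..T}. N 1 (u t - proj K1 (u t)) \<le> \<epsilon> / 4"
    using lin_tail_uniform[OF l \<nu> T, of "\<epsilon> / 4"] by auto
  have "\<forall>\<^sub>F K in sequentially. N 1 (a - proj K a) < \<epsilon> / 4"
    by (rule order_tendstoD(2)[OF N_tail[OF a]]) (use \<epsilon> in simp)
  then obtain K2 where K2: "\<And>K. K \<ge> K2 \<Longrightarrow> N 1 (a - proj K a) < \<epsilon> / 4" by (auto simp: eventually_sequentially)
  have mono: "N 1 (x - proj K' x) \<le> N 1 (x - proj K x)" if "K \<le> K'" "x \<in> H 1" for x K K'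
  proof -
    have "W 1 (x - proj K' x) \<le> W 1 (x - proj K x)"
      unfolding W_def using that(1)
      by (intro suminf_le summableI ennreal_leI mult_left_mono) (auto simp: inner_diff_left proj_inner m_nonneg)
    moreover have "x - proj K x \<in> H 1" "x - proj K' x \<in> H 1" using that by (auto intro: H_diff proj_H)
    ultimately show ?thesis by (simp add: W_eq_N N_nonneg)
  qed
  let ?K = "max K1 K2"
  have "N 1 ((u t - a) - proj ?K (u t - a)) \<le> \<epsilon>" if t: "t \<in> {0..T}" for t
  proof -
    have ut: "u t \<in> H 1" by (rule lin_H1(1)[OF l \<nu> t])
    have "(u t - a) - proj ?K (u t - a) = (u t - proj ?K (u t)) - (a - proj ?K a)"
      by (rule basis_eqI) (simp add: inner_diff_left proj_inner)
    then have "N 1 ((u t - a) - proj ?K (u t - a)) \<le> 2 * N 1 (u t - proj ?K (u t)) + 2 * N 1 (a - proj ?K a)"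
      using ut a by (simp only:) (intro N_diff H_diff proj_H)
    moreover have "N 1 (u t - proj ?K (u t)) \<le> \<epsilon> / 4" using mono[of K1 ?K "u t"] ut K1 t by force
    moreover have "N 1 (a - proj ?K a) \<le> \<epsilon> / 4" using K2[of ?K] by simp
    ultimately show ?thesis by linarith
  qed
  then show "\<exists>K. \<forall>t\<in>{0..T}. N 1 ((u t - a) - proj K (u t - a)) \<le> \<epsilon>" by blast
qed

lemma lin_exists:
  assumes F: "F \<in> borel_measurable (tmeas T)" "(\<integral>\<^sup>+s. ennreal ((norm (F s))\<^sup>2) \<partial>tmeas T) < \<infinity>"
    and u0: "u0 \<in> H 1" and \<nu>: "\<nu> > 0" and T: "T \<ge> 0"
  shows "\<exists>u. u 0 = u0 \<and> lin \<nu> T u F"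
proof -
  note C = coeff_square_integrable[OF F]
  note [measurable] = C(1) F(1)
  have "\<exists>c. c 0 = u0 \<bullet> e n \<and> ac T c (\<lambda>s. - (\<nu> * m n) * c s + F s \<bullet> e n)" for n
    by (rule scalar_duhamel[OF C(3)])
  then obtain c where c: "\<And>n. c n 0 = u0 \<bullet> e n" "\<And>n. ac T (c n) (\<lambda>s. - (\<nu> * m n) * c n s + F s \<bullet> e n)"
    by metis
  let ?B = "N 1 u0 + (1 / \<nu>) * (\<integral>s. (norm (F s))\<^sup>2 \<partial>tmeas T)"
  have sum: "summable (\<lambda>n. (c n t)\<^sup>2)" if t: "t \<in> {0..T}" for t
  proof (rule summableI_nonneg_bounded[where x="?B"])
    fix K
    have "(\<Sum>n<K. (c n t)\<^sup>2) \<le> (\<Sum>n<K. m n * (u0 \<bullet> e n)\<^sup>2 + (1 / \<nu>) * (\<integral>s. (F s \<bullet> e n)\<^sup>2 \<partial>tmeas T))"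
    proof (rule sum_mono)
      fix n
      have "1 * (c n t)\<^sup>2 \<le> m n * (c n t)\<^sup>2" by (intro mult_right_mono m_ge_1) simp
      moreover have "0 \<le> \<nu> * (m n)\<^sup>2 * prim T (\<lambda>s. (c n s)\<^sup>2) t"
        using \<nu> by (intro mult_nonneg_nonneg prim_nonneg) auto
      moreover have "prim T (\<lambda>s. (F s \<bullet> e n)\<^sup>2) t / \<nu> \<le> (1 / \<nu>) * (\<integral>s. (F s \<bullet> e n)\<^sup>2 \<partial>tmeas T)"
        using prim_le_total[OF C(2)[of n], of t] \<nu> by (simp add: divide_right_mono)
      ultimately show "(c n t)\<^sup>2 \<le> m n * (u0 \<bullet> e n)\<^sup>2 + (1 / \<nu>) * (\<integral>s. (F s \<bullet> e n)\<^sup>2 \<partial>tmeas T)"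
        using scalar_estimate[OF c(2) C(1,2) t \<nu> m_pos[of n], unfolded c(1)] by linarith
    qed
    also have "\<dots> = (\<Sum>n<K. m n ^ 1 * (u0 \<bullet> e n)\<^sup>2) + (1 / \<nu>) * (\<integral>s. (\<Sum>n<K. (F s \<bullet> e n)\<^sup>2) \<partial>tmeas T)"
      using C(2) by (simp add: sum.distrib Bochner_Integration.integral_sum sum_divide_distrib)
    also have "\<dots> \<le> ?B"
    proof (intro add_mono mult_left_mono)
      show "(\<Sum>n<K. m n ^ 1 * (u0 \<bullet> e n)\<^sup>2) \<le> N 1 u0"
        using N_split[OF u0, of K] N_nonneg[OF H_diff[OF u0 proj_H[of K u0]]] by linarith
      show "(\<integral>s. (\<Sum>n<K. (F s \<bullet> e n)\<^sup>2) \<partial>tmeas T) \<le> (\<integral>s. (norm (F s))\<^sup>2 \<partial>tmeas T)"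
        using C(2,4) by (intro integral_mono bessel) auto
    qed (use \<nu> in simp)
    finally show "(\<Sum>n<K. (c n t)\<^sup>2) \<le> ?B" .
  qed simp
  define u where "u t = (SOME v. \<forall>n. v \<bullet> e n = c n t)" for t
  have u: "u t \<bullet> e n = c n t" if "t \<in> {0..T}" for t n
    using someI_ex[of "\<lambda>v. \<forall>n. v \<bullet> e n = c n t"] riesz_fischer[OF sum[OF that]] unfolding u_def by blast
  have "u 0 = u0" by (rule basis_eqI) (use u T c(1) in auto)
  moreover have "lin \<nu> T u F"
    unfolding lin_def
  proof (intro conjI allI F)
    show "u 0 \<in> H 1" using u0 \<open>u 0 = u0\<close> by simp
    show "ac T (\<lambda>t. u t \<bullet> e n) (\<lambda>s. - (\<nu> * m n) * (u s \<bullet> e n) + F s \<bullet> e n)" for n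
      by (rule ac_cong[OF c(2)]) (use u T in auto)
  qed
  ultimately show ?thesis by blast
qed

end

subsection \<open>Quadratic perturbations\<close>

declare One_nat_def [simp del]

lemma tmeas_mono:
  assumes "T \<le> T'"
  shows "f \<in> borel_measurable (tmeas T') \<Longrightarrow> f \<in> borel_measurable (tmeas T)"
    and "(\<integral>\<^sup>+s. h s \<partial>tmeas T) \<le> (\<integral>\<^sup>+s. h s \<partial>tmeas T')"
proof -
  have eq: "tmeas T = restrict_space (tmeas T') {0<..<T}"
    unfolding tmeas_def using assms by (subst restrict_restrict_space) (auto simp: Int_absorb1 Int_commute greaterThanLessThan_subseteq_greaterThanLessThan)
  show "f \<in> borel_measurable (tmeas T') \<Longrightarrow> f \<in> borel_measurable (tmeas T)"
    unfolding eq by (rule measurable_restrict_space1)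
  have "{0<..<T} \<inter> space (tmeas T') \<in> sets (tmeas T')"
    using measurable_sets[OF borel_measurable_tmeas_id, of "{0<..<T}" T'] by (simp add: vimage_def Int_def)
  then have "(\<integral>\<^sup>+s. h s \<partial>tmeas T) = (\<integral>\<^sup>+s. h s * indicator {0<..<T} s \<partial>tmeas T')"
    unfolding eq by (rule nn_integral_restrict_space)
  also have "\<dots> \<le> (\<integral>\<^sup>+s. h s \<partial>tmeas T')" by (intro nn_integral_mono) (auto simp: indicator_def)
  finally show "(\<integral>\<^sup>+s. h s \<partial>tmeas T) \<le> (\<integral>\<^sup>+s. h s \<partial>tmeas T')" .
qed

lemma prim_dominated_convergence:
  fixes h :: "nat \<Rightarrow> real \<Rightarrow> real"
  assumes w: "integrable (tmeas T) w" and [measurable]: "\<And>n. h n \<in> borel_measurable (tmeas T)" "g \<in> borel_measurable (tmeas T)"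
    and lim: "AE s in tmeas T. (\<lambda>n. h n s) \<longlonglongrightarrow> g s" and le: "\<And>n. AE s in tmeas T. \<bar>h n s\<bar> \<le> w s"
  shows "(\<lambda>n. prim T (h n) t) \<longlonglongrightarrow> prim T g t"
  unfolding prim_def
proof (rule integral_dominated_convergence[where w="\<lambda>s. w s"])
  show "AE s in tmeas T. (\<lambda>n. if s \<le> t then h n s else 0) \<longlonglongrightarrow> (if s \<le> t then g s else 0)"
    using lim by eventually_elim auto
  show "AE s in tmeas T. norm (if s \<le> t then h n s else 0) \<le> w s" for n
    using le[of n] by eventually_elim auto
qed (use w in auto)

locale quadratic_evolution = weighted_basis e m
  for e :: "nat \<Rightarrow> 'a::{real_inner, banach, second_countable_topology}" and m +
  fixes B :: "'a \<Rightarrow> 'a \<Rightarrow> 'a" and \<nu> :: real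
  assumes nu_pos: "0 < \<nu>"
    and B_add_left: "u \<in> H 1 \<Longrightarrow> u' \<in> H 1 \<Longrightarrow> v \<in> H 2 \<Longrightarrow> B (u + u') v = B u v + B u' v"
    and B_add_right: "u \<in> H 1 \<Longrightarrow> v \<in> H 2 \<Longrightarrow> v' \<in> H 2 \<Longrightarrow> B u (v + v') = B u v + B u v'"
    and B_scaleR_left: "u \<in> H 1 \<Longrightarrow> v \<in> H 2 \<Longrightarrow> B (r *\<^sub>R u) v = r *\<^sub>R B u v"
    and B_scaleR_right: "u \<in> H 1 \<Longrightarrow> v \<in> H 2 \<Longrightarrow> B u (r *\<^sub>R v) = r *\<^sub>R B u v"
    and B_bound: "0 < \<epsilon> \<Longrightarrow> \<exists>C\<ge>0. \<forall>u\<in>H 1. \<forall>v\<in>H 2. (norm (B u v))\<^sup>2 \<le> N 1 u * (\<epsilon> * N 2 v + C * N 1 v)"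
    and B_orth: "u \<in> H 1 \<Longrightarrow> v \<in> H 2 \<Longrightarrow> B u v \<bullet> v = 0"
begin

text \<open>The linear part of \<open>lin\<close> stands for \<open>\<nu> (1 - \<Delta>)\<close>, hence the compensating term \<open>\<nu> u\<close> in the forcing.
  Solutions lie in \<open>H 2\<close> at almost every time only; the value of \<open>Q\<close> elsewhere is irrelevant.\<close>

definition Q :: "'a \<Rightarrow> 'a" where
  "Q u = (if u \<in> H 2 then B u u else 0)"

definition forcing :: "(real \<Rightarrow> 'a) \<Rightarrow> (real \<Rightarrow> 'a) \<Rightarrow> real \<Rightarrow> 'a" where
  "forcing f u t = f t + \<nu> *\<^sub>R u t - Q (u t)"

definition sol :: "real \<Rightarrow> (real \<Rightarrow> 'a) \<Rightarrow> (real \<Rightarrow> 'a) \<Rightarrow> bool" where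
  "sol T f u \<longleftrightarrow> lin \<nu> T u (forcing f u)"

lemma H21: "u \<in> H 2 \<Longrightarrow> u \<in> H 1"
  by (rule H_mono) auto

lemma basis_H: "e n \<in> H s"
  using sum_basis_H[of "{n}" "\<lambda>_. 1" s] by simp

lemma B_sum_left: "finite I \<Longrightarrow> (\<And>i. i \<in> I \<Longrightarrow> x i \<in> H 1) \<Longrightarrow> v \<in> H 2 \<Longrightarrow>
    B (\<Sum>i\<in>I. x i) v = (\<Sum>i\<in>I. B (x i) v) \<and> (\<Sum>i\<in>I. x i) \<in> H 1"
proof (induction I rule: finite_induct)
  case empty
  then show ?case using B_scaleR_left[of 0 v 0] by simp
qed (simp add: B_add_left H_add)

lemma B_sum_right: "finite I \<Longrightarrow> (\<And>i. i \<in> I \<Longrightarrow> x i \<in> H 2) \<Longrightarrow> u \<in> H 1 \<Longrightarrow>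
    B u (\<Sum>i\<in>I. x i) = (\<Sum>i\<in>I. B u (x i)) \<and> (\<Sum>i\<in>I. x i) \<in> H 2"
proof (induction I rule: finite_induct)
  case empty
  then show ?case using B_scaleR_right[of u 0 0] by simp
qed (simp add: B_add_right H_add)

lemma B_proj:
  "B (proj K u) (proj K u) = (\<Sum>i<K. \<Sum>j<K. (u \<bullet> e i) *\<^sub>R (u \<bullet> e j) *\<^sub>R B (e i) (e j))"
proof -
  have "B (proj K u) (proj K u) = (\<Sum>i<K. B ((u \<bullet> e i) *\<^sub>R e i) (proj K u))"
    using B_sum_left[of "{..<K}" "\<lambda>i. (u \<bullet> e i) *\<^sub>R e i" "proj K u"] basis_H H_scaleR proj_H
    by (simp add: proj_def)
  also have "\<dots> = (\<Sum>i<K. (u \<bullet> e i) *\<^sub>R B (e i) (proj K u))"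
    by (intro sum.cong refl B_scaleR_left basis_H proj_H)
  also have "\<dots> = (\<Sum>i<K. (u \<bullet> e i) *\<^sub>R (\<Sum>j<K. B (e i) ((u \<bullet> e j) *\<^sub>R e j)))"
    using B_sum_right[of "{..<K}" "\<lambda>j. (u \<bullet> e j) *\<^sub>R e j"] basis_H H_scaleR
    by (simp add: proj_def)
  also have "\<dots> = (\<Sum>i<K. \<Sum>j<K. (u \<bullet> e i) *\<^sub>R (u \<bullet> e j) *\<^sub>R B (e i) (e j))"
    by (simp add: scaleR_sum_right B_scaleR_right basis_H)
  finally show ?thesis .
qed

lemma Q_diff:
  assumes "u \<in> H 2" "v \<in> H 2"
  shows "Q u - Q v = B (u - v) u + B v (u - v)"
proof -
  have "B u u = B (u - v) u + B v u"
    using B_add_left[of "u - v" v u] assms by (simp add: H21 H_diff)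
  moreover have "B v u = B v (u - v) + B v v"
    using B_add_right[of v "u - v" v] assms by (simp add: H21 H_diff)
  ultimately show ?thesis using assms by (simp add: Q_def)
qed

lemma proj_Q_tendsto:
  assumes u: "u \<in> H 2"
  shows "(\<lambda>K. B (proj K u) (proj K u)) \<longlonglongrightarrow> Q u"
proof -
  obtain C where C: "C \<ge> 0" "\<And>u v. u \<in> H 1 \<Longrightarrow> v \<in> H 2 \<Longrightarrow> (norm (B u v))\<^sup>2 \<le> N 1 u * (1 * N 2 v + C * N 1 v)"
    using B_bound[of 1] by auto
  let ?d = "\<lambda>K. u - proj K u"
  let ?b = "\<lambda>K. 2 * (N 1 (?d K) * (1 * N 2 u + C * N 1 u))
    + 2 * ((2 * N 1 u + 2 * N 1 (?d K)) * (1 * N 2 (?d K) + C * N 1 (?d K)))"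
  note u1 = H21[OF u]
  have le: "(norm (Q u - B (proj K u) (proj K u)))\<^sup>2 \<le> ?b K" for K
  proof -
    have d: "?d K \<in> H 2" "?d K \<in> H 1" using u u1 by (auto intro: H_diff proj_H)
    have p: "proj K u \<in> H 1" "proj K u \<in> H 2" by (rule proj_H)+
    have "Q u - B (proj K u) (proj K u) = B (?d K) u + B (proj K u) (?d K)"
      using Q_diff[OF u p(2)] p by (simp add: Q_def)
    then have "(norm (Q u - B (proj K u) (proj K u)))\<^sup>2 \<le> (norm (B (?d K) u) + norm (B (proj K u) (?d K)))\<^sup>2"
      by (simp add: power_mono norm_triangle_ineq)
    also have "\<dots> \<le> 2 * (norm (B (?d K) u))\<^sup>2 + 2 * (norm (B (proj K u) (?d K)))\<^sup>2" by (rule square_add_le)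
    also have "\<dots> \<le> 2 * (N 1 (?d K) * (1 * N 2 u + C * N 1 u)) + 2 * (N 1 (proj K u) * (1 * N 2 (?d K) + C * N 1 (?d K)))"
      by (intro add_mono mult_left_mono C d p u) auto
    also have "\<dots> \<le> ?b K"
    proof -
      have "N 1 (proj K u) \<le> 2 * N 1 u + 2 * N 1 (?d K)" using N_diff[OF u1 d(2)] by simp
      then show ?thesis using N_nonneg[OF d(1)] N_nonneg[OF d(2)] C(1)
        by (intro add_left_mono mult_left_mono mult_right_mono) auto
    qed
    finally show ?thesis .
  qed
  have "?b \<longlonglongrightarrow> 2 * (0 * (1 * N 2 u + C * N 1 u)) + 2 * ((2 * N 1 u + 2 * 0) * (1 * 0 + C * 0))"
    by (intro tendsto_intros N_tail u u1)
  then have b0: "?b \<longlonglongrightarrow> 0" by simp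
  have "(\<lambda>K. (norm (Q u - B (proj K u) (proj K u)))\<^sup>2) \<longlonglongrightarrow> 0"
    by (rule Lim_null_comparison[OF _ b0]) (use le in simp)
  then have "(\<lambda>K. sqrt ((norm (Q u - B (proj K u) (proj K u)))\<^sup>2)) \<longlonglongrightarrow> sqrt 0"
    by (rule tendsto_real_sqrt)
  then have "(\<lambda>K. norm (B (proj K u) (proj K u) - Q u)) \<longlonglongrightarrow> 0"
    by (simp add: norm_minus_commute)
  then show ?thesis by (rule LIM_zero_cancel[OF tendsto_norm_zero_cancel])
qed

lemma borel_measurable_Q:
  assumes [measurable]: "u \<in> borel_measurable M"
  shows "(\<lambda>x. Q (u x)) \<in> borel_measurable M"
proof (rule borel_measurable_LIMSEQ_metric)
  have [measurable]: "(\<lambda>x. u x \<bullet> e n) \<in> borel_measurable M" for n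
    by (intro borel_measurable_inner assms borel_measurable_const)
  show "(\<lambda>x. if W 2 (u x) < \<infinity> then (\<Sum>i<K. \<Sum>j<K. (u x \<bullet> e i) *\<^sub>R (u x \<bullet> e j) *\<^sub>R B (e i) (e j)) else 0) \<in> borel_measurable M" for K
    by measurable
  show "(\<lambda>K. if W 2 (u x) < \<infinity> then (\<Sum>i<K. \<Sum>j<K. (u x \<bullet> e i) *\<^sub>R (u x \<bullet> e j) *\<^sub>R B (e i) (e j)) else 0)
      \<longlonglongrightarrow> Q (u x)" for x
    using proj_Q_tendsto[of "u x"] unfolding B_proj H_iff_W[symmetric] by (cases "u x \<in> H 2") (auto simp: Q_def)
qed

lemma borel_measurable_forcing:
  assumes [measurable]: "f \<in> borel_measurable M" "u \<in> borel_measurable M"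
  shows "forcing f u \<in> borel_measurable M"
  unfolding forcing_def[abs_def] using borel_measurable_Q[OF assms(2)] by measurable

lemma square_add3_le: "(norm (a + b + c :: 'a))\<^sup>2 \<le> 3 * (norm a)\<^sup>2 + 3 * (norm b)\<^sup>2 + 3 * (norm c)\<^sup>2"
proof -
  have "(norm (a + b + c))\<^sup>2 \<le> (norm a + norm b + norm c)\<^sup>2"
    by (intro power_mono order_trans[OF norm_triangle_ineq] add_right_mono norm_triangle_ineq) auto
  also have "\<dots> \<le> 3 * (norm a)\<^sup>2 + 3 * (norm b)\<^sup>2 + 3 * (norm c)\<^sup>2"
    using sum_squares_bound[of "norm a" "norm b"] sum_squares_bound[of "norm a" "norm c"]
      sum_squares_bound[of "norm b" "norm c"]
    by (simp add: power2_eq_square algebra_simps)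
  finally show ?thesis .
qed

lemma forcing_diff_bound:
  assumes C: "\<And>u v. u \<in> H 1 \<Longrightarrow> v \<in> H 2 \<Longrightarrow> (norm (B u v))\<^sup>2 \<le> N 1 u * (\<epsilon> * N 2 v + C * N 1 v)"
    and u: "u t \<in> H 2" and v: "v t \<in> H 2"
  shows "(norm (forcing f u t - forcing f v t))\<^sup>2 \<le> 3 * \<nu>\<^sup>2 * N 1 (u t - v t)
    + 3 * (N 1 (u t - v t) * (\<epsilon> * N 2 (u t) + C * N 1 (u t)))
    + 3 * (N 1 (v t) * (\<epsilon> * N 2 (u t - v t) + C * N 1 (u t - v t)))"
proof -
  let ?w = "u t - v t"
  have w: "?w \<in> H 2" "?w \<in> H 1" "v t \<in> H 1" using u v by (auto intro: H_diff H21)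
  have "forcing f u t - forcing f v t = \<nu> *\<^sub>R ?w + - B ?w (u t) + - B (v t) ?w"
    using Q_diff[OF u v] by (simp add: forcing_def scaleR_diff_right algebra_simps)
  then have "(norm (forcing f u t - forcing f v t))\<^sup>2
      \<le> 3 * (norm (\<nu> *\<^sub>R ?w))\<^sup>2 + 3 * (norm (B ?w (u t)))\<^sup>2 + 3 * (norm (B (v t) ?w))\<^sup>2"
    using square_add3_le[of "\<nu> *\<^sub>R ?w" "- B ?w (u t)" "- B (v t) ?w"] by (simp only:) simp
  moreover have "(norm (\<nu> *\<^sub>R ?w))\<^sup>2 \<le> \<nu>\<^sup>2 * N 1 ?w"
    using norm_le_N[OF w(2)] by (simp add: power_mult_distrib mult_left_mono)
  ultimately show ?thesis using C[OF w(2) u] C[OF w(3) w(1)] by linarith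
qed

lemma forcing_bound:
  assumes C: "\<And>u v. u \<in> H 1 \<Longrightarrow> v \<in> H 2 \<Longrightarrow> (norm (B u v))\<^sup>2 \<le> N 1 u * (\<epsilon> * N 2 v + C * N 1 v)"
    and u: "u t \<in> H 2"
  shows "(norm (forcing f u t))\<^sup>2 \<le> 3 * (norm (f t))\<^sup>2 + 3 * \<nu>\<^sup>2 * N 1 (u t)
    + 3 * (N 1 (u t) * (\<epsilon> * N 2 (u t) + C * N 1 (u t)))"
proof -
  have "forcing f u t = f t + \<nu> *\<^sub>R u t + - B (u t) (u t)" using u by (simp add: forcing_def Q_def)
  then have "(norm (forcing f u t))\<^sup>2 \<le> 3 * (norm (f t))\<^sup>2 + 3 * (norm (\<nu> *\<^sub>R u t))\<^sup>2 + 3 * (norm (B (u t) (u t)))\<^sup>2"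
    using square_add3_le[of "f t" "\<nu> *\<^sub>R u t" "- B (u t) (u t)"] by (simp only:) simp
  moreover have "(norm (\<nu> *\<^sub>R u t))\<^sup>2 \<le> \<nu>\<^sup>2 * N 1 (u t)"
    using norm_le_N[OF H21[OF u]] by (simp add: power_mult_distrib mult_left_mono)
  ultimately show ?thesis using C[OF H21[OF u] u] by linarith
qed

definition energy_bounded :: "real \<Rightarrow> (real \<Rightarrow> 'a) \<Rightarrow> real \<Rightarrow> bool" where
  "energy_bounded T u r \<longleftrightarrow> u \<in> borel_measurable (tmeas T) \<and> (\<forall>t\<in>{0..T}. W 1 (u t) \<le> ennreal r)
     \<and> ennreal \<nu> * (\<integral>\<^sup>+s. W 2 (u s) \<partial>tmeas T) \<le> ennreal r"

lemma energy_bounded_D: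
  assumes "energy_bounded T u r" "r \<ge> 0"
  shows "u \<in> borel_measurable (tmeas T)" "t \<in> {0..T} \<Longrightarrow> u t \<in> H 1" "t \<in> {0..T} \<Longrightarrow> N 1 (u t) \<le> r"
    "AE s in tmeas T. u s \<in> H 2" "(\<integral>\<^sup>+s. W 2 (u s) \<partial>tmeas T) \<le> ennreal (r / \<nu>)"
proof -
  show [measurable]: "u \<in> borel_measurable (tmeas T)" using assms by (simp add: energy_bounded_def)
  show h: "u t \<in> H 1" if "t \<in> {0..T}" for t
  proof -
    have "W 1 (u t) \<le> ennreal r" using assms that by (simp add: energy_bounded_def)
    then show ?thesis unfolding H_iff_W by (rule order_le_less_trans) simp
  qed
  show "N 1 (u t) \<le> r" if "t \<in> {0..T}" for t
  proof -
    have "ennreal (N 1 (u t)) \<le> ennreal r"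
      using assms that W_eq_N[OF h[OF that]] unfolding energy_bounded_def by metis
    then show ?thesis using assms(2) by simp
  qed
  have "ennreal \<nu> * (\<integral>\<^sup>+s. W 2 (u s) \<partial>tmeas T) \<le> ennreal r" using assms by (simp add: energy_bounded_def)
  then have "ennreal (1 / \<nu>) * (ennreal \<nu> * (\<integral>\<^sup>+s. W 2 (u s) \<partial>tmeas T)) \<le> ennreal (1 / \<nu>) * ennreal r"
    by (rule mult_left_mono) simp
  then show le: "(\<integral>\<^sup>+s. W 2 (u s) \<partial>tmeas T) \<le> ennreal (r / \<nu>)"
    using nu_pos assms(2) by (simp add: mult.assoc[symmetric] ennreal_mult'[symmetric])
  have "AE s in tmeas T. W 2 (u s) \<noteq> \<infinity>"
    using order_le_less_trans[OF le ennreal_less_top] by (intro nn_integral_PInf_AE) auto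
  then show "AE s in tmeas T. u s \<in> H 2" by eventually_elim (simp add: H_iff_W top.not_eq_extremum)
qed

lemma energy_bounded_add:
  assumes "energy_bounded T u r" "energy_bounded T v s" "r \<ge> 0" "s \<ge> 0"
  shows "energy_bounded T (\<lambda>t. u t + v t) (2 * r + 2 * s)"
  unfolding energy_bounded_def
proof (intro conjI ballI)
  have [measurable]: "u \<in> borel_measurable (tmeas T)" "v \<in> borel_measurable (tmeas T)"
    using assms by (auto simp: energy_bounded_def)
  show "(\<lambda>t. u t + v t) \<in> borel_measurable (tmeas T)" by measurable
  have e: "2 * ennreal r + 2 * ennreal s = ennreal (2 * r + 2 * s)"
    using assms by (simp add: ennreal_mult)
  show "W 1 (u t + v t) \<le> ennreal (2 * r + 2 * s)" if "t \<in> {0..T}" for t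
    unfolding e[symmetric] using assms that unfolding energy_bounded_def
    by (intro order_trans[OF W_add] add_mono mult_left_mono) auto
  have "ennreal \<nu> * (\<integral>\<^sup>+s. W 2 (u s + v s) \<partial>tmeas T)
      \<le> ennreal \<nu> * (\<integral>\<^sup>+s. 2 * W 2 (u s) + 2 * W 2 (v s) \<partial>tmeas T)"
    by (intro mult_left_mono nn_integral_mono W_add) auto
  also have "\<dots> = 2 * (ennreal \<nu> * (\<integral>\<^sup>+s. W 2 (u s) \<partial>tmeas T)) + 2 * (ennreal \<nu> * (\<integral>\<^sup>+s. W 2 (v s) \<partial>tmeas T))"
    by (simp add: nn_integral_add nn_integral_cmult distrib_left mult.left_commute)
  also have "\<dots> \<le> 2 * ennreal r + 2 * ennreal s"
    using assms unfolding energy_bounded_def by (intro add_mono mult_left_mono) auto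
  finally show "ennreal \<nu> * (\<integral>\<^sup>+s. W 2 (u s + v s) \<partial>tmeas T) \<le> ennreal (2 * r + 2 * s)" unfolding e .
qed

lemma energy_bounded_uminus: "energy_bounded T u r \<Longrightarrow> energy_bounded T (\<lambda>t. - u t) r"
  by (simp add: energy_bounded_def W_minus)

lemma energy_bounded_mono: "energy_bounded T u r \<Longrightarrow> r \<le> r' \<Longrightarrow> energy_bounded T u r'"
  unfolding energy_bounded_def by (auto intro: order_trans ennreal_leI)

lemma energy_bounded_lin:
  assumes "lin \<nu> T u F" "(\<integral>\<^sup>+s. ennreal ((norm (F s))\<^sup>2) \<partial>tmeas T) \<le> ennreal \<Phi>" "\<Phi> \<ge> 0" "T \<ge> 0"
  shows "energy_bounded T u (N 1 (u 0) + \<Phi> / \<nu>)"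
proof -
  note h = lin_D(3)[OF assms(1)]
  have "W 1 (u 0) + ennreal (1 / \<nu>) * (\<integral>\<^sup>+s. ennreal ((norm (F s))\<^sup>2) \<partial>tmeas T)
      \<le> ennreal (N 1 (u 0)) + ennreal (1 / \<nu>) * ennreal \<Phi>"
    unfolding W_eq_N[OF h] by (intro add_mono mult_left_mono assms) auto
  also have "\<dots> = ennreal (N 1 (u 0) + \<Phi> / \<nu>)"
    using nu_pos assms(3) N_nonneg[OF h] by (simp add: ennreal_mult'[symmetric])
  finally have "W 1 (u 0) + ennreal (1 / \<nu>) * (\<integral>\<^sup>+s. ennreal ((norm (F s))\<^sup>2) \<partial>tmeas T) \<le> ennreal (N 1 (u 0) + \<Phi> / \<nu>)" .
  note le = order_trans[OF _ this]
  show ?thesis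
    unfolding energy_bounded_def
    using lin_D(6)[OF assms(1)] le[OF lin_estimate_total(1)[OF assms(1) nu_pos]]
      le[OF lin_estimate_total(2)[OF assms(1) nu_pos, of T]] assms(4)
    by auto
qed

lemma nn_integral_affine_W:
  assumes "energy_bounded T u r" "r \<ge> 0" "a \<ge> 0" "b \<ge> 0" "T \<ge> 0"
  shows "(\<integral>\<^sup>+s. ennreal a + ennreal b * W 2 (u s) \<partial>tmeas T) \<le> ennreal (a * T + b * r / \<nu>)"
proof -
  note [measurable] = energy_bounded_D(1)[OF assms(1,2)]
  have "(\<integral>\<^sup>+s. ennreal a + ennreal b * W 2 (u s) \<partial>tmeas T)
      = ennreal a * ennreal T + ennreal b * (\<integral>\<^sup>+s. W 2 (u s) \<partial>tmeas T)"
    by (simp add: nn_integral_add nn_integral_cmult emeasure_tmeas[OF assms(5), simplified])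
  also have "\<dots> \<le> ennreal a * ennreal T + ennreal b * ennreal (r / \<nu>)"
    by (intro add_left_mono mult_left_mono energy_bounded_D(5)[OF assms(1,2)]) auto
  also have "\<dots> = ennreal (a * T + b * r / \<nu>)"
    using assms nu_pos by (simp add: ennreal_mult'[symmetric])
  finally show ?thesis .
qed

lemma forcing_diff_integral:
  assumes C: "\<And>u v. u \<in> H 1 \<Longrightarrow> v \<in> H 2 \<Longrightarrow> (norm (B u v))\<^sup>2 \<le> N 1 u * (\<epsilon> * N 2 v + C * N 1 v)"
    and C0: "C \<ge> 0" "\<epsilon> \<ge> 0" and T: "T \<ge> 0"
    and u: "energy_bounded T u r" and v: "energy_bounded T v s" and w: "energy_bounded T (\<lambda>t. u t - v t) \<rho>" and r: "r \<ge> 0" "s \<ge> 0" "\<rho> \<ge> 0"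
  shows "(\<integral>\<^sup>+t. ennreal ((norm (forcing f u t - forcing f v t))\<^sup>2) \<partial>tmeas T)
    \<le> ennreal (\<rho> * (3 * \<nu>\<^sup>2 * T + 3 * (r + s) * (\<epsilon> / \<nu> + C * T)))"
proof -
  note [measurable] = energy_bounded_D(1)[OF u r(1)] energy_bounded_D(1)[OF v r(2)] energy_bounded_D(1)[OF w r(3)]
  let ?a1 = "3 * \<nu>\<^sup>2 * \<rho> + 3 * C * r * \<rho>" and ?b1 = "3 * \<epsilon> * \<rho>"
  let ?a2 = "3 * C * s * \<rho>" and ?b2 = "3 * \<epsilon> * s"
  have nn: "0 \<le> ?a1" "0 \<le> ?b1" "0 \<le> ?a2" "0 \<le> ?b2" using C0 r by auto
  have "(\<integral>\<^sup>+t. ennreal ((norm (forcing f u t - forcing f v t))\<^sup>2) \<partial>tmeas T)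
    \<le> (\<integral>\<^sup>+t. (ennreal ?a1 + ennreal ?b1 * W 2 (u t)) + (ennreal ?a2 + ennreal ?b2 * W 2 (u t - v t)) \<partial>tmeas T)"
  proof (rule nn_integral_mono_AE, use energy_bounded_D(4)[OF u r(1)] energy_bounded_D(4)[OF v r(2)] AE_space[of "tmeas T"] in eventually_elim)
    case (elim t)
    then have t: "t \<in> {0..T}" by simp
    let ?w = "u t - v t"
    have h: "?w \<in> H 2" using elim by (intro H_diff)
    have b: "N 1 (u t) \<le> r" "N 1 (v t) \<le> s" "N 1 ?w \<le> \<rho>" "0 \<le> N 1 ?w" "0 \<le> N 2 (u t)" "0 \<le> N 2 ?w" "0 \<le> N 1 (v t)" "0 \<le> N 1 (u t)"
      using energy_bounded_D(3)[OF u r(1) t] energy_bounded_D(3)[OF v r(2) t] energy_bounded_D(3)[OF w r(3) t] N_nonneg elim h H21 by auto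
    have "(norm (forcing f u t - forcing f v t))\<^sup>2 \<le> 3 * \<nu>\<^sup>2 * N 1 ?w + 3 * (N 1 ?w * (\<epsilon> * N 2 (u t) + C * N 1 (u t)))
        + 3 * (N 1 (v t) * (\<epsilon> * N 2 ?w + C * N 1 ?w))"
      by (rule forcing_diff_bound[OF C]) (use elim in auto)
    also have "\<dots> \<le> 3 * \<nu>\<^sup>2 * \<rho> + 3 * (\<rho> * (\<epsilon> * N 2 (u t) + C * r)) + 3 * (s * (\<epsilon> * N 2 ?w + C * \<rho>))"
      using b C0 r by (intro add_mono mult_left_mono mult_mono add_nonneg_nonneg mult_nonneg_nonneg) auto
    also have "\<dots> = (?a1 + ?b1 * N 2 (u t)) + (?a2 + ?b2 * N 2 ?w)" by (simp add: algebra_simps)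
    finally have "ennreal ((norm (forcing f u t - forcing f v t))\<^sup>2) \<le> ennreal ((?a1 + ?b1 * N 2 (u t)) + (?a2 + ?b2 * N 2 ?w))"
      by (rule ennreal_leI)
    also have "\<dots> = (ennreal ?a1 + ennreal ?b1 * W 2 (u t)) + (ennreal ?a2 + ennreal ?b2 * W 2 ?w)"
    proof -
      have e: "ennreal (a + b * c) = ennreal a + ennreal b * ennreal c" if "0 \<le> a" "0 \<le> b" "0 \<le> c" for a b c
        using that by (simp add: ennreal_mult)
      show ?thesis using elim h b nn by (simp only: W_eq_N e[symmetric] ennreal_plus[symmetric] add_nonneg_nonneg mult_nonneg_nonneg)
    qed
    finally show ?case .
  qed
  also have "\<dots> = (\<integral>\<^sup>+t. ennreal ?a1 + ennreal ?b1 * W 2 (u t) \<partial>tmeas T) + (\<integral>\<^sup>+t. ennreal ?a2 + ennreal ?b2 * W 2 (u t - v t) \<partial>tmeas T)"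
    by (rule nn_integral_add) measurable
  also have "\<dots> \<le> ennreal (?a1 * T + ?b1 * r / \<nu>) + ennreal (?a2 * T + ?b2 * \<rho> / \<nu>)"
    by (intro add_mono nn_integral_affine_W u w r nn T)
  also have "\<dots> = ennreal ((?a1 * T + ?b1 * r / \<nu>) + (?a2 * T + ?b2 * \<rho> / \<nu>))"
    using nn C0 T r nu_pos by (intro ennreal_plus[symmetric] add_nonneg_nonneg divide_nonneg_nonneg mult_nonneg_nonneg) auto
  also have "(?a1 * T + ?b1 * r / \<nu>) + (?a2 * T + ?b2 * \<rho> / \<nu>) = \<rho> * (3 * \<nu>\<^sup>2 * T + 3 * (r + s) * (\<epsilon> / \<nu> + C * T))"
    using nu_pos by (simp add: field_simps)
  finally show ?thesis .
qed

lemma forcing_integral: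
  assumes C: "\<And>u v. u \<in> H 1 \<Longrightarrow> v \<in> H 2 \<Longrightarrow> (norm (B u v))\<^sup>2 \<le> N 1 u * (\<epsilon> * N 2 v + C * N 1 v)"
    and C0: "C \<ge> 0" "\<epsilon> \<ge> 0" and T: "T \<ge> 0"
    and u: "energy_bounded T u r" and r: "r \<ge> 0"
    and [measurable]: "f \<in> borel_measurable (tmeas T)"
    and f: "(\<integral>\<^sup>+s. ennreal ((norm (f s))\<^sup>2) \<partial>tmeas T) \<le> ennreal \<Phi>" "\<Phi> \<ge> 0"
  shows "(\<integral>\<^sup>+t. ennreal ((norm (forcing f u t))\<^sup>2) \<partial>tmeas T)
    \<le> ennreal (3 * \<Phi> + (3 * \<nu>\<^sup>2 * T * r + 3 * r\<^sup>2 * (\<epsilon> / \<nu> + C * T)))"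
proof -
  note [measurable] = energy_bounded_D(1)[OF u r(1)]
  let ?a = "3 * \<nu>\<^sup>2 * r + 3 * C * r\<^sup>2" and ?b = "3 * \<epsilon> * r"
  have nn: "0 \<le> ?a" "0 \<le> ?b" using C0 r by auto
  have "(\<integral>\<^sup>+t. ennreal ((norm (forcing f u t))\<^sup>2) \<partial>tmeas T)
    \<le> (\<integral>\<^sup>+t. 3 * ennreal ((norm (f t))\<^sup>2) + (ennreal ?a + ennreal ?b * W 2 (u t)) \<partial>tmeas T)"
  proof (rule nn_integral_mono_AE, use energy_bounded_D(4)[OF u r(1)] AE_space[of "tmeas T"] in eventually_elim)
    case (elim t)
    then have t: "t \<in> {0..T}" by simp
    have b: "N 1 (u t) \<le> r" "0 \<le> N 2 (u t)" "0 \<le> N 1 (u t)"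
      using energy_bounded_D(3)[OF u r(1) t] N_nonneg elim H21 by auto
    have "(norm (forcing f u t))\<^sup>2 \<le> 3 * (norm (f t))\<^sup>2 + 3 * \<nu>\<^sup>2 * N 1 (u t) + 3 * (N 1 (u t) * (\<epsilon> * N 2 (u t) + C * N 1 (u t)))"
      by (rule forcing_bound[OF C]) (use elim in auto)
    also have "\<dots> \<le> 3 * (norm (f t))\<^sup>2 + 3 * \<nu>\<^sup>2 * r + 3 * (r * (\<epsilon> * N 2 (u t) + C * r))"
      using b C0 r by (intro add_mono mult_left_mono mult_mono add_nonneg_nonneg mult_nonneg_nonneg) auto
    also have "\<dots> = 3 * (norm (f t))\<^sup>2 + (?a + ?b * N 2 (u t))" by (simp add: algebra_simps power2_eq_square)
    finally have "ennreal ((norm (forcing f u t))\<^sup>2) \<le> ennreal (3 * (norm (f t))\<^sup>2 + (?a + ?b * N 2 (u t)))"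
      by (rule ennreal_leI)
    also have "\<dots> = ennreal (3 * (norm (f t))\<^sup>2) + ennreal (?a + ?b * N 2 (u t))"
      using b nn C0 by (intro ennreal_plus add_nonneg_nonneg mult_nonneg_nonneg) auto
    also have "ennreal (?a + ?b * N 2 (u t)) = ennreal ?a + ennreal ?b * W 2 (u t)"
    proof -
      have e: "ennreal (a + b * c) = ennreal a + ennreal b * ennreal c" if "0 \<le> a" "0 \<le> b" "0 \<le> c" for a b c
        using that by (simp add: ennreal_mult)
      show ?thesis using elim b nn by (simp only: W_eq_N e)
    qed
    also have "ennreal (3 * (norm (f t))\<^sup>2) = 3 * ennreal ((norm (f t))\<^sup>2)" by (simp add: ennreal_mult)
    finally show ?case .
  qed
  also have "\<dots> = (\<integral>\<^sup>+t. 3 * ennreal ((norm (f t))\<^sup>2) \<partial>tmeas T) + (\<integral>\<^sup>+t. ennreal ?a + ennreal ?b * W 2 (u t) \<partial>tmeas T)"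
    by (rule nn_integral_add) measurable
  also have "(\<integral>\<^sup>+t. 3 * ennreal ((norm (f t))\<^sup>2) \<partial>tmeas T) = 3 * (\<integral>\<^sup>+t. ennreal ((norm (f t))\<^sup>2) \<partial>tmeas T)"
    by (rule nn_integral_cmult) measurable
  also have "3 * (\<integral>\<^sup>+t. ennreal ((norm (f t))\<^sup>2) \<partial>tmeas T) + (\<integral>\<^sup>+t. ennreal ?a + ennreal ?b * W 2 (u t) \<partial>tmeas T)
      \<le> 3 * ennreal \<Phi> + ennreal (?a * T + ?b * r / \<nu>)"
    by (intro add_mono mult_left_mono nn_integral_affine_W u r nn T f) simp
  also have "3 * ennreal \<Phi> = ennreal (3 * \<Phi>)" using f by (simp add: ennreal_mult)
  also have "ennreal (3 * \<Phi>) + ennreal (?a * T + ?b * r / \<nu>) = ennreal (3 * \<Phi> + (?a * T + ?b * r / \<nu>))"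
    using nn C0 T r nu_pos f(2) by (intro ennreal_plus[symmetric] add_nonneg_nonneg divide_nonneg_nonneg mult_nonneg_nonneg) auto
  also have "?a * T + ?b * r / \<nu> = 3 * \<nu>\<^sup>2 * T * r + 3 * r\<^sup>2 * (\<epsilon> / \<nu> + C * T)"
    using nu_pos by (simp add: field_simps power2_eq_square)
  finally show ?thesis .
qed

end

context weighted_basis
begin

lemma lin_cong:
  assumes "lin \<nu> T u F" "\<And>t. t \<in> {0<..<T} \<Longrightarrow> F t = G t" "T \<ge> 0"
  shows "lin \<nu> T u G"
  unfolding lin_def
proof (intro conjI allI)
  note D = lin_D[OF assms(1)]
  show "G \<in> borel_measurable (tmeas T)"
    using D(1) by (subst measurable_cong[of _ _ F]) (use assms(2) in auto)
  show "(\<integral>\<^sup>+s. ennreal ((norm (G s))\<^sup>2) \<partial>tmeas T) < \<infinity>"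
    using D(2) by (subst nn_integral_cong[of _ _ "\<lambda>s. ennreal ((norm (F s))\<^sup>2)"]) (use assms(2) in auto)
  show "u 0 \<in> H 1" by (rule D)
  show "ac T (\<lambda>t. u t \<bullet> e n) (\<lambda>s. - (\<nu> * m n) * (u s \<bullet> e n) + G s \<bullet> e n)" for n
    by (rule ac_cong[OF D(4)]) (use assms in auto)
qed

lemma lin_estimate_real:
  assumes l: "lin \<nu> T u F" and \<nu>: "\<nu> > 0" and T: "T \<ge> 0"
  shows "integrable (tmeas T) (\<lambda>s. enn2real (W 2 (u s)))"
    and "t \<in> {0..T} \<Longrightarrow> N 1 (u t) + \<nu> * prim T (\<lambda>s. enn2real (W 2 (u s))) t
      \<le> N 1 (u 0) + (1 / \<nu>) * prim T (\<lambda>s. (norm (F s))\<^sup>2) t"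
proof -
  note D = lin_D[OF l]
  note [measurable] = D(1) D(6)
  have T0: "0 \<in> {0..T}" using T by simp
  have fin: "AE s in tmeas T. W 2 (u s) = ennreal (enn2real (W 2 (u s)))"
    using lin_H1(3)[OF l \<nu> T0] by eventually_elim (simp add: H_iff_W)
  show i: "integrable (tmeas T) (\<lambda>s. enn2real (W 2 (u s)))"
  proof (rule integrableI_bounded)
    have "(\<integral>\<^sup>+s. ennreal (norm (enn2real (W 2 (u s)))) \<partial>tmeas T) = (\<integral>\<^sup>+s. W 2 (u s) \<partial>tmeas T)"
      by (rule nn_integral_cong_AE) (use fin in \<open>eventually_elim, simp\<close>)
    then show "(\<integral>\<^sup>+s. ennreal (norm (enn2real (W 2 (u s)))) \<partial>tmeas T) < \<infinity>"
      using lin_H1(2)[OF l \<nu> T0] by simp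
  qed measurable
  assume t: "t \<in> {0..T}"
  have "(\<integral>\<^sup>+s. W 2 (u s) * indicator {..t} s \<partial>tmeas T) = (\<integral>\<^sup>+s. ennreal (enn2real (W 2 (u s))) * indicator {..t} s \<partial>tmeas T)"
    by (rule nn_integral_cong_AE) (use fin in \<open>eventually_elim, simp\<close>)
  also have "\<dots> = ennreal (prim T (\<lambda>s. enn2real (W 2 (u s))) t)"
    by (rule ennreal_prim[OF i, symmetric]) simp
  finally have W: "(\<integral>\<^sup>+s. W 2 (u s) * indicator {..t} s \<partial>tmeas T) = ennreal (prim T (\<lambda>s. enn2real (W 2 (u s))) t)" .
  have F: "(\<integral>\<^sup>+s. ennreal ((norm (F s))\<^sup>2) * indicator {..t} s \<partial>tmeas T) = ennreal (prim T (\<lambda>s. (norm (F s))\<^sup>2) t)"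
    by (rule ennreal_prim[symmetric]) (use coeff_square_integrable(4)[OF D(1,2)] in auto)
  have h: "u t \<in> H 1" "u 0 \<in> H 1" using lin_H1(1)[OF l \<nu> t] D(3) by auto
  have nn: "0 \<le> prim T (\<lambda>s. enn2real (W 2 (u s))) t" "0 \<le> prim T (\<lambda>s. (norm (F s))\<^sup>2) t"
    "0 \<le> N 1 (u t)" "0 \<le> N 1 (u 0)"
    using h by (auto intro: prim_nonneg N_nonneg)
  have e: "ennreal a + ennreal b * ennreal c = ennreal (a + b * c)" if "0 \<le> a" "0 \<le> b" "0 \<le> c" for a b c
    using that by (simp add: ennreal_mult)
  have "ennreal (N 1 (u t) + \<nu> * prim T (\<lambda>s. enn2real (W 2 (u s))) t)
      \<le> ennreal (N 1 (u 0) + (1 / \<nu>) * prim T (\<lambda>s. (norm (F s))\<^sup>2) t)"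
  proof -
    have "0 \<le> \<nu>" "0 \<le> 1 / \<nu>" using \<nu> by auto
    then show ?thesis
      using lin_estimate[OF l \<nu> t] unfolding W F W_eq_N[OF h(1)] W_eq_N[OF h(2)]
      by (simp only: e nn)
  qed
  then show "N 1 (u t) + \<nu> * prim T (\<lambda>s. enn2real (W 2 (u s))) t
      \<le> N 1 (u 0) + (1 / \<nu>) * prim T (\<lambda>s. (norm (F s))\<^sup>2) t"
    using nn \<nu> by (subst (asm) ennreal_le_iff) auto
qed

end

context quadratic_evolution
begin

lemma energy_bounded_limit:
  assumes x: "\<And>j. energy_bounded T (x j) \<rho>" and lim: "\<And>t. t \<in> {0..T} \<Longrightarrow> (\<lambda>j. x j t) \<longlonglongrightarrow> y t"
  shows "energy_bounded T y \<rho>"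
  unfolding energy_bounded_def
proof (intro conjI ballI)
  have [measurable]: "x j \<in> borel_measurable (tmeas T)" for j using x by (simp add: energy_bounded_def)
  show "y \<in> borel_measurable (tmeas T)"
    by (rule borel_measurable_LIMSEQ_metric[of x]) (use lim in auto)
  have c: "W s (y t) \<le> liminf (\<lambda>j. W s (x j t))" if "t \<in> {0..T}" for t s
    by (intro W_liminf tendsto_inner lim[OF that] tendsto_const)
  have le: "liminf a \<le> c" if "\<And>j::nat. a j \<le> c" for a :: "nat \<Rightarrow> ennreal" and c
    using that by (intro Liminf_le always_eventually allI) auto
  show "W 1 (y t) \<le> ennreal \<rho>" if "t \<in> {0..T}" for t
    using x that unfolding energy_bounded_def by (intro order_trans[OF c[OF that]] le) auto
  have "ennreal \<nu> * (\<integral>\<^sup>+s. W 2 (y s) \<partial>tmeas T) \<le> (\<integral>\<^sup>+s. liminf (\<lambda>j. ennreal \<nu> * W 2 (x j s)) \<partial>tmeas T)"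
  proof -
    have [measurable]: "y \<in> borel_measurable (tmeas T)" by fact
    have "ennreal \<nu> * (\<integral>\<^sup>+s. W 2 (y s) \<partial>tmeas T) = (\<integral>\<^sup>+s. ennreal \<nu> * W 2 (y s) \<partial>tmeas T)"
      by (rule nn_integral_cmult[symmetric]) measurable
    also have "\<dots> \<le> (\<integral>\<^sup>+s. liminf (\<lambda>j. ennreal \<nu> * W 2 (x j s)) \<partial>tmeas T)"
    proof (rule nn_integral_mono)
      fix s assume "s \<in> space (tmeas T)"
      then have "s \<in> {0..T}" by simp
      then have l: "(\<lambda>j. sqrt \<nu> *\<^sub>R x j s) \<longlonglongrightarrow> sqrt \<nu> *\<^sub>R y s" by (intro tendsto_intros lim)
      have "W 2 (sqrt \<nu> *\<^sub>R y s) \<le> liminf (\<lambda>j. W 2 (sqrt \<nu> *\<^sub>R x j s))"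
        by (intro W_liminf tendsto_inner l tendsto_const)
      then show "ennreal \<nu> * W 2 (y s) \<le> liminf (\<lambda>j. ennreal \<nu> * W 2 (x j s))"
        using nu_pos by (simp add: W_scaleR)
    qed
    finally show ?thesis .
  qed
  also have "\<dots> \<le> liminf (\<lambda>j. \<integral>\<^sup>+s. ennreal \<nu> * W 2 (x j s) \<partial>tmeas T)"
    by (rule nn_integral_liminf) measurable
  also have "\<dots> \<le> ennreal \<rho>"
  proof (rule le)
    fix j
    have "(\<integral>\<^sup>+s. ennreal \<nu> * W 2 (x j s) \<partial>tmeas T) = ennreal \<nu> * (\<integral>\<^sup>+s. W 2 (x j s) \<partial>tmeas T)"
      by (rule nn_integral_cmult) measurable
    then show "(\<integral>\<^sup>+s. ennreal \<nu> * W 2 (x j s) \<partial>tmeas T) \<le> ennreal \<rho>"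
      using x[of j] by (simp add: energy_bounded_def)
  qed
  finally show "ennreal \<nu> * (\<integral>\<^sup>+s. W 2 (y s) \<partial>tmeas T) \<le> ennreal \<rho>" .
qed

lemma energy_bounded_contraction:
  assumes C: "\<And>u v. u \<in> H 1 \<Longrightarrow> v \<in> H 2 \<Longrightarrow> (norm (B u v))\<^sup>2 \<le> N 1 u * (\<epsilon> * N 2 v + C * N 1 v)"
    and C0: "C \<ge> 0" "\<epsilon> \<ge> 0" and T: "T \<ge> 0"
    and u: "energy_bounded T u r" and v: "energy_bounded T v s" and w: "energy_bounded T (\<lambda>t. u t - v t) \<rho>" and r: "r \<ge> 0" "s \<ge> 0" "\<rho> \<ge> 0"
    and a: "lin \<nu> T a (forcing f u)" and b: "lin \<nu> T b (forcing f v)" and ab: "a 0 = b 0"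
  shows "energy_bounded T (\<lambda>t. a t - b t) (\<rho> * ((3 * \<nu>\<^sup>2 * T + 3 * (r + s) * (\<epsilon> / \<nu> + C * T)) / \<nu>))"
proof -
  have "0 \<le> \<rho> * (3 * \<nu>\<^sup>2 * T + 3 * (r + s) * (\<epsilon> / \<nu> + C * T))"
    using C0 T r nu_pos by (intro mult_nonneg_nonneg add_nonneg_nonneg divide_nonneg_nonneg) auto
  from energy_bounded_lin[OF lin_diff[OF a b] forcing_diff_integral[OF C C0 T u v w r] this T]
  show ?thesis using ab by (simp add: N_def)
qed

lemma sol_exists:
  assumes fm: "f \<in> borel_measurable (tmeas T')" and fi: "(\<integral>\<^sup>+s. ennreal ((norm (f s))\<^sup>2) \<partial>tmeas T') < \<infinity>"
    and T': "T' > 0" and u0: "u0 \<in> H 1"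
  shows "\<exists>T u. 0 < T \<and> T < T' \<and> u 0 = u0 \<and> sol T f u"
proof -
  define \<Phi> where "\<Phi> = enn2real (\<integral>\<^sup>+s. ennreal ((norm (f s))\<^sup>2) \<partial>tmeas T')"
  have \<Phi>: "(\<integral>\<^sup>+s. ennreal ((norm (f s))\<^sup>2) \<partial>tmeas T') = ennreal \<Phi>" "\<Phi> \<ge> 0" using fi by (auto simp: \<Phi>_def)
  define r where "r = N 1 u0 + 3 * \<Phi> / \<nu> + 1"
  have r: "r \<ge> 1" using N_nonneg[OF u0] \<Phi> nu_pos by (simp add: r_def)
  then have r0: "r \<ge> 0" "r > 0" by auto
  define \<theta> where "\<theta> = \<nu> / (48 * r\<^sup>2)"
  have \<theta>: "\<theta> > 0" using nu_pos r by (simp add: \<theta>_def)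
  define \<epsilon> where "\<epsilon> = \<nu> * \<theta> / 2"
  have \<epsilon>: "\<epsilon> > 0" using nu_pos \<theta> by (simp add: \<epsilon>_def)
  obtain C where C0: "C \<ge> 0" and C: "\<And>u v. u \<in> H 1 \<Longrightarrow> v \<in> H 2 \<Longrightarrow> (norm (B u v))\<^sup>2 \<le> N 1 u * (\<epsilon> * N 2 v + C * N 1 v)"
    using B_bound[OF \<epsilon>] by blast
  define T where "T = Min {T' / 2, 1 / (24 * \<nu> * r), \<theta> / (2 * (C + 1))}"
  have T: "T > 0" using T' nu_pos r0 \<theta> C0 by (simp add: T_def)
  then have T0: "T \<ge> 0" by simp
  have T1: "T \<le> T' / 2" "T \<le> 1 / (24 * \<nu> * r)" "T \<le> \<theta> / (2 * (C + 1))"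
    unfolding T_def by (rule Min_le; simp)+
  have TT': "T < T'" "T \<le> T'" using T1(1) T' by auto
  have fmT: "f \<in> borel_measurable (tmeas T)" by (rule tmeas_mono(1)[OF TT'(2) fm])
  have fiT: "(\<integral>\<^sup>+s. ennreal ((norm (f s))\<^sup>2) \<partial>tmeas T) \<le> ennreal \<Phi>"
    using tmeas_mono(2)[OF TT'(2)] \<Phi>(1) by metis
  have CT: "\<epsilon> / \<nu> + C * T \<le> \<theta>"
  proof -
    have "C * T \<le> (C + 1) * (\<theta> / (2 * (C + 1)))" using T1(3) C0 T by (intro mult_mono) auto
    also have "\<dots> = \<theta> / 2"
    proof -
      have "c * (\<theta> / (2 * c)) = \<theta> / 2" if "c > 0" for c :: real using that by simp
      from this[of "C + 1"] show ?thesis using C0 by linarith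
    qed
    finally show ?thesis using nu_pos by (simp add: \<epsilon>_def)
  qed
  have \<nu>T: "\<nu> * T * r \<le> 1 / 24"
    using T1(2) nu_pos r0 by (simp add: field_simps)
  have \<nu>T': "\<nu> * T \<le> 1 / 24"
  proof -
    have "\<nu> * T * 1 \<le> \<nu> * T * r" using r nu_pos T by (intro mult_left_mono) auto
    then show ?thesis using \<nu>T by simp
  qed
  have \<theta>r: "r\<^sup>2 * \<theta> = \<nu> / 48" using r0 by (simp add: \<theta>_def)
  have X: "(3 * \<nu>\<^sup>2 * T * r + 3 * r\<^sup>2 * (\<epsilon> / \<nu> + C * T)) / \<nu> \<le> 1"
  proof -
    have "3 * \<nu>\<^sup>2 * T * r = \<nu> * (3 * (\<nu> * T * r))" by (simp add: power2_eq_square)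
    also have "\<dots> \<le> \<nu> * (3 * (1 / 24))" using \<nu>T nu_pos by (intro mult_left_mono) auto
    finally have 1: "3 * \<nu>\<^sup>2 * T * r \<le> \<nu> / 8" by simp
    have "3 * r\<^sup>2 * (\<epsilon> / \<nu> + C * T) \<le> 3 * r\<^sup>2 * \<theta>" using CT by (intro mult_left_mono) auto
    also have "\<dots> = \<nu> / 16" using \<theta>r by simp
    finally show ?thesis using 1 nu_pos by (simp add: divide_le_eq)
  qed
  have K: "(3 * \<nu>\<^sup>2 * T + 3 * (r + r) * (\<epsilon> / \<nu> + C * T)) / \<nu> \<le> 1 / 4"
  proof -
    have "3 * \<nu>\<^sup>2 * T = \<nu> * (3 * (\<nu> * T))" by (simp add: power2_eq_square)
    also have "\<dots> \<le> \<nu> * (3 * (1 / 24))" using \<nu>T' nu_pos by (intro mult_left_mono) auto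
    finally have 1: "3 * \<nu>\<^sup>2 * T \<le> \<nu> / 8" by simp
    have "3 * (r + r) * (\<epsilon> / \<nu> + C * T) \<le> 6 * (r * \<theta>)" using CT r0 mult_left_mono[OF CT, of "3 * (r + r)"] by simp
    also have "r * \<theta> \<le> r * (r * \<theta>)" using mult_right_mono[OF r, of "r * \<theta>"] r0 \<theta> by simp
    also have "r * (r * \<theta>) = \<nu> / 48" using \<theta>r by (simp add: power2_eq_square)
    finally have "3 * (r + r) * (\<epsilon> / \<nu> + C * T) \<le> \<nu> / 8" by simp
    then show ?thesis using 1 nu_pos by (simp add: divide_le_eq)
  qed
  have step: "\<exists>v. v 0 = u0 \<and> lin \<nu> T v (forcing f u) \<and> energy_bounded T v r" if u: "energy_bounded T u r" for u
  proof -
    let ?X = "3 * \<nu>\<^sup>2 * T * r + 3 * r\<^sup>2 * (\<epsilon> / \<nu> + C * T)"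
    note int = forcing_integral[OF C C0 less_imp_le[OF \<epsilon>] T0 u r0(1) fmT fiT \<Phi>(2)]
    have X0: "0 \<le> ?X"
      using nu_pos \<epsilon> C0 T0 r0 by (intro mult_nonneg_nonneg add_nonneg_nonneg divide_nonneg_nonneg) auto
    obtain v where v: "v 0 = u0" "lin \<nu> T v (forcing f u)"
      using lin_exists[OF borel_measurable_forcing[OF fmT energy_bounded_D(1)[OF u r0(1)]]
          order_le_less_trans[OF int] u0 nu_pos T0] by auto
    have "energy_bounded T v (N 1 (v 0) + (3 * \<Phi> + ?X) / \<nu>)"
      by (rule energy_bounded_lin[OF v(2) int _ T0]) (use X0 \<Phi> in auto)
    moreover have "N 1 (v 0) + (3 * \<Phi> + ?X) / \<nu> \<le> r"
      using X by (simp add: v(1) r_def add_divide_distrib)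
    ultimately show ?thesis using v energy_bounded_mono by blast
  qed
  define S where "S u = (SOME v. v 0 = u0 \<and> lin \<nu> T v (forcing f u) \<and> energy_bounded T v r)" for u
  have S: "S u 0 = u0" "lin \<nu> T (S u) (forcing f u)" "energy_bounded T (S u) r" if "energy_bounded T u r" for u
    using someI_ex[OF step[OF that]] unfolding S_def by auto
  define V where "V k = (S ^^ Suc k) (\<lambda>_. 0)" for k
  have z: "energy_bounded T (\<lambda>_. 0) r" by (simp add: energy_bounded_def)
  have Vr: "energy_bounded T (V k) r" and V0: "V k 0 = u0" for k
  proof -
    have "energy_bounded T ((S ^^ j) (\<lambda>_. 0)) r" for j by (induction j) (auto simp: z S)
    then show "energy_bounded T (V k) r" "V k 0 = u0" by (auto simp: V_def S)
  qed
  have Vl: "lin \<nu> T (V (Suc k)) (forcing f (V k))" for k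
    using S(2)[OF Vr[of k]] by (simp add: V_def)
  have d1: "energy_bounded T (\<lambda>t. V (Suc k) t - V k t) (4 * r / 4 ^ k)" for k
  proof (induction k)
    case 0
    show ?case using energy_bounded_add[OF Vr[of 1] energy_bounded_uminus[OF Vr[of 0]] r0(1) r0(1)] by (simp add: One_nat_def)
  next
    case (Suc k)
    have "energy_bounded T (\<lambda>t. V (Suc (Suc k)) t - V (Suc k) t)
        (4 * r / 4 ^ k * ((3 * \<nu>\<^sup>2 * T + 3 * (r + r) * (\<epsilon> / \<nu> + C * T)) / \<nu>))"
      by (rule energy_bounded_contraction[OF C C0 less_imp_le[OF \<epsilon>] T0 Vr Vr Suc.IH r0(1) r0(1) _ Vl Vl])
         (use r0 V0 in auto)
    moreover have "4 * r / 4 ^ k * ((3 * \<nu>\<^sup>2 * T + 3 * (r + r) * (\<epsilon> / \<nu> + C * T)) / \<nu>) \<le> 4 * r / 4 ^ k * (1 / 4)"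
      using r0 by (intro mult_left_mono K) auto
    ultimately show ?case by (auto elim!: energy_bounded_mono)
  qed
  have d2: "energy_bounded T (\<lambda>t. V (k + j) t - V k t) (16 * r / 4 ^ k)" for k j
  proof (induction j arbitrary: k)
    case 0
    show ?case using r0 by (simp add: energy_bounded_def)
  next
    case (Suc j)
    have "energy_bounded T (\<lambda>t. (V (Suc k) t - V k t) + (V (Suc k + j) t - V (Suc k) t)) (2 * (4 * r / 4 ^ k) + 2 * (16 * r / 4 ^ Suc k))"
      by (rule energy_bounded_add[OF d1 Suc.IH]) (use r0 in auto)
    then show ?case by simp
  qed
  have to0: "(\<lambda>k. c / 4 ^ k) \<longlonglongrightarrow> (0::real)" for c
    by (rule LIMSEQ_divide_realpow_zero) simp
  have conv: "convergent (\<lambda>k. V k t)" if t: "t \<in> {0..T}" for t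
  proof (intro Cauchy_convergent CauchyI')
    fix e :: real assume e: "e > 0"
    have "\<forall>\<^sub>F k in sequentially. 16 * r / 4 ^ k < e\<^sup>2"
      by (rule order_tendstoD(2)[OF to0]) (use e in simp)
    then obtain k0 where k0: "\<And>k. k \<ge> k0 \<Longrightarrow> 16 * r / 4 ^ k < e\<^sup>2" by (auto simp: eventually_sequentially)
    have "dist (V k t) (V l t) < e" if kl: "k \<ge> k0" "l > k" for k l
    proof -
      have *: "energy_bounded T (\<lambda>t. V l t - V k t) (16 * r / 4 ^ k)" using d2[of k "l - k"] kl by simp
      have nn: "0 \<le> 16 * r / 4 ^ k" using r0 by simp
      have "(norm (V l t - V k t))\<^sup>2 \<le> N 1 (V l t - V k t)" by (rule norm_le_N[OF energy_bounded_D(2)[OF * nn t]])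
      also have "\<dots> \<le> 16 * r / 4 ^ k" by (rule energy_bounded_D(3)[OF * nn t])
      also have "\<dots> < e\<^sup>2" by (rule k0[OF kl(1)])
      finally have "norm (V l t - V k t) < e" using e by (simp add: power2_less_imp_less)
      then show ?thesis by (simp add: dist_norm norm_minus_commute)
    qed
    then show "\<exists>M. \<forall>k\<ge>M. \<forall>l>k. dist (V k t) (V l t) < e" by blast
  qed
  define u where "u t = lim (\<lambda>k. V k t)" for t
  have lim: "(\<lambda>k. V k t) \<longlonglongrightarrow> u t" if "t \<in> {0..T}" for t
    using conv[OF that] unfolding u_def by (simp add: convergent_LIMSEQ_iff)
  have uV: "energy_bounded T (\<lambda>t. u t - V k t) (16 * r / 4 ^ k)" for k
  proof (rule energy_bounded_limit[OF d2])
    fix t assume t: "t \<in> {0..T}"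
    have "(\<lambda>j. V (j + k) t) \<longlonglongrightarrow> u t" by (rule LIMSEQ_ignore_initial_segment[OF lim[OF t]])
    then show "(\<lambda>j. V (k + j) t - V k t) \<longlonglongrightarrow> u t - V k t"
      by (intro tendsto_intros) (simp add: add.commute)
  qed
  have ur: "energy_bounded T u (34 * r)"
  proof -
    have "energy_bounded T (\<lambda>t. (u t - V 0 t) + V 0 t) (2 * (16 * r / 4 ^ 0) + 2 * r)"
      by (rule energy_bounded_add[OF uV Vr]) (use r0 in auto)
    then show ?thesis by (simp add: algebra_simps)
  qed
  have r34: "34 * r \<ge> 0" using r0 by simp
  note int = forcing_integral[OF C C0 less_imp_le[OF \<epsilon>] T0 ur r34 fmT fiT \<Phi>(2)]
  obtain v where v: "v 0 = u0" "lin \<nu> T v (forcing f u)"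
    using lin_exists[OF borel_measurable_forcing[OF fmT energy_bounded_D(1)[OF ur r34]]
          order_le_less_trans[OF int] u0 nu_pos T0] by auto
  let ?k = "(3 * \<nu>\<^sup>2 * T + 3 * (34 * r + r) * (\<epsilon> / \<nu> + C * T)) / \<nu>"
  have vV: "energy_bounded T (\<lambda>t. v t - V (Suc k) t) (16 * r / 4 ^ k * ?k)" for k
    by (rule energy_bounded_contraction[OF C C0 less_imp_le[OF \<epsilon>] T0 ur Vr uV r34 r0(1) _ v(2) Vl])
       (use r0 V0 v in auto)
  have k0: "?k \<ge> 0"
    using nu_pos \<epsilon> C0 T0 r0 by (intro mult_nonneg_nonneg add_nonneg_nonneg divide_nonneg_nonneg) auto
  have vu: "v t = u t" if t: "t \<in> {0..T}" for t
  proof -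
    have "(norm (v t - V (Suc k) t))\<^sup>2 \<le> (16 * r * ?k) / 4 ^ k" for k
    proof -
      have nn: "0 \<le> 16 * r / 4 ^ k * ?k" using r0 k0 by (intro mult_nonneg_nonneg) auto
      show ?thesis
        using order_trans[OF norm_le_N[OF energy_bounded_D(2)[OF vV nn t]] energy_bounded_D(3)[OF vV nn t]]
        by (simp only: times_divide_eq_left)
    qed
    note le = this
    have "(\<lambda>k. (norm (v t - V (Suc k) t))\<^sup>2) \<longlonglongrightarrow> 0"
      by (rule Lim_null_comparison[OF _ to0[of "16 * r * ?k"]]) (use le in simp)
    moreover have "(\<lambda>k. (norm (v t - V (Suc k) t))\<^sup>2) \<longlonglongrightarrow> (norm (v t - u t))\<^sup>2"
      by (intro tendsto_intros LIMSEQ_Suc lim t)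
    ultimately have "(norm (v t - u t))\<^sup>2 = 0" by (intro LIMSEQ_unique)
    then show ?thesis by simp
  qed
  have "lin \<nu> T v (forcing f v)"
    by (rule lin_cong[OF v(2) _ T0]) (simp add: forcing_def vu)
  then show ?thesis using T TT' v(1) unfolding sol_def by blast
qed

text \<open>The difference \<open>w\<close> satisfies a linear Gronwall estimate as long as \<open>N 1 w \<le> 1\<close>, which absorbs the
  terms that are quadratic in \<open>w\<close>; a first-time argument shows that this bound is never left.\<close>

lemma sol_dependence:
  assumes u: "sol T f u" and T: "T > 0"
  shows "\<exists>K d. 0 < d \<and> 0 \<le> K \<and> (\<forall>v. sol T f v \<longrightarrow> N 1 (u 0 - v 0) < d \<longrightarrow>
    (\<forall>t\<in>{0..T}. N 1 (u t - v t) \<le> K * N 1 (u 0 - v 0)) \<and>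
    (\<integral>s. enn2real (W 2 (u s - v s)) \<partial>tmeas T) \<le> K * N 1 (u 0 - v 0))"
proof -
  have T0: "T \<ge> 0" using T by simp
  have lu: "lin \<nu> T u (forcing f u)" using u by (simp add: sol_def)
  have "continuous_on {0..T} (\<lambda>t. N 1 (u t))"
    using lin_N_continuous[OF lu nu_pos T0 H_zero] by simp
  then obtain R where "\<And>t. t \<in> {0..T} \<Longrightarrow> \<bar>N 1 (u t)\<bar> \<le> R" using continuous_on_bounded_interval by blast
  then have R: "N 1 (u t) \<le> R" if "t \<in> {0..T}" for t using that by (meson abs_le_D1)
  have R0: "R \<ge> 0" using R[of 0] N_nonneg[OF lin_D(3)[OF lu]] T by (meson T0 atLeastAtMost_iff order_refl order_trans)
  define \<epsilon> where "\<epsilon> = \<nu>\<^sup>2 / (12 * (R + 1))"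
  have \<epsilon>: "\<epsilon> > 0" using nu_pos R0 by (simp add: \<epsilon>_def)
  obtain C where C0: "C \<ge> 0" and C: "\<And>u v. u \<in> H 1 \<Longrightarrow> v \<in> H 2 \<Longrightarrow> (norm (B u v))\<^sup>2 \<le> N 1 u * (\<epsilon> * N 2 v + C * N 1 v)"
    using B_bound[OF \<epsilon>] by blast
  define \<alpha> where "\<alpha> s = (1 / \<nu>) * (3 * \<nu>\<^sup>2 + 3 * \<epsilon> * enn2real (W 2 (u s)) + 3 * C * R + 6 * (R + 1) * C)" for s
  have \<alpha>i: "integrable (tmeas T) \<alpha>"
    unfolding \<alpha>_def[abs_def] using lin_estimate_real(1)[OF lu nu_pos T0]
    by (intro integrable_mult_right Bochner_Integration.integrable_add) auto
  have \<alpha>0: "0 \<le> \<alpha> s" for s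
    unfolding \<alpha>_def using nu_pos \<epsilon> C0 R0 by (intro mult_nonneg_nonneg add_nonneg_nonneg) auto
  define A where "A = (\<integral>s. \<alpha> s \<partial>tmeas T)"
  have A0: "A \<ge> 0" unfolding A_def using \<alpha>0 by (intro integral_nonneg_AE) auto
  define G where "G = exp A"
  have G: "G \<ge> 1" using A0 by (simp add: G_def)
  have main: "(\<forall>t\<in>{0..T}. N 1 (u t - v t) \<le> (G + (2 / \<nu>) * (1 + A * G)) * N 1 (u 0 - v 0)) \<and>
      (\<integral>s. enn2real (W 2 (u s - v s)) \<partial>tmeas T) \<le> (G + (2 / \<nu>) * (1 + A * G)) * N 1 (u 0 - v 0)"
    if v: "sol T f v" and d: "N 1 (u 0 - v 0) < 1 / (2 * G)" for v
  proof -
    have lv: "lin \<nu> T v (forcing f v)" using v by (simp add: sol_def)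
    note lw = lin_diff[OF lu lv]
    define y where "y t = N 1 (u t - v t)" for t
    define n2 where "n2 s = enn2real (W 2 (u s - v s))" for s
    have yc: "continuous_on {0..T} y"
      using lin_N_continuous[OF lw nu_pos T0 H_zero] by (simp add: y_def[abs_def])
    have hw: "u t - v t \<in> H 1" if "t \<in> {0..T}" for t by (rule lin_H1(1)[OF lw nu_pos that])
    have y0: "0 \<le> y t" if "t \<in> {0..T}" for t unfolding y_def by (rule N_nonneg[OF hw[OF that]])
    have y00: "0 \<le> y 0" using y0 T by simp
    note n2i = lin_estimate_real(1)[OF lw nu_pos T0, folded n2_def]
    obtain Y where Y: "\<And>s. s \<in> {0..T} \<Longrightarrow> \<bar>y s\<bar> \<le> Y" using continuous_on_bounded_interval[OF yc] by blast
    have \<alpha>y: "integrable (tmeas T) (\<lambda>s. \<alpha> s * y s)"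
      by (rule integrable_mult_bounded(2)[OF \<alpha>i continuous_on_tmeas_measurable[OF yc], of Y]) (use Y in auto)
    let ?F = "\<lambda>s. (norm (forcing f u s - forcing f v s))\<^sup>2"
    have Fi: "integrable (tmeas T) ?F" by (rule coeff_square_integrable(4)[OF lin_D(1,2)[OF lw]])
    have ineq: "y t + (\<nu> / 2) * prim T n2 t \<le> y 0 + prim T (\<lambda>s. \<alpha> s * y s) t"
      if t: "t \<in> {0..T}" and small: "\<And>s. s \<in> {0..<t} \<Longrightarrow> y s \<le> 1" for t
    proof -
      have "prim T ?F t \<le> prim T (\<lambda>s. \<nu> * (\<alpha> s * y s) + (\<nu>\<^sup>2 / 2) * n2 s) t"
      proof (rule prim_mono[OF Fi])
        show "integrable (tmeas T) (\<lambda>s. \<nu> * (\<alpha> s * y s) + (\<nu>\<^sup>2 / 2) * n2 s)"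
          using \<alpha>y n2i by simp
        show "AE s in tmeas T. s < t \<longrightarrow> ?F s \<le> \<nu> * (\<alpha> s * y s) + (\<nu>\<^sup>2 / 2) * n2 s"
          using lin_H1(3)[OF lu nu_pos t] lin_H1(3)[OF lv nu_pos t] AE_space[of "tmeas T"]
        proof eventually_elim
          case (elim s)
          show ?case
          proof
            assume "s < t"
            then have s: "s \<in> {0..T}" "s \<in> {0..<t}" using elim by auto
            let ?w = "u s - v s"
            have h2: "?w \<in> H 2" using elim by (intro H_diff)
            have n2s: "n2 s = N 2 ?w" and nu: "enn2real (W 2 (u s)) = N 2 (u s)"
              using h2 elim by (simp_all add: n2_def W_eq_N N_nonneg)
            have nv: "N 1 (v s) \<le> 2 * R + 2"
            proof -
              have "N 1 (u s - ?w) \<le> 2 * N 1 (u s) + 2 * N 1 ?w" using elim h2 by (intro N_diff H21)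
              then show ?thesis using R[OF s(1)] small[OF s(2)] by (simp add: y_def)
            qed
            have nn: "0 \<le> N 2 ?w" "0 \<le> N 1 ?w" "0 \<le> N 2 (u s)" "0 \<le> N 1 (u s)"
              using h2 elim by (auto intro: N_nonneg H21)
            have "?F s \<le> 3 * \<nu>\<^sup>2 * N 1 ?w + 3 * (N 1 ?w * (\<epsilon> * N 2 (u s) + C * N 1 (u s)))
                + 3 * (N 1 (v s) * (\<epsilon> * N 2 ?w + C * N 1 ?w))"
              by (rule forcing_diff_bound[OF C]) (use elim in auto)
            also have "\<dots> \<le> 3 * \<nu>\<^sup>2 * N 1 ?w + 3 * (N 1 ?w * (\<epsilon> * N 2 (u s) + C * R))
                + 3 * ((2 * R + 2) * (\<epsilon> * N 2 ?w + C * N 1 ?w))"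
              using R[OF s(1)] nv nn C0 \<epsilon> by (intro add_mono mult_left_mono mult_right_mono order_refl add_nonneg_nonneg mult_nonneg_nonneg) auto
            also have "\<dots> = \<nu> * (\<alpha> s * N 1 ?w) + 6 * ((R + 1) * \<epsilon>) * N 2 ?w"
              using nu_pos unfolding \<alpha>_def nu by (simp add: algebra_simps)
            also have "(R + 1) * \<epsilon> = \<nu>\<^sup>2 / 12"
            proof -
              have "c * (\<nu>\<^sup>2 / (12 * c)) = \<nu>\<^sup>2 / 12" if "c > 0" for c :: real using that by simp
              from this[of "R + 1"] show ?thesis using R0 unfolding \<epsilon>_def by linarith
            qed
            finally show "?F s \<le> \<nu> * (\<alpha> s * y s) + (\<nu>\<^sup>2 / 2) * n2 s" by (simp add: y_def n2s)
          qed
        qed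
      qed
      also have "\<dots> = \<nu> * prim T (\<lambda>s. \<alpha> s * y s) t + (\<nu>\<^sup>2 / 2) * prim T n2 t"
        unfolding prim_add[OF integrable_mult_right[OF \<alpha>y] integrable_mult_right[OF n2i]] prim_cmult ..
      finally have "(1 / \<nu>) * prim T ?F t \<le> (1 / \<nu>) * (\<nu> * prim T (\<lambda>s. \<alpha> s * y s) t + (\<nu>\<^sup>2 / 2) * prim T n2 t)"
        using nu_pos by (intro mult_left_mono) auto
      also have "\<dots> = prim T (\<lambda>s. \<alpha> s * y s) t + (\<nu> / 2) * prim T n2 t"
        using nu_pos by (simp add: field_simps power2_eq_square)
      finally show ?thesis
        using lin_estimate_real(2)[OF lw nu_pos T0 t] unfolding y_def n2_def by linarith
    qed
    have gron: "y t \<le> y 0 * G" if S: "S \<in> {0..T}" "\<And>s. s \<in> {0..<S} \<Longrightarrow> y s \<le> 1" and t: "t \<in> {0..S}" for t S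
    proof -
      have "y t \<le> y 0 * exp (prim T \<alpha> t)"
      proof (rule gronwall_prim[OF \<alpha>i \<alpha>0 yc S(1) y00 _ t])
        fix t assume t: "t \<in> {0..S}"
        have "0 \<le> prim T n2 t" by (rule prim_nonneg) (simp add: n2_def)
        then have "0 \<le> (\<nu> / 2) * prim T n2 t" using nu_pos by simp
        then show "y t \<le> y 0 + prim T (\<lambda>s. \<alpha> s * y s) t"
          using ineq[of t] S t by (force simp: )
      qed
      also have "\<dots> \<le> y 0 * G"
        unfolding G_def A_def using y00 by (intro mult_left_mono) (auto intro: prim_le_total[OF \<alpha>i \<alpha>0])
      finally show ?thesis .
    qed
    have yG: "y 0 * G < 1"
    proof -
      have "y 0 * G \<le> 1 / (2 * G) * G" using d G by (intro mult_right_mono) (auto simp: y_def)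
      also have "\<dots> < 1" using G by simp
      finally show ?thesis .
    qed
    have lt1: "y t < 1" if "t \<in> {0..T}" for t
    proof (rule ccontr)
      assume "\<not> y t < 1"
      let ?S = "{0..T} \<inter> y -` {1..}"
      have ne: "?S \<noteq> {}" using that \<open>\<not> y t < 1\<close> by auto
      have "closed ?S" by (rule continuous_closed_preimage[OF yc]) auto
      then have "compact ?S"
        unfolding compact_eq_bounded_closed by (auto intro: bounded_subset[of "{0..T}"])
      then obtain S where S: "S \<in> ?S" "\<And>s. s \<in> ?S \<Longrightarrow> S \<le> s"
        using compact_attains_inf[OF _ ne] by blast
      have "y s \<le> 1" if "s \<in> {0..<S}" for s
        using S that by (force simp: not_le)
      then have "y S \<le> y 0 * G" using gron[of S S] S by auto
      then show False using yG S by simp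
    qed
    have yt: "y t \<le> y 0 * G" if "t \<in> {0..T}" for t
      by (rule gron[of T]) (use lt1 less_imp_le that T0 in auto)
    have "(\<nu> / 2) * prim T n2 T \<le> y 0 + prim T (\<lambda>s. \<alpha> s * y s) T"
    proof -
      have "y s \<le> 1" if "s \<in> {0..<T}" for s using lt1[of s] that by simp
      then have "y T + (\<nu> / 2) * prim T n2 T \<le> y 0 + prim T (\<lambda>s. \<alpha> s * y s) T"
        by (intro ineq) (use T0 in auto)
      then show ?thesis using y0[of T] T0 by simp
    qed
    also have "prim T (\<lambda>s. \<alpha> s * y s) T \<le> prim T (\<lambda>s. (y 0 * G) * \<alpha> s) T"
      by (rule prim_mono[OF \<alpha>y integrable_mult_right[OF \<alpha>i]], intro AE_I2 impI, subst mult.commute, rule mult_right_mono)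
         (use yt \<alpha>0 in auto)
    also have "\<dots> = (y 0 * G) * A" unfolding prim_cmult by (simp add: prim_total A_def)
    finally have "prim T n2 T \<le> (2 / \<nu>) * (y 0 + (y 0 * G) * A)" using nu_pos by (simp add: field_simps)
    also have "\<dots> = (2 / \<nu>) * (1 + A * G) * y 0" by (simp add: algebra_simps add_divide_distrib)
    also have "\<dots> \<le> (G + (2 / \<nu>) * (1 + A * G)) * y 0" using G y00 by (intro mult_right_mono) auto
    finally have "(\<integral>s. n2 s \<partial>tmeas T) \<le> (G + (2 / \<nu>) * (1 + A * G)) * y 0" by (simp add: prim_total)
    moreover have "y t \<le> (G + (2 / \<nu>) * (1 + A * G)) * y 0" if "t \<in> {0..T}" for t
    proof -
      have "G * y 0 \<le> (G + (2 / \<nu>) * (1 + A * G)) * y 0"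
        using nu_pos A0 G y00 by (intro mult_right_mono) auto
      then show ?thesis using yt[OF that] by (simp add: mult.commute)
    qed
    ultimately show ?thesis unfolding y_def n2_def by blast
  qed
  have "0 < 1 / (2 * G)" "0 \<le> G + (2 / \<nu>) * (1 + A * G)" using G A0 nu_pos by simp_all
  then show ?thesis using main by blast
qed

lemma sol_unique:
  assumes "sol T f u" "sol T f v" "T > 0" "u 0 = v 0" "t \<in> {0..T}"
  shows "u t = v t"
proof -
  obtain K d where "0 < d" "\<And>v. sol T f v \<Longrightarrow> N 1 (u 0 - v 0) < d \<Longrightarrow> \<forall>t\<in>{0..T}. N 1 (u t - v t) \<le> K * N 1 (u 0 - v 0)"
    using sol_dependence[OF assms(1,3)] by blast
  then have "N 1 (u t - v t) \<le> 0" using assms(2,4,5) by (force simp: N_def)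
  moreover have "u t - v t \<in> H 1"
    using lin_H1(1)[OF lin_diff nu_pos assms(5)] assms(1,2) unfolding sol_def by blast
  ultimately have "(norm (u t - v t))\<^sup>2 \<le> 0" using norm_le_N[of "u t - v t" 1] by linarith
  then show ?thesis by simp
qed

lemma sol_energy:
  assumes s: "sol T f u" and f: "f \<in> borel_measurable (tmeas T)" and t: "t \<in> {0..T}"
  shows "(norm (u t))\<^sup>2 + 2 * \<nu> * prim T (\<lambda>s. N 1 (u s) - (norm (u s))\<^sup>2) t
    = (norm (u 0))\<^sup>2 + 2 * prim T (\<lambda>s. f s \<bullet> u s) t"
proof -
  have T0: "T \<ge> 0" using t by auto
  let ?F = "forcing f u"
  have l: "lin \<nu> T u ?F" using s by (simp add: sol_def)
  note D = lin_D[OF l]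
  note F = coeff_square_integrable[OF D(1,2)]
  note [measurable] = D(6) D(1) f F(1)
  have um [measurable]: "(\<lambda>s. u s \<bullet> e n) \<in> borel_measurable (tmeas T)" for n
    by (intro borel_measurable_inner D(6) borel_measurable_const)
  have Nc: "continuous_on {0..T} (\<lambda>t. N 1 (u t))"
    using lin_N_continuous[OF l nu_pos T0 H_zero] by simp
  note Nm [measurable] = continuous_on_tmeas_measurable[OF Nc]
  obtain R where R: "\<And>t. t \<in> {0..T} \<Longrightarrow> \<bar>N 1 (u t)\<bar> \<le> R" using continuous_on_bounded_interval[OF Nc] by blast
  have Ni: "integrable (tmeas T) (\<lambda>s. N 1 (u s))"
    by (rule tmeas.integrable_const_bound[where B=R]) (use R in auto)
  have u1: "u s \<in> H 1" if "s \<in> {0..T}" for s by (rule lin_H1(1)[OF l nu_pos that])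
  have u2: "integrable (tmeas T) (\<lambda>s. (norm (u s))\<^sup>2)"
    by (rule Bochner_Integration.integrable_bound[OF Ni])
       (use norm_le_N[OF u1] in \<open>auto intro!: AE_I2 order_trans[OF _ abs_ge_self]\<close>)
  have uF: "integrable (tmeas T) (\<lambda>s. u s \<bullet> ?F s)"
  proof (rule Bochner_Integration.integrable_bound[OF Bochner_Integration.integrable_add[OF u2 F(4)]])
    show "AE s in tmeas T. norm (u s \<bullet> ?F s) \<le> norm ((norm (u s))\<^sup>2 + (norm (?F s))\<^sup>2)"
    proof (intro AE_I2)
      fix s
      have "2 * (norm (u s) * norm (?F s)) \<le> (norm (u s))\<^sup>2 + (norm (?F s))\<^sup>2"
        using sum_squares_bound[of "norm (u s)" "norm (?F s)"] by (simp add: mult.assoc)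
      moreover have "0 \<le> norm (u s) * norm (?F s)" by simp
      ultimately show "norm (u s \<bullet> ?F s) \<le> norm ((norm (u s))\<^sup>2 + (norm (?F s))\<^sup>2)"
        using Cauchy_Schwarz_ineq2[of "u s" "?F s"] by simp
    qed
  qed measurable
  have eq: "(\<Sum>n<K. (u t \<bullet> e n)\<^sup>2) + 2 * \<nu> * prim T (\<lambda>s. \<Sum>n<K. m n ^ 1 * (u s \<bullet> e n)\<^sup>2) t
      = (\<Sum>n<K. (u 0 \<bullet> e n)\<^sup>2) + 2 * prim T (\<lambda>s. \<Sum>n<K. (u s \<bullet> e n) * (?F s \<bullet> e n)) t" for K
  proof (induction K)
    case 0
    show ?case by (simp add: prim_def)
  next
    case (Suc K)
    note en = scalar_energy[OF D(4)[of K] F(1,2) t]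
    have i: "integrable (tmeas T) (\<lambda>s. \<Sum>n<K. m n ^ 1 * (u s \<bullet> e n)\<^sup>2)"
       "integrable (tmeas T) (\<lambda>s. \<Sum>n<K. (u s \<bullet> e n) * (?F s \<bullet> e n))"
      using scalar_energy(2,3)[OF D(4) F(1,2) t] by auto
    have "prim T (\<lambda>s. \<Sum>n<Suc K. m n ^ 1 * (u s \<bullet> e n)\<^sup>2) t
        = prim T (\<lambda>s. \<Sum>n<K. m n ^ 1 * (u s \<bullet> e n)\<^sup>2) t + m K * prim T (\<lambda>s. (u s \<bullet> e K)\<^sup>2) t"
      unfolding sum.lessThan_Suc power_one_right
        prim_add[OF i(1)[unfolded power_one_right] integrable_mult_right[OF en(2)]] prim_cmult ..
    moreover have "prim T (\<lambda>s. \<Sum>n<Suc K. (u s \<bullet> e n) * (?F s \<bullet> e n)) t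
        = prim T (\<lambda>s. \<Sum>n<K. (u s \<bullet> e n) * (?F s \<bullet> e n)) t + prim T (\<lambda>s. (u s \<bullet> e K) * (?F s \<bullet> e K)) t"
      unfolding sum.lessThan_Suc by (rule prim_add[OF i(2) en(3)])
    ultimately show ?case using Suc.IH en(1) by (simp add: algebra_simps)
  qed
  have p1: "(\<lambda>K. prim T (\<lambda>s. \<Sum>n<K. m n ^ 1 * (u s \<bullet> e n)\<^sup>2) t) \<longlonglongrightarrow> prim T (\<lambda>s. N 1 (u s)) t"
  proof (rule prim_dominated_convergence[OF Ni])
    show "AE s in tmeas T. (\<lambda>K. \<Sum>n<K. m n ^ 1 * (u s \<bullet> e n)\<^sup>2) \<longlonglongrightarrow> N 1 (u s)"
      using u1 unfolding H_def N_def by (intro AE_I2 summable_LIMSEQ) auto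
    show "AE s in tmeas T. \<bar>\<Sum>n<K. m n ^ 1 * (u s \<bullet> e n)\<^sup>2\<bar> \<le> N 1 (u s)" for K
    proof (intro AE_I2)
      fix s assume "s \<in> space (tmeas T)"
      then have "u s \<in> H 1" using u1 by simp
      from N_split[OF this, of K] N_nonneg[OF H_diff[OF this proj_H[of K "u s"]]]
      show "\<bar>\<Sum>n<K. m n ^ 1 * (u s \<bullet> e n)\<^sup>2\<bar> \<le> N 1 (u s)"
        by (subst abs_of_nonneg) (auto intro!: sum_nonneg mult_nonneg_nonneg m_nonneg)
    qed
  qed measurable
  have p2: "(\<lambda>K. prim T (\<lambda>s. \<Sum>n<K. (u s \<bullet> e n) * (?F s \<bullet> e n)) t) \<longlonglongrightarrow> prim T (\<lambda>s. u s \<bullet> ?F s) t"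
  proof (rule prim_dominated_convergence[OF Bochner_Integration.integrable_add[OF u2 F(4)]])
    show "AE s in tmeas T. (\<lambda>K. \<Sum>n<K. (u s \<bullet> e n) * (?F s \<bullet> e n)) \<longlonglongrightarrow> u s \<bullet> ?F s"
      using parseval_inner by (intro AE_I2) (simp add: sums_def)
    show "AE s in tmeas T. \<bar>\<Sum>n<K. (u s \<bullet> e n) * (?F s \<bullet> e n)\<bar> \<le> (norm (u s))\<^sup>2 + (norm (?F s))\<^sup>2" for K
    proof (intro AE_I2)
      fix s
      have "\<bar>\<Sum>n<K. (u s \<bullet> e n) * (?F s \<bullet> e n)\<bar> \<le> (\<Sum>n<K. (u s \<bullet> e n)\<^sup>2 + (?F s \<bullet> e n)\<^sup>2)"
      proof (intro order_trans[OF sum_abs] sum_mono)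
        fix n
        have "2 * (\<bar>u s \<bullet> e n\<bar> * \<bar>?F s \<bullet> e n\<bar>) \<le> (u s \<bullet> e n)\<^sup>2 + (?F s \<bullet> e n)\<^sup>2"
          using sum_squares_bound[of "\<bar>u s \<bullet> e n\<bar>" "\<bar>?F s \<bullet> e n\<bar>"] by (simp add: mult.assoc)
        moreover have "0 \<le> \<bar>u s \<bullet> e n\<bar> * \<bar>?F s \<bullet> e n\<bar>" by simp
        ultimately show "\<bar>(u s \<bullet> e n) * (?F s \<bullet> e n)\<bar> \<le> (u s \<bullet> e n)\<^sup>2 + (?F s \<bullet> e n)\<^sup>2"
          unfolding abs_mult by linarith
      qed
      also have "\<dots> \<le> (norm (u s))\<^sup>2 + (norm (?F s))\<^sup>2"
        unfolding sum.distrib by (intro add_mono bessel)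
      finally show "\<bar>\<Sum>n<K. (u s \<bullet> e n) * (?F s \<bullet> e n)\<bar> \<le> (norm (u s))\<^sup>2 + (norm (?F s))\<^sup>2" .
    qed
  qed measurable
  have "(\<lambda>K. (\<Sum>n<K. (u t \<bullet> e n)\<^sup>2) + 2 * \<nu> * prim T (\<lambda>s. \<Sum>n<K. m n ^ 1 * (u s \<bullet> e n)\<^sup>2) t)
      \<longlonglongrightarrow> (norm (u t))\<^sup>2 + 2 * \<nu> * prim T (\<lambda>s. N 1 (u s)) t"
    using parseval[of "u t"] p1 by (intro tendsto_intros) (auto simp: sums_def)
  moreover have "(\<lambda>K. (\<Sum>n<K. (u t \<bullet> e n)\<^sup>2) + 2 * \<nu> * prim T (\<lambda>s. \<Sum>n<K. m n ^ 1 * (u s \<bullet> e n)\<^sup>2) t)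
      \<longlonglongrightarrow> (norm (u 0))\<^sup>2 + 2 * prim T (\<lambda>s. u s \<bullet> ?F s) t"
    unfolding eq using parseval[of "u 0"] p2 by (intro tendsto_intros) (auto simp: sums_def)
  ultimately have bal: "(norm (u t))\<^sup>2 + 2 * \<nu> * prim T (\<lambda>s. N 1 (u s)) t = (norm (u 0))\<^sup>2 + 2 * prim T (\<lambda>s. u s \<bullet> ?F s) t"
    by (rule LIMSEQ_unique)
  have FE: "AE s in tmeas T. u s \<bullet> ?F s = f s \<bullet> u s + \<nu> * (norm (u s))\<^sup>2"
    using lin_H1(3)[OF l nu_pos t]
  proof eventually_elim
    case (elim s)
    then have "Q (u s) \<bullet> u s = 0" using B_orth[OF H21[OF elim] elim] by (simp add: Q_def)
    then show ?case
      by (simp add: forcing_def inner_diff_right inner_add_right inner_commute power2_norm_eq_inner)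
  qed
  have fu: "integrable (tmeas T) (\<lambda>s. f s \<bullet> u s)"
  proof (rule integrable_cong_AE[THEN iffD1])
    show "integrable (tmeas T) (\<lambda>s. u s \<bullet> ?F s - \<nu> * (norm (u s))\<^sup>2)" using uF u2 by simp
    show "AE s in tmeas T. u s \<bullet> ?F s - \<nu> * (norm (u s))\<^sup>2 = f s \<bullet> u s"
      using FE by eventually_elim simp
  qed measurable
  have "prim T (\<lambda>s. u s \<bullet> ?F s) t = prim T (\<lambda>s. f s \<bullet> u s + \<nu> * (norm (u s))\<^sup>2) t"
    unfolding prim_def
  proof (rule integral_cong_AE)
    show "AE s in tmeas T. (if s \<le> t then u s \<bullet> ?F s else 0) = (if s \<le> t then f s \<bullet> u s + \<nu> * (norm (u s))\<^sup>2 else 0)"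
      using FE by eventually_elim simp
  qed measurable
  also have "\<dots> = prim T (\<lambda>s. f s \<bullet> u s) t + \<nu> * prim T (\<lambda>s. (norm (u s))\<^sup>2) t"
    unfolding prim_add[OF fu integrable_mult_right[OF u2]] prim_cmult ..
  finally show ?thesis using bal unfolding prim_diff[OF Ni u2] by (simp add: algebra_simps)
qed

end

subsection \<open>The trigonometric system on the torus\<close>

lemma space_torus: "space torus = {x. \<forall>i. 0 \<le> x $ i \<and> x $ i < 2 * pi}"
  by (simp add: torus_def space_restrict_space)

lemma borel_measurable_torusI: "f \<in> borel_measurable borel \<Longrightarrow> f \<in> borel_measurable torus"
  unfolding torus_def by (rule measurable_restrict_space1) simp

lemma torus_integral_lborel:
  fixes h :: "real^3 \<Rightarrow> real"
  shows "(\<integral>x. h x \<partial>torus) = (\<integral>x. indicator (space torus) x * h x \<partial>lborel)"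
  using integral_restrict_space[of "space torus" lborel h] cell_borel
  by (simp add: torus_def space_restrict_space)

lemma lborel_integral_translate:
  fixes h :: "real^3 \<Rightarrow> real"
  assumes "h \<in> borel_measurable borel"
  shows "(\<integral>x. h (c + x) \<partial>lborel) = (\<integral>x. h x \<partial>lborel)"
  using integral_distr[of "(+) c" lborel borel h] assms by (simp add: lborel_distr_plus)

lemma integrable_lborel_bounded:
  fixes h :: "real^3 \<Rightarrow> real"
  assumes "h \<in> borel_measurable borel" "\<And>x. \<bar>h x\<bar> \<le> M * indicator (cbox a b) x"
  shows "integrable lborel h"
proof (rule Bochner_Integration.integrable_bound)
  show "integrable lborel (\<lambda>x. M * indicator (cbox a b) x)"
    using emeasure_lborel_cbox_finite[of a b] by (intro integrable_mult_right integrable_real_indicator) auto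
  show "AE x in lborel. norm (h x) \<le> norm (M * indicator (cbox a b) x)"
    using assms(2) by (intro AE_I2) (auto intro: order_trans[OF _ abs_ge_self])
qed (use assms in simp)

lemma torus_integral_translate:
  fixes h :: "real^3 \<Rightarrow> real"
  assumes c: "continuous_on UNIV h" and p: "\<And>x. h (x + (2 * pi) *\<^sub>R axis j 1) = h x" and s: "0 \<le> s" "s \<le> 2 * pi"
  shows "(\<integral>x. h (x + s *\<^sub>R axis j 1) \<partial>torus) = (\<integral>x. h x \<partial>torus)"
proof -
  let ?e = "axis j 1 :: real^3" and ?C = "space torus"
  have C[measurable]: "?C \<in> sets borel" unfolding space_torus by (rule cell_borel)
  have h[measurable]: "h \<in> borel_measurable borel" by (rule borel_measurable_continuous_onI[OF c])
  have j[measurable]: "{x :: real^3. x $ j < 2 * pi} \<in> sets borel"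
    using borel_open[OF open_halfspace_component_lt_cart[of j "2 * pi"]] .
  have ind[measurable]: "indicator A \<in> borel_measurable borel" if "A \<in> sets borel" for A :: "(real^3) set"
    using that by (rule borel_measurable_indicator)
  have shift[measurable]: "(\<lambda>x :: real^3. indicator ?C (x - s *\<^sub>R ?e) :: real) \<in> borel_measurable borel"
    by (rule measurable_compose[of "\<lambda>x. x - s *\<^sub>R ?e" borel borel]) (auto intro: ind C)
  define A where "A x = indicator ?C (x - s *\<^sub>R ?e) * indicator {x. x $ j < 2 * pi} x * h x" for x
  define D where "D x = indicator ?C (x - s *\<^sub>R ?e) * (1 - indicator {x. x $ j < 2 * pi} x) * h x" for x
  have Am: "A \<in> borel_measurable borel" and Dm: "D \<in> borel_measurable borel"
    unfolding A_def[abs_def] D_def[abs_def] using ind[OF j] shift h by measurable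
  let ?K = "cbox 0 (\<chi> i. 4 * pi) :: (real^3) set"
  have "bounded (h ` ?K)"
    by (intro compact_imp_bounded compact_continuous_image continuous_on_subset[OF c]) auto
  then obtain M where M: "\<And>x. x \<in> ?K \<Longrightarrow> \<bar>h x\<bar> \<le> M" by (force simp: bounded_iff)
  have M0: "0 \<le> M" using M[of 0] by (force simp: mem_box_cart)
  have sub: "x \<in> ?K" if "x - s *\<^sub>R ?e \<in> ?C" for x
    unfolding mem_box_cart
  proof
    fix i
    have "0 \<le> (x - s *\<^sub>R ?e) $ i \<and> (x - s *\<^sub>R ?e) $ i < 2 * pi" using that by (simp only: space_torus mem_Collect_eq)
    then show "(0::real^3) $ i \<le> x $ i \<and> x $ i \<le> (\<chi> i. 4 * pi) $ i"
      using s by (cases "i = j") (auto simp: axis_def)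
  qed
  have bd: "\<bar>indicator ?C (x - s *\<^sub>R ?e) * r * h x\<bar> \<le> M * indicator ?K x" if "r \<in> {0, 1}" for r x
    using that sub[of x] M[of x] M0 by (auto simp: indicator_def)
  have Ai: "integrable lborel A"
    by (rule integrable_lborel_bounded[OF Am, of M 0 "\<chi> i. 4 * pi"]) (use bd in \<open>simp add: A_def indicator_def\<close>)
  have Di: "integrable lborel D"
    by (rule integrable_lborel_bounded[OF Dm, of M 0 "\<chi> i. 4 * pi"]) (use bd in \<open>simp add: D_def indicator_def\<close>)
  have Dt: "integrable lborel (\<lambda>x. D ((2 * pi) *\<^sub>R ?e + x))"
    using integrable_distr[of "(+) ((2 * pi) *\<^sub>R ?e)" lborel borel D] Di by (simp add: lborel_distr_plus)
  have "(\<integral>x. h (x + s *\<^sub>R ?e) \<partial>torus) = (\<integral>x. (\<lambda>y. A y + D y) (s *\<^sub>R ?e + x) \<partial>lborel)"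
    unfolding torus_integral_lborel
    by (intro Bochner_Integration.integral_cong) (auto simp: A_def D_def indicator_def add.commute)
  also have "\<dots> = (\<integral>x. A x + D x \<partial>lborel)"
    by (rule lborel_integral_translate) (use Am Dm in measurable)
  also have "\<dots> = (\<integral>x. A x \<partial>lborel) + (\<integral>x. D ((2 * pi) *\<^sub>R ?e + x) \<partial>lborel)"
    using Ai Di Dm by (simp add: lborel_integral_translate)
  also have "\<dots> = (\<integral>x. A x + D ((2 * pi) *\<^sub>R ?e + x) \<partial>lborel)"
    using Ai Dt by simp
  also have "\<dots> = (\<integral>x. indicator ?C x * h x \<partial>lborel)"
  proof (rule Bochner_Integration.integral_cong[OF refl])
    fix x :: "real^3"
    have hp: "h ((2 * pi) *\<^sub>R ?e + x) = h x" using p[of x] by (simp add: add.commute)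
    have 1: "x - s *\<^sub>R ?e \<in> ?C \<and> x $ j < 2 * pi \<longleftrightarrow> x \<in> ?C \<and> s \<le> x $ j"
    proof -
      have "(x - s *\<^sub>R ?e) $ i = (if i = j then x $ j - s else x $ i)" for i by (simp add: axis_def)
      then have "x - s *\<^sub>R ?e \<in> ?C \<longleftrightarrow> (\<forall>i. 0 \<le> (if i = j then x $ j - s else x $ i) \<and> (if i = j then x $ j - s else x $ i) < 2 * pi)"
        unfolding space_torus mem_Collect_eq by simp
      then show ?thesis unfolding space_torus mem_Collect_eq using s by (smt (verit))
    qed
    have 2: "(2 * pi) *\<^sub>R ?e + x - s *\<^sub>R ?e \<in> ?C \<and> \<not> ((2 * pi) *\<^sub>R ?e + x) $ j < 2 * pi \<longleftrightarrow> x \<in> ?C \<and> x $ j < s"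
    proof -
      have "((2 * pi) *\<^sub>R ?e + x - s *\<^sub>R ?e) $ i = (if i = j then 2 * pi + x $ j - s else x $ i)" for i by (simp add: axis_def)
      then have "(2 * pi) *\<^sub>R ?e + x - s *\<^sub>R ?e \<in> ?C \<longleftrightarrow> (\<forall>i. 0 \<le> (if i = j then 2 * pi + x $ j - s else x $ i) \<and> (if i = j then 2 * pi + x $ j - s else x $ i) < 2 * pi)"
        unfolding space_torus mem_Collect_eq by simp
      moreover have "((2 * pi) *\<^sub>R ?e + x) $ j = 2 * pi + x $ j" by (simp add: axis_def)
      ultimately show ?thesis unfolding space_torus mem_Collect_eq using s by (smt (verit))
    qed
    have "A x = (if x \<in> ?C \<and> s \<le> x $ j then h x else 0)"
      unfolding A_def using 1 by (auto simp: indicator_def)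
    moreover have "D ((2 * pi) *\<^sub>R ?e + x) = (if x \<in> ?C \<and> x $ j < s then h x else 0)"
      unfolding D_def hp using 2 by (auto simp: indicator_def)
    ultimately show "A x + D ((2 * pi) *\<^sub>R ?e + x) = indicator ?C x * h x"
      by (auto simp: indicator_def)
  qed
  finally show ?thesis unfolding torus_integral_lborel .
qed

lemma torus_integral_derivative_0:
  fixes \<phi> :: "real^3 \<Rightarrow> real"
  assumes d: "\<And>x. \<phi> differentiable (at x)"
    and c: "continuous_on UNIV (\<lambda>x. frechet_derivative \<phi> (at x) (axis j 1))"
    and p: "\<And>x. \<phi> (x + (2 * pi) *\<^sub>R axis j 1) = \<phi> x"
  shows "(\<integral>x. frechet_derivative \<phi> (at x) (axis j 1) \<partial>torus) = 0"
proof -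
  let ?e = "axis j 1 :: real^3"
  let ?D = "\<lambda>x. frechet_derivative \<phi> (at x) ?e"
  define h where "h n = 1 / real (Suc n)" for n
  have h: "0 < h n" "h n \<le> 1" for n by (auto simp: h_def)
  have h0: "h \<longlonglongrightarrow> 0" unfolding h_def[abs_def] by (rule LIMSEQ_Suc[OF lim_const_over_n])
  have \<phi>c: "continuous_on UNIV \<phi>"
    using d by (simp add: continuous_at_imp_continuous_on differentiable_imp_continuous_within)
  note [measurable] = borel_measurable_torusI[OF borel_measurable_continuous_onI[OF \<phi>c]]
    borel_measurable_torusI[OF borel_measurable_continuous_onI[OF c]]
  have line: "((\<lambda>t. \<phi> (x + t *\<^sub>R ?e)) has_real_derivative ?D (x + t *\<^sub>R ?e)) (at t)" for x t
  proof -
    have "((\<lambda>t. x + t *\<^sub>R ?e) has_derivative (\<lambda>h. h *\<^sub>R ?e)) (at t)"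
      by (auto intro!: derivative_eq_intros)
    moreover have f: "(\<phi> has_derivative frechet_derivative \<phi> (at (x + t *\<^sub>R ?e))) (at (x + t *\<^sub>R ?e))"
      using d frechet_derivative_works by blast
    ultimately have "((\<lambda>t. \<phi> (x + t *\<^sub>R ?e)) has_derivative (\<lambda>h. frechet_derivative \<phi> (at (x + t *\<^sub>R ?e)) (h *\<^sub>R ?e))) (at t)"
      by (rule has_derivative_compose)
    moreover have "frechet_derivative \<phi> (at (x + t *\<^sub>R ?e)) (h *\<^sub>R ?e) = ?D (x + t *\<^sub>R ?e) * h" for h
      using linear_scale[OF has_derivative_linear[OF f], of h ?e] by simp
    ultimately show ?thesis by (simp add: has_field_derivative_def)
  qed
  let ?K = "cbox 0 (\<chi> i. 4 * pi) :: (real^3) set"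
  have "bounded (?D ` ?K)"
    by (intro compact_imp_bounded compact_continuous_image continuous_on_subset[OF c]) auto
  then obtain M where M: "\<And>x. x \<in> ?K \<Longrightarrow> \<bar>?D x\<bar> \<le> M" by (force simp: bounded_iff)
  define q where "q n x = (\<phi> (x + h n *\<^sub>R ?e) - \<phi> x) / h n" for n x
  have hm [measurable]: "(\<lambda>x. \<phi> (x + h n *\<^sub>R ?e)) \<in> borel_measurable torus" for n
    by (intro borel_measurable_torusI borel_measurable_continuous_onI continuous_on_compose2[OF \<phi>c] continuous_intros) auto
  have qle: "\<bar>q n x\<bar> \<le> M" if x: "x \<in> space torus" for n x
  proof -
    obtain z where z: "0 < z" "z < h n" "\<phi> (x + h n *\<^sub>R ?e) - \<phi> (x + 0 *\<^sub>R ?e) = (h n - 0) * ?D (x + z *\<^sub>R ?e)"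
      using MVT2[OF h(1)[of n] line[of x]] by blast
    have "x + z *\<^sub>R ?e \<in> ?K"
    proof (unfold mem_box_cart, rule allI)
      fix i
      have "0 \<le> x $ i" "x $ i < 2 * pi" using x by (auto simp: space_torus)
      then show "(0::real^3) $ i \<le> (x + z *\<^sub>R ?e) $ i \<and> (x + z *\<^sub>R ?e) $ i \<le> (\<chi> i. 4 * pi) $ i"
        using z h(2)[of n] pi_gt3 by (cases "i = j") (auto simp: axis_def)
    qed
    then have "\<bar>?D (x + z *\<^sub>R ?e)\<bar> \<le> M" by (rule M)
    moreover have "q n x = ?D (x + z *\<^sub>R ?e)" using z(3) h(1)[of n] by (simp add: q_def)
    ultimately show ?thesis by simp
  qed
  have q0: "(\<integral>x. q n x \<partial>torus) = 0" for n
  proof -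
    have bounded: "integrable torus (\<lambda>x. \<phi> (x + t *\<^sub>R ?e))" if "0 \<le> t" "t \<le> 1" for t
    proof -
      have "bounded (\<phi> ` ?K)"
        by (intro compact_imp_bounded compact_continuous_image continuous_on_subset[OF \<phi>c]) auto
      then obtain L where L: "\<And>x. x \<in> ?K \<Longrightarrow> \<bar>\<phi> x\<bar> \<le> L" by (force simp: bounded_iff)
      show ?thesis
      proof (rule torus.integrable_const_bound[where B=L])
        show "AE x in torus. norm (\<phi> (x + t *\<^sub>R ?e)) \<le> L"
        proof (intro AE_I2)
          fix x assume x: "x \<in> space torus"
          have "x + t *\<^sub>R ?e \<in> ?K"
          proof (unfold mem_box_cart, rule allI)
            fix i
            have "0 \<le> x $ i" "x $ i < 2 * pi" using x by (auto simp: space_torus)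
            then show "(0::real^3) $ i \<le> (x + t *\<^sub>R ?e) $ i \<and> (x + t *\<^sub>R ?e) $ i \<le> (\<chi> i. 4 * pi) $ i"
              using that pi_gt3 by (cases "i = j") (auto simp: axis_def)
          qed
          then show "norm (\<phi> (x + t *\<^sub>R ?e)) \<le> L" using L by simp
        qed
        show "(\<lambda>x. \<phi> (x + t *\<^sub>R ?e)) \<in> borel_measurable torus"
          by (intro borel_measurable_torusI borel_measurable_continuous_onI continuous_on_compose2[OF \<phi>c] continuous_intros) auto
      qed
    qed
    have "(\<integral>x. \<phi> (x + h n *\<^sub>R ?e) \<partial>torus) = (\<integral>x. \<phi> x \<partial>torus)"
      by (rule torus_integral_translate[OF \<phi>c p]) (use h[of n] pi_gt3 in auto)
    then show ?thesis
      using bounded[of "h n"] bounded[of 0] h[of n] by (simp add: q_def)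
  qed
  have "(\<lambda>n. \<integral>x. q n x \<partial>torus) \<longlonglongrightarrow> (\<integral>x. ?D x \<partial>torus)"
  proof (rule integral_dominated_convergence[where w="\<lambda>_. M"])
    show "AE x in torus. (\<lambda>n. q n x) \<longlonglongrightarrow> ?D x"
    proof (intro AE_I2)
      fix x
      have "((\<lambda>t. (\<phi> (x + (0 + t) *\<^sub>R ?e) - \<phi> (x + 0 *\<^sub>R ?e)) / t) \<longlongrightarrow> ?D (x + 0 *\<^sub>R ?e)) (at 0)"
        using line[of x 0] unfolding DERIV_def .
      then have "((\<lambda>t. (\<phi> (x + t *\<^sub>R ?e) - \<phi> x) / t) \<longlongrightarrow> ?D x) (at 0)" by simp
      moreover have "filterlim h (at 0) sequentially"
        using h0 h(1) by (intro filterlim_atI) (auto simp: less_imp_neq[THEN not_sym])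
      ultimately show "(\<lambda>n. q n x) \<longlonglongrightarrow> ?D x"
        unfolding q_def by (rule filterlim_compose)
    qed
    show "AE x in torus. norm (q n x) \<le> M" for n using qle by (intro AE_I2) simp
  qed (auto simp: q_def[abs_def])
  then show ?thesis using q0 LIMSEQ_unique[OF _ tendsto_const[of 0]] by simp
qed

definition wave :: "int^3 \<Rightarrow> real^3" where
  "wave k = (\<chi> i. real_of_int (k $ i))"

text \<open>Hartley's function \<open>cas\<close>: unlike the exponentials it gives one real orthogonal family
  indexed by \<open>\<int>\<^sup>3\<close>.\<close>

definition cas :: "int^3 \<Rightarrow> real^3 \<Rightarrow> real" where
  "cas k x = cos (wave k \<bullet> x) + sin (wave k \<bullet> x)"

lemma wave_axis [simp]: "wave k \<bullet> axis j 1 = real_of_int (k $ j)"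
  by (simp add: inner_axis wave_def)

lemma wave_simps: "wave (k + l) = wave k + wave l" "wave (k - l) = wave k - wave l" "wave (- k) = - wave k"
  by (simp_all add: wave_def vec_eq_iff)

lemma continuous_trig: "continuous_on S (\<lambda>x. cos (v \<bullet> x))" "continuous_on S (\<lambda>x. sin (v \<bullet> x))"
  by (auto intro!: continuous_intros)

lemma continuous_cas: "continuous_on S (cas k)"
  unfolding cas_def[abs_def] by (intro continuous_intros)

lemma cas_bound: "\<bar>cas k x\<bar> \<le> 2"
  unfolding cas_def using abs_cos_le_one[of "wave k \<bullet> x"] abs_sin_le_one[of "wave k \<bullet> x"] by linarith

lemma wave_periodic:
  "cos (wave k \<bullet> (x + (2 * pi) *\<^sub>R axis j 1)) = cos (wave k \<bullet> x)"
  "sin (wave k \<bullet> (x + (2 * pi) *\<^sub>R axis j 1)) = sin (wave k \<bullet> x)"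
proof -
  have "wave k \<bullet> (x + (2 * pi) *\<^sub>R axis j 1) = wave k \<bullet> x + (2 * pi) * real_of_int (k $ j)"
    by (simp add: inner_add_right)
  then show "cos (wave k \<bullet> (x + (2 * pi) *\<^sub>R axis j 1)) = cos (wave k \<bullet> x)"
    "sin (wave k \<bullet> (x + (2 * pi) *\<^sub>R axis j 1)) = sin (wave k \<bullet> x)"
    by (simp_all only: cos_add sin_add cos_int_2pin sin_int_2pin mult_1_right mult_zero_right diff_0_right add_0_right)
qed

lemma cas_periodic: "cas k (x + (2 * pi) *\<^sub>R axis j 1) = cas k x"
  unfolding cas_def by (simp only: wave_periodic)

lemma torus_integral_trig:
  "k \<noteq> 0 \<Longrightarrow> (\<integral>x. cos (wave k \<bullet> x) \<partial>torus) = 0" "(\<integral>x. sin (wave k \<bullet> x) \<partial>torus) = 0"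
proof -
  have *: "(\<integral>x. cos (wave k \<bullet> x) \<partial>torus) = 0 \<and> (\<integral>x. sin (wave k \<bullet> x) \<partial>torus) = 0" if k: "k \<noteq> 0"
  proof -
    obtain j where j: "k $ j \<noteq> 0" using k by (metis vec_eq_iff zero_index)
    define s where "s = pi / \<bar>real_of_int (k $ j)\<bar>"
    have "1 \<le> \<bar>real_of_int (k $ j)\<bar>" using j by linarith
    then have s: "0 \<le> s" "s \<le> 2 * pi"
      unfolding s_def using pi_gt_zero by (auto simp: divide_le_eq intro: order_trans[of _ "pi * 1"])
    have "s * real_of_int (k $ j) = pi \<or> s * real_of_int (k $ j) = - pi"
      using j by (auto simp: s_def abs_if)
    then have "cos (wave k \<bullet> (x + s *\<^sub>R axis j 1)) = - cos (wave k \<bullet> x)"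
      "sin (wave k \<bullet> (x + s *\<^sub>R axis j 1)) = - sin (wave k \<bullet> x)" for x
      by (auto simp: inner_add_right cos_add sin_add)
    then show ?thesis
      using torus_integral_translate[where j=j, OF continuous_trig(1) wave_periodic(1) s, of k]
        torus_integral_translate[where j=j, OF continuous_trig(2) wave_periodic(2) s, of k] by simp
  qed
  show "k \<noteq> 0 \<Longrightarrow> (\<integral>x. cos (wave k \<bullet> x) \<partial>torus) = 0" using * by blast
  show "(\<integral>x. sin (wave k \<bullet> x) \<partial>torus) = 0"
    using * by (cases "k = 0") (auto simp: wave_def zero_vec_def[symmetric])
qed

definition torus_volume :: real where
  "torus_volume = measure torus (space torus)"

lemma torus_volume_pos: "torus_volume > 0"
proof -
  have "emeasure torus (space torus) = emeasure lborel (space torus)"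
    unfolding space_torus using cell_borel by (simp add: torus_def emeasure_restrict_space)
  moreover have "emeasure lborel (cbox 0 (\<chi> i. 1) :: (real^3) set) \<le> emeasure lborel (space torus)"
  proof (rule emeasure_mono)
    have "x $ i < 2 * pi" if "x $ i \<le> 1" for x :: "real^3" and i using that pi_gt3 by linarith
    then show "cbox 0 (\<chi> i. 1) \<subseteq> space torus" by (auto simp: space_torus mem_box_cart)
  qed (use cell_borel in \<open>simp add: space_torus\<close>)
  moreover have "emeasure lborel (cbox 0 (\<chi> i. 1) :: (real^3) set) = 1"
    by (subst emeasure_lborel_cbox) (auto simp: Basis_vec_def inner_axis intro!: prod.neutral)
  ultimately have "emeasure torus (space torus) \<noteq> 0" by auto
  then show ?thesis
    unfolding torus_volume_def using torus.emeasure_eq_measure[of "space torus"] measure_nonneg[of torus "space torus"]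
    by (metis ennreal_0 less_eq_real_def)
qed

lemma integrable_torus_continuous:
  fixes h :: "real^3 \<Rightarrow> real"
  assumes "continuous_on UNIV h" "\<And>x. \<bar>h x\<bar> \<le> M"
  shows "integrable torus h"
  using assms by (intro torus.integrable_const_bound[where B=M] borel_measurable_torusI borel_measurable_continuous_onI) auto

lemma cas_mult: "cas k x * cas l x = cos (wave (k - l) \<bullet> x) + sin (wave (k + l) \<bullet> x)"
  by (simp add: cas_def wave_simps inner_diff_left inner_add_left cos_diff sin_add algebra_simps)

lemma cas_orthogonal: "(\<integral>x. cas k x * cas l x \<partial>torus) = (if k = l then torus_volume else 0)"
proof -
  have i: "integrable torus (\<lambda>x. cos (wave (k - l) \<bullet> x))" "integrable torus (\<lambda>x. sin (wave (k + l) \<bullet> x))"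
    by (auto intro!: integrable_torus_continuous[where M=1] continuous_trig)
  have "wave 0 = 0" by (simp add: wave_def vec_eq_iff)
  then show ?thesis
    unfolding cas_mult using i torus_integral_trig[of "k - l"] torus_integral_trig(2)[of "k + l"]
    by (auto simp: torus_volume_def)
qed

inductive_set trig_poly :: "(real^3 \<Rightarrow> real) set" where
  cas: "cas k \<in> trig_poly"
| add: "p \<in> trig_poly \<Longrightarrow> q \<in> trig_poly \<Longrightarrow> (\<lambda>x. p x + q x) \<in> trig_poly"
| cmult: "p \<in> trig_poly \<Longrightarrow> (\<lambda>x. r * p x) \<in> trig_poly"

lemma trig_poly_cos: "(\<lambda>x. cos (wave k \<bullet> x)) \<in> trig_poly"
proof -
  have "(\<lambda>x. (1/2) * (cas k x + cas (- k) x)) \<in> trig_poly" by (intro trig_poly.intros)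
  then show ?thesis by (simp add: cas_def wave_simps)
qed

lemma trig_poly_sin: "(\<lambda>x. sin (wave k \<bullet> x)) \<in> trig_poly"
proof -
  have "(\<lambda>x. (1/2) * (cas k x + (-1) * cas (- k) x)) \<in> trig_poly" by (intro trig_poly.intros)
  then show ?thesis by (simp add: cas_def wave_simps)
qed

lemma trig_poly_const: "(\<lambda>x. r) \<in> trig_poly"
proof -
  have "(\<lambda>x. r * cas 0 x) \<in> trig_poly" by (intro trig_poly.intros)
  moreover have "wave 0 = 0" by (simp add: wave_def vec_eq_iff)
  ultimately show ?thesis by (simp add: cas_def)
qed

lemma trig_poly_mult: "p \<in> trig_poly \<Longrightarrow> q \<in> trig_poly \<Longrightarrow> (\<lambda>x. p x * q x) \<in> trig_poly"
proof (induction arbitrary: q rule: trig_poly.induct)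
  case (cas k)
  show ?case using cas
  proof (induction rule: trig_poly.induct)
    case (cas l)
    show ?case unfolding cas_mult by (intro trig_poly.add trig_poly_cos trig_poly_sin)
  next
    case (add p q)
    then show ?case unfolding distrib_left by (intro trig_poly.add)
  next
    case (cmult p r)
    then show ?case unfolding mult.left_commute[of _ r] by (intro trig_poly.cmult)
  qed
next
  case (add p p')
  then show ?case unfolding distrib_right by (intro trig_poly.add)
next
  case (cmult p r)
  then show ?case unfolding mult.assoc by (intro trig_poly.cmult)
qed

lemma trig_poly_sum: "finite I \<Longrightarrow> (\<And>i. i \<in> I \<Longrightarrow> p i \<in> trig_poly) \<Longrightarrow> (\<lambda>x. \<Sum>i\<in>I. p i x) \<in> trig_poly"
proof (induction I rule: finite_induct)
  case empty
  show ?case using trig_poly_const[of 0] by simp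
next
  case (insert i I)
  then have "(\<lambda>x. p i x + (\<Sum>i\<in>I. p i x)) \<in> trig_poly" by (intro trig_poly.add) auto
  then show ?case using insert by simp
qed

text \<open>Completeness: by Stone-Weierstrass, functions of \<open>circles x\<close> are uniform limits of trigonometric
  polynomials, and \<open>circles\<close> has a Borel inverse on the cell.\<close>

definition circles :: "real^3 \<Rightarrow> complex^3" where
  "circles x = (\<chi> i. cis (x $ i))"

lemma continuous_circles: "continuous_on S circles"
  unfolding circles_def[abs_def] by (intro continuous_intros)

lemma polynomial_circles: "real_polynomial_function q \<Longrightarrow> (\<lambda>x. q (circles x)) \<in> trig_poly"
proof (induction rule: real_polynomial_function.induct)
  case (linear f)
  then interpret f: bounded_linear f .
  have ax: "wave (axis i 1) \<bullet> x = x $ i" for i x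
    by (subst inner_commute) (simp add: wave_def inner_vec_def axis_def if_distrib cong: if_cong)
  have rep: "f z = (\<Sum>b\<in>Basis. (z \<bullet> b) * f b)" for z
  proof -
    have "f z = f (\<Sum>b\<in>Basis. (z \<bullet> b) *\<^sub>R b)" by (simp add: euclidean_representation)
    then show ?thesis by (simp add: f.sum f.scaleR)
  qed
  have "(\<lambda>x. (circles x \<bullet> b) * f b) \<in> trig_poly" if b0: "b \<in> Basis" for b
  proof -
    obtain i c where b: "b = axis i c" using b0 unfolding Basis_vec_def by blast
    have "(\<lambda>x. f b * (Re c * cos (wave (axis i 1) \<bullet> x) + Im c * sin (wave (axis i 1) \<bullet> x))) \<in> trig_poly"
      by (intro trig_poly.intros trig_poly_cos trig_poly_sin)
    moreover have "f b * (Re c * cos (wave (axis i 1) \<bullet> x) + Im c * sin (wave (axis i 1) \<bullet> x)) = (circles x \<bullet> b) * f b" for x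
      unfolding ax by (simp add: b inner_axis circles_def inner_complex_def mult.commute)
    ultimately show ?thesis by simp
  qed
  then have "(\<lambda>x. \<Sum>b\<in>Basis. (circles x \<bullet> b) * f b) \<in> trig_poly" by (intro trig_poly_sum) auto
  moreover have "(\<lambda>x. f (circles x)) = (\<lambda>x. \<Sum>b\<in>Basis. (circles x \<bullet> b) * f b)" by (intro ext rep)
  ultimately show ?case by (rule back_subst[where P="\<lambda>p. p \<in> trig_poly", OF _ sym])
qed (auto intro: trig_poly_const trig_poly.add trig_poly_mult)

lemma integrable_mult_bounded_torus:
  fixes g h :: "real^3 \<Rightarrow> real"
  assumes g: "integrable torus g" and [measurable]: "h \<in> borel_measurable torus"
    and M: "\<And>x. x \<in> space torus \<Longrightarrow> \<bar>h x\<bar> \<le> M"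
  shows "integrable torus (\<lambda>x. g x * h x)"
proof (rule Bochner_Integration.integrable_bound)
  have [measurable]: "g \<in> borel_measurable torus" using g by auto
  show "(\<lambda>x. g x * h x) \<in> borel_measurable torus" by measurable
  show "integrable torus (\<lambda>x. M * g x)" using g by simp
  show "AE x in torus. norm (g x * h x) \<le> norm (M * g x)"
  proof (intro AE_I2)
    fix x assume "x \<in> space torus"
    then have "\<bar>h x\<bar> \<le> \<bar>M\<bar>" using M[of x] by simp
    then have "\<bar>h x\<bar> * \<bar>g x\<bar> \<le> \<bar>M\<bar> * \<bar>g x\<bar>" by (rule mult_right_mono) simp
    then show "norm (g x * h x) \<le> norm (M * g x)" by (simp add: abs_mult mult.commute[of "\<bar>g x\<bar>"])
  qed
qed

lemma torus_bounded:
  fixes h :: "real^3 \<Rightarrow> 'b::real_normed_vector"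
  assumes "continuous_on UNIV h"
  obtains M where "\<And>x. x \<in> space torus \<Longrightarrow> norm (h x) \<le> M"
proof -
  let ?K = "cbox 0 (\<chi> i. 2 * pi) :: (real^3) set"
  have "bounded (h ` ?K)"
    by (intro compact_imp_bounded compact_continuous_image continuous_on_subset[OF assms]) auto
  then obtain M where "\<And>x. x \<in> ?K \<Longrightarrow> norm (h x) \<le> M" by (force simp: bounded_iff)
  moreover have "space torus \<subseteq> ?K" by (auto simp: space_torus mem_box_cart less_imp_le)
  ultimately show ?thesis using that by blast
qed

lemma trig_poly_integral_0:
  assumes g: "integrable torus g" and z: "\<And>k. (\<integral>x. g x * cas k x \<partial>torus) = 0" and p: "p \<in> trig_poly"
  shows "integrable torus (\<lambda>x. g x * p x) \<and> (\<integral>x. g x * p x \<partial>torus) = 0"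
  using p
proof (induction rule: trig_poly.induct)
  case (cas k)
  have "integrable torus (\<lambda>x. g x * cas k x)"
    by (rule integrable_mult_bounded_torus[OF g, of _ 2])
       (auto intro: borel_measurable_torusI borel_measurable_continuous_onI continuous_cas cas_bound)
  then show ?case using z by simp
next
  case (add p q)
  then show ?case by (simp add: distrib_left)
next
  case (cmult p r)
  then show ?case by (simp add: mult.left_commute[of _ r])
qed

lemma continuous_circles_integral_0:
  assumes g: "integrable torus g" and z: "\<And>k. (\<integral>x. g x * cas k x \<partial>torus) = 0"
    and F: "continuous_on UNIV F"
  shows "(\<integral>x. g x * F (circles x) \<partial>torus) = (0::real)"
proof (rule ccontr)
  assume nz: "(\<integral>x. g x * F (circles x) \<partial>torus) \<noteq> 0"
  let ?I = "\<bar>\<integral>x. g x * F (circles x) \<partial>torus\<bar>" and ?A = "\<integral>x. \<bar>g x\<bar> \<partial>torus"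
  let ?K = "circles ` cbox 0 (\<chi> i. 2 * pi)"
  define e where "e = ?I / (2 * (?A + 1))"
  have A0: "0 \<le> ?A" by simp
  have e: "e > 0"
    unfolding e_def by (intro divide_pos_pos mult_pos_pos add_nonneg_pos) (use nz A0 in auto)
  have "compact ?K" by (intro compact_continuous_image continuous_circles) auto
  then obtain q where q: "real_polynomial_function q" "\<And>z. z \<in> ?K \<Longrightarrow> \<bar>F z - q z\<bar> < e"
    using Stone_Weierstrass_real_polynomial_function[OF _ continuous_on_subset[OF F subset_UNIV] e, of ?K] by blast
  note p = trig_poly_integral_0[OF g z polynomial_circles[OF q(1)]]
  have Fc: "continuous_on UNIV (\<lambda>x. F (circles x))"
    by (rule continuous_on_compose2[OF F continuous_circles]) auto
  obtain M where M: "\<And>x. x \<in> space torus \<Longrightarrow> norm (F (circles x)) \<le> M" using torus_bounded[OF Fc] by blast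
  have Fi: "integrable torus (\<lambda>x. g x * F (circles x))"
    by (rule integrable_mult_bounded_torus[OF g, of _ M])
       (use M in \<open>auto intro: borel_measurable_torusI borel_measurable_continuous_onI Fc\<close>)
  have "?I = \<bar>\<integral>x. g x * F (circles x) - g x * q (circles x) \<partial>torus\<bar>" using Fi p by simp
  also have "\<dots> \<le> (\<integral>x. norm (g x * F (circles x) - g x * q (circles x)) \<partial>torus)"
    unfolding real_norm_def[symmetric] by (rule integral_norm_bound)
  also have "\<dots> \<le> (\<integral>x. \<bar>g x\<bar> * e \<partial>torus)"
  proof (rule integral_mono)
    fix x assume "x \<in> space torus"
    then have "circles x \<in> ?K" by (auto simp: space_torus mem_box_cart less_imp_le)
    then have "\<bar>F (circles x) - q (circles x)\<bar> \<le> e" using q(2) by (simp add: less_imp_le)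
    then show "norm (g x * F (circles x) - g x * q (circles x)) \<le> \<bar>g x\<bar> * e"
      by (simp add: abs_mult mult_left_mono flip: right_diff_distrib)
  qed (use g Fi p in auto)
  also have "\<dots> = ?A * e" by simp
  also have "\<dots> \<le> (?A + 1) * e" using e by (intro mult_right_mono) auto
  also have "\<dots> = ?I / 2"
  proof -
    have "c * (i / (2 * c)) = i / 2" if "c > 0" for c i :: real using that by simp
    from this[of "?A + 1" ?I] show ?thesis using A0 unfolding e_def by linarith
  qed
  finally show False using nz by simp
qed

lemma closed_circles_integral_0:
  assumes g: "integrable torus g" and z: "\<And>k. (\<integral>x. g x * cas k x \<partial>torus) = 0"
    and A: "closed A"
  shows "(\<integral>x. g x * indicator A (circles x) \<partial>torus) = (0::real)"
proof (cases "A = {}")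
  case False
  define F where "F n w = max 0 (1 - real n * infdist w A)" for n and w :: "complex^3"
  have Fc: "continuous_on UNIV (F n)" for n
    unfolding F_def[abs_def] by (intro continuous_intros)
  have [measurable]: "g \<in> borel_measurable torus" using g by auto
  have cm: "(\<lambda>x. h (circles x)) \<in> borel_measurable torus" if "h \<in> borel_measurable borel" for h :: "complex^3 \<Rightarrow> real"
    using measurable_compose[OF borel_measurable_continuous_onI[OF continuous_circles] that]
    by (rule borel_measurable_torusI)
  have [measurable]: "(\<lambda>x. F n (circles x)) \<in> borel_measurable torus" for n
    by (intro cm borel_measurable_continuous_onI Fc)
  have [measurable]: "(\<lambda>x. indicator A (circles x) :: real) \<in> borel_measurable torus"
    using A by (intro cm borel_measurable_indicator) auto
  have lim: "(\<lambda>n. F n w) \<longlonglongrightarrow> indicator A w" for w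
  proof (cases "w \<in> A")
    case True
    then show ?thesis by (simp add: F_def)
  next
    case False
    then have d: "infdist w A > 0"
      using A \<open>A \<noteq> {}\<close> infdist_nonneg[of w A] in_closed_iff_infdist_zero[of A w] by (simp add: less_le)
    obtain n0 where n0: "1 < real n0 * infdist w A" using reals_Archimedean3[OF d] by blast
    have "F n w = 0" if "n \<ge> n0" for n
    proof -
      have "real n0 * infdist w A \<le> real n * infdist w A" using that d by (intro mult_right_mono) auto
      then show ?thesis using n0 by (simp add: F_def)
    qed
    then have "\<forall>\<^sub>F n in sequentially. F n w = indicator A w"
      using False unfolding eventually_sequentially by auto
    then show ?thesis by (rule tendsto_eventually)
  qed
  have "(\<lambda>n. \<integral>x. g x * F n (circles x) \<partial>torus) \<longlonglongrightarrow> (\<integral>x. g x * indicator A (circles x) \<partial>torus)"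
  proof (rule integral_dominated_convergence[where w="\<lambda>x. \<bar>g x\<bar>"])
    show "AE x in torus. (\<lambda>n. g x * F n (circles x)) \<longlonglongrightarrow> g x * indicator A (circles x)"
      by (intro AE_I2 tendsto_intros lim)
    have "\<bar>F n w\<bar> \<le> 1" for n w unfolding F_def using infdist_nonneg[of w A] by (auto simp: max_def)
    then have "\<bar>g x\<bar> * \<bar>F n (circles x)\<bar> \<le> \<bar>g x\<bar> * 1" for n x by (intro mult_left_mono) auto
    then show "AE x in torus. norm (g x * F n (circles x)) \<le> \<bar>g x\<bar>" for n by (simp add: abs_mult)
  qed (use g in auto)
  then show ?thesis
    unfolding continuous_circles_integral_0[OF g z Fc] using LIMSEQ_unique[OF tendsto_const] by metis
qed simp

lemma borel_circles_integral_0: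
  assumes g: "integrable torus g" and z: "\<And>k. (\<integral>x. g x * cas k x \<partial>torus) = 0"
    and A: "A \<in> sets borel"
  shows "(\<integral>x. g x * indicator A (circles x) \<partial>torus) = (0::real)"
proof -
  have st: "Int_stable (Collect closed :: (complex^3) set set)" by (intro Int_stableI) auto
  have A': "A \<in> sigma_sets UNIV (Collect closed)"
    using A by (simp add: borel_eq_closed sets_measure_of)
  have [measurable]: "g \<in> borel_measurable torus" using g by auto
  have cm: "(\<lambda>x. indicator A (circles x) :: real) \<in> borel_measurable torus" if "A \<in> sigma_sets UNIV (Collect closed)" for A
  proof -
    have "A \<in> sets borel" using that by (simp add: borel_eq_closed sets_measure_of)
    then show ?thesis
      using measurable_compose[OF borel_measurable_continuous_onI[OF continuous_circles] borel_measurable_indicator]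
      by (intro borel_measurable_torusI)
  qed
  have ci: "integrable torus (\<lambda>x. g x * indicator A (circles x))" if "A \<in> sigma_sets UNIV (Collect closed)" for A
    by (rule integrable_mult_bounded_torus[OF g cm[OF that], of 1]) (auto simp: indicator_def)
  have gz: "(\<integral>x. g x \<partial>torus) = 0" using closed_circles_integral_0[OF g z closed_UNIV] by simp
  show ?thesis
    using A'
  proof (induction rule: sigma_sets_induct_disjoint[OF st subset_UNIV[of "Collect closed", folded Pow_UNIV], consumes 1, case_names basic empty compl union])
    case (basic A)
    then show ?case using closed_circles_integral_0[OF g z] by simp
  next
    case empty
    then show ?case by simp
  next
    case (compl A)
    have "(\<integral>x. g x * indicator (UNIV - A) (circles x) \<partial>torus) = (\<integral>x. g x - g x * indicator A (circles x) \<partial>torus)"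
      by (intro Bochner_Integration.integral_cong) (auto simp: indicator_def)
    then show ?case using g ci[OF compl(1)] gz compl(2) by simp
  next
    case (union A)
    have Am: "A i \<in> sigma_sets UNIV (Collect closed)" for i using union(2) by auto
    have "(\<lambda>n. \<integral>x. (\<Sum>i<n. g x * indicator (A i) (circles x)) \<partial>torus) \<longlonglongrightarrow> (\<integral>x. g x * indicator (\<Union>i. A i) (circles x) \<partial>torus)"
    proof (rule integral_dominated_convergence[where w="\<lambda>x. \<bar>g x\<bar>"])
      show "AE x in torus. (\<lambda>n. \<Sum>i<n. g x * indicator (A i) (circles x)) \<longlonglongrightarrow> g x * indicator (\<Union>i. A i) (circles x)"
        unfolding sum_distrib_left[symmetric]
        by (intro AE_I2 tendsto_mult tendsto_const indicator_sums[unfolded sums_def])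
           (use union(1) in \<open>auto simp: disjoint_family_on_def\<close>)
      have "\<bar>\<Sum>i<n. indicator (A i) w\<bar> \<le> (1::real)" for n and w :: "complex^3"
      proof -
        have "disjoint_family_on A {..<n}" using union(1) by (auto simp: disjoint_family_on_def)
        then have "(\<Sum>i<n. indicator (A i) w) = (indicator (\<Union>i<n. A i) w :: real)"
          by (intro indicator_UN_disjoint[symmetric]) auto
        then show ?thesis by (simp add: indicator_def)
      qed
      then have "\<bar>g x\<bar> * \<bar>\<Sum>i<n. indicator (A i) (circles x)\<bar> \<le> \<bar>g x\<bar> * 1" for n x by (intro mult_left_mono) auto
      then show "AE x in torus. norm (\<Sum>i<n. g x * indicator (A i) (circles x)) \<le> \<bar>g x\<bar>" for n
        unfolding sum_distrib_left[symmetric] by (simp add: abs_mult)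
      show "(\<lambda>x. g x * indicator (\<Union>i. A i) (circles x)) \<in> borel_measurable torus"
        using cm[OF sigma_sets.Union[OF Am]] by measurable
      show "(\<lambda>x. \<Sum>i<n. g x * indicator (A i) (circles x)) \<in> borel_measurable torus" for n
        using cm[OF Am] by measurable
    qed (use g in auto)
    moreover have "(\<integral>x. (\<Sum>i<n. g x * indicator (A i) (circles x)) \<partial>torus) = 0" for n
      by (subst Bochner_Integration.integral_sum[OF ci[OF Am]]) (simp add: union(3))
    ultimately have "(\<lambda>n::nat. 0) \<longlonglongrightarrow> (\<integral>x. g x * indicator (\<Union>i. A i) (circles x) \<partial>torus)"
      by (simp only:)
    then show ?case by (rule LIMSEQ_unique[OF _ tendsto_const])
  qed
qed

definition angles :: "complex^3 \<Rightarrow> real^3" where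
  "angles z = (\<chi> i. Arg2pi (z $ i))"

lemma borel_measurable_Arg2pi: "Arg2pi \<in> borel_measurable borel"
proof -
  have "continuous_on (- \<real>\<^sub>\<ge>\<^sub>0) Arg2pi"
    by (intro continuous_at_imp_continuous_on ballI continuous_at_Arg2pi) auto
  then have "(\<lambda>z. indicator (- \<real>\<^sub>\<ge>\<^sub>0) z *\<^sub>R Arg2pi z) \<in> borel_measurable borel"
    by (intro borel_measurable_continuous_on_indicator) auto
  moreover have "(\<lambda>z. indicator (- \<real>\<^sub>\<ge>\<^sub>0) z *\<^sub>R Arg2pi z) = Arg2pi"
    by (intro ext) (auto simp: indicator_def Arg2pi_eq_0 complex_nonneg_Reals_iff complex_is_Real_iff)
  ultimately show ?thesis by (simp only:)
qed

lemma borel_measurable_angles: "angles \<in> borel_measurable borel"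
proof (subst borel_measurable_euclidean_space, intro ballI)
  fix b :: "real^3" assume b0: "b \<in> Basis"
  then obtain i where b: "b = axis i 1" by (auto simp: Basis_vec_def)
  have "(\<lambda>z :: complex^3. Arg2pi (z $ i)) \<in> borel_measurable borel"
    by (intro measurable_compose[OF _ borel_measurable_Arg2pi] borel_measurable_continuous_onI continuous_intros)
  then show "(\<lambda>z. angles z \<bullet> b) \<in> borel_measurable borel"
    by (simp add: b angles_def inner_axis)
qed

lemma angles_circles: "x \<in> space torus \<Longrightarrow> angles (circles x) = x"
  unfolding angles_def circles_def vec_eq_iff
  by (auto simp: space_torus cis_conv_exp intro!: Arg2pi_unique[of 1])

lemma cas_complete:
  assumes g: "integrable torus g" and z: "\<And>k. (\<integral>x. g x * cas k x \<partial>torus) = 0"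
  shows "AE x in torus. g x = (0::real)"
proof -
  have [measurable]: "g \<in> borel_measurable torus" using g by auto
  have set0: "(\<integral>x. g x * indicator A x \<partial>torus) = 0" if "A \<in> sets torus" for A
  proof -
    have "angles -` A \<in> sets borel"
      using measurable_sets[OF borel_measurable_angles sets_torus[OF that]] by simp
    from borel_circles_integral_0[OF g z this] have "(\<integral>x. g x * indicator (angles -` A) (circles x) \<partial>torus) = 0" .
    moreover have "(\<integral>x. g x * indicator (angles -` A) (circles x) \<partial>torus) = (\<integral>x. g x * indicator A x \<partial>torus)"
      by (intro Bochner_Integration.integral_cong) (auto simp: indicator_def angles_circles)
    ultimately show ?thesis by simp
  qed
  have pos: "AE x in torus. s * g x \<le> 0" if s: "s = 1 \<or> s = -1" for s
  proof -
    let ?A = "{x \<in> space torus. s * g x > 0}"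
    have A: "?A \<in> sets torus" by measurable
    have i: "integrable torus (\<lambda>x. s * (g x * indicator ?A x))"
      by (intro integrable_mult_right integrable_mult_bounded_torus[OF g, of _ 1] borel_measurable_indicator A)
         (auto simp: indicator_def)
    have "(\<integral>x. s * (g x * indicator ?A x) \<partial>torus) = 0" using set0[OF A] by simp
    then have "AE x in torus. s * (g x * indicator ?A x) = 0"
      using integral_nonneg_eq_0_iff_AE[OF i] by (auto simp: indicator_def)
    with AE_space show ?thesis by eventually_elim (auto simp: indicator_def split: if_splits)
  qed
  show ?thesis using pos[OF disjI1[OF refl]] pos[OF disjI2[OF refl]] by eventually_elim simp
qed

subsection \<open>Sobolev spaces in terms of coefficients\<close>

lemma inner_abs_l2:
  assumes "square_integrable f"
  shows "u \<bullet> abs_l2 f = (\<integral>x. rep_l2 u x \<bullet> f x \<partial>torus)"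
proof -
  have "abs_l2 (rep_l2 u) \<bullet> abs_l2 f = (\<integral>x. rep_l2 u x \<bullet> f x \<partial>torus)"
    by (rule inner_l2.abs_eq) (use assms abs_rep_l2(1) in auto)
  then show ?thesis by (simp add: abs_rep_l2)
qed

lemma square_integrable_continuous:
  assumes c: "continuous_on UNIV f"
  shows "square_integrable f"
proof -
  obtain M where M: "\<And>x. x \<in> space torus \<Longrightarrow> norm (f x) \<le> M" using torus_bounded[OF c] by blast
  have m[measurable]: "f \<in> borel_measurable torus" by (intro borel_measurable_torusI borel_measurable_continuous_onI c)
  have "norm ((norm (f x))\<^sup>2) \<le> M\<^sup>2" if "x \<in> space torus" for x
    using M[OF that] by (simp add: power_mono)
  then show ?thesis unfolding square_integrable_def
    by (auto intro!: torus.integrable_const_bound[where B="M\<^sup>2"] AE_I2)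
qed

lemma rep_abs_l2: "square_integrable f \<Longrightarrow> AE x in torus. rep_l2 (abs_l2 f) x = f x"
  using Quotient_rep_abs[OF Quotient_l2, of f] by auto

lemma l2_eq_iff: "u = v \<longleftrightarrow> (AE x in torus. rep_l2 u x = rep_l2 v x)"
proof
  assume "AE x in torus. rep_l2 u x = rep_l2 v x"
  from abs_l2_eq[OF abs_rep_l2(1) abs_rep_l2(1) this] show "u = v" by (simp add: abs_rep_l2)
qed simp

lemma rep_l2_add: "AE x in torus. rep_l2 (u + v) x = rep_l2 u x + rep_l2 v x"
proof -
  have "u + v = abs_l2 (\<lambda>x. rep_l2 u x + rep_l2 v x)"
    using plus_l2.abs_eq[of "rep_l2 u" "rep_l2 v"] abs_rep_l2 by simp
  then show ?thesis using rep_abs_l2[OF square_integrable_add[OF abs_rep_l2(1)[of u] abs_rep_l2(1)[of v]]] by simp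
qed

lemma rep_l2_scaleR: "AE x in torus. rep_l2 (r *\<^sub>R u) x = r *\<^sub>R rep_l2 u x"
proof -
  have "r *\<^sub>R u = abs_l2 (\<lambda>x. r *\<^sub>R rep_l2 u x)"
    using scaleR_l2.abs_eq[of "rep_l2 u" r] abs_rep_l2 by simp
  then show ?thesis using rep_abs_l2[OF square_integrable_scaleR[OF abs_rep_l2(1)[of u]]] by simp
qed

definition mode :: "nat \<Rightarrow> (int^3) \<times> 3" where
  "mode = from_nat_into UNIV"

lemma bij_mode: "bij mode"
proof -
  have c: "countable (UNIV :: ((int^3) \<times> 3) set)"
    unfolding UNIV_Times_UNIV[symmetric] by (intro countable_SIGMA) (auto intro: countable_finite)
  have "infinite (UNIV :: ((int^3) \<times> 3) set)"
  proof
    assume "finite (UNIV :: ((int^3) \<times> 3) set)"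
    then have "finite (range (\<lambda>p :: (int^3) \<times> 3. fst p $ 1))" by (rule finite_imageI)
    moreover have "range (\<lambda>p :: (int^3) \<times> 3. fst p $ 1) = UNIV"
    proof (intro set_eqI iffI UNIV_I)
      fix a :: int
      show "a \<in> range (\<lambda>p :: (int^3) \<times> 3. fst p $ 1)"
        by (rule image_eqI[of _ _ "(\<chi> i. a, 1)"]) auto
    qed
    ultimately show False using infinite_UNIV_int by simp
  qed
  then show ?thesis unfolding mode_def using bij_betw_from_nat_into[OF c] by blast
qed

definition freq :: "3 \<Rightarrow> nat \<Rightarrow> real" where
  "freq j n = real_of_int (fst (mode n) $ j)"

definition weight :: "nat \<Rightarrow> real" where
  "weight n = 1 + (\<Sum>j\<in>UNIV. (freq j n)\<^sup>2)"

text \<open>Differentiation turns \<open>cas k\<close> into a multiple of \<open>cas (- k)\<close>.\<close>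

definition reflect :: "nat \<Rightarrow> nat" where
  "reflect n = inv mode (- fst (mode n), snd (mode n))"

definition basis_field :: "nat \<Rightarrow> real^3 \<Rightarrow> real^3" where
  "basis_field n x = (cas (fst (mode n)) x / sqrt torus_volume) *\<^sub>R axis (snd (mode n)) 1"

definition basis :: "nat \<Rightarrow> l2" where
  "basis n = abs_l2 (basis_field n)"

lemma mode_reflect: "mode (reflect n) = (- fst (mode n), snd (mode n))"
  unfolding reflect_def using bij_mode by (simp add: bij_is_surj surj_f_inv_f)

lemma reflect_reflect [simp]: "reflect (reflect n) = n"
  using bij_mode by (simp add: reflect_def[of "reflect n"] mode_reflect bij_is_inj)

lemma bij_reflect: "bij reflect"
  by (rule o_bij[of reflect]) (auto simp: fun_eq_iff)

lemma freq_reflect [simp]: "freq j (reflect n) = - freq j n"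
  by (simp add: freq_def mode_reflect)

lemma weight_reflect [simp]: "weight (reflect n) = weight n"
  by (simp add: weight_def)

lemma continuous_basis_field: "continuous_on S (basis_field n)"
  unfolding basis_field_def[abs_def] using torus_volume_pos
  by (intro continuous_intros continuous_cas) auto

lemma square_integrable_basis_field: "square_integrable (basis_field n)"
  by (rule square_integrable_continuous[OF continuous_basis_field])

lemma basis_inner: "u \<bullet> basis n = (\<integral>x. rep_l2 u x \<bullet> basis_field n x \<partial>torus)"
  unfolding basis_def by (rule inner_abs_l2[OF square_integrable_basis_field])

lemma basis_orthonormal: "basis i \<bullet> basis j = (if i = j then 1 else 0)"
proof -
  have "basis i \<bullet> basis j = (\<integral>x. basis_field i x \<bullet> basis_field j x \<partial>torus)"
    unfolding basis_def by (rule inner_l2.abs_eq) (use square_integrable_basis_field in auto)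
  also have "\<dots> = (\<integral>x. (cas (fst (mode i)) x * cas (fst (mode j)) x) * ((axis (snd (mode i)) 1 :: real^3) \<bullet> axis (snd (mode j)) 1 / torus_volume) \<partial>torus)"
    using torus_volume_pos by (intro Bochner_Integration.integral_cong) (auto simp: basis_field_def)
  also have "\<dots> = (if fst (mode i) = fst (mode j) then torus_volume else 0) * ((axis (snd (mode i)) 1 :: real^3) \<bullet> axis (snd (mode j)) 1 / torus_volume)"
    by (simp add: cas_orthogonal)
  also have "\<dots> = (if i = j then 1 else 0)"
    using torus_volume_pos bij_mode by (auto simp: inner_axis_axis prod_eq_iff bij_def inj_def)
  finally show ?thesis .
qed

lemma basis_complete:
  assumes z: "\<And>n. u \<bullet> basis n = 0"
  shows "u = 0"
proof -
  have rm: "rep_l2 u \<in> borel_measurable torus" using abs_rep_l2(1) by (simp add: square_integrable_def)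
  have "AE x in torus. rep_l2 u x $ i = 0" for i
  proof (rule cas_complete)
    have sq: "square_integrable (\<lambda>x. axis i (1::real))" by (rule square_integrable_continuous) auto
    from square_integrable_inner[OF abs_rep_l2(1)[of u] this]
    show "integrable torus (\<lambda>x. rep_l2 u x $ i)" by (simp add: inner_axis)
    fix k
    obtain n where n: "mode n = (k, i)" using bij_mode by (metis bij_pointE)
    have "u \<bullet> basis n = (\<integral>x. (rep_l2 u x $ i * cas k x) / sqrt torus_volume \<partial>torus)"
      unfolding basis_inner by (intro Bochner_Integration.integral_cong) (auto simp: basis_field_def n inner_axis)
    then show "(\<integral>x. rep_l2 u x $ i * cas k x \<partial>torus) = 0" using z[of n] torus_volume_pos by simp
  qed
  then have "AE x in torus. \<forall>i\<in>UNIV. rep_l2 u x $ i = 0" by (intro AE_finite_allI) auto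
  then have "AE x in torus. rep_l2 u x = 0" by eventually_elim (simp add: vec_eq_iff)
  from abs_l2_eq[OF abs_rep_l2(1) _ this] show ?thesis
    by (simp add: abs_rep_l2 zero_l2_def square_integrable_continuous)
qed

interpretation fourier: weighted_basis basis weight
  by unfold_locales (auto simp: basis_orthonormal weight_def sum_nonneg intro: basis_complete)

lemma cas_has_derivative: "(cas k has_derivative (\<lambda>h. (wave k \<bullet> h) * cas (- k) x)) (at x)"
  unfolding cas_def[abs_def]
  by (auto intro!: derivative_eq_intros simp: wave_simps algebra_simps)

lemma basis_field_has_derivative:
  "(basis_field n has_derivative (\<lambda>h. (wave (fst (mode n)) \<bullet> h) *\<^sub>R basis_field (reflect n) x)) (at x)"
proof -
  have "((\<lambda>x. (cas (fst (mode n)) x / sqrt torus_volume) *\<^sub>R (axis (snd (mode n)) 1 :: real^3)) has_derivative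
      (\<lambda>h. ((wave (fst (mode n)) \<bullet> h) * cas (- fst (mode n)) x / sqrt torus_volume) *\<^sub>R axis (snd (mode n)) 1)) (at x)"
    unfolding divide_inverse
    by (intro has_derivative_scaleR_left has_derivative_mult_left cas_has_derivative)
  then show ?thesis by (simp add: basis_field_def[abs_def] mode_reflect)
qed

lemma C_k_basis_field: "C_k K (\<lambda>x. r *\<^sub>R basis_field n x)"
proof (induction K arbitrary: r n)
  case 0
  show ?case by (auto intro!: continuous_intros continuous_basis_field)
next
  case (Suc K)
  have d: "((\<lambda>x. r *\<^sub>R basis_field n x) has_derivative (\<lambda>h. r *\<^sub>R ((wave (fst (mode n)) \<bullet> h) *\<^sub>R basis_field (reflect n) x))) (at x)" for x
    by (intro has_derivative_scaleR_right basis_field_has_derivative)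
  have "frechet_derivative (\<lambda>x. r *\<^sub>R basis_field n x) (at x) = (\<lambda>h. (r * (wave (fst (mode n)) \<bullet> h)) *\<^sub>R basis_field (reflect n) x)" for x
    using frechet_derivative_at[OF d[of x]] by simp
  moreover have "(\<lambda>x. r *\<^sub>R basis_field n x) differentiable (at x)" for x
    using d[of x] unfolding differentiable_def by blast
  ultimately show ?case using Suc by simp
qed

lemma basis_field_test: "torus_test_field (basis_field n)"
proof -
  have "C_k K (basis_field n)" for K using C_k_basis_field[of K 1 n] by simp
  then show ?thesis by (simp add: torus_test_field_def C_infinity_def basis_field_def cas_periodic)
qed

lemma frechet_derivative_basis_field:
  "frechet_derivative (basis_field n) (at x) (axis j 1) = freq j n *\<^sub>R basis_field (reflect n) x"
  using frechet_derivative_at[OF basis_field_has_derivative[of n x]]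
  by (metis freq_def wave_axis)

lemma torus_test_fieldD:
  assumes "torus_test_field \<psi>"
  shows "\<psi> differentiable (at x)" "continuous_on UNIV \<psi>"
    "continuous_on UNIV (\<lambda>x. frechet_derivative \<psi> (at x) (axis j 1))" "\<psi> (x + (2 * pi) *\<^sub>R axis j 1) = \<psi> x"
proof -
  have "C_k 0 \<psi>" "C_k (Suc 0) \<psi>" using assms by (auto simp only: torus_test_field_def C_infinity_def)
  moreover have "axis j 1 \<in> (Basis :: (real^3) set)" by (auto simp: Basis_vec_def)
  ultimately show "\<psi> differentiable (at x)" "continuous_on UNIV \<psi>"
    "continuous_on UNIV (\<lambda>x. frechet_derivative \<psi> (at x) (axis j 1))" by auto
  show "\<psi> (x + (2 * pi) *\<^sub>R axis j 1) = \<psi> x" using assms by (simp add: torus_test_field_def)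
qed

lemma torus_integration_by_parts:
  assumes \<psi>: "torus_test_field \<psi>" and \<zeta>: "torus_test_field \<zeta>"
  shows "(\<integral>x. frechet_derivative \<psi> (at x) (axis j 1) \<bullet> \<zeta> x \<partial>torus)
    = - (\<integral>x. \<psi> x \<bullet> frechet_derivative \<zeta> (at x) (axis j 1) \<partial>torus)"
proof -
  note p = torus_test_fieldD[OF \<psi>] and c = torus_test_fieldD[OF \<zeta>]
  let ?P = "\<lambda>x. frechet_derivative \<psi> (at x)" and ?C = "\<lambda>x. frechet_derivative \<zeta> (at x)"
  have d: "((\<lambda>x. \<psi> x \<bullet> \<zeta> x) has_derivative (\<lambda>h. \<psi> x \<bullet> ?C x h + ?P x h \<bullet> \<zeta> x)) (at x)" for x
    using p(1) c(1) by (intro has_derivative_inner) (simp_all add: frechet_derivative_works[symmetric])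
  have fd: "frechet_derivative (\<lambda>x. \<psi> x \<bullet> \<zeta> x) (at x) = (\<lambda>h. \<psi> x \<bullet> ?C x h + ?P x h \<bullet> \<zeta> x)" for x
    using frechet_derivative_at[OF d[of x]] by simp
  have "(\<integral>x. frechet_derivative (\<lambda>x. \<psi> x \<bullet> \<zeta> x) (at x) (axis j 1) \<partial>torus) = 0"
  proof (rule torus_integral_derivative_0)
    show "(\<lambda>x. \<psi> x \<bullet> \<zeta> x) differentiable (at x)" for x using d unfolding differentiable_def by blast
    show "continuous_on UNIV (\<lambda>x. frechet_derivative (\<lambda>x. \<psi> x \<bullet> \<zeta> x) (at x) (axis j 1))"
      unfolding fd by (intro continuous_intros p c)
  qed (simp add: p(4) c(4))
  moreover have "integrable torus (\<lambda>x. \<psi> x \<bullet> ?C x (axis j 1))" "integrable torus (\<lambda>x. ?P x (axis j 1) \<bullet> \<zeta> x)"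
    by (intro square_integrable_inner square_integrable_continuous p c)+
  ultimately show ?thesis unfolding fd by simp
qed

lemma has_weak_pd_coeff:
  assumes "has_weak_pd u w j"
  shows "w \<bullet> basis n = - freq j n * (u \<bullet> basis (reflect n))"
proof -
  have "(\<integral>x. rep_l2 u x \<bullet> (freq j n *\<^sub>R basis_field (reflect n) x) \<partial>torus) = - (\<integral>x. rep_l2 w x \<bullet> basis_field n x \<partial>torus)"
    using assms basis_field_test[of n] unfolding has_weak_pd_def frechet_derivative_basis_field[symmetric] by blast
  then show ?thesis unfolding basis_inner by simp
qed

lemma sums_bij:
  fixes f :: "nat \<Rightarrow> real"
  assumes "bij \<sigma>" "summable (\<lambda>n. norm (f n))" "f sums S"
  shows "(\<lambda>n. f (\<sigma> n)) sums S"
  using norm_summable_imp_has_sum[OF assms(2,3)] has_sum_reindex_bij_betw[OF assms(1), of f S]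
  by (intro has_sum_imp_sums) simp

lemma summable_reflect:
  fixes f :: "nat \<Rightarrow> real"
  assumes "summable f" "\<And>n. 0 \<le> f n"
  shows "summable (\<lambda>n. f (reflect n))" "(\<Sum>n. f (reflect n)) = (\<Sum>n. f n)"
  using sums_bij[OF bij_reflect, of f] assms summable_sums[OF assms(1)] by (auto simp: sums_iff)

lemma summable_inner_coeff: "summable (\<lambda>n. norm ((u \<bullet> basis n) * (v \<bullet> basis n)))"
proof (rule summable_comparison_test[OF _ summable_add[OF fourier.summable_coeff[of u] fourier.summable_coeff[of v]]],
    intro exI allI impI)
  fix n
  have "2 * (\<bar>u \<bullet> basis n\<bar> * \<bar>v \<bullet> basis n\<bar>) \<le> (u \<bullet> basis n)\<^sup>2 + (v \<bullet> basis n)\<^sup>2"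
    using sum_squares_bound[of "\<bar>u \<bullet> basis n\<bar>" "\<bar>v \<bullet> basis n\<bar>"] by (simp add: mult.assoc)
  moreover have "0 \<le> \<bar>u \<bullet> basis n\<bar> * \<bar>v \<bullet> basis n\<bar>" by simp
  ultimately show "norm (norm ((u \<bullet> basis n) * (v \<bullet> basis n))) \<le> (u \<bullet> basis n)\<^sup>2 + (v \<bullet> basis n)\<^sup>2"
    unfolding abs_mult real_norm_def abs_abs by linarith
qed

lemma has_weak_pdI:
  assumes w: "\<And>n. w \<bullet> basis n = - freq j n * (u \<bullet> basis (reflect n))"
  shows "has_weak_pd u w j"
  unfolding has_weak_pd_def
proof (intro allI impI)
  fix \<psi> assume \<psi>: "torus_test_field \<psi>"
  note p = torus_test_fieldD[OF \<psi>]
  let ?D = "\<lambda>x. frechet_derivative \<psi> (at x) (axis j 1)"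
  have sq: "square_integrable \<psi>" "square_integrable ?D" by (intro square_integrable_continuous p)+
  have D: "abs_l2 ?D \<bullet> basis n = - freq j n * (abs_l2 \<psi> \<bullet> basis (reflect n))" for n
  proof -
    have "abs_l2 ?D \<bullet> basis n = (\<integral>x. ?D x \<bullet> basis_field n x \<partial>torus)"
      unfolding basis_def by (rule inner_l2.abs_eq) (use sq square_integrable_basis_field in auto)
    also have "\<dots> = - (\<integral>x. \<psi> x \<bullet> (freq j n *\<^sub>R basis_field (reflect n) x) \<partial>torus)"
      using torus_integration_by_parts[OF \<psi> basis_field_test[of n]] unfolding frechet_derivative_basis_field .
    also have "\<dots> = - freq j n * (\<integral>x. \<psi> x \<bullet> basis_field (reflect n) x \<partial>torus)" by simp
    also have "(\<integral>x. \<psi> x \<bullet> basis_field (reflect n) x \<partial>torus) = abs_l2 \<psi> \<bullet> basis (reflect n)"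
      unfolding basis_def by (rule inner_l2.abs_eq[symmetric]) (use sq square_integrable_basis_field in auto)
    finally show ?thesis .
  qed
  have "(\<lambda>n. (u \<bullet> basis (reflect n)) * (abs_l2 ?D \<bullet> basis (reflect n))) sums (u \<bullet> abs_l2 ?D)"
    by (rule sums_bij[OF bij_reflect summable_inner_coeff fourier.parseval_inner])
  moreover have "(\<lambda>n. - ((w \<bullet> basis n) * (abs_l2 \<psi> \<bullet> basis n))) sums (- (w \<bullet> abs_l2 \<psi>))"
    by (intro sums_minus fourier.parseval_inner)
  moreover have "(u \<bullet> basis (reflect n)) * (abs_l2 ?D \<bullet> basis (reflect n)) = - ((w \<bullet> basis n) * (abs_l2 \<psi> \<bullet> basis n))" for n
    by (simp add: D w)
  ultimately have "u \<bullet> abs_l2 ?D = - (w \<bullet> abs_l2 \<psi>)" by (simp add: sums_iff)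
  then show "(\<integral>x. rep_l2 u x \<bullet> ?D x \<partial>torus) = - (\<integral>x. rep_l2 w x \<bullet> \<psi> x \<partial>torus)"
    by (simp add: inner_abs_l2 sq)
qed

lemma pd_eq:
  assumes "has_weak_pd u w j"
  shows "pd j u = w"
  unfolding pd_def
proof (rule the_equality[of _ w])
  fix v assume "has_weak_pd u v j"
  then show "v = w" using has_weak_pd_coeff assms by (intro fourier.basis_eqI) metis
qed (rule assms)

lemma ex_weak_pd_iff: "(\<exists>w. has_weak_pd u w j) \<longleftrightarrow> summable (\<lambda>n. (freq j n)\<^sup>2 * (u \<bullet> basis n)\<^sup>2)"
proof
  assume "\<exists>w. has_weak_pd u w j"
  then obtain w where w: "has_weak_pd u w j" by blast
  have "summable (\<lambda>n. (w \<bullet> basis (reflect n))\<^sup>2)"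
    by (rule summable_reflect(1)[OF fourier.summable_coeff]) simp
  then show "summable (\<lambda>n. (freq j n)\<^sup>2 * (u \<bullet> basis n)\<^sup>2)"
    by (simp add: has_weak_pd_coeff[OF w] power_mult_distrib)
next
  assume "summable (\<lambda>n. (freq j n)\<^sup>2 * (u \<bullet> basis n)\<^sup>2)"
  from summable_reflect(1)[OF this]
  have "summable (\<lambda>n. (- freq j n * (u \<bullet> basis (reflect n)))\<^sup>2)" by (simp add: power_mult_distrib)
  from fourier.riesz_fischer[OF this] obtain w where "\<forall>n. w \<bullet> basis n = - freq j n * (u \<bullet> basis (reflect n))"
    by blast
  then have "has_weak_pd u w j" by (intro has_weak_pdI) simp
  then show "\<exists>w. has_weak_pd u w j" ..
qed

lemma pd_inner:
  assumes "summable (\<lambda>n. (freq j n)\<^sup>2 * (u \<bullet> basis n)\<^sup>2)"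
  shows "pd j u \<bullet> basis n = - freq j n * (u \<bullet> basis (reflect n))"
  using assms has_weak_pd_coeff pd_eq unfolding ex_weak_pd_iff[symmetric] by metis

lemma weight_split: "weight n ^ s * c = c * weight n ^ s" "weight n * c = c + (\<Sum>j\<in>UNIV. (freq j n)\<^sup>2 * c)"
  by (simp_all add: weight_def distrib_right sum_distrib_right)

lemma H_Suc_iff: "u \<in> fourier.H (Suc s) \<longleftrightarrow>
    u \<in> fourier.H s \<and> (\<forall>j. summable (\<lambda>n. weight n ^ s * ((freq j n)\<^sup>2 * (u \<bullet> basis n)\<^sup>2)))"
proof -
  have w: "weight n ^ Suc s * (u \<bullet> basis n)\<^sup>2
      = weight n ^ s * (u \<bullet> basis n)\<^sup>2 + (\<Sum>j\<in>UNIV. weight n ^ s * ((freq j n)\<^sup>2 * (u \<bullet> basis n)\<^sup>2))" for n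
    by (simp add: weight_split(2)[of n "(u \<bullet> basis n)\<^sup>2"] mult.assoc mult.left_commute[of "weight n"] distrib_left sum_distrib_left)
  have nn: "0 \<le> weight n ^ s * ((freq j n)\<^sup>2 * (u \<bullet> basis n)\<^sup>2)" for n j
    using fourier.m_nonneg by simp
  show ?thesis
  proof safe
    assume u: "u \<in> fourier.H (Suc s)"
    then show "u \<in> fourier.H s" by (rule fourier.H_mono) simp
    fix j
    show "summable (\<lambda>n. weight n ^ s * ((freq j n)\<^sup>2 * (u \<bullet> basis n)\<^sup>2))"
    proof (rule summable_comparison_test[OF _ u[unfolded fourier.H_def mem_Collect_eq]], intro exI allI impI)
      fix n
      have "weight n ^ s * ((freq j n)\<^sup>2 * (u \<bullet> basis n)\<^sup>2) \<le> (\<Sum>j\<in>UNIV. weight n ^ s * ((freq j n)\<^sup>2 * (u \<bullet> basis n)\<^sup>2))"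
        by (rule member_le_sum) (use nn in auto)
      then show "norm (weight n ^ s * ((freq j n)\<^sup>2 * (u \<bullet> basis n)\<^sup>2)) \<le> weight n ^ Suc s * (u \<bullet> basis n)\<^sup>2"
        unfolding w using nn[of n j] fourier.weight_nonneg[of n s u] by simp
    qed
  next
    assume "u \<in> fourier.H s" "\<forall>j. summable (\<lambda>n. weight n ^ s * ((freq j n)\<^sup>2 * (u \<bullet> basis n)\<^sup>2))"
    then show "u \<in> fourier.H (Suc s)"
      unfolding fourier.H_def mem_Collect_eq w by (intro summable_add summable_sum) auto
  qed
qed

lemma N_Suc:
  assumes "u \<in> fourier.H (Suc s)"
  shows "fourier.N (Suc s) u = fourier.N s u + (\<Sum>j\<in>UNIV. \<Sum>n. weight n ^ s * ((freq j n)\<^sup>2 * (u \<bullet> basis n)\<^sup>2))"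
proof -
  have w: "weight n ^ Suc s * (u \<bullet> basis n)\<^sup>2
      = weight n ^ s * (u \<bullet> basis n)\<^sup>2 + (\<Sum>j\<in>UNIV. weight n ^ s * ((freq j n)\<^sup>2 * (u \<bullet> basis n)\<^sup>2))" for n
    by (simp add: weight_split(2)[of n "(u \<bullet> basis n)\<^sup>2"] mult.assoc mult.left_commute[of "weight n"] distrib_left sum_distrib_left)
  have s: "u \<in> fourier.H s" "\<And>j. summable (\<lambda>n. weight n ^ s * ((freq j n)\<^sup>2 * (u \<bullet> basis n)\<^sup>2))"
    using assms unfolding H_Suc_iff by auto
  show ?thesis
    unfolding fourier.N_def w using s(1)[unfolded fourier.H_def] s(2)
    by (simp add: suminf_add[symmetric] suminf_sum summable_sum)
qed

lemma H_0: "u \<in> fourier.H 0"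
  using fourier.summable_coeff[of u] by (simp add: fourier.H_def)

lemma N_0: "fourier.N 0 u = (norm u)\<^sup>2"
  using fourier.parseval[of u] by (simp add: fourier.N_def sums_iff)

lemma pd_weighted:
  assumes "summable (\<lambda>n. (freq j n)\<^sup>2 * (u \<bullet> basis n)\<^sup>2)"
  shows "pd j u \<in> fourier.H s \<longleftrightarrow> summable (\<lambda>n. weight n ^ s * ((freq j n)\<^sup>2 * (u \<bullet> basis n)\<^sup>2))"
    and "pd j u \<in> fourier.H s \<Longrightarrow> fourier.N s (pd j u) = (\<Sum>n. weight n ^ s * ((freq j n)\<^sup>2 * (u \<bullet> basis n)\<^sup>2))"
proof -
  let ?f = "\<lambda>n. weight n ^ s * ((freq j n)\<^sup>2 * (u \<bullet> basis n)\<^sup>2)"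
  have nn: "0 \<le> ?f n" for n using fourier.m_nonneg by simp
  have e: "weight n ^ s * (pd j u \<bullet> basis n)\<^sup>2 = ?f (reflect n)" for n
    by (simp add: pd_inner[OF assms] power_mult_distrib)
  have e': "?f n = weight (reflect n) ^ s * (pd j u \<bullet> basis (reflect n))\<^sup>2" for n
    unfolding e by simp
  show iff: "pd j u \<in> fourier.H s \<longleftrightarrow> summable ?f"
  proof
    assume "pd j u \<in> fourier.H s"
    from summable_reflect(1)[OF this[unfolded fourier.H_def mem_Collect_eq] fourier.weight_nonneg]
    show "summable ?f" unfolding e' .
  next
    assume "summable ?f"
    from summable_reflect(1)[OF this nn] show "pd j u \<in> fourier.H s" unfolding fourier.H_def mem_Collect_eq e .
  qed
  show "fourier.N s (pd j u) = (\<Sum>n. ?f n)" if "pd j u \<in> fourier.H s"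
    unfolding fourier.N_def e by (rule summable_reflect(2)) (use that iff nn in auto)
qed

lemma sobolev_Suc_H:
  assumes "sobolev s = fourier.H s"
  shows "sobolev (Suc s) = fourier.H (Suc s)"
proof (rule set_eqI)
  fix u
  have le: "summable (\<lambda>n. (freq j n)\<^sup>2 * (u \<bullet> basis n)\<^sup>2)" if "summable (\<lambda>n. weight n ^ s * ((freq j n)\<^sup>2 * (u \<bullet> basis n)\<^sup>2))" for j
  proof (rule summable_comparison_test[OF _ that], intro exI allI impI)
    fix n
    have "1 \<le> weight n ^ s" using fourier.m_ge_1 by (rule one_le_power)
    then show "norm ((freq j n)\<^sup>2 * (u \<bullet> basis n)\<^sup>2) \<le> weight n ^ s * ((freq j n)\<^sup>2 * (u \<bullet> basis n)\<^sup>2)"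
      using mult_right_mono[of 1 "weight n ^ s" "(freq j n)\<^sup>2 * (u \<bullet> basis n)\<^sup>2"] by simp
  qed
  have "u \<in> sobolev (Suc s) \<longleftrightarrow> (\<forall>j. summable (\<lambda>n. weight n ^ s * ((freq j n)\<^sup>2 * (u \<bullet> basis n)\<^sup>2)))"
  proof -
    have "(\<exists>w. has_weak_pd u w j) \<and> pd j u \<in> fourier.H s
        \<longleftrightarrow> summable (\<lambda>n. weight n ^ s * ((freq j n)\<^sup>2 * (u \<bullet> basis n)\<^sup>2))" for j
      using le[of j] pd_weighted(1)[of j u s] unfolding ex_weak_pd_iff by blast
    then show ?thesis by (simp add: assms)
  qed
  moreover have "u \<in> fourier.H s" if "\<forall>j. summable (\<lambda>n. weight n ^ s * ((freq j n)\<^sup>2 * (u \<bullet> basis n)\<^sup>2))"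
    using that
  proof (induction s)
    case 0
    show ?case by (rule H_0)
  next
    case (Suc s)
    have "summable (\<lambda>n. weight n ^ s * ((freq j n)\<^sup>2 * (u \<bullet> basis n)\<^sup>2))" for j
    proof (rule summable_comparison_test[OF _ Suc.prems[rule_format, of j]], intro exI allI impI)
      fix n
      have "weight n ^ s \<le> weight n ^ Suc s" using fourier.m_ge_1[of n] by (intro power_increasing) auto
      then show "norm (weight n ^ s * ((freq j n)\<^sup>2 * (u \<bullet> basis n)\<^sup>2)) \<le> weight n ^ Suc s * ((freq j n)\<^sup>2 * (u \<bullet> basis n)\<^sup>2)"
        using fourier.m_nonneg[of n] by (simp add: abs_mult mult_right_mono del: power_Suc)
    qed
    then show ?case using Suc.IH unfolding H_Suc_iff by blast
  qed
  ultimately show "u \<in> sobolev (Suc s) \<longleftrightarrow> u \<in> fourier.H (Suc s)" unfolding H_Suc_iff by blast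
qed

lemma sobolev_H: "sobolev s = fourier.H s"
  by (induction s) (simp add: H_0 set_eq_iff, rule sobolev_Suc_H)

lemma H_freq: "u \<in> fourier.H 1 \<Longrightarrow> summable (\<lambda>n. (freq j n)\<^sup>2 * (u \<bullet> basis n)\<^sup>2)"
  using H_Suc_iff[of u 0] by (simp add: One_nat_def)

lemma norm_pd:
  assumes "u \<in> fourier.H 1"
  shows "(\<Sum>j\<in>UNIV. (norm (pd j u))\<^sup>2) = fourier.N 1 u - (norm u)\<^sup>2"
  using N_Suc[of u 0] assms pd_weighted(2)[OF H_freq[OF assms] H_0]
  by (simp add: One_nat_def N_0)

lemma sobolev_norm_1: "u \<in> fourier.H 1 \<Longrightarrow> sobolev_norm 1 u = sqrt (fourier.N 1 u)"
  by (simp add: One_nat_def[of] norm_pd[unfolded One_nat_def])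

lemma pd_H1: "u \<in> fourier.H 2 \<Longrightarrow> pd j u \<in> fourier.H 1"
  using pd_weighted(1)[OF H_freq[OF fourier.H_mono[of u 2 1]], of j 1] H_Suc_iff[of u 1]
  by (simp add: numeral_2_eq_2 One_nat_def)

lemma sobolev_norm_2:
  assumes "u \<in> fourier.H 2"
  shows "sobolev_norm 2 u = sqrt ((norm u)\<^sup>2 + (fourier.N 2 u - fourier.N 1 u))"
proof -
  have u1: "u \<in> fourier.H 1" using assms by (rule fourier.H_mono) simp
  have "(sobolev_norm 1 (pd j u))\<^sup>2 = (\<Sum>n. weight n ^ 1 * ((freq j n)\<^sup>2 * (u \<bullet> basis n)\<^sup>2))" for j
    using sobolev_norm_1[OF pd_H1[OF assms]] fourier.N_nonneg[OF pd_H1[OF assms]]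
      pd_weighted(2)[OF H_freq[OF u1] pd_H1[OF assms]] by simp
  then show ?thesis
    using N_Suc[of u 1] assms by (simp add: numeral_2_eq_2 One_nat_def)
qed

lemma pd_pd_inner:
  assumes "u \<in> fourier.H 2"
  shows "pd j (pd j u) \<bullet> basis n = - (freq j n)\<^sup>2 * (u \<bullet> basis n)"
  using pd_inner[OF H_freq[OF pd_H1[OF assms]]] pd_inner[OF H_freq[OF fourier.H_mono[OF assms, of 1]]]
  by (simp add: power2_eq_square)

lemma laplacian_inner:
  assumes "u \<in> fourier.H 2"
  shows "laplacian u \<bullet> basis n = (1 - weight n) * (u \<bullet> basis n)"
  by (simp add: laplacian_def inner_sum_left pd_pd_inner[OF assms] weight_def sum_negf sum_distrib_right)

subsection \<open>The convection term\<close>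

lemma summable_decay: "summable (\<lambda>n. (1 + (real n)\<^sup>2) powr (-2/3))"
proof (rule summable_comparison_test_ev)
  show "summable (\<lambda>n. real n powr (-4/3))" by (simp add: summable_real_powr_iff)
  show "\<forall>\<^sub>F n in sequentially. norm ((1 + (real n)\<^sup>2) powr (-2/3)) \<le> real n powr (-4/3)"
    using eventually_gt_at_top[of 0]
  proof eventually_elim
    case (elim n)
    have "(1 + (real n)\<^sup>2) powr (-2/3) \<le> ((real n)\<^sup>2) powr (-2/3)"
      by (rule powr_mono2') (use elim in auto)
    also have "((real n)\<^sup>2) powr (-2/3) = real n powr (-4/3)"
    proof -
      have "(real n)\<^sup>2 = real n powr 2" using elim by simp
      then have "((real n)\<^sup>2) powr (-2/3) = real n powr (2 * (-2/3))" by (simp only: powr_powr)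
      then show ?thesis by simp
    qed
    finally show ?case by simp
  qed
qed

lemma summable_inverse_weight: "summable (\<lambda>n. 1 / (weight n)\<^sup>2)"
proof -
  define g where "g a = (1 + (real_of_int a)\<^sup>2) powr (-2/3)" for a
  define S where "S = (\<Sum>n. (1 + (real n)\<^sup>2) powr (-2/3))"
  have S0: "0 \<le> S" unfolding S_def by (intro suminf_nonneg summable_decay) auto
  have g0: "0 \<le> g a" for a by (simp add: g_def)
  have sum_g: "(\<Sum>a\<in>{- int L..int L}. g a) \<le> 2 * S" for L
  proof -
    have le: "(\<Sum>n\<le>L. g (int n)) \<le> S"
      unfolding S_def g_def using sum_le_suminf[OF summable_decay, of "{..L}"] by simp
    have "(\<Sum>a\<in>{- int L..int L}. g a) \<le> (\<Sum>a\<in>int ` {..L} \<union> (\<lambda>n. - int n) ` {..L}. g a)"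
    proof (rule sum_mono2)
      show "{- int L..int L} \<subseteq> int ` {..L} \<union> (\<lambda>n. - int n) ` {..L}"
      proof
        fix a assume a: "a \<in> {- int L..int L}"
        show "a \<in> int ` {..L} \<union> (\<lambda>n. - int n) ` {..L}"
        proof (cases "a \<ge> 0")
          case True
          then show ?thesis using a by (intro UnI1 image_eqI[of _ _ "nat a"]) auto
        next
          case False
          then show ?thesis using a by (intro UnI2 image_eqI[of _ _ "nat (- a)"]) auto
        qed
      qed
    qed (use g0 in auto)
    also have "\<dots> \<le> (\<Sum>a\<in>int ` {..L}. g a) + (\<Sum>a\<in>(\<lambda>n. - int n) ` {..L}. g a)"
      using sum_nonneg[of "int ` {..L} \<inter> (\<lambda>n. - int n) ` {..L}" g] g0 by (subst sum_Un) auto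
    also have "\<dots> = 2 * (\<Sum>n\<le>L. g (int n))"
      by (simp add: sum.reindex inj_on_def g_def)
    finally show ?thesis using le by simp
  qed
  show ?thesis
  proof (rule summableI_nonneg_bounded[where x="3 * (2 * S) ^ 3"])
    fix K
    define h where "h n = ((fst (mode n) $ 1, fst (mode n) $ 2, fst (mode n) $ 3), snd (mode n))" for n
    have inj: "inj h"
    proof (rule injI)
      fix n n' assume "h n = h n'"
      then have "fst (mode n) = fst (mode n')" "snd (mode n) = snd (mode n')" by (auto simp: h_def vec_eq_iff forall_3)
      then show "n = n'" using bij_mode by (auto simp: bij_def inj_def prod_eq_iff)
    qed
    have "finite (fst ` h ` {..<K})" by simp
    define L where "L = Max (insert 0 ((\<lambda>n. nat \<bar>fst (mode n) $ 1\<bar> + nat \<bar>fst (mode n) $ 2\<bar> + nat \<bar>fst (mode n) $ 3\<bar>) ` {..<K}))"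
    let ?A = "{- int L..int L}"
    have sub: "h ` {..<K} \<subseteq> (?A \<times> ?A \<times> ?A) \<times> UNIV"
    proof (rule image_subsetI)
      fix n assume "n \<in> {..<K}"
      then have "nat \<bar>fst (mode n) $ 1\<bar> + nat \<bar>fst (mode n) $ 2\<bar> + nat \<bar>fst (mode n) $ 3\<bar> \<le> L"
        unfolding L_def by (intro Max_ge) auto
      then show "h n \<in> (?A \<times> ?A \<times> ?A) \<times> UNIV" by (auto simp: h_def)
    qed
    have term_le: "1 / (weight n)\<^sup>2 \<le> (\<lambda>((a, b, c), i). g a * (g b * g c)) (h n)" for n
    proof -
      have w: "weight n = 1 + (real_of_int (fst (mode n) $ 1))\<^sup>2 + (real_of_int (fst (mode n) $ 2))\<^sup>2 + (real_of_int (fst (mode n) $ 3))\<^sup>2"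
        by (simp add: weight_def freq_def sum_3)
      have wp: "weight n > 0" by (rule fourier.m_pos)
      have le: "weight n powr (-2/3) \<le> g a" if "1 + (real_of_int a)\<^sup>2 \<le> weight n" for a
        unfolding g_def by (rule powr_mono2') (use that in \<open>auto intro: add_pos_nonneg\<close>)
      have "1 / (weight n)\<^sup>2 = weight n powr (-2)" using wp by (simp add: powr_minus divide_inverse)
      also have "\<dots> = weight n powr (-2/3) * (weight n powr (-2/3) * weight n powr (-2/3))"
        by (simp flip: powr_add)
      also have "\<dots> \<le> g (fst (mode n) $ 1) * (g (fst (mode n) $ 2) * g (fst (mode n) $ 3))"
        by (intro mult_mono le mult_nonneg_nonneg g0) (auto simp: w)
      finally show ?thesis by (simp add: h_def)
    qed
    have "(\<Sum>n<K. 1 / (weight n)\<^sup>2) \<le> (\<Sum>n<K. (\<lambda>((a, b, c), i). g a * (g b * g c)) (h n))"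
      by (intro sum_mono term_le)
    also have "\<dots> = (\<Sum>p\<in>h ` {..<K}. (\<lambda>((a, b, c), i). g a * (g b * g c)) p)"
      using inj by (subst sum.reindex) (auto simp: inj_on_def inj_def)
    also have "\<dots> \<le> (\<Sum>p\<in>(?A \<times> ?A \<times> ?A) \<times> (UNIV :: 3 set). (\<lambda>((a, b, c), i). g a * (g b * g c)) p)"
      by (intro sum_mono2 sub) (auto intro!: mult_nonneg_nonneg g0)
    also have "\<dots> = 3 * ((\<Sum>a\<in>?A. g a) * ((\<Sum>b\<in>?A. g b) * (\<Sum>c\<in>?A. g c)))"
    proof -
      let ?B = "?A \<times> ?A" and ?G = "\<lambda>(b, c). g b * g c"
      have "(\<Sum>p\<in>(?A \<times> ?B) \<times> (UNIV :: 3 set). (\<lambda>((a, b, c), i). g a * (g b * g c)) p)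
          = (\<Sum>q\<in>?A \<times> ?B. \<Sum>i\<in>(UNIV :: 3 set). (\<lambda>(a, r). g a * ?G r) q)"
        by (subst sum.cartesian_product) (auto intro!: sum.cong)
      also have "\<dots> = 3 * (\<Sum>q\<in>?A \<times> ?B. (\<lambda>(a, r). g a * ?G r) q)"
        by (simp add: sum_distrib_left)
      also have "(\<Sum>q\<in>?A \<times> ?B. (\<lambda>(a, r). g a * ?G r) q) = (\<Sum>a\<in>?A. g a) * (\<Sum>r\<in>?B. ?G r)"
        unfolding sum_product by (rule sum.cartesian_product[symmetric])
      also have "(\<Sum>r\<in>?B. ?G r) = (\<Sum>b\<in>?A. g b) * (\<Sum>c\<in>?A. g c)"
        unfolding sum_product by (rule sum.cartesian_product[symmetric])
      finally show ?thesis .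
    qed
    also have "\<dots> \<le> 3 * ((2 * S) * ((2 * S) * (2 * S)))"
      using S0 by (intro mult_left_mono mult_mono sum_g mult_nonneg_nonneg sum_nonneg g0) auto
    finally show "(\<Sum>n<K. 1 / (weight n)\<^sup>2) \<le> 3 * (2 * S) ^ 3" by (simp add: power3_eq_cube mult.assoc)
  qed simp
qed

definition convection :: "l2 \<Rightarrow> l2 \<Rightarrow> l2" where
  "convection u v = abs_l2 (\<lambda>x. cross3 (curl u x) (rep_l2 v x))"

lemma measurable_rep_l2 [measurable]: "rep_l2 u \<in> borel_measurable torus"
  using abs_rep_l2(1) by (simp add: square_integrable_def)

lemma measurable_rep_l2_nth: "(\<lambda>x. rep_l2 u x $ i) \<in> borel_measurable torus"
proof -
  have "(\<lambda>x. rep_l2 u x \<bullet> axis i 1) \<in> borel_measurable torus" by measurable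
  then show ?thesis by (simp add: inner_axis)
qed

lemma borel_measurable_vec3:
  fixes f :: "'x \<Rightarrow> real^3"
  assumes "\<And>i. (\<lambda>x. f x $ i) \<in> borel_measurable M"
  shows "f \<in> borel_measurable M"
proof (subst borel_measurable_euclidean_space, intro ballI)
  fix b :: "real^3" assume b0: "b \<in> Basis"
  then obtain i where b: "b = axis i 1" by (auto simp: Basis_vec_def)
  show "(\<lambda>x. f x \<bullet> b) \<in> borel_measurable M" using assms by (simp add: b inner_axis)
qed

lemma curl_nth:
  "curl u x $ 1 = rep_l2 (pd 2 u) x $ 3 - rep_l2 (pd 3 u) x $ 2"
  "curl u x $ 2 = rep_l2 (pd 3 u) x $ 1 - rep_l2 (pd 1 u) x $ 3"
  "curl u x $ 3 = rep_l2 (pd 1 u) x $ 2 - rep_l2 (pd 2 u) x $ 1"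
  by (simp_all add: curl_def Let_def)

lemma measurable_curl: "curl u \<in> borel_measurable torus"
proof (rule borel_measurable_vec3)
  note [measurable] = measurable_rep_l2_nth
  have "\<forall>i. (\<lambda>x. curl u x $ i) \<in> borel_measurable torus"
    unfolding forall_3 curl_nth by measurable
  then show "(\<lambda>x. curl u x $ i) \<in> borel_measurable torus" for i by blast
qed

lemma norm_square_3: "(norm (x::real^3))\<^sup>2 = (x $ 1)\<^sup>2 + (x $ 2)\<^sup>2 + (x $ 3)\<^sup>2"
  unfolding power2_norm_eq_inner inner_vec_def sum_3 by (simp add: power2_eq_square)

lemma square_diff_le: "(a - b)\<^sup>2 \<le> 2 * a\<^sup>2 + 2 * (b::real)\<^sup>2"
  using sum_squares_bound[of a "- b"] by (simp add: power2_diff)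

lemma norm_curl_le: "(norm (curl u x))\<^sup>2 \<le> 2 * (\<Sum>j\<in>UNIV. (norm (rep_l2 (pd j u) x))\<^sup>2)"
proof -
  let ?D = "\<lambda>j i. rep_l2 (pd j u) x $ i"
  have "(norm (curl u x))\<^sup>2 \<le> 2 * ((?D 2 3)\<^sup>2 + (?D 3 2)\<^sup>2 + (?D 3 1)\<^sup>2 + (?D 1 3)\<^sup>2 + (?D 1 2)\<^sup>2 + (?D 2 1)\<^sup>2)"
    unfolding norm_square_3 curl_nth
    by (rule order_trans[OF add_mono[OF add_mono[OF square_diff_le square_diff_le] square_diff_le]]) simp
  also have "\<dots> \<le> 2 * (\<Sum>j\<in>UNIV. (norm (rep_l2 (pd j u) x))\<^sup>2)"
    unfolding sum_3 norm_square_3 by simp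
  finally show ?thesis .
qed

lemma norm_cross_le: "(norm (cross3 a b))\<^sup>2 \<le> (norm a)\<^sup>2 * (norm b)\<^sup>2"
  using norm_cross_dot[of a b] by (simp add: power_mult_distrib) (metis le_add_same_cancel1 zero_le_power2)

lemma measurable_cross: "(\<lambda>x. cross3 (curl u x) (rep_l2 v x)) \<in> borel_measurable torus"
proof (rule borel_measurable_vec3)
  have c: "(\<lambda>x. curl u x $ i) \<in> borel_measurable torus" for i
  proof -
    have "(\<lambda>x. curl u x \<bullet> axis i 1) \<in> borel_measurable torus" using measurable_curl[of u] by measurable
    then show ?thesis by (simp add: inner_axis)
  qed
  note [measurable] = c measurable_rep_l2_nth
  have "\<forall>i. (\<lambda>x. cross3 (curl u x) (rep_l2 v x) $ i) \<in> borel_measurable torus"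
    unfolding forall_3 cross3_def by simp
  then show "(\<lambda>x. cross3 (curl u x) (rep_l2 v x) $ i) \<in> borel_measurable torus" for i by blast
qed

lemma integral_norm_rep_l2: "(\<integral>x. (norm (rep_l2 u x))\<^sup>2 \<partial>torus) = (norm u)\<^sup>2"
  "integrable torus (\<lambda>x. (norm (rep_l2 u x))\<^sup>2)"
proof -
  show "(\<integral>x. (norm (rep_l2 u x))\<^sup>2 \<partial>torus) = (norm u)\<^sup>2"
    using norm_abs_l2[OF abs_rep_l2(1)[of u]] by (simp add: abs_rep_l2 integral_nonneg_AE)
  show "integrable torus (\<lambda>x. (norm (rep_l2 u x))\<^sup>2)" using abs_rep_l2(1)[of u] by (simp add: square_integrable_def)
qed

lemma convection_bounded:
  assumes v: "AE x in torus. norm (rep_l2 v x) \<le> L"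
  shows "square_integrable (\<lambda>x. cross3 (curl u x) (rep_l2 v x))"
    and "(norm (convection u v))\<^sup>2 \<le> L\<^sup>2 * (2 * (\<Sum>j\<in>UNIV. (norm (pd j u))\<^sup>2))"
proof -
  let ?c = "\<lambda>x. cross3 (curl u x) (rep_l2 v x)"
  let ?d = "\<lambda>x. L\<^sup>2 * (2 * (\<Sum>j\<in>UNIV. (norm (rep_l2 (pd j u) x))\<^sup>2))"
  have di: "integrable torus ?d" using integral_norm_rep_l2(2) by simp
  note [measurable] = measurable_cross
  have le: "AE x in torus. (norm (?c x))\<^sup>2 \<le> ?d x"
    using v
  proof eventually_elim
    case (elim x)
    have "(norm (?c x))\<^sup>2 \<le> (norm (curl u x))\<^sup>2 * (norm (rep_l2 v x))\<^sup>2" by (rule norm_cross_le)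
    also have "\<dots> \<le> (2 * (\<Sum>j\<in>UNIV. (norm (rep_l2 (pd j u) x))\<^sup>2)) * L\<^sup>2"
      using elim by (intro mult_mono norm_curl_le power_mono) (auto intro!: sum_nonneg)
    finally show ?case by (simp add: mult.commute)
  qed
  have ci: "integrable torus (\<lambda>x. (norm (?c x))\<^sup>2)"
    by (rule Bochner_Integration.integrable_bound[OF di])
       (measurable, use le in \<open>eventually_elim, auto intro: order_trans[OF _ abs_ge_self]\<close>)
  then show sq: "square_integrable ?c" by (simp add: square_integrable_def)
  have "(norm (convection u v))\<^sup>2 = (\<integral>x. (norm (?c x))\<^sup>2 \<partial>torus)"
    unfolding convection_def norm_abs_l2[OF sq] by (simp add: integral_nonneg_AE)
  also have "\<dots> \<le> (\<integral>x. ?d x \<partial>torus)" by (rule integral_mono_AE[OF ci di le])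
  also have "\<dots> = L\<^sup>2 * (2 * (\<Sum>j\<in>UNIV. (norm (pd j u))\<^sup>2))"
    using integral_norm_rep_l2 by (simp add: Bochner_Integration.integral_sum)
  finally show "(norm (convection u v))\<^sup>2 \<le> L\<^sup>2 * (2 * (\<Sum>j\<in>UNIV. (norm (pd j u))\<^sup>2))" .
qed

lemma norm_basis_field: "norm (basis_field n x) \<le> 2 / sqrt torus_volume"
  using torus_volume_pos cas_bound[of "fst (mode n)" x] by (simp add: basis_field_def divide_right_mono)

lemma rep_l2_proj:
  "AE x in torus. rep_l2 (fourier.proj K v) x = (\<Sum>n<K. (v \<bullet> basis n) *\<^sub>R basis_field n x)"
proof -
  have sq: "square_integrable (\<lambda>x. (v \<bullet> basis n) *\<^sub>R basis_field n x)" for n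
    by (intro square_integrable_scaleR square_integrable_basis_field)
  have "fourier.proj K v = (\<Sum>n<K. abs_l2 (\<lambda>x. (v \<bullet> basis n) *\<^sub>R basis_field n x))"
    unfolding fourier.proj_def by (intro sum.cong refl) (simp add: basis_def scaleR_l2.abs_eq square_integrable_basis_field)
  then have eq: "fourier.proj K v = abs_l2 (\<lambda>x. \<Sum>n<K. (v \<bullet> basis n) *\<^sub>R basis_field n x)"
    and sum_sq: "square_integrable (\<lambda>x. \<Sum>n<K. (v \<bullet> basis n) *\<^sub>R basis_field n x)"
    using abs_l2_sum[of "{..<K}" "\<lambda>n x. (v \<bullet> basis n) *\<^sub>R basis_field n x", OF _ sq] by auto
  show ?thesis unfolding eq by (rule rep_abs_l2[OF sum_sq])
qed

lemma rep_l2_bound: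
  assumes S: "\<And>K. (\<Sum>n<K. \<bar>v \<bullet> basis n\<bar>) \<le> S"
  shows "AE x in torus. norm (rep_l2 v x) \<le> (2 / sqrt torus_volume) * S"
proof -
  let ?L = "(2 / sqrt torus_volume) * S"
  define h where "h x = (max 0 (norm (rep_l2 v x) - ?L))\<^sup>2" for x
  have [measurable]: "h \<in> borel_measurable torus" unfolding h_def[abs_def] by measurable
  have le: "AE x in torus. h x \<le> (norm (rep_l2 v x - rep_l2 (fourier.proj K v) x))\<^sup>2" for K
    using rep_l2_proj[of K v]
  proof eventually_elim
    case (elim x)
    have "norm (rep_l2 (fourier.proj K v) x) \<le> (\<Sum>n<K. norm ((v \<bullet> basis n) *\<^sub>R basis_field n x))"
      unfolding elim by (rule norm_sum)
    also have "\<dots> \<le> (\<Sum>n<K. \<bar>v \<bullet> basis n\<bar> * (2 / sqrt torus_volume))"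
      by (intro sum_mono) (simp add: mult_left_mono norm_basis_field del: times_divide_eq_right)
    also have "\<dots> \<le> ?L"
      unfolding sum_distrib_right[symmetric] mult.commute[of _ S]
      using torus_volume_pos by (intro mult_right_mono S) auto
    finally have "norm (rep_l2 v x) - ?L \<le> norm (rep_l2 v x - rep_l2 (fourier.proj K v) x)"
      using norm_triangle_ineq2[of "rep_l2 v x" "rep_l2 (fourier.proj K v) x"] by linarith
    then show ?case unfolding h_def by (intro power_mono) auto
  qed
  have hi: "integrable torus h"
  proof (rule Bochner_Integration.integrable_bound[OF norm_diff_l2(2)[of v "fourier.proj 0 v"]])
    show "AE x in torus. norm (h x) \<le> norm ((norm (rep_l2 v x - rep_l2 (fourier.proj 0 v) x))\<^sup>2)"
      using le[of 0] by eventually_elim (simp add: h_def)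
  qed fact
  have bd: "(\<integral>x. h x \<partial>torus) \<le> (norm (v - fourier.proj K v))\<^sup>2" for K
    unfolding norm_diff_l2(1) by (rule integral_mono_AE[OF hi norm_diff_l2(2) le])
  have "(\<lambda>K. (norm (v - fourier.proj K v))\<^sup>2) \<longlonglongrightarrow> (norm (v - v))\<^sup>2"
    by (intro tendsto_intros fourier.proj_tendsto)
  then have "(\<integral>x. h x \<partial>torus) \<le> (norm (v - v))\<^sup>2"
    by (rule LIMSEQ_le_const) (use bd in blast)
  moreover have "0 \<le> (\<integral>x. h x \<partial>torus)" by (rule integral_nonneg_AE) (simp add: h_def)
  ultimately have "(\<integral>x. h x \<partial>torus) = 0" by simp
  moreover have "AE x in torus. 0 \<le> h x" by (simp add: h_def)
  ultimately have "AE x in torus. h x = 0"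
    using integral_nonneg_eq_0_iff_AE[OF hi] by blast
  then show ?thesis by eventually_elim (simp add: h_def max_def split: if_splits)
qed

text \<open>Splitting off finitely many modes makes the coefficient of the top-order norm small.\<close>

lemma coeff_sum_bound:
  assumes \<epsilon>: "\<epsilon> > 0"
  shows "\<exists>C\<ge>0. \<forall>v\<in>fourier.H 2. \<forall>K. (\<Sum>n<K. \<bar>v \<bullet> basis n\<bar>)\<^sup>2 \<le> \<epsilon> * fourier.N 2 v + C * fourier.N 1 v"
proof -
  obtain M where M: "\<And>k l. k \<ge> M \<Longrightarrow> norm (\<Sum>n\<in>{k..<l}. 1 / (weight n)\<^sup>2) < \<epsilon> / 2"
    using summable_inverse_weight \<epsilon> unfolding summable_Cauchy by (meson half_gt_zero)
  have "(\<Sum>n<K. \<bar>v \<bullet> basis n\<bar>)\<^sup>2 \<le> \<epsilon> * fourier.N 2 v + (2 * real M) * fourier.N 1 v" if v: "v \<in> fourier.H 2" for v K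
  proof -
    have v1: "v \<in> fourier.H 1" using v by (rule fourier.H_mono) simp
    let ?c = "\<lambda>n. \<bar>v \<bullet> basis n\<bar>"
    have "(\<Sum>n<K. ?c n) \<le> (\<Sum>n\<in>{..<M} \<union> {M..<K}. ?c n)" by (intro sum_mono2) auto
    also have "\<dots> = (\<Sum>n<M. ?c n) + (\<Sum>n\<in>{M..<K}. ?c n)" by (intro sum.union_disjoint) auto
    finally have "(\<Sum>n<K. ?c n)\<^sup>2 \<le> ((\<Sum>n<M. ?c n) + (\<Sum>n\<in>{M..<K}. ?c n))\<^sup>2"
      by (intro power_mono) (auto intro: sum_nonneg)
    also have "\<dots> \<le> 2 * (\<Sum>n<M. ?c n)\<^sup>2 + 2 * (\<Sum>n\<in>{M..<K}. ?c n)\<^sup>2" by (rule fourier.square_add_le)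
    also have "(\<Sum>n<M. ?c n)\<^sup>2 \<le> real M * fourier.N 1 v"
    proof -
      have "(\<Sum>n<M. 1 * ?c n)\<^sup>2 \<le> (\<Sum>n<M. 1\<^sup>2) * (\<Sum>n<M. (?c n)\<^sup>2)" by (rule Cauchy_Schwarz_ineq_sum)
      then have "(\<Sum>n<M. ?c n)\<^sup>2 \<le> real M * (\<Sum>n<M. (v \<bullet> basis n)\<^sup>2)" by simp
      also have "\<dots> \<le> real M * (norm v)\<^sup>2" by (intro mult_left_mono fourier.bessel) auto
      also have "\<dots> \<le> real M * fourier.N 1 v" by (intro mult_left_mono fourier.norm_le_N v1) auto
      finally show ?thesis .
    qed
    also have "(\<Sum>n\<in>{M..<K}. ?c n)\<^sup>2 \<le> (\<epsilon> / 2) * fourier.N 2 v"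
    proof -
      have "(\<Sum>n\<in>{M..<K}. ?c n) = (\<Sum>n\<in>{M..<K}. (1 / weight n) * (weight n * ?c n))"
        using fourier.m_pos by (intro sum.cong) (auto simp: less_imp_neq[THEN not_sym])
      also have "\<dots>\<^sup>2 \<le> (\<Sum>n\<in>{M..<K}. (1 / weight n)\<^sup>2) * (\<Sum>n\<in>{M..<K}. (weight n * ?c n)\<^sup>2)"
        by (rule Cauchy_Schwarz_ineq_sum)
      also have "\<dots> \<le> (\<epsilon> / 2) * fourier.N 2 v"
      proof (intro mult_mono)
        show "(\<Sum>n\<in>{M..<K}. (1 / weight n)\<^sup>2) \<le> \<epsilon> / 2"
          using M[of M K] by (simp add: power_divide)
        show "(\<Sum>n\<in>{M..<K}. (weight n * ?c n)\<^sup>2) \<le> fourier.N 2 v"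
          using sum_le_suminf[OF v[unfolded fourier.H_def mem_Collect_eq], of "{M..<K}"] fourier.weight_nonneg[of _ 2 v]
          by (simp add: fourier.N_def power_mult_distrib)
      qed (use \<epsilon> in \<open>auto intro: sum_nonneg\<close>)
      finally show ?thesis .
    qed
    finally show ?thesis by simp
  qed
  then show ?thesis by (intro exI[of _ "2 * real M"]) auto
qed

lemma H2_bounded:
  assumes "v \<in> fourier.H 2"
  shows "\<exists>L. AE x in torus. norm (rep_l2 v x) \<le> L"
proof -
  obtain C where C: "\<And>K. (\<Sum>n<K. \<bar>v \<bullet> basis n\<bar>)\<^sup>2 \<le> 1 * fourier.N 2 v + C * fourier.N 1 v"
    using coeff_sum_bound[of 1] assms by auto
  have "(\<Sum>n<K. \<bar>v \<bullet> basis n\<bar>) \<le> sqrt (1 * fourier.N 2 v + C * fourier.N 1 v)" for K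
    by (rule real_le_rsqrt[OF C])
  from rep_l2_bound[OF this] show ?thesis by blast
qed

lemma convection_square_integrable:
  "v \<in> fourier.H 2 \<Longrightarrow> square_integrable (\<lambda>x. cross3 (curl u x) (rep_l2 v x))"
  using H2_bounded convection_bounded(1) by blast

lemma convection_bound:
  assumes \<epsilon>: "\<epsilon> > 0"
  shows "\<exists>C\<ge>0. \<forall>u\<in>fourier.H 1. \<forall>v\<in>fourier.H 2.
    (norm (convection u v))\<^sup>2 \<le> fourier.N 1 u * (\<epsilon> * fourier.N 2 v + C * fourier.N 1 v)"
proof -
  define \<kappa> where "\<kappa> = 2 * (2 / sqrt torus_volume)\<^sup>2"
  have \<kappa>: "\<kappa> > 0" using torus_volume_pos by (simp add: \<kappa>_def)
  obtain C where C: "C \<ge> 0" "\<And>v K. v \<in> fourier.H 2 \<Longrightarrow> (\<Sum>n<K. \<bar>v \<bullet> basis n\<bar>)\<^sup>2 \<le> (\<epsilon> / \<kappa>) * fourier.N 2 v + C * fourier.N 1 v"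
    using coeff_sum_bound[of "\<epsilon> / \<kappa>"] \<epsilon> \<kappa> by auto
  have "(norm (convection u v))\<^sup>2 \<le> fourier.N 1 u * (\<epsilon> * fourier.N 2 v + (\<kappa> * C) * fourier.N 1 v)"
    if u: "u \<in> fourier.H 1" and v: "v \<in> fourier.H 2" for u v
  proof -
    let ?S = "(\<epsilon> / \<kappa>) * fourier.N 2 v + C * fourier.N 1 v"
    have S0: "?S \<ge> 0" using order_trans[OF zero_le_power2 C(2)[OF v, of 0]] .
    have "(\<Sum>n<K. \<bar>v \<bullet> basis n\<bar>) \<le> sqrt ?S" for K by (rule real_le_rsqrt[OF C(2)[OF v]])
    from convection_bounded(2)[OF rep_l2_bound[OF this], of u]
    have "(norm (convection u v))\<^sup>2 \<le> (2 / sqrt torus_volume * sqrt ?S)\<^sup>2 * (2 * (\<Sum>j\<in>UNIV. (norm (pd j u))\<^sup>2))" .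
    also have "(2 / sqrt torus_volume * sqrt ?S)\<^sup>2 = (2 / sqrt torus_volume)\<^sup>2 * ?S"
      unfolding power_mult_distrib[of _ "sqrt ?S"] real_sqrt_pow2[OF S0] ..
    also have "(2 / sqrt torus_volume)\<^sup>2 * ?S * (2 * (\<Sum>j\<in>UNIV. (norm (pd j u))\<^sup>2)) = \<kappa> * ?S * (\<Sum>j\<in>UNIV. (norm (pd j u))\<^sup>2)"
      unfolding \<kappa>_def by (simp only: mult_ac)
    also have "\<dots> \<le> \<kappa> * ?S * fourier.N 1 u"
      unfolding norm_pd[OF u] using \<kappa> S0 by (intro mult_left_mono) auto
    also have "\<dots> = fourier.N 1 u * (\<epsilon> * fourier.N 2 v + (\<kappa> * C) * fourier.N 1 v)"
      using \<kappa> by (simp add: algebra_simps)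
    finally show ?thesis .
  qed
  then show ?thesis using C(1) \<kappa> by (intro exI[of _ "\<kappa> * C"]) auto
qed

lemma pd_add: "u \<in> fourier.H 1 \<Longrightarrow> v \<in> fourier.H 1 \<Longrightarrow> pd j (u + v) = pd j u + pd j v"
  by (rule fourier.basis_eqI) (simp add: pd_inner[OF H_freq] fourier.H_add inner_add_left algebra_simps)

lemma pd_scaleR: "u \<in> fourier.H 1 \<Longrightarrow> pd j (r *\<^sub>R u) = r *\<^sub>R pd j u"
  by (rule fourier.basis_eqI) (simp add: pd_inner[OF H_freq] fourier.H_scaleR algebra_simps)

lemma curl_add:
  assumes "u \<in> fourier.H 1" "v \<in> fourier.H 1"
  shows "AE x in torus. curl (u + v) x = curl u x + curl v x"
proof -
  have "AE x in torus. \<forall>j\<in>UNIV. rep_l2 (pd j (u + v)) x = rep_l2 (pd j u) x + rep_l2 (pd j v) x"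
    unfolding pd_add[OF assms] by (intro AE_finite_allI rep_l2_add) auto
  then show ?thesis by eventually_elim (simp add: vec_eq_iff forall_3 curl_nth)
qed

lemma curl_scaleR:
  assumes "u \<in> fourier.H 1"
  shows "AE x in torus. curl (r *\<^sub>R u) x = r *\<^sub>R curl u x"
proof -
  have "AE x in torus. \<forall>j\<in>UNIV. rep_l2 (pd j (r *\<^sub>R u)) x = r *\<^sub>R rep_l2 (pd j u) x"
    unfolding pd_scaleR[OF assms] by (intro AE_finite_allI rep_l2_scaleR) auto
  then show ?thesis by eventually_elim (simp add: vec_eq_iff forall_3 curl_nth right_diff_distrib)
qed

lemma abs_l2_add: "square_integrable f \<Longrightarrow> square_integrable g \<Longrightarrow> abs_l2 f + abs_l2 g = abs_l2 (\<lambda>x. f x + g x)"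
  by (simp add: plus_l2.abs_eq)

lemma abs_l2_scaleR: "square_integrable f \<Longrightarrow> r *\<^sub>R abs_l2 f = abs_l2 (\<lambda>x. r *\<^sub>R f x)"
  by (simp add: scaleR_l2.abs_eq)

lemma convection_quadratic_evolution:
  assumes "\<nu> > 0"
  shows "quadratic_evolution basis weight convection \<nu>"
proof
  note sq = convection_square_integrable
  show "0 < \<nu>" by fact
  show "convection (u + u') v = convection u v + convection u' v"
    if "u \<in> fourier.H 1" "u' \<in> fourier.H 1" "v \<in> fourier.H 2" for u u' v
    unfolding convection_def abs_l2_add[OF sq[OF that(3)] sq[OF that(3)]]
    using curl_add[OF that(1,2)]
    by (intro abs_l2_eq sq square_integrable_add that) (auto simp: cross_add_left elim!: eventually_mono)
  show "convection u (v + v') = convection u v + convection u v'"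
    if "u \<in> fourier.H 1" "v \<in> fourier.H 2" "v' \<in> fourier.H 2" for u v v'
    unfolding convection_def abs_l2_add[OF sq[OF that(2)] sq[OF that(3)]]
    using rep_l2_add[of v v']
    by (intro abs_l2_eq sq square_integrable_add that fourier.H_add) (auto simp: cross_add_right elim!: eventually_mono)
  show "convection (r *\<^sub>R u) v = r *\<^sub>R convection u v"
    if "u \<in> fourier.H 1" "v \<in> fourier.H 2" for u v r
    unfolding convection_def abs_l2_scaleR[OF sq[OF that(2)]]
    using curl_scaleR[OF that(1), of r]
    by (intro abs_l2_eq sq square_integrable_scaleR that) (auto simp: cross_mult_left elim!: eventually_mono)
  show "convection u (r *\<^sub>R v) = r *\<^sub>R convection u v"
    if "u \<in> fourier.H 1" "v \<in> fourier.H 2" for u v r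
    unfolding convection_def abs_l2_scaleR[OF sq[OF that(2)]]
    using rep_l2_scaleR[of r v]
    by (intro abs_l2_eq sq square_integrable_scaleR that fourier.H_scaleR) (auto simp: cross_mult_right elim!: eventually_mono)
  show "\<exists>C\<ge>0. \<forall>u\<in>fourier.H 1. \<forall>v\<in>fourier.H 2.
      (norm (convection u v))\<^sup>2 \<le> fourier.N 1 u * (\<epsilon> * fourier.N 2 v + C * fourier.N 1 v)" if "0 < \<epsilon>" for \<epsilon>
    by (rule convection_bound[OF that])
  show "convection u v \<bullet> v = 0" if "v \<in> fourier.H 2" for u v
    by (subst inner_commute) (simp add: convection_def inner_abs_l2[OF sq[OF that]] dot_cross_self)
qed

subsection \<open>Strong solutions\<close>

lemma tmeas_measurable_AE:
  fixes f g :: "real \<Rightarrow> 'b::topological_space"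
  assumes g: "g \<in> borel_measurable (tmeas T)" and eq: "AE t in tmeas T. f t = g t"
  shows "f \<in> borel_measurable (tmeas T)"
proof (rule measurableI)
  fix A :: "'b set" assume A: "A \<in> sets borel"
  obtain Z where Z: "Z \<in> null_sets (tmeas T)" "{t \<in> space (tmeas T). f t \<noteq> g t} \<subseteq> Z"
    using eq unfolding eventually_ae_filter by auto
  have sub: "Y \<in> sets (tmeas T)" if "Y \<subseteq> Z" for Y
  proof -
    have "Z \<in> null_sets lebesgue" using Z(1) by (simp add: tmeas_def null_sets_restrict_space)
    then have "Y \<in> sets lebesgue" using that null_sets_completion_subset by blast
    moreover have "Y \<subseteq> {0<..<T}" using that null_setsD2[OF Z(1)] sets.sets_into_space[of Z "tmeas T"] by auto
    ultimately show ?thesis by (auto simp: tmeas_def sets_restrict_space_iff)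
  qed
  have "f -` A \<inter> space (tmeas T) = ((g -` A \<inter> space (tmeas T)) - Z) \<union> (f -` A \<inter> space (tmeas T) \<inter> Z)"
    using Z(2) by auto
  also have "\<dots> \<in> sets (tmeas T)"
    using measurable_sets[OF g A] sub by (intro sets.Un sets.Diff) auto
  finally show "f -` A \<inter> space (tmeas T) \<in> sets (tmeas T)" .
qed simp

lemma norm_le_sobolev_norm: "norm u \<le> sobolev_norm s u"
  by (cases s) (auto intro!: real_le_rsqrt sum_nonneg)

lemma L2_timeD:
  assumes u: "u \<in> L2_time T X (sobolev_norm s)"
  shows "u \<in> borel_measurable (tmeas T)" "AE t in tmeas T. u t \<in> X"
    "integrable (tmeas T) (\<lambda>t. (sobolev_norm s (u t))\<^sup>2)"
proof -
  obtain S where S: "\<And>n. simple_function (tmeas T) (S n)"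
    "AE t in tmeas T. u t \<in> X \<and> (\<lambda>n::nat. sobolev_norm s (S n t - u t)) \<longlonglongrightarrow> 0"
    using u unfolding L2_time_def tmeas_def[symmetric] by blast
  show "AE t in tmeas T. u t \<in> X" using S(2) by eventually_elim simp
  show "integrable (tmeas T) (\<lambda>t. (sobolev_norm s (u t))\<^sup>2)"
    using u unfolding L2_time_def tmeas_def[symmetric] by blast
  have lim: "AE t in tmeas T. (\<lambda>n. S n t) \<longlonglongrightarrow> u t"
    using S(2)
  proof eventually_elim
    case (elim t)
    then have "(\<lambda>n. norm (S n t - u t)) \<longlonglongrightarrow> 0"
      by (intro Lim_null_comparison[of "\<lambda>n. norm (S n t - u t)" "\<lambda>n. sobolev_norm s (S n t - u t)"])
         (auto intro!: always_eventually norm_le_sobolev_norm)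
    then show ?case by (rule LIM_zero_cancel[OF tendsto_norm_zero_cancel])
  qed
  obtain Z where Z: "Z \<in> null_sets (tmeas T)" "{t \<in> space (tmeas T). \<not> (\<lambda>n. S n t) \<longlonglongrightarrow> u t} \<subseteq> Z"
    using lim unfolding eventually_ae_filter by auto
  have [measurable]: "S n \<in> borel_measurable (tmeas T)" for n
    using S(1) by (rule borel_measurable_simple_function)
  have [measurable]: "Z \<in> sets (tmeas T)" using Z by auto
  have "(\<lambda>t. if t \<in> Z then 0 else u t) \<in> borel_measurable (tmeas T)"
  proof (rule borel_measurable_LIMSEQ_metric)
    show "(\<lambda>t. if t \<in> Z then 0 else S n t) \<in> borel_measurable (tmeas T)" for n by measurable
    show "(\<lambda>n. if t \<in> Z then 0 else S n t) \<longlonglongrightarrow> (if t \<in> Z then 0 else u t)" if "t \<in> space (tmeas T)" for t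
      using Z(2) that by auto
  qed
  then show "u \<in> borel_measurable (tmeas T)"
  proof (rule tmeas_measurable_AE)
    show "AE t in tmeas T. u t = (if t \<in> Z then 0 else u t)"
      using AE_not_in[OF Z(1)] by eventually_elim simp
  qed
qed

lemma sobolev_norm_0: "sobolev_norm 0 = norm"
  by (simp add: fun_eq_iff)

lemma L2_time_normD:
  assumes "g \<in> L2_time T X norm"
  shows "g \<in> borel_measurable (tmeas T)" "(\<integral>\<^sup>+t. ennreal ((norm (g t))\<^sup>2) \<partial>tmeas T) < \<infinity>"
proof -
  note D = L2_timeD[of g T X 0, unfolded sobolev_norm_0, OF assms]
  show "g \<in> borel_measurable (tmeas T)" by (rule D)
  show "(\<integral>\<^sup>+t. ennreal ((norm (g t))\<^sup>2) \<partial>tmeas T) < \<infinity>"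
    using D(3) by (simp add: nn_integral_eq_integral)
qed

lemma L2_time_normI:
  assumes g: "g \<in> borel_measurable (tmeas T)" and i: "(\<integral>\<^sup>+t. ennreal ((norm (g t))\<^sup>2) \<partial>tmeas T) < \<infinity>"
  shows "g \<in> L2_time T UNIV norm"
proof -
  obtain S where S: "\<And>i. simple_function (tmeas T) (S i)" "\<And>t. t \<in> space (tmeas T) \<Longrightarrow> (\<lambda>i. S i t) \<longlonglongrightarrow> g t"
    using borel_measurable_implies_sequence_metric[OF g, of 0] by metis
  have "AE t in tmeas T. g t \<in> UNIV \<and> (\<lambda>n. norm (S n t - g t)) \<longlonglongrightarrow> 0"
    using S(2) by (intro AE_I2 conjI UNIV_I tendsto_norm_zero LIM_zero) auto
  then show ?thesis
    using S(1) fourier.coeff_square_integrable(4)[OF g i] unfolding L2_time_def tmeas_def[symmetric] by blast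
qed

lemma L2_time_sobolev_2I:
  assumes u [measurable]: "u \<in> borel_measurable (tmeas T)" and H2: "AE t in tmeas T. u t \<in> fourier.H 2"
    and i: "(\<integral>\<^sup>+t. fourier.W 2 (u t) \<partial>tmeas T) < \<infinity>"
  shows "u \<in> L2_time T (sobolev 2) (sobolev_norm 2)"
proof -
  let ?R = "fourier.multiplier (\<lambda>n. 1 / weight n)"
  define y where "y t = (if u t \<in> fourier.H 2 then fourier.multiplier weight (u t) else 0)" for t
  have cm [measurable]: "(\<lambda>t. u t \<bullet> basis n) \<in> borel_measurable (tmeas T)" for n
    by (intro borel_measurable_inner u borel_measurable_const)
  have "y \<in> borel_measurable (tmeas T)"
  proof (rule fourier.borel_measurable_coeff)
    fix n
    have "(\<lambda>t. y t \<bullet> basis n) = (\<lambda>t. if u t \<in> fourier.H 2 then weight n * (u t \<bullet> basis n) else 0)"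
      by (auto simp: fun_eq_iff y_def fourier.multiplier_m)
    also have "\<dots> \<in> borel_measurable (tmeas T)" unfolding fourier.H_iff_W by measurable
    finally show "(\<lambda>t. y t \<bullet> basis n) \<in> borel_measurable (tmeas T)" .
  qed
  from borel_measurable_implies_sequence_metric[OF this, of 0]
  obtain S where S: "\<And>i. simple_function (tmeas T) (S i)" "\<And>t. t \<in> space (tmeas T) \<Longrightarrow> (\<lambda>i. S i t) \<longlonglongrightarrow> y t"
    by metis
  have RH: "?R w \<in> fourier.H 2" for w by (rule fourier.multiplier_inverse)
  have le: "sobolev_norm 2 w \<le> sqrt (fourier.N 2 w)" if "w \<in> fourier.H 2" for w
    unfolding sobolev_norm_2[OF that] using fourier.norm_le_N[OF fourier.H_mono[OF that, of 1]] by simp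
  have lim: "AE t in tmeas T. u t \<in> sobolev 2 \<and> (\<lambda>i. sobolev_norm 2 (?R (S i t) - u t)) \<longlonglongrightarrow> 0"
    using H2 AE_space
  proof eventually_elim
    case (elim t)
    have ut: "u t = ?R (y t)"
      using elim fourier.m_pos
      by (intro fourier.basis_eqI)
         (auto simp: fourier.multiplier_inverse y_def fourier.multiplier_m less_imp_neq[THEN not_sym])
    have le': "sobolev_norm 2 (?R (S i t) - u t) \<le> norm (S i t - y t)" for i
    proof -
      have "?R (S i t) - u t = ?R (S i t - y t)"
        unfolding ut by (rule fourier.basis_eqI) (simp add: inner_diff_left fourier.multiplier_inverse diff_divide_distrib)
      then show ?thesis using le[OF RH, of "S i t - y t"] by (simp add: fourier.multiplier_inverse(3))
    qed
    have lim': "(\<lambda>i. norm (S i t - y t)) \<longlonglongrightarrow> 0"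
      by (intro tendsto_norm_zero LIM_zero S(2) elim)
    have "(\<lambda>i. sobolev_norm 2 (?R (S i t) - u t)) \<longlonglongrightarrow> 0"
    proof (rule Lim_null_comparison[OF always_eventually lim'], rule allI)
      fix i
      have "0 \<le> sobolev_norm 2 (?R (S i t) - u t)"
        by (rule order_trans[OF norm_ge_zero norm_le_sobolev_norm])
      then show "norm (sobolev_norm 2 (?R (S i t) - u t)) \<le> norm (S i t - y t)"
        unfolding real_norm_def using le'[of i] by (simp only: abs_of_nonneg)
    qed
    then show ?case unfolding sobolev_H using elim(1) by blast
  qed
  have int: "integrable (tmeas T) (\<lambda>t. (sobolev_norm 2 (u t))\<^sup>2)"
  proof -
    let ?G = "\<lambda>t. (norm (u t))\<^sup>2 + (enn2real (fourier.W 2 (u t)) - enn2real (fourier.W 1 (u t)))"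
    have eq: "AE t in tmeas T. (sobolev_norm 2 (u t))\<^sup>2 = ?G t \<and> ?G t \<le> enn2real (fourier.W 2 (u t)) \<and> 0 \<le> ?G t"
      using H2
    proof eventually_elim
      case (elim t)
      note h1 = fourier.H_mono[OF elim, of 1]
      have e: "enn2real (fourier.W 2 (u t)) = fourier.N 2 (u t)" "enn2real (fourier.W 1 (u t)) = fourier.N 1 (u t)"
        using elim h1 by (simp_all add: fourier.W_eq_N fourier.N_nonneg)
      have "fourier.N 1 (u t) \<le> fourier.N 2 (u t)" by (rule fourier.N_mono[OF elim]) simp
      then show ?case unfolding e sobolev_norm_2[OF elim] using fourier.norm_le_N[OF h1] by simp
    qed
    have W2: "integrable (tmeas T) (\<lambda>t. enn2real (fourier.W 2 (u t)))"
    proof (rule integrableI_bounded)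
      have "(\<integral>\<^sup>+t. ennreal (norm (enn2real (fourier.W 2 (u t)))) \<partial>tmeas T) = (\<integral>\<^sup>+t. fourier.W 2 (u t) \<partial>tmeas T)"
        by (rule nn_integral_cong_AE) (use H2 in \<open>eventually_elim, simp add: fourier.H_iff_W\<close>)
      then show "(\<integral>\<^sup>+t. ennreal (norm (enn2real (fourier.W 2 (u t)))) \<partial>tmeas T) < \<infinity>" using i by simp
    qed measurable
    have G: "integrable (tmeas T) ?G"
    proof (rule Bochner_Integration.integrable_bound[OF W2])
      show "AE t in tmeas T. norm (?G t) \<le> norm (enn2real (fourier.W 2 (u t)))"
        using eq by eventually_elim (metis abs_of_nonneg enn2real_nonneg real_norm_def)
    qed measurable
    have e: "AE t in tmeas T. (sobolev_norm 2 (u t))\<^sup>2 = ?G t" using eq by eventually_elim blast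
    have "(\<lambda>t. (sobolev_norm 2 (u t))\<^sup>2) \<in> borel_measurable (tmeas T)"
      by (rule tmeas_measurable_AE[OF borel_measurable_integrable[OF G] e])
    moreover have "AE t in tmeas T. ?G t = (sobolev_norm 2 (u t))\<^sup>2" using e by eventually_elim (rule sym)
    ultimately show ?thesis by (rule integrable_cong_AE_imp[OF G])
  qed
  have simple: "simple_function (tmeas T) (\<lambda>t. ?R (S i t))" for i by (rule simple_function_compose1[OF S(1)])
  have sub: "(\<lambda>t. ?R (S i t)) ` {0<..<T} \<subseteq> sobolev 2" for i
    unfolding sobolev_H using RH by (rule image_subsetI)
  show ?thesis
    unfolding L2_time_def tmeas_def[symmetric]
    by (intro CollectI conjI int exI[of _ "\<lambda>i t. ?R (S i t)"] allI simple sub lim)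
qed

lemma N_2_le:
  assumes "u \<in> fourier.H 2"
  shows "fourier.N 2 u \<le> 2 * (sobolev_norm 2 u)\<^sup>2"
proof -
  note h1 = fourier.H_mono[OF assms, of 1]
  have s: "summable (\<lambda>n. weight n ^ 2 * (u \<bullet> basis n)\<^sup>2)" "summable (\<lambda>n. weight n ^ 1 * (u \<bullet> basis n)\<^sup>2)" "summable (\<lambda>n. (u \<bullet> basis n)\<^sup>2)"
    using assms h1 fourier.summable_coeff by (auto simp: fourier.H_def)
  have "0 \<le> (\<Sum>n. weight n ^ 2 * (u \<bullet> basis n)\<^sup>2 - 2 * (weight n ^ 1 * (u \<bullet> basis n)\<^sup>2) + 2 * (u \<bullet> basis n)\<^sup>2)"
  proof (rule suminf_nonneg)
    fix n
    have "0 \<le> ((weight n - 1)\<^sup>2 + 1) * (u \<bullet> basis n)\<^sup>2" by simp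
    also have "\<dots> = weight n ^ 2 * (u \<bullet> basis n)\<^sup>2 - 2 * (weight n ^ 1 * (u \<bullet> basis n)\<^sup>2) + 2 * (u \<bullet> basis n)\<^sup>2"
      by (simp add: power2_diff algebra_simps)
    finally show "0 \<le> weight n ^ 2 * (u \<bullet> basis n)\<^sup>2 - 2 * (weight n ^ 1 * (u \<bullet> basis n)\<^sup>2) + 2 * (u \<bullet> basis n)\<^sup>2" .
  qed (intro summable_add summable_diff summable_mult s)
  also have "\<dots> = fourier.N 2 u - 2 * fourier.N 1 u + 2 * (norm u)\<^sup>2"
    unfolding fourier.N_def N_0[symmetric] using s
    by (simp add: suminf_add[symmetric] suminf_diff[symmetric] summable_diff suminf_mult[symmetric])
  finally have "fourier.N 2 u \<le> 2 * ((norm u)\<^sup>2 + (fourier.N 2 u - fourier.N 1 u))" by simp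
  moreover have "0 \<le> (norm u)\<^sup>2 + (fourier.N 2 u - fourier.N 1 u)"
    using fourier.N_mono[OF assms, of 1] by simp
  ultimately show ?thesis unfolding sobolev_norm_2[OF assms] by simp
qed

lemma integrable_of_norm_square:
  fixes h :: "real \<Rightarrow> l2"
  assumes [measurable]: "h \<in> borel_measurable (tmeas T)" and i: "(\<integral>\<^sup>+t. ennreal ((norm (h t))\<^sup>2) \<partial>tmeas T) < \<infinity>"
    and \<phi>: "continuous_on UNIV \<phi>"
  shows "integrable (tmeas T) (\<lambda>t. \<phi> t *\<^sub>R h t)"
proof -
  obtain M where M: "\<And>s. s \<in> {0..T} \<Longrightarrow> \<bar>\<phi> s\<bar> \<le> M"
    using continuous_on_bounded_interval[OF continuous_on_subset[OF \<phi> subset_UNIV]] by blast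
  have [measurable]: "\<phi> \<in> borel_measurable (tmeas T)"
    by (rule continuous_on_tmeas_measurable[OF continuous_on_subset[OF \<phi> subset_UNIV]])
  have "integrable (tmeas T) (\<lambda>t. norm (h t))"
    by (rule integrable_of_square) (use fourier.coeff_square_integrable(4)[OF assms(1) i] in auto)
  then have n: "integrable (tmeas T) (\<lambda>t. \<phi> t * norm (h t))"
    by (rule integrable_mult_bounded(1)[of _ _ _ M]) (use M in auto)
  show ?thesis
    by (rule Bochner_Integration.integrable_bound[OF n]) auto
qed

lemma has_weak_time_deriv_iff:
  assumes T: "T > 0"
    and u: "u \<in> borel_measurable (tmeas T)" "(\<integral>\<^sup>+t. ennreal ((norm (u t))\<^sup>2) \<partial>tmeas T) < \<infinity>"
    and g: "g \<in> borel_measurable (tmeas T)" "(\<integral>\<^sup>+t. ennreal ((norm (g t))\<^sup>2) \<partial>tmeas T) < \<infinity>"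
    and c: "\<And>n. continuous_on {0..T} (\<lambda>t. u t \<bullet> basis n)"
  shows "has_weak_time_deriv T u g \<longleftrightarrow> (\<forall>n. ac T (\<lambda>t. u t \<bullet> basis n) (\<lambda>t. g t \<bullet> basis n))"
proof -
  have int: "integrable (tmeas T) (\<lambda>t. deriv \<phi> t *\<^sub>R u t)" "integrable (tmeas T) (\<lambda>t. \<phi> t *\<^sub>R g t)"
    if "time_test T \<phi>" for \<phi>
    using integrable_of_norm_square[OF u time_test_ac(4)[OF that]] integrable_of_norm_square[OF g time_test_ac(5)[OF that]] .
  have coeff: "(\<integral>t. deriv \<phi> t *\<^sub>R u t \<partial>tmeas T) \<bullet> basis n = (\<integral>t. deriv \<phi> t * (u t \<bullet> basis n) \<partial>tmeas T)"
    "(\<integral>t. \<phi> t *\<^sub>R g t \<partial>tmeas T) \<bullet> basis n = (\<integral>t. \<phi> t * (g t \<bullet> basis n) \<partial>tmeas T)" if "time_test T \<phi>" for \<phi> n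
    using integral_inner_left[of "basis n", OF int(1)[OF that]] integral_inner_left[of "basis n", OF int(2)[OF that]]
    by (simp_all)
  have def: "has_weak_time_deriv T u g \<longleftrightarrow> (\<forall>\<phi>. time_test T \<phi> \<longrightarrow>
      (\<integral>t. deriv \<phi> t *\<^sub>R u t \<partial>tmeas T) = - (\<integral>t. \<phi> t *\<^sub>R g t \<partial>tmeas T))"
    unfolding has_weak_time_deriv_def time_test_def tmeas_def ..
  show ?thesis
  proof
    assume w: "has_weak_time_deriv T u g"
    show "\<forall>n. ac T (\<lambda>t. u t \<bullet> basis n) (\<lambda>t. g t \<bullet> basis n)"
    proof (intro allI weak_deriv_ac c T fourier.coeff_square_integrable(3)[OF g])
      fix n \<phi> assume \<phi>: "time_test T \<phi>"
      then have "(\<integral>t. deriv \<phi> t *\<^sub>R u t \<partial>tmeas T) = - (\<integral>t. \<phi> t *\<^sub>R g t \<partial>tmeas T)" using w def by blast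
      from arg_cong[OF this, of "\<lambda>x. x \<bullet> basis n"]
      show "(\<integral>t. deriv \<phi> t * (u t \<bullet> basis n) \<partial>tmeas T) = - (\<integral>t. \<phi> t * (g t \<bullet> basis n) \<partial>tmeas T)"
        by (simp add: coeff[OF \<phi>])
    qed
  next
    assume a: "\<forall>n. ac T (\<lambda>t. u t \<bullet> basis n) (\<lambda>t. g t \<bullet> basis n)"
    show "has_weak_time_deriv T u g"
      unfolding def
    proof (intro allI impI fourier.basis_eqI)
      fix n \<phi> assume \<phi>: "time_test T \<phi>"
      show "(\<integral>t. deriv \<phi> t *\<^sub>R u t \<partial>tmeas T) \<bullet> basis n = (- (\<integral>t. \<phi> t *\<^sub>R g t \<partial>tmeas T)) \<bullet> basis n"
        using ac_weak_deriv(1)[OF \<phi> a[rule_format] T] by (simp add: coeff[OF \<phi>])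
    qed
  qed
qed

lemma equation_iff:
  assumes u: "u \<in> fourier.H 2"
  shows "(AE x in torus. rep_l2 g x + cross3 (curl u x) (rep_l2 u x) = \<nu> *\<^sub>R rep_l2 (laplacian u) x + rep_l2 f x)
    \<longleftrightarrow> g + convection u u = \<nu> *\<^sub>R laplacian u + f"
proof -
  note c = rep_abs_l2[OF convection_square_integrable[OF u], of u, folded convection_def]
  note a = rep_l2_add[of g "convection u u"] rep_l2_add[of "\<nu> *\<^sub>R laplacian u" f] rep_l2_scaleR[of \<nu> "laplacian u"]
  have "AE x in torus. (rep_l2 g x + cross3 (curl u x) (rep_l2 u x) = \<nu> *\<^sub>R rep_l2 (laplacian u) x + rep_l2 f x)
    \<longleftrightarrow> (rep_l2 (g + convection u u) x = rep_l2 (\<nu> *\<^sub>R laplacian u + f) x)"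
    using a c by eventually_elim simp
  then show ?thesis unfolding l2_eq_iff by (rule eventually_subst)
qed

lemma ac_cong_AE:
  assumes p: "ac T p q" and q: "q' \<in> borel_measurable (tmeas T)" and eq: "AE t in tmeas T. q t = q' t"
  shows "ac T p q'"
proof -
  have [measurable]: "q \<in> borel_measurable (tmeas T)" using ac_integrable[OF p] by auto
  note [measurable] = q
  have pq: "prim T q t = prim T q' t" for t
    unfolding prim_def
  proof (rule integral_cong_AE)
    show "AE s in tmeas T. (if s \<le> t then q s else 0) = (if s \<le> t then q' s else 0)"
      using eq by eventually_elim simp
  qed measurable
  from integrable_cong_AE_imp[OF ac_integrable[OF p] q eq]
  show ?thesis unfolding ac_def using ac_prim[OF p, unfolded pq] by blast
qed

lemma strong_solution_iff_sol:
  assumes \<nu>: "\<nu> > 0" and T: "T > 0"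
    and f: "f \<in> borel_measurable (tmeas T)"
  shows "strong_solution \<nu> T f u0 u \<longleftrightarrow> u 0 = u0 \<and> quadratic_evolution.sol basis weight convection \<nu> T f u"
proof -
  interpret E: quadratic_evolution basis weight convection \<nu>
    by (rule convection_quadratic_evolution[OF \<nu>])
  have T0: "0 \<le> T" "0 \<in> {0..T}" using T by auto
  have W0le: "(\<integral>\<^sup>+t. ennreal ((norm (x t))\<^sup>2) \<partial>tmeas T) < \<infinity>"
    if "(\<integral>\<^sup>+t. fourier.W 2 (x t) \<partial>tmeas T) < \<infinity>" for x
    by (rule order_le_less_trans[OF nn_integral_mono that]) (rule fourier.norm_le_W)
  have bound: "(\<integral>\<^sup>+t. ennreal ((norm (a t))\<^sup>2) \<partial>tmeas T) < \<infinity>"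
    if [measurable]: "b \<in> borel_measurable (tmeas T)" "x \<in> borel_measurable (tmeas T)"
      and b: "(\<integral>\<^sup>+t. ennreal ((norm (b t))\<^sup>2) \<partial>tmeas T) < \<infinity>" and x: "(\<integral>\<^sup>+t. fourier.W 2 (x t) \<partial>tmeas T) < \<infinity>"
      and c: "AE t in tmeas T. \<forall>n. ((a t - b t) \<bullet> basis n)\<^sup>2 = \<nu>\<^sup>2 * (weight n ^ 2 * (x t \<bullet> basis n)\<^sup>2)" for a b x
  proof -
    have "(\<integral>\<^sup>+t. ennreal ((norm (a t))\<^sup>2) \<partial>tmeas T) \<le> (\<integral>\<^sup>+t. 2 * ennreal ((norm (b t))\<^sup>2) + 2 * (ennreal (\<nu>\<^sup>2) * fourier.W 2 (x t)) \<partial>tmeas T)"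
    proof (rule nn_integral_mono_AE, use c in eventually_elim)
      case (elim t)
      have "fourier.W 0 (a t - b t) = (\<Sum>n. ennreal (\<nu>\<^sup>2) * ennreal (weight n ^ 2 * (x t \<bullet> basis n)\<^sup>2))"
        unfolding fourier.W_def by (rule suminf_cong) (simp add: elim[rule_format] ennreal_mult)
      also have "\<dots> = ennreal (\<nu>\<^sup>2) * fourier.W 2 (x t)"
        unfolding fourier.W_def by (rule ennreal_suminf_cmult)
      finally have "fourier.W 0 (a t - b t) = ennreal (\<nu>\<^sup>2) * fourier.W 2 (x t)" .
      then show ?case
        using fourier.W_add[of 0 "b t" "a t - b t"] by (simp add: fourier.W_0)
    qed
    also have "\<dots> < \<infinity>"
      using b x by (simp add: nn_integral_add nn_integral_cmult ennreal_mult_less_top)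
    finally show ?thesis .
  qed
  show ?thesis
  proof
    assume s: "strong_solution \<nu> T f u0 u"
    then have C: "u \<in> C_time T (sobolev 1) (sobolev_norm 1)" and L: "u \<in> L2_time T (sobolev 2) (sobolev_norm 2)"
      and u0: "u 0 = u0" unfolding strong_solution_def by auto
    from s obtain g where g: "g \<in> L2_time T UNIV norm" "has_weak_time_deriv T u g"
      "AE t in tmeas T. AE x in torus. rep_l2 (g t) x + cross3 (curl (u t) x) (rep_l2 (u t) x) =
           \<nu> *\<^sub>R rep_l2 (laplacian (u t)) x + rep_l2 (f t) x"
      unfolding strong_solution_def tmeas_def by blast
    note g' = L2_time_normD[OF g(1)]
    note um = L2_timeD(1)[OF L]
    have H2: "AE t in tmeas T. u t \<in> fourier.H 2" using L2_timeD(2)[OF L] by (simp add: sobolev_H)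
    have W2: "(\<integral>\<^sup>+t. fourier.W 2 (u t) \<partial>tmeas T) < \<infinity>"
    proof -
      have "(\<integral>\<^sup>+t. fourier.W 2 (u t) \<partial>tmeas T) \<le> (\<integral>\<^sup>+t. ennreal (2 * (sobolev_norm 2 (u t))\<^sup>2) \<partial>tmeas T)"
        by (rule nn_integral_mono_AE) (use H2 in \<open>eventually_elim, simp add: fourier.W_eq_N ennreal_leI N_2_le\<close>)
      also have "\<dots> < \<infinity>" using L2_timeD(3)[OF L] by (subst nn_integral_eq_integral) auto
      finally show ?thesis .
    qed
    have c: "continuous_on {0..T} (\<lambda>t. u t \<bullet> basis n)" for n
      unfolding continuous_on_def
    proof
      fix t assume t: "t \<in> {0..T}"
      then have l: "((\<lambda>s. sobolev_norm 1 (u s - u t)) \<longlongrightarrow> 0) (at t within {0..T})"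
        using C by (simp add: C_time_def)
      have "((\<lambda>s. (u s - u t) \<bullet> basis n) \<longlongrightarrow> 0) (at t within {0..T})"
      proof (rule Lim_null_comparison[OF always_eventually l], rule allI)
        fix s
        have "\<bar>(u s - u t) \<bullet> basis n\<bar> \<le> norm (u s - u t) * norm (basis n)" by (rule Cauchy_Schwarz_ineq2)
        also have "norm (basis n) = 1" by (simp add: norm_eq_sqrt_inner basis_orthonormal)
        finally show "norm ((u s - u t) \<bullet> basis n) \<le> sobolev_norm 1 (u s - u t)"
          using norm_le_sobolev_norm[of "u s - u t" 1] by simp
      qed
      then show "((\<lambda>s. u s \<bullet> basis n) \<longlongrightarrow> u t \<bullet> basis n) (at t within {0..T})"
        unfolding inner_diff_left by (rule LIM_zero_cancel)
    qed
    have acg: "ac T (\<lambda>t. u t \<bullet> basis n) (\<lambda>t. g t \<bullet> basis n)" for n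
      using g(2) has_weak_time_deriv_iff[OF T um W0le[OF W2] g' c] by blast
    note Fm = E.borel_measurable_forcing[OF f um]
    have eq: "AE t in tmeas T. \<forall>n. g t \<bullet> basis n = - (\<nu> * weight n) * (u t \<bullet> basis n) + E.forcing f u t \<bullet> basis n"
      using H2 g(3)
    proof eventually_elim
      case (elim t)
      then have g_eq: "g t = \<nu> *\<^sub>R laplacian (u t) + f t - convection (u t) (u t)"
        using equation_iff[OF elim(1)] by (simp add: eq_diff_eq)
      show ?case
        unfolding g_eq using elim(1) by (auto simp: E.forcing_def E.Q_def inner_diff_left inner_add_left laplacian_inner algebra_simps)
    qed
    have "E.sol T f u"
      unfolding E.sol_def fourier.lin_def
    proof (intro conjI allI)
      show "E.forcing f u \<in> borel_measurable (tmeas T)" by (rule Fm)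
      show "u 0 \<in> fourier.H 1" using C T by (simp add: C_time_def sobolev_H)
      show "(\<integral>\<^sup>+s. ennreal ((norm (E.forcing f u s))\<^sup>2) \<partial>tmeas T) < \<infinity>"
        by (rule bound[OF g'(1) um g'(2) W2]) (use eq in \<open>auto elim!: eventually_mono simp: inner_diff_left power_mult_distrib\<close>)
      fix n
      have [measurable]: "(\<lambda>t. u t \<bullet> basis n) \<in> borel_measurable (tmeas T)"
        "(\<lambda>t. E.forcing f u t \<bullet> basis n) \<in> borel_measurable (tmeas T)"
        by (intro borel_measurable_inner um Fm borel_measurable_const)+
      show "ac T (\<lambda>t. u t \<bullet> basis n) (\<lambda>s. - (\<nu> * weight n) * (u s \<bullet> basis n) + E.forcing f u s \<bullet> basis n)"
      proof (rule ac_cong_AE[OF acg])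
        show "AE t in tmeas T. g t \<bullet> basis n = - (\<nu> * weight n) * (u t \<bullet> basis n) + E.forcing f u t \<bullet> basis n"
          using eq by eventually_elim (rule spec)
      qed measurable
    qed
    then show "u 0 = u0 \<and> E.sol T f u" using u0 by simp
  next
    assume "u 0 = u0 \<and> E.sol T f u"
    then have u0: "u 0 = u0" and l: "fourier.lin \<nu> T u (E.forcing f u)" by (auto simp: E.sol_def)
    note D = fourier.lin_D[OF l]
    note H = fourier.lin_H1[OF l \<nu>]
    note [measurable] = D(1) D(6)
    have [measurable]: "(\<lambda>t. u t \<bullet> basis n) \<in> borel_measurable (tmeas T)"
        "(\<lambda>t. E.forcing f u t \<bullet> basis n) \<in> borel_measurable (tmeas T)" for n
        by (intro borel_measurable_inner D borel_measurable_const)+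
    have C: "u \<in> C_time T (sobolev 1) (sobolev_norm 1)"
      unfolding C_time_def sobolev_H
    proof (intro CollectI ballI conjI)
      fix t assume t: "t \<in> {0..T}"
      show ut: "u t \<in> fourier.H 1" by (rule H(1)[OF t])
      have "((\<lambda>s. sqrt (fourier.N 1 (u s - u t))) \<longlongrightarrow> sqrt (fourier.N 1 (u t - u t))) (at t within {0..T})"
        by (rule tendsto_real_sqrt[OF bspec[OF fourier.lin_N_continuous[OF l \<nu> T0(1) ut, unfolded continuous_on_def] t]])
      then have "((\<lambda>s. sqrt (fourier.N 1 (u s - u t))) \<longlongrightarrow> 0) (at t within {0..T})" by (simp add: fourier.N_def)
      moreover have "\<forall>\<^sub>F s in at t within {0..T}. sqrt (fourier.N 1 (u s - u t)) = sobolev_norm 1 (u s - u t)"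
        unfolding eventually_at_filter using H(1) ut by (intro always_eventually) (auto simp: sobolev_norm_1 fourier.H_diff)
      ultimately show "((\<lambda>s. sobolev_norm 1 (u s - u t)) \<longlongrightarrow> 0) (at t within {0..T})"
        by (rule Lim_transform_eventually)
    qed
    have L: "u \<in> L2_time T (sobolev 2) (sobolev_norm 2)"
      by (rule L2_time_sobolev_2I[OF D(6) H(3,2)[OF T0(2)]])
    define g where "g t = (if u t \<in> fourier.H 2 then E.forcing f u t - \<nu> *\<^sub>R fourier.multiplier weight (u t) else 0)" for t
    have gn: "g t \<bullet> basis n = (if u t \<in> fourier.H 2 then - (\<nu> * weight n) * (u t \<bullet> basis n) + E.forcing f u t \<bullet> basis n else 0)" for t n
      by (auto simp: g_def inner_diff_left fourier.multiplier_m)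
    have gm: "g \<in> borel_measurable (tmeas T)"
    proof (rule fourier.borel_measurable_coeff)
      show "(\<lambda>t. g t \<bullet> basis n) \<in> borel_measurable (tmeas T)" for n
        unfolding gn fourier.H_iff_W by measurable
    qed
    have eq: "AE t in tmeas T. \<forall>n. g t \<bullet> basis n = - (\<nu> * weight n) * (u t \<bullet> basis n) + E.forcing f u t \<bullet> basis n"
      using H(3)[OF T0(2)] by eventually_elim (simp add: gn)
    have gi: "(\<integral>\<^sup>+t. ennreal ((norm (g t))\<^sup>2) \<partial>tmeas T) < \<infinity>"
      by (rule bound[OF D(1,6,2) H(2)[OF T0(2)]]) (use eq in \<open>auto elim!: eventually_mono simp: inner_diff_left power_mult_distrib\<close>)
    have gc: "(\<lambda>t. g t \<bullet> basis n) \<in> borel_measurable (tmeas T)" for n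
      by (intro borel_measurable_inner gm borel_measurable_const)
    have "ac T (\<lambda>t. u t \<bullet> basis n) (\<lambda>t. g t \<bullet> basis n)" for n
    proof (rule ac_cong_AE[OF D(4) gc])
      show "AE t in tmeas T. - (\<nu> * weight n) * (u t \<bullet> basis n) + E.forcing f u t \<bullet> basis n = g t \<bullet> basis n"
        using eq by eventually_elim (simp only:)
    qed
    then have w: "has_weak_time_deriv T u g"
      using has_weak_time_deriv_iff[OF T D(6) W0le[OF H(2)[OF T0(2)]] gm gi D(5)] by blast
    have "AE t in tmeas T. AE x in torus. rep_l2 (g t) x + cross3 (curl (u t) x) (rep_l2 (u t) x) =
           \<nu> *\<^sub>R rep_l2 (laplacian (u t)) x + rep_l2 (f t) x"
      using H(3)[OF T0(2)] eq
    proof eventually_elim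
      case (elim t)
      show ?case
        unfolding equation_iff[OF elim(1)]
        by (rule fourier.basis_eqI)
           (use elim in \<open>simp add: E.forcing_def E.Q_def inner_diff_left inner_add_left laplacian_inner algebra_simps\<close>)
    qed
    then show "strong_solution \<nu> T f u0 u"
      unfolding strong_solution_def tmeas_def[symmetric] using C L u0 L2_time_normI[OF gm gi] w by blast
  qed
qed

theorem theorem4p2:
  fixes \<nu> T' :: real and u\<^sub>0 :: l2 and f :: "real \<Rightarrow> l2"
  assumes "\<nu> > 0" and "T' > 0"
    and "u\<^sub>0 \<in> sobolev 1"
    and "f \<in> L2_time T' mean_free norm"
  shows
    "(\<exists>T. 0 < T \<and> T < T' \<and>
       (\<exists>u. strong_solution \<nu> T f u\<^sub>0 u \<and>
          (\<forall>v. strong_solution \<nu> T f u\<^sub>0 v \<longrightarrow> (\<forall>t\<in>{0..T}. v t = u t)))) \<and>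
     (\<forall>T u. \<forall>un :: nat \<Rightarrow> real \<Rightarrow> l2.
       0 < T \<and> T \<le> T' \<and>
       strong_solution \<nu> T f (u 0) u \<and>
       (\<forall>n. strong_solution \<nu> T f (un n 0) (un n)) \<and>
       (\<lambda>n. sobolev_norm 1 (un n 0 - u 0)) \<longlonglongrightarrow> 0 \<longrightarrow>
       (\<lambda>n. C_time_norm T (sobolev_norm 1) (\<lambda>t. un n t - u t)) \<longlonglongrightarrow> 0 \<and>
       (\<lambda>n. L2_time_norm T (sobolev_norm 2) (\<lambda>t. un n t - u t)) \<longlonglongrightarrow> 0) \<and>
     (\<forall>T u. 0 < T \<and> T \<le> T' \<and> strong_solution \<nu> T f u\<^sub>0 u \<longrightarrow>
       (\<forall>t\<in>{0..T}.
          (norm (u t))\<^sup>2 + 2 * \<nu> * (\<integral>s. (\<Sum>j\<in>UNIV. (norm (pd j (u s)))\<^sup>2) \<partial>lebesgue_on {0..t}) =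
          (norm u\<^sub>0)\<^sup>2 + 2 * (\<integral>s. inner (f s) (u s) \<partial>lebesgue_on {0..t})))"
proof -
  interpret E: quadratic_evolution basis weight convection \<nu>
    by (rule convection_quadratic_evolution[OF assms(1)])
  note f = L2_time_normD[OF assms(4)]
  have fT: "f \<in> borel_measurable (tmeas T)" if "T \<le> T'" for T by (rule tmeas_mono(1)[OF that f(1)])
  note iff = strong_solution_iff_sol[OF assms(1) _ fT]
  have exist: "\<exists>T. 0 < T \<and> T < T' \<and> (\<exists>u. strong_solution \<nu> T f u\<^sub>0 u \<and>
          (\<forall>v. strong_solution \<nu> T f u\<^sub>0 v \<longrightarrow> (\<forall>t\<in>{0..T}. v t = u t)))"
  proof -
    obtain T u where T: "0 < T" "T < T'" and u: "u 0 = u\<^sub>0" "E.sol T f u"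
      using E.sol_exists[OF f assms(2), of u\<^sub>0] assms(3) by (auto simp: sobolev_H)
    note iff' = iff[OF T(1) less_imp_le[OF T(2)]]
    have "v t = u t" if v: "strong_solution \<nu> T f u\<^sub>0 v" and t: "t \<in> {0..T}" for v t
    proof -
      from v have "v 0 = u 0" "E.sol T f v" unfolding iff' u(1) by blast+
      then show ?thesis using E.sol_unique[OF _ u(2) _ _ t] T(1) by blast
    qed
    moreover have "strong_solution \<nu> T f u\<^sub>0 u" unfolding iff' using u by blast
    ultimately show ?thesis using T by blast
  qed
  have depend: "(\<lambda>n. C_time_norm T (sobolev_norm 1) (\<lambda>t. un n t - u t)) \<longlonglongrightarrow> 0 \<and>
       (\<lambda>n. L2_time_norm T (sobolev_norm 2) (\<lambda>t. un n t - u t)) \<longlonglongrightarrow> 0"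
    if T: "0 < T" "T \<le> T'" and su: "strong_solution \<nu> T f (u 0) u" and sn: "\<And>n. strong_solution \<nu> T f (un n 0) (un n)"
      and lim: "(\<lambda>n. sobolev_norm 1 (un n 0 - u 0)) \<longlonglongrightarrow> 0"
    for T u and un :: "nat \<Rightarrow> real \<Rightarrow> l2"
  proof -
    have u: "E.sol T f u" and un: "E.sol T f (un n)" for n using iff T su sn by blast+
    obtain K d where d: "0 < d" and K: "0 \<le> K"
      and dep: "\<And>v. E.sol T f v \<Longrightarrow> fourier.N 1 (u 0 - v 0) < d \<Longrightarrow>
        (\<forall>t\<in>{0..T}. fourier.N 1 (u t - v t) \<le> K * fourier.N 1 (u 0 - v 0)) \<and>
        (\<integral>s. enn2real (fourier.W 2 (u s - v s)) \<partial>tmeas T) \<le> K * fourier.N 1 (u 0 - v 0)"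
      using E.sol_dependence[OF u T(1)] by blast
    have l: "fourier.lin \<nu> T (\<lambda>t. un n t - u t) (\<lambda>t. E.forcing f (un n) t - E.forcing f u t)" for n
      using fourier.lin_diff un u unfolding E.sol_def by blast
    have T0: "0 \<in> {0..T}" "0 \<le> T" using T by auto
    note H = fourier.lin_H1[OF l assms(1)]
    define y where "y n = fourier.N 1 (u 0 - un n 0)" for n
    have sym: "fourier.N 1 (u t - un n t) = fourier.N 1 (un n t - u t)" for n t
      using fourier.N_minus[of 1 "un n t - u t"] by simp
    have symW: "fourier.W 2 (u t - un n t) = fourier.W 2 (un n t - u t)" for n t
      using fourier.W_minus[of 2 "un n t - u t"] by simp
    have y: "y n = (sobolev_norm 1 (un n 0 - u 0))\<^sup>2" "0 \<le> y n" for n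
      using sobolev_norm_1[OF H(1)[OF T0(1)]] fourier.N_nonneg[OF H(1)[OF T0(1)]] unfolding y_def sym by simp_all
    have y0: "y \<longlonglongrightarrow> 0"
      using tendsto_power[OF lim, of 2] unfolding y(1)[abs_def] by simp
    then have ev: "\<forall>\<^sub>F n in sequentially. y n < d" using d by (rule order_tendstoD)
    have s0: "(\<lambda>n. sqrt (K * y n)) \<longlonglongrightarrow> 0"
      using tendsto_real_sqrt[OF tendsto_mult[OF tendsto_const[of K] y0]] by simp
    have Cle: "0 \<le> C_time_norm T (sobolev_norm 1) (\<lambda>t. un n t - u t) \<and>
        C_time_norm T (sobolev_norm 1) (\<lambda>t. un n t - u t) \<le> sqrt (K * y n)"
      and Lle: "L2_time_norm T (sobolev_norm 2) (\<lambda>t. un n t - u t) \<le> sqrt (K * y n)" if n: "y n < d" for n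
    proof -
      have le: "sobolev_norm 1 (un n t - u t) \<le> sqrt (K * y n)" if t: "t \<in> {0..T}" for t
        unfolding sobolev_norm_1[OF H(1)[OF t]] using dep[OF un n[unfolded y_def]] t
        by (simp add: sym[symmetric] y_def)
      have "sobolev_norm 1 (un n 0 - u 0) \<le> (SUP t\<in>{0..T}. sobolev_norm 1 (un n t - u t))"
        by (rule cSUP_upper[OF T0(1)]) (use le in \<open>auto intro!: bdd_aboveI2[where M="sqrt (K * y n)"]\<close>)
      moreover have "0 \<le> sobolev_norm 1 (un n 0 - u 0)"
        using norm_le_sobolev_norm[of "un n 0 - u 0" 1] norm_ge_zero order_trans by blast
      moreover have "(SUP t\<in>{0..T}. sobolev_norm 1 (un n t - u t)) \<le> sqrt (K * y n)"
        by (rule cSUP_least) (use T0 le in auto)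
      ultimately show "0 \<le> C_time_norm T (sobolev_norm 1) (\<lambda>t. un n t - u t) \<and>
        C_time_norm T (sobolev_norm 1) (\<lambda>t. un n t - u t) \<le> sqrt (K * y n)"
        unfolding C_time_norm_def by simp
      have "(\<integral>t. (sobolev_norm 2 (un n t - u t))\<^sup>2 \<partial>tmeas T) \<le> (\<integral>t. enn2real (fourier.W 2 (un n t - u t)) \<partial>tmeas T)"
      proof (rule integral_mono_AE)
        show "integrable (tmeas T) (\<lambda>t. (sobolev_norm 2 (un n t - u t))\<^sup>2)"
          by (rule L2_timeD(3)[OF L2_time_sobolev_2I[OF fourier.lin_D(6)[OF l] H(3,2)[OF T0(1)]]])
        show "integrable (tmeas T) (\<lambda>t. enn2real (fourier.W 2 (un n t - u t)))"
          by (rule fourier.lin_estimate_real(1)[OF l assms(1) T0(2)])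
        show "AE t in tmeas T. (sobolev_norm 2 (un n t - u t))\<^sup>2 \<le> enn2real (fourier.W 2 (un n t - u t))"
          using fourier.lin_H1(3)[OF l[of n] assms(1) T0(1)]
        proof eventually_elim
          case (elim t)
          note h1 = fourier.H_mono[OF elim, of 1]
          have "fourier.N 1 (un n t - u t) \<le> fourier.N 2 (un n t - u t)" by (rule fourier.N_mono[OF elim]) simp
          then show ?case
            using fourier.norm_le_N[OF h1] fourier.N_nonneg[OF elim]
            by (simp add: sobolev_norm_2[OF elim] fourier.W_eq_N[OF elim])
        qed
      qed
      also have "\<dots> \<le> K * y n"
        using dep[OF un n[unfolded y_def]] unfolding y_def symW by (rule conjunct2)
      finally show "L2_time_norm T (sobolev_norm 2) (\<lambda>t. un n t - u t) \<le> sqrt (K * y n)"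
        unfolding L2_time_norm_def tmeas_def by simp
    qed
    have L0: "0 \<le> L2_time_norm T (sobolev_norm 2) (\<lambda>t. un n t - u t)" for n
      unfolding L2_time_norm_def by (simp add: integral_nonneg_AE)
    show ?thesis
    proof
      show "(\<lambda>n. C_time_norm T (sobolev_norm 1) (\<lambda>t. un n t - u t)) \<longlonglongrightarrow> 0"
      proof (rule Lim_null_comparison[OF _ s0])
        show "\<forall>\<^sub>F n in sequentially. norm (C_time_norm T (sobolev_norm 1) (\<lambda>t. un n t - u t)) \<le> sqrt (K * y n)"
          using ev by eventually_elim (use Cle in \<open>simp only: real_norm_def abs_of_nonneg\<close>)
      qed
      show "(\<lambda>n. L2_time_norm T (sobolev_norm 2) (\<lambda>t. un n t - u t)) \<longlonglongrightarrow> 0"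
      proof (rule Lim_null_comparison[OF _ s0])
        show "\<forall>\<^sub>F n in sequentially. norm (L2_time_norm T (sobolev_norm 2) (\<lambda>t. un n t - u t)) \<le> sqrt (K * y n)"
          using ev by eventually_elim (use Lle L0 in \<open>simp only: real_norm_def abs_of_nonneg\<close>)
      qed
    qed
  qed
  have energy: "(norm (u t))\<^sup>2 + 2 * \<nu> * (\<integral>s. (\<Sum>j\<in>UNIV. (norm (pd j (u s)))\<^sup>2) \<partial>lebesgue_on {0..t}) =
          (norm u\<^sub>0)\<^sup>2 + 2 * (\<integral>s. inner (f s) (u s) \<partial>lebesgue_on {0..t})"
    if T: "0 < T" "T \<le> T'" and su: "strong_solution \<nu> T f u\<^sub>0 u" and t: "t \<in> {0..T}" for T u t
  proof -
    have u: "E.sol T f u" "u 0 = u\<^sub>0" using iff T su by blast+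
    then have l: "fourier.lin \<nu> T u (E.forcing f u)" by (simp add: E.sol_def)
    note [measurable] = fourier.lin_D(6)[OF l] fT[OF T(2)]
    have g: "(\<Sum>j\<in>UNIV. (norm (pd j (u s)))\<^sup>2) = fourier.N 1 (u s) - (norm (u s))\<^sup>2" if "s \<in> {0<..<T}" for s
      by (rule norm_pd[OF fourier.lin_H1(1)[OF l assms(1)]]) (use that in auto)
    have "continuous_on {0..T} (\<lambda>t. fourier.N 1 (u t))"
      using fourier.lin_N_continuous[OF l assms(1) _ fourier.H_zero] T by simp
    note [measurable] = continuous_on_tmeas_measurable[OF this]
    have "(\<lambda>s. \<Sum>j\<in>UNIV. (norm (pd j (u s)))\<^sup>2) \<in> borel_measurable (tmeas T)"
      by (subst measurable_cong[OF g]) auto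
    from prim_eq_lebesgue_on[OF this t]
    have "(\<integral>s. (\<Sum>j\<in>UNIV. (norm (pd j (u s)))\<^sup>2) \<partial>lebesgue_on {0..t}) = prim T (\<lambda>s. fourier.N 1 (u s) - (norm (u s))\<^sup>2) t"
      using prim_cong[of T t, OF g] by simp
    moreover have "(\<integral>s. f s \<bullet> u s \<partial>lebesgue_on {0..t}) = prim T (\<lambda>s. f s \<bullet> u s) t"
      by (rule prim_eq_lebesgue_on[symmetric, OF _ t]) measurable
    ultimately show ?thesis using E.sol_energy[OF u(1) fT[OF T(2)] t] u(2) by simp
  qed
  show ?thesis using exist depend energy by blast
qed

end
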